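(* (1) There is a dense $G_\delta$ subset $\mathcal R_\infty\subset{\rm Aut}(X,\mathcal B,\mu)$ such that every $T\in\mathcal R_\infty$ has $T^n$ of rank one for every $n\in\mathbb Z\setminus\{0\}$. Consequently every such $T$ has $T^n$ with simple spectrum for all $n\ge1$, $J^\infty(T)=J_2(T)$, the set of periodic points of $\widetilde T$ is closed and nowhere dense in $C_2(\mu)$, and $(C_2(\mu),\widetilde T)$ is not a $P$-system. (2) If $T$ is a Gaussian system with simple spectrum, then $T^n$ has simple spectrum for every $n\ge1$; in particular $J^\infty(T)=J_2(T)$ and $(C_2(\mu),\widetilde T)$ is not a $P$-system.
   Context: $(X,\mathcal B,\mu)$ is a standard non-atomic probability space; ${\rm Aut}(X,\mathcal B,\mu)$ carries the weak (Polish) topology. $C_2(\mu)$: probability measures on $X\times X$ with both marginals $\mu$, with the compact topology $\rho_n\to\rho$ iff $\rho_n(A\times B)\to\rho(A\times B)$ for all measurable $A,B$; lens $\widetilde T(\rho)(A\times B)=\rho(T^{-1}A\times T^{-1}B)$. $J_2(T)$ is the set of $T\times T$-invariant couplings and $J^\infty(T)=\bigcup_{n\ge1}J_2(T^n)$ is the set of periodic points of $\widetilde T$. A $P$-system is a topologically transitive system with dense periodic points. $T$ has simple spectrum if the Koopman operator $U_Tf=f\circ T$ on $L^2(\mu)$ (or on $L^2_0$) has a cyclic vector. *)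

theory Defs
  imports "HOL-Probability.Probability"
begin

definition std_nonatomic :: "'a::polish_space measure \<Rightarrow> bool" where
  "std_nonatomic M \<longleftrightarrow> prob_space M \<and> space M = UNIV \<and> sets M = sets (borel :: 'a measure)
     \<and> (\<forall>x. emeasure M {x} = 0)"

definition symdiff :: "'a set \<Rightarrow> 'a set \<Rightarrow> 'a set" where
  "symdiff A B = (A - B) \<union> (B - A)"

definition aut :: "'a measure \<Rightarrow> ('a \<Rightarrow> 'a) set" where
  "aut M = {T. bij T \<and> T \<in> M \<rightarrow>\<^sub>M M \<and> inv T \<in> M \<rightarrow>\<^sub>M M \<and> distr M M T = M}"

definition zpow :: "('a \<Rightarrow> 'a) \<Rightarrow> int \<Rightarrow> ('a \<Rightarrow> 'a)" where
  "zpow T n = (if 0 \<le> n then T ^^ nat n else inv T ^^ nat (- n))"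

definition weak_top :: "'a measure \<Rightarrow> ('a \<Rightarrow> 'a) topology" where
  "weak_top M = topology_generated_by
     (insert (aut M)
       {{S \<in> aut M. measure M (symdiff (S -` A \<inter> space M) (T -` A \<inter> space M)) < e}
         | T A e. T \<in> aut M \<and> A \<in> sets M \<and> e > 0})"

definition rank_one :: "'a measure \<Rightarrow> ('a \<Rightarrow> 'a) \<Rightarrow> bool" where
  "rank_one M T \<longleftrightarrow>
     (\<forall>As e. finite As \<and> As \<subseteq> sets M \<and> e > 0 \<longrightarrow>
        (\<exists>B h. B \<in> sets M \<and> h > 0 \<and>
           disjoint_family_on (\<lambda>i. (T ^^ i) ` B) {..<h} \<and>
           measure M (\<Union>i<h. (T ^^ i) ` B) > 1 - e \<and>
           (\<forall>A\<in>As. \<exists>J \<subseteq> {..<h}. measure M (symdiff A (\<Union>i\<in>J. (T ^^ i) ` B)) < e)))"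

definition square_integrable :: "'a measure \<Rightarrow> ('a \<Rightarrow> complex) \<Rightarrow> bool" where
  "square_integrable M f \<longleftrightarrow> f \<in> borel_measurable M \<and> integrable M (\<lambda>x. (cmod (f x))\<^sup>2)"

definition simple_spectrum :: "'a measure \<Rightarrow> ('a \<Rightarrow> 'a) \<Rightarrow> bool" where
  "simple_spectrum M T \<longleftrightarrow>
     (\<exists>f. square_integrable M f \<and>
        (\<forall>g e. square_integrable M g \<and> e > 0 \<longrightarrow>
           (\<exists>F c. finite (F :: int set) \<and>
              (\<integral>x. (cmod (g x - (\<Sum>k\<in>F. c k * f (zpow T k x))))\<^sup>2 \<partial>M) < e)))"

definition C2 :: "'a measure \<Rightarrow> ('a \<times> 'a) measure set" where
  "C2 M = {\<rho>. sets \<rho> = sets (M \<Otimes>\<^sub>M M) \<and> prob_space \<rho> \<and>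
               distr \<rho> M fst = M \<and> distr \<rho> M snd = M}"

definition C2_top :: "'a measure \<Rightarrow> ('a \<times> 'a) measure topology" where
  "C2_top M = topology_generated_by
     (insert (C2 M) {{\<sigma> \<in> C2 M. measure \<sigma> (A \<times> B) \<in> U} | A B U.
                      A \<in> sets M \<and> B \<in> sets M \<and> open U})"

definition lens :: "'a measure \<Rightarrow> ('a \<Rightarrow> 'a) \<Rightarrow> ('a \<times> 'a) measure \<Rightarrow> ('a \<times> 'a) measure" where
  "lens M T \<rho> = distr \<rho> (M \<Otimes>\<^sub>M M) (map_prod T T)"

definition J2 :: "'a measure \<Rightarrow> ('a \<Rightarrow> 'a) \<Rightarrow> ('a \<times> 'a) measure set" where
  "J2 M T = {\<rho> \<in> C2 M. distr \<rho> (M \<Otimes>\<^sub>M M) (map_prod T T) = \<rho>}"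

definition Jinf :: "'a measure \<Rightarrow> ('a \<Rightarrow> 'a) \<Rightarrow> ('a \<times> 'a) measure set" where
  "Jinf M T = (\<Union>n\<in>{1..}. J2 M (T ^^ n))"

definition periodic_pts :: "'a measure \<Rightarrow> ('a \<Rightarrow> 'a) \<Rightarrow> ('a \<times> 'a) measure set" where
  "periodic_pts M T = {\<rho> \<in> C2 M. \<exists>n\<ge>1. (lens M T ^^ n) \<rho> = \<rho>}"

definition nowhere_dense_in :: "'b topology \<Rightarrow> 'b set \<Rightarrow> bool" where
  "nowhere_dense_in X S \<longleftrightarrow> X interior_of (X closure_of S) = {}"

definition P_system :: "'a measure \<Rightarrow> ('a \<Rightarrow> 'a) \<Rightarrow> bool" where
  "P_system M T \<longleftrightarrow>
     (\<forall>U V. openin (C2_top M) U \<and> openin (C2_top M) V \<and> U \<noteq> {} \<and> V \<noteq> {} \<longrightarrow>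
        (\<exists>n\<ge>1. (lens M T ^^ n) ` U \<inter> V \<noteq> {})) \<and>
     (C2_top M) closure_of (periodic_pts M T) = topspace (C2_top M)"

definition gaussian_rv :: "'a measure \<Rightarrow> ('a \<Rightarrow> real) \<Rightarrow> bool" where
  "gaussian_rv M f \<longleftrightarrow> f \<in> borel_measurable M \<and>
     (distr M borel f = return borel 0 \<or>
      (\<exists>\<sigma>>0. distr M borel f = density lborel (normal_density 0 \<sigma>)))"

definition gaussian_system :: "'a measure \<Rightarrow> ('a \<Rightarrow> 'a) \<Rightarrow> bool" where
  "gaussian_system M T \<longleftrightarrow> T \<in> aut M \<and>
     (\<exists>H. (\<lambda>x. 0) \<in> H \<and>
        (\<forall>f\<in>H. \<forall>g\<in>H. (\<lambda>x. f x + g x) \<in> H) \<and>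
        (\<forall>f\<in>H. \<forall>c::real. (\<lambda>x. c * f x) \<in> H) \<and>
        (\<forall>f\<in>H. gaussian_rv M f) \<and>
        (\<forall>f\<in>H. f \<circ> T \<in> H \<and> f \<circ> inv T \<in> H) \<and>
        (\<forall>A\<in>sets M. \<exists>A' \<in> sigma_sets (space M)
              (\<Union>f\<in>H. {f -` U \<inter> space M | U. U \<in> sets borel}).
            emeasure M (symdiff A A') = 0))"

end

theory Submission
  imports Defs "HOL-Complex_Analysis.Complex_Analysis" "HOL-Computational_Algebra.Fundamental_Theorem_Algebra"
    "HOL-Number_Theory.Cong"
begin

text \<open>If every power of \<open>T\<close> has simple spectrum, then the Markov operator of a coupling invariant under
  \<open>T\<^sup>n\<close> commutes with \<open>U\<^sub>T\<^sup>n\<close>; since the commutant of an operator with simple spectrum is abelian, it commutes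
  with \<open>U\<^sub>T\<close> as well. Hence all periodic points of the lens are fixed points.

  Rank one implies simple spectrum. Having \<open>T\<^sup>n\<close> of rank one up to a given precision is an open condition for the
  weak topology, which is a Baire topology, and it is dense: \<open>T\<close> is approximated by a transformation that permutes
  cyclically \<open>L\<close> levels of equal measure, with \<open>L\<close> prime to \<open>n\<close>.

  For a Gaussian system, a cyclic vector for the \<open>n\<close>-th power comes from the spectral components of a form that is an
  eigenvector of \<open>U\<^sub>T\<close> with eigenvalue an \<open>n\<close>-th root of unity: Schur products of positive semidefinite kernels force it
  to vanish unless the eigenvalue is 1.\<close>

section \<open>Complex Hilbert spaces\<close>

text \<open>No spectral measure or functional calculus occurs: every spectral argument is phrased
  with bounded sesquilinear forms. A coupling, a projection and an operator each become a form, and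
  a spectral component is a form with \<open>\<beta> (U x) (U y) = \<zeta> * \<beta> x y\<close>.
  The Hilbert space has to be a type, which cannot depend on the measure; it is built once over the
  uniform law on (0,1), and each standard space is carried there by a coordinate
  \<open>\<phi>\<close> with almost inverse \<open>\<kappa>\<close>. The elements of
  \<open>aut M\<close> are point maps, not classes, so the weak topology does not separate maps that
  agree almost everywhere. It is described as a pullback of a metric topology, along the map that
  sends \<open>T\<close> to the images of the coordinate under the Koopman operators of
  \<open>T\<close> and of \<open>inv T\<close>; the inverse is recorded because a strong limit of
  Koopman operators may fail to be invertible. In the Gaussian case an n-th root of an identity
  between powers can be extracted only where the functions do not vanish; this obstacle is the
  reason for the alternative that ends that argument.\<close>

class complex_inner = real_inner +
 fixes scaleC :: "complex => 'a => 'a" (infixr "*\<^sub>C" 75)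
  and cip :: "'a => 'a => complex"
 assumes scaleC_add_right: "c *\<^sub>C (x + y) = c *\<^sub>C x + c *\<^sub>C y"
  and scaleC_add_left: "(c + d) *\<^sub>C x = c *\<^sub>C x + d *\<^sub>C x"
  and scaleC_scaleC: "c *\<^sub>C (d *\<^sub>C x) = (c * d) *\<^sub>C x"
  and scaleR_scaleC: "r *\<^sub>R x = complex_of_real r *\<^sub>C x"
  and cip_add_left: "cip (x + y) z = cip x z + cip y z"
  and cip_scaleC_left: "cip (c *\<^sub>C x) y = c * cip x y"
  and cip_commute: "cip x y = cnj (cip y x)"
  and inner_cip: "inner x y = Re (cip x y)"

class complex_hilbert = complex_inner + complete_space

instantiation complex :: complex_hilbert
begin
definition scaleC_complex_def: "scaleC_complex = ((*) :: complex => _)"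
definition cip_complex_def: "cip_complex x y = x * cnj (y :: complex)"
instance
 by standard (auto simp: scaleC_complex_def cip_complex_def algebra_simps inner_complex_def
   scaleR_conv_of_real)
end

lemma scaleC_one [simp]: "1 *\<^sub>C (x :: 'a::complex_hilbert) = x"
 by (metis of_real_1 scaleR_one scaleR_scaleC)

interpretation complex_vs: vector_space "scaleC :: complex => 'a => 'a::complex_hilbert"
 by standard (simp_all add: scaleC_add_right scaleC_add_left scaleC_scaleC)

abbreviation "cspan \<equiv> complex_vs.span"
abbreviation "csubspace \<equiv> complex_vs.subspace"

lemma cip_add_right: "cip x (y + z) = cip x y + cip x (z :: 'a::complex_hilbert)"
 by (metis cip_add_left cip_commute complex_cnj_add)

lemma cip_scaleC_right: "cip x (c *\<^sub>C y) = cnj c * cip x (y :: 'a::complex_hilbert)"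
 by (metis cip_commute cip_scaleC_left complex_cnj_mult)

lemma cip_self: "cip x x = complex_of_real ((norm (x :: 'a::complex_hilbert))\<^sup>2)"
proof -
 have "Im (cip x x) = 0"
  by (metis cip_commute cnj.simps(2) equal_neg_zero)
 moreover have "Re (cip x x) = (norm x)\<^sup>2"
  by (metis inner_cip power2_norm_eq_inner)
 ultimately show ?thesis
  by (simp add: complex_eq_iff)
qed

lemma norm_scaleC: "norm (c *\<^sub>C (x :: 'a::complex_hilbert)) = cmod c * norm x"
proof -
 have "complex_of_real ((norm (c *\<^sub>C x))\<^sup>2) = complex_of_real ((cmod c * norm x)\<^sup>2)"
  unfolding cip_self[symmetric] cip_scaleC_left cip_scaleC_right
  using complex_norm_square[of c] by (simp add: cip_self power_mult_distrib algebra_simps)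
 then show ?thesis
  by (metis norm_ge_zero of_real_eq_iff power2_eq_imp_eq mult_nonneg_nonneg)
qed

lemma cip_bound: "cmod (cip x y) <= norm x * norm (y :: 'a::complex_hilbert)"
proof -
 \<comment> \<open>A phase that makes the product real and nonnegative, so that the real
   Cauchy-Schwarz inequality applies.\<close>
 define c where "c = cnj (sgn (cip x y))"
 have c: "cmod c <= 1"
  by (simp add: c_def norm_sgn)
 have "c * cip x y = complex_of_real (cmod (cip x y))"
  unfolding c_def by (simp add: sgn_eq complex_norm_square[symmetric] power2_eq_square field_simps)
 then have "cmod (cip x y) = Re (cip (c *\<^sub>C x) y)"
  by (simp add: cip_scaleC_left)
 also have "... <= norm (c *\<^sub>C x) * norm y"
  by (metis inner_cip norm_cauchy_schwarz)
 also have "... <= norm x * norm y"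
  using c by (simp add: norm_scaleC mult_left_le_one_le mult_right_mono)
 finally show ?thesis .
qed

interpretation cip: bounded_bilinear "cip :: 'a::complex_hilbert => 'a => complex"
proof
 show "EX K. ALL a b. cmod (cip a b) <= norm a * norm (b::'a) * K"
  using cip_bound by (metis mult.right_neutral)
qed (auto simp: cip_add_left cip_add_right scaleR_scaleC cip_scaleC_left cip_scaleC_right scaleC_complex_def)

interpretation scaleC: bounded_bilinear "scaleC :: complex => 'a => 'a::complex_hilbert"
proof
 show "EX K. ALL a b. norm (a *\<^sub>C (b::'a)) <= norm a * norm b * K"
  by (intro exI[of _ 1]) (simp add: norm_scaleC)
qed (auto simp: scaleC_add_left scaleC_add_right scaleR_scaleC scaleC_scaleC scaleC_complex_def mult.commute)

lemma cip_eq_iff: "(ALL z. cip x z = cip y z) \<longleftrightarrow> x = (y :: 'a::complex_hilbert)"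
proof
 assume "ALL z. cip x z = cip y z"
 then have "cip (x - y) (x - y) = 0"
  by (simp add: cip.diff_left)
 then show "x = y"
  by (simp add: cip_self)
qed simp

lemma cip_eq_iff_right: "(ALL z. cip z x = cip z y) \<longleftrightarrow> x = (y :: 'a::complex_hilbert)"
 by (metis cip_commute cip_eq_iff)

lemma csubspace_closure: "csubspace W ==> csubspace (closure (W :: 'a::complex_hilbert set))"
proof (rule complex_vs.subspaceI)
 assume W: "csubspace W"
 show "0 \<in> closure W"
  using W closure_subset complex_vs.subspace_0 by blast
 show "x + y \<in> closure W" if xy: "x \<in> closure W" "y \<in> closure W" for x y
 proof -
  from xy obtain f g where "ALL n. f n \<in> W" "f \<longlonglongrightarrow> x" "ALL n. g n \<in> W" "g \<longlonglongrightarrow> y"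
   unfolding closure_sequential by blast
  then show ?thesis
   unfolding closure_sequential
   using W by (intro exI[of _ "%n. f n + g n"]) (auto intro: tendsto_add complex_vs.subspace_add)
 qed
 show "c *\<^sub>C x \<in> closure W" if x: "x \<in> closure W" for c x
 proof -
  from x obtain f where "ALL n. f n \<in> W" "f \<longlonglongrightarrow> x"
   unfolding closure_sequential by blast
  then show ?thesis
   unfolding closure_sequential
   using W by (intro exI[of _ "%n. c *\<^sub>C f n"]) (auto intro: scaleC.tendsto complex_vs.subspace_scale)
 qed
qed

text \<open>Density argument in the form of an induction: a property passes from a total set to the
  whole space once it defines a closed subspace.\<close>

lemma total_induct:
 fixes B :: "'a::complex_hilbert set"
 assumes "closure (cspan B) = UNIV" "closed W" "csubspace W" "B <= W"
 shows "x \<in> W"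
proof -
 have "cspan B <= W"
  using assms by (intro complex_vs.span_minimal)
 then have "closure (cspan B) <= W"
  using assms closure_minimal by blast
 then show ?thesis
  using assms by blast
qed

lemma span_range_explicit:
 fixes f :: "'i => 'a::complex_hilbert"
 assumes "x \<in> cspan (f ` I)"
 obtains A r where "finite A" "A <= I" "x = (\<Sum>i\<in>A. r i *\<^sub>C f i)"
proof -
 let ?S = "{x. EX A r. finite A & A <= I & x = (\<Sum>i\<in>A. r i *\<^sub>C f i)}"
 have "csubspace ?S"
 proof (rule complex_vs.subspaceI)
  show "0 \<in> ?S"
   by (auto intro!: exI[of _ "{}"])
  show "x + y \<in> ?S" if xy: "x \<in> ?S" "y \<in> ?S" for x y
  proof -
   from xy obtain A r B s where A: "finite A" "A <= I" "x = (\<Sum>i\<in>A. r i *\<^sub>C f i)"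
    and B: "finite B" "B <= I" "y = (\<Sum>i\<in>B. s i *\<^sub>C f i)"
    by blast
   have "x = (\<Sum>i\<in>A \<union> B. (if i \<in> A then r i else 0) *\<^sub>C f i)"
    unfolding A(3) using A B by (intro sum.mono_neutral_cong_left) auto
   moreover have "y = (\<Sum>i\<in>A \<union> B. (if i \<in> B then s i else 0) *\<^sub>C f i)"
    unfolding B(3) using A B by (intro sum.mono_neutral_cong_left) auto
   ultimately have "x + y = (\<Sum>i\<in>A \<union> B. ((if i \<in> A then r i else 0) + (if i \<in> B then s i else 0)) *\<^sub>C f i)"
    by (simp add: scaleC_add_left sum.distrib)
   then show ?thesis
    using A B by (intro CollectI exI[of _ "A \<union> B"]) (auto intro: exI[of _ "%i. (if i \<in> A then r i else 0) + (if i \<in> B then s i else 0)"])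
  qed
  show "c *\<^sub>C x \<in> ?S" if "x \<in> ?S" for c x
  proof -
   from that obtain A r where "finite A" "A <= I" "x = (\<Sum>i\<in>A. r i *\<^sub>C f i)"
    by blast
   then have "finite A & A <= I & c *\<^sub>C x = (\<Sum>i\<in>A. (c * r i) *\<^sub>C f i)"
    by (simp add: complex_vs.scale_sum_right scaleC_scaleC)
   then show ?thesis
    by (intro CollectI exI[of _ A] exI[of _ "%i. c * r i"])
  qed
 qed
 moreover have "f ` I <= ?S"
 proof (clarify)
  fix i assume "i \<in> I"
  then show "EX A r. finite A & A <= I & f i = (\<Sum>i\<in>A. r i *\<^sub>C f i)"
   by (intro exI[of _ "{i}"] exI[of _ "%_. 1"]) auto
 qed
 ultimately have "cspan (f ` I) <= ?S"
  by (intro complex_vs.span_minimal)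
 with assms that show ?thesis
  by blast
qed

text \<open>A minimising sequence for the distance is Cauchy by the parallelogram law, because
  midpoints stay in \<open>W\<close>. The minimiser is orthogonal since moving it along
  \<open>z\<close> cannot shorten the distance.\<close>

lemma orthogonal_projection_exists:
 fixes W :: "'a::complex_hilbert set"
 assumes "closed W" and W: "csubspace W"
 obtains w where "w \<in> W" "!!z. z \<in> W ==> cip (x - w) z = 0"
proof -
 define d where "d = Inf ((%w. (norm (x - w))\<^sup>2) ` W)"
 have ne: "(%w. (norm (x - w))\<^sup>2) ` W ~= {}"
  using complex_vs.subspace_0[OF W] by blast
 have bdd: "bdd_below ((%w. (norm (x - w))\<^sup>2) ` W)"
  by (intro bdd_belowI[of _ 0]) auto
 have d_le: "d <= (norm (x - w))\<^sup>2" if "w \<in> W" for w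
  unfolding d_def using that bdd by (intro cInf_lower) auto
 have "\<exists>w\<in>W. (norm (x - w))\<^sup>2 < d + 1 / real (Suc n)" for n
 proof -
  have "d < d + 1 / real (Suc n)" by simp
  then show ?thesis
   using cInf_lessD[OF ne, folded d_def] by blast
 qed
 then obtain f where f: "f n \<in> W" "(norm (x - f n))\<^sup>2 < d + 1 / real (Suc n)" for n
  by metis
 have par: "(norm (f m - f n))\<^sup>2 <= 2 * (1 / real (Suc m)) + 2 * (1 / real (Suc n))" for m n
 proof -
  let ?h = "(1/2) *\<^sub>C (f m + f n)"
  have "?h \<in> W"
   using W f by (intro complex_vs.subspace_scale complex_vs.subspace_add)
  then have h: "d <= (norm (x - ?h))\<^sup>2"
   by (rule d_le)
  have "2 *\<^sub>R ?h = f m + f n"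
   by (simp add: scaleR_scaleC scaleC_scaleC)
  then have "(x - f m) + (x - f n) = 2 *\<^sub>R (x - ?h)"
   by (simp add: scaleR_diff_right scaleR_2)
  then have "(norm ((x - f m) + (x - f n)))\<^sup>2 = 4 * (norm (x - ?h))\<^sup>2"
   by (simp add: power_mult_distrib)
  moreover have "(norm ((x - f m) + (x - f n)))\<^sup>2 + (norm ((x - f m) - (x - f n)))\<^sup>2
    = 2 * (norm (x - f m))\<^sup>2 + 2 * (norm (x - f n))\<^sup>2"
   by (simp only: power2_norm_eq_inner) (simp add: inner_add_left inner_add_right inner_diff_left inner_diff_right)
  moreover have "(x - f m) - (x - f n) = f n - f m"
   by simp
  ultimately show ?thesis
   using h f(2)[of m] f(2)[of n] by (simp add: norm_minus_commute)
 qed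
 have "Cauchy f"
 proof (rule metric_CauchyI)
  fix e :: real assume e: "e > 0"
  then obtain N where N: "4 / e\<^sup>2 < real N"
   using reals_Archimedean2 by blast
  have "dist (f m) (f n) < e" if "m >= N" "n >= N" for m n
  proof -
   have N0: "N > 0" using N e by (intro gr0I) (auto simp: field_simps power2_less_0)
   have "1 / real (Suc m) < 1 / real N" "1 / real (Suc n) < 1 / real N"
    using that N0 by (auto simp: field_simps)
   with par[of m n] have "(norm (f m - f n))\<^sup>2 < 4 / real N"
    by simp
   also have "... < e\<^sup>2"
    using N N0 e by (simp add: field_simps)
   finally show ?thesis
    using e by (simp add: dist_norm power2_less_imp_less)
  qed
  then show "EX M. \<forall>m\<ge>M. \<forall>n\<ge>M. dist (f m) (f n) < e"
   by blast
 qed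
 then obtain w where w: "f \<longlonglongrightarrow> w"
  using Cauchy_convergent_iff convergentD by blast
 have wW: "w \<in> W"
  using assms(1) f(1) w closed_sequentially by blast
 have wd: "(norm (x - w))\<^sup>2 <= d"
 proof (rule LIMSEQ_le)
  show "(%n. (norm (x - f n))\<^sup>2) \<longlonglongrightarrow> (norm (x - w))\<^sup>2"
   by (intro tendsto_intros w)
  show "(%n. d + 1 / real (Suc n)) \<longlonglongrightarrow> d"
   using tendsto_add[OF tendsto_const LIMSEQ_Suc[OF lim_1_over_n], of d] by simp
 qed (use f(2) less_imp_le in blast)
 have "cip (x - w) z = 0" if z: "z \<in> W" for z
 proof (cases "z = 0")
  case False
  \<comment> \<open>The optimal step along \<open>z\<close>: it lowers the squared distance by the
    squared modulus of \<open>cip (x - w) z\<close> over that of \<open>norm z\<close>, which must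
    then vanish.\<close>
  define c where "c = cip (x - w) z / of_real ((norm z)\<^sup>2)"
  have "w + c *\<^sub>C z \<in> W"
   using W wW z by (intro complex_vs.subspace_add complex_vs.subspace_scale)
  then have le: "(norm (x - w))\<^sup>2 <= (norm ((x - w) - c *\<^sub>C z))\<^sup>2"
   using d_le wd by (metis diff_diff_add order_trans)
  have "complex_of_real ((norm ((x - w) - c *\<^sub>C z))\<^sup>2)
    = of_real ((norm (x - w))\<^sup>2) - cnj c * cip (x - w) z - c * cnj (cip (x - w) z) + c * cnj c * of_real ((norm z)\<^sup>2)"
  proof -
   have "cip (v - c *\<^sub>C z) (v - c *\<^sub>C z) = cip v v - cnj c * cip v z - c * cip z v + c * cnj c * cip z z" for v
    by (simp add: cip.diff_left cip.diff_right cip_scaleC_left cip_scaleC_right algebra_simps)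
   from this[of "x - w"] show ?thesis
    unfolding cip_self cip_commute[of z "x - w"] .
  qed
  also have "... = of_real ((norm (x - w))\<^sup>2) - cnj c * cip (x - w) z"
   using False by (simp add: c_def field_simps power2_eq_square)
  also have "cnj c * cip (x - w) z = of_real ((cmod (cip (x - w) z))\<^sup>2 / (norm z)\<^sup>2)"
   using complex_norm_square[of "cip (x - w) z"] by (simp add: c_def mult.commute)
  finally have "(norm ((x - w) - c *\<^sub>C z))\<^sup>2 = (norm (x - w))\<^sup>2 - (cmod (cip (x - w) z))\<^sup>2 / (norm z)\<^sup>2"
   by (metis of_real_diff of_real_eq_iff)
  with le have "(cmod (cip (x - w) z))\<^sup>2 / (norm z)\<^sup>2 <= 0"
   by simp
  then show ?thesis
   using False by (simp add: divide_le_0_iff)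
 qed (simp add: cip.zero_right)
 with wW that show ?thesis by blast
qed

section \<open>Bounded operators: Riesz representation and extension from total families\<close>

definition cbounded_linear :: "('a::complex_hilbert => 'b::complex_hilbert) => bool" where
 "cbounded_linear f \<longleftrightarrow> bounded_linear f & (ALL c x. f (c *\<^sub>C x) = c *\<^sub>C f x)"

lemma cbounded_linearI:
 assumes "!!x y. f (x + y) = f x + f y" "!!c x. f (c *\<^sub>C x) = c *\<^sub>C f x" "!!x. norm (f x) <= norm x * K"
 shows "cbounded_linear f"
 unfolding cbounded_linear_def using assms
 by (auto intro!: bounded_linear_intro[of _ K] simp: scaleR_scaleC)

lemma cbounded_linear_eq_on_total:
 assumes f: "cbounded_linear f" and g: "cbounded_linear g"
  and B: "closure (cspan B) = UNIV" "!!b. b \<in> B ==> f b = g b"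
 shows "f x = g x"
proof -
 interpret f: bounded_linear f using f by (simp add: cbounded_linear_def)
 interpret g: bounded_linear g using g by (simp add: cbounded_linear_def)
 have "x \<in> {x. f x = g x}"
 proof (rule total_induct[OF B(1)])
  show "closed {x. f x = g x}"
   by (intro closed_Collect_eq f.continuous_on g.continuous_on continuous_on_id)
  show "csubspace {x. f x = g x}"
   using f g by (intro complex_vs.subspaceI) (auto simp: f.add g.add f.zero g.zero cbounded_linear_def)
 qed (use B in auto)
 then show ?thesis by simp
qed

text \<open>Subtracting from \<open>a\<close> its projection on the kernel leaves a vector
  \<open>u\<close> orthogonal to the kernel. Since \<open>f u *\<^sub>C x - f x *\<^sub>C u\<close>
  lies in the kernel, pairing it with \<open>u\<close> yields the representing multiple of
  \<open>u\<close>.\<close>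

lemma riesz_representation:
 fixes f :: "'a::complex_hilbert => complex"
 assumes f: "cbounded_linear f"
 obtains w where "!!x. f x = cip x w"
proof (cases "ALL x. f x = 0")
 case True
 then show ?thesis using that[of 0] by (simp add: cip.zero_right)
next
 case False
 then obtain a where a: "f a ~= 0" by blast
 interpret f: bounded_linear f using f by (simp add: cbounded_linear_def)
 have fC: "f (c *\<^sub>C x) = c * f x" for c x
  using f by (simp add: cbounded_linear_def scaleC_complex_def)
 let ?W = "{x. f x = 0}"
 have "closed ?W"
  by (intro closed_Collect_eq f.continuous_on continuous_on_id continuous_on_const)
 moreover have "csubspace ?W"
  by (intro complex_vs.subspaceI) (auto simp: f.add f.zero fC)
 ultimately obtain w where w: "w \<in> ?W" "!!z. z \<in> ?W ==> cip (a - w) z = 0"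
  using orthogonal_projection_exists[where x=a] by metis
 define u where "u = a - w"
 have fu: "f u = f a"
  using w by (simp add: u_def f.diff)
 then have u: "u ~= 0"
  using a f.zero by auto
 have "f x = cip x ((cnj (f a) / of_real ((norm u)\<^sup>2)) *\<^sub>C u)" for x
 proof -
  have "f (f u *\<^sub>C x - f x *\<^sub>C u) = 0"
   by (simp add: f.diff fC)
  then have "cip u (f u *\<^sub>C x - f x *\<^sub>C u) = 0"
   using w(2) u_def by blast
  then have "f u * cip x u = f x * of_real ((norm u)\<^sup>2)"
   by (metis (no_types, lifting) cip.diff_left cip_commute cip_scaleC_left cip_self complex_cnj_zero_iff eq_iff_diff_eq_0)
  then show ?thesis
   using u fu by (simp add: cip_scaleC_right field_simps)
 qed
 then show ?thesis using that by blast
qed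

text \<open>The vectors \<open>e i\<close> may be dependent or repeated, so the map is not
  prescribed on a basis. The bound for coefficient families is what makes the image of a combination
  independent of how it is written.\<close>

lemma contraction_extends:
 fixes e :: "'i => 'a::complex_hilbert" and f :: "'i => 'b::complex_hilbert"
 assumes total: "closure (cspan (e ` I)) = UNIV"
  and bound: "!!A r. finite A ==> A <= I ==> norm (\<Sum>i\<in>A. r i *\<^sub>C f i) <= C * norm (\<Sum>i\<in>A. r i *\<^sub>C e i)"
 obtains K where "cbounded_linear K" "!!i. i \<in> I ==> K (e i) = f i"
proof -
 let ?D = "cspan (e ` I)"
 have "\<forall>x\<in>?D. EX A r. finite A & A <= I & x = (\<Sum>i\<in>A. r i *\<^sub>C e i)"
  by (metis span_range_explicit)
 \<comment> \<open>An arbitrary representation is fixed for each vector of the span;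
   \<open>lip\<close> then shows that the choice does not matter.\<close>
 then obtain A r where Ar: "x \<in> ?D ==> finite (A x) & A x <= I & x = (\<Sum>i\<in>A x. r x i *\<^sub>C e i)" for x
  by metis
 define g where "g x = (\<Sum>i\<in>A x. r x i *\<^sub>C f i)" for x
 \<comment> \<open>Three representations at once: if the third one represents
   \<open>c *\<^sub>C x + y\<close>, the right side is zero, so well-definedness and linearity of
   \<open>g\<close> come together.\<close>
 have lip: "norm (c *\<^sub>C (\<Sum>i\<in>A1. r1 i *\<^sub>C f i) + (\<Sum>i\<in>A2. r2 i *\<^sub>C f i) - (\<Sum>i\<in>A3. r3 i *\<^sub>C f i))
   \<le> C * norm (c *\<^sub>C (\<Sum>i\<in>A1. r1 i *\<^sub>C e i) + (\<Sum>i\<in>A2. r2 i *\<^sub>C e i) - (\<Sum>i\<in>A3. r3 i *\<^sub>C e i))"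
  if "finite A1" "finite A2" "finite A3" "A1 <= I" "A2 <= I" "A3 <= I" for A1 A2 A3 c r1 r2 r3
 proof -
  define s where "s i = c * (if i \<in> A1 then r1 i else 0) + (if i \<in> A2 then r2 i else 0) - (if i \<in> A3 then r3 i else 0)" for i
  have ext: "(\<Sum>i\<in>B. q i *\<^sub>C h i) = (\<Sum>i\<in>A1 \<union> A2 \<union> A3. (if i \<in> B then q i else 0) *\<^sub>C h i)"
   if "B <= A1 \<union> A2 \<union> A3" for B q and h :: "'i => 'c::complex_hilbert"
   using that \<open>finite A1\<close> \<open>finite A2\<close> \<open>finite A3\<close> by (intro sum.mono_neutral_cong_left) auto
  have eq: "c *\<^sub>C (\<Sum>i\<in>A1. r1 i *\<^sub>C h i) + (\<Sum>i\<in>A2. r2 i *\<^sub>C h i) - (\<Sum>i\<in>A3. r3 i *\<^sub>C h i)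
    = (\<Sum>i\<in>A1 \<union> A2 \<union> A3. s i *\<^sub>C h i)" for h :: "'i => 'c::complex_hilbert"
   unfolding ext[of A1 r1, OF Un_upper1[THEN subset_trans, OF Un_upper1]]
    ext[of A2 r2, OF subset_trans[OF Un_upper2 Un_upper1]] ext[of A3 r3, OF Un_upper2] s_def
   by (simp add: complex_vs.scale_sum_right scaleC_scaleC sum.distrib[symmetric] sum_subtractf[symmetric]
     complex_vs.scale_left_diff_distrib scaleC_add_left)
  show ?thesis
   unfolding eq using that by (intro bound) auto
 qed
 have lin: "g (c *\<^sub>C x + y) = c *\<^sub>C g x + g y" if xy: "x \<in> ?D" "y \<in> ?D" for c x y
 proof -
  have xyD: "c *\<^sub>C x + y \<in> ?D"
   using xy by (intro complex_vs.span_add complex_vs.span_scale)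
  have "norm (c *\<^sub>C g x + g y - g (c *\<^sub>C x + y)) <= C * norm (c *\<^sub>C x + y - (c *\<^sub>C x + y))"
   using lip[of "A x" "A y" "A (c *\<^sub>C x + y)" c "r x" "r y" "r (c *\<^sub>C x + y)"] Ar[OF xy(1)] Ar[OF xy(2)] Ar[OF xyD]
   unfolding g_def by simp
  then show ?thesis by simp
 qed
 have diff: "g x - g y = g (x - y)" if xy: "x \<in> ?D" "y \<in> ?D" for x y
  using lin[of y x "-1"] xy by (simp add: complex_vs.scale_minus_left)
 have gnorm: "norm (g x) <= C * norm x" if "x \<in> ?D" for x
  using lip[of "A x" "{}" "{}" 1 "r x"] Ar[OF that] unfolding g_def by simp
 have "\<bar>C\<bar>-lipschitz_on ?D g"
 proof (rule lipschitz_onI)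
  fix x y assume xy: "x \<in> ?D" "y \<in> ?D"
  then have "norm (g x - g y) <= C * norm (x - y)"
   unfolding diff[OF xy] by (intro gnorm complex_vs.span_diff)
  then show "dist (g x) (g y) <= \<bar>C\<bar> * dist x y"
   by (simp add: dist_norm) (meson abs_ge_self mult_right_mono norm_ge_zero order_trans)
 qed simp
 then have "uniformly_continuous_on ?D g"
  by (rule lipschitz_on_uniformly_continuous)
 then obtain K where K: "uniformly_continuous_on (closure ?D) K" "!!x. x \<in> ?D ==> g x = K x"
  using uniformly_continuous_on_extension_on_closure by metis
 then have cont: "continuous_on UNIV K"
  using total uniformly_continuous_imp_continuous by auto
 have approx: "EX u. (ALL n. u n \<in> ?D) & u \<longlonglongrightarrow> x" for x
  using total closure_sequential[of x ?D] by auto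
 have KC: "(%n. K (u n)) \<longlonglongrightarrow> K x" if "u \<longlonglongrightarrow> x" for u x
  using cont that by (metis continuous_on_tendsto_compose UNIV_I eventually_sequentially)
 have Klin: "K (c *\<^sub>C x + y) = c *\<^sub>C K x + K y" for c x y
 proof -
  obtain u v where uv: "!!n. u n \<in> ?D" "u \<longlonglongrightarrow> x" "!!n. v n \<in> ?D" "v \<longlonglongrightarrow> y"
   using approx by metis
  have "(%n. K (c *\<^sub>C u n + v n)) \<longlonglongrightarrow> K (c *\<^sub>C x + y)"
   by (intro KC tendsto_add scaleC.tendsto tendsto_const uv)
  moreover have "K (c *\<^sub>C u n + v n) = c *\<^sub>C K (u n) + K (v n)" for n
   using lin[OF uv(1) uv(3), of c n n] K(2)[OF uv(1), of n] K(2)[OF uv(3), of n]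
    K(2)[OF complex_vs.span_add[OF complex_vs.span_scale[OF uv(1)] uv(3)], of c n n] by simp
  moreover have "(%n. c *\<^sub>C K (u n) + K (v n)) \<longlonglongrightarrow> c *\<^sub>C K x + K y"
   by (intro KC tendsto_add scaleC.tendsto tendsto_const uv)
  ultimately show ?thesis
   by (simp add: LIMSEQ_unique)
 qed
 have Kbd: "norm (K x) <= C * norm x" for x
 proof -
  obtain u where u: "!!n. u n \<in> ?D" "u \<longlonglongrightarrow> x"
   using approx by metis
  show ?thesis
  proof (rule LIMSEQ_le)
   show "(%n. norm (K (u n))) \<longlonglongrightarrow> norm (K x)" "(%n. C * norm (u n)) \<longlonglongrightarrow> C * norm x"
    by (intro tendsto_intros KC u)+
   show "EX N. \<forall>n\<ge>N. norm (K (u n)) <= C * norm (u n)"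
    using gnorm[OF u(1)] K(2)[OF u(1)] by metis
  qed
 qed
 have "cbounded_linear K"
 proof (rule cbounded_linearI)
  show "K (x + y) = K x + K y" for x y
   using Klin[of 1 x y] by simp
  have "K 0 = 0"
   using Kbd[of 0] by simp
  then show "K (c *\<^sub>C x) = c *\<^sub>C K x" for c x
   using Klin[of c x 0] by simp
  show "norm (K x) <= norm x * C" for x
   using Kbd[of x] by (simp add: mult.commute)
 qed
 moreover have "K (e i) = f i" if i: "i \<in> I" for i
 proof -
  have iD: "e i \<in> ?D"
   using i by (intro complex_vs.span_base) auto
  have "norm (g (e i) - f i) <= C * norm (e i - e i)"
   using lip[of "A (e i)" "{}" "{i}" 1 "r (e i)" _ "%_. 1"] Ar[OF iD] i unfolding g_def by simp
  then show ?thesis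
   using K(2)[OF iD] by simp
 qed
 ultimately show ?thesis using that by blast
qed

subsection \<open>Bounded sesquilinear forms\<close>

definition sesquilinear :: "('a::complex_hilbert => 'a => complex) => bool" where
 "sesquilinear \<beta> \<longleftrightarrow> bounded_bilinear \<beta> & (ALL c x y. \<beta> (c *\<^sub>C x) y = c * \<beta> x y)
   & (ALL c x y. \<beta> x (c *\<^sub>C y) = cnj c * \<beta> x y)"

lemma sesquilinear_bb: "sesquilinear \<beta> ==> bounded_bilinear \<beta>"
 by (simp add: sesquilinear_def)

lemma sesquilinear_left: "sesquilinear \<beta> ==> \<beta> (c *\<^sub>C x) y = c * \<beta> x y"
 by (simp add: sesquilinear_def)

lemma sesquilinear_right: "sesquilinear \<beta> ==> \<beta> x (c *\<^sub>C y) = cnj c * \<beta> x y"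
 by (simp add: sesquilinear_def)

lemma sesquilinearI:
 assumes "!!x y z. \<beta> (x + y) z = \<beta> x z + \<beta> y z" "!!x y z. \<beta> x (y + z) = \<beta> x y + \<beta> x z"
  and "!!c x y. \<beta> (c *\<^sub>C x) y = c * \<beta> x y" "!!c x y. \<beta> x (c *\<^sub>C y) = cnj c * \<beta> x y"
  and "!!x y. cmod (\<beta> x y) <= norm x * norm y * K"
 shows "sesquilinear \<beta>"
 unfolding sesquilinear_def
 using assms by (auto intro!: bounded_bilinear.intro simp: scaleR_scaleC scaleC_complex_def)

lemma sesquilinear_cip: "sesquilinear cip"
 by (rule sesquilinearI[where K=1]) (auto simp: cip_add_left cip_add_right cip_scaleC_left cip_scaleC_right cip_bound)

lemma cbounded_linear_sesquilinear: "sesquilinear \<beta> ==> cbounded_linear (%x. \<beta> x y)"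
 unfolding cbounded_linear_def sesquilinear_def
 by (auto intro: bounded_bilinear.bounded_linear_left simp: scaleC_complex_def)

lemma cbounded_linear_sesquilinear_cnj: "sesquilinear \<beta> ==> cbounded_linear (%y. cnj (\<beta> x y))"
 unfolding cbounded_linear_def sesquilinear_def
 by (auto intro: bounded_linear_compose[OF bounded_linear_cnj bounded_bilinear.bounded_linear_right] simp: scaleC_complex_def)

lemma sesquilinear_compose:
 assumes b: "sesquilinear \<beta>" and f: "cbounded_linear f" and g: "cbounded_linear g"
 shows "sesquilinear (%x y. \<beta> (f x) (g y))"
 using f g bounded_bilinear.comp[OF sesquilinear_bb[OF b], of f g] sesquilinear_left[OF b] sesquilinear_right[OF b]
 unfolding sesquilinear_def cbounded_linear_def by simp

text \<open>Riesz applied in the first variable for each \<open>y\<close>; the operator is bounded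
  because the squared norm of \<open>R x\<close> is \<open>\<beta> (R x) x\<close>.\<close>

lemma sesquilinear_adjoint:
 assumes b: "sesquilinear \<beta>"
 obtains R where "cbounded_linear R" "!!x y. \<beta> x y = cip x (R y)"
proof -
 interpret b: bounded_bilinear \<beta> using b by (rule sesquilinear_bb)
 have "EX w. ALL x. \<beta> x y = cip x w" for y
  using riesz_representation[OF cbounded_linear_sesquilinear[OF b]] by metis
 then obtain R where R: "!!x y. \<beta> x y = cip x (R y)" by metis
 obtain K where K: "K > 0" "!!x y. cmod (\<beta> x y) <= norm x * norm y * K"
  using b.pos_bounded by blast
 have "cbounded_linear R"
 proof (rule cbounded_linearI)
  show "R (x + y) = R x + R y" for x y
   by (subst cip_eq_iff_right[symmetric]) (simp add: cip_add_right R[symmetric] b.add_right)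
  show "R (c *\<^sub>C x) = c *\<^sub>C R x" for c x
   by (subst cip_eq_iff_right[symmetric]) (simp add: cip_scaleC_right R[symmetric] sesquilinear_right[OF b])
  show "norm (R x) <= norm x * K" for x
  proof -
   have "(norm (R x))\<^sup>2 = cmod (\<beta> (R x) x)"
    by (simp add: R cip_self norm_power)
   also have "... <= norm (R x) * norm x * K" by (rule K)
   finally show ?thesis
    by (cases "R x = 0") (use K in \<open>auto simp: power2_eq_square\<close>)
  qed
 qed
 with R that show ?thesis by blast
qed

lemma sesquilinear_operator:
 assumes b: "sesquilinear \<beta>"
 obtains R where "cbounded_linear R" "!!x y. \<beta> x y = cip (R x) y"
proof -
 have "sesquilinear (%x y. cnj (\<beta> y x))"
 proof -
  interpret b: bounded_bilinear \<beta> using b by (rule sesquilinear_bb)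
  obtain K where "K > 0" "!!x y. cmod (\<beta> x y) <= norm x * norm y * K"
   using b.pos_bounded by blast
  then show ?thesis
   using b by (intro sesquilinearI[where K=K])
    (auto simp: b.add_left b.add_right sesquilinear_left sesquilinear_right
     intro: order_trans[OF _ eq_refl[OF mult.commute[THEN arg_cong[where f="%t. t * K"]]]])
 qed
 from sesquilinear_adjoint[OF this] obtain R where "cbounded_linear R" "!!x y. cnj (\<beta> y x) = cip x (R y)"
  by metis
 then show ?thesis
  using that by (metis cip_commute complex_cnj_cnj)
qed

text \<open>Two extensions: each column of \<open>c\<close> is a bounded functional, hence
  represented by some \<open>f j\<close>, and the assumed bound then says that sending
  \<open>e j\<close> to \<open>f j\<close> is a contraction in the sense of
  \<open>contraction_extends\<close>.\<close>

lemma sesquilinear_from_kernel: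
 fixes e :: "'i => 'a::complex_hilbert"
 assumes total: "closure (cspan (e ` I)) = UNIV"
  and bound: "!!A a b. finite A ==> A <= I ==>
   cmod (\<Sum>i\<in>A. \<Sum>j\<in>A. a i * cnj (b j) * c i j) <= norm (\<Sum>i\<in>A. a i *\<^sub>C e i) * norm (\<Sum>j\<in>A. b j *\<^sub>C e j)"
 obtains \<gamma> where "sesquilinear \<gamma>" "!!i j. i \<in> I ==> j \<in> I ==> \<gamma> (e i) (e j) = c i j"
proof -
 \<comment> \<open>Padding with zero coefficients allows different index sets for the two variables;
   the hypothesis has a single one because that is what \<open>block_contractive\<close>
   supplies.\<close>
 have bound2: "cmod (\<Sum>i\<in>A. \<Sum>j\<in>B. a i * cnj (b j) * c i j) <= norm (\<Sum>i\<in>A. a i *\<^sub>C e i) * norm (\<Sum>j\<in>B. b j *\<^sub>C e j)"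
  if AB: "finite A" "A <= I" "finite B" "B <= I" for A B a b
 proof -
  define a' b' where "a' i = (if i \<in> A then a i else 0)" and "b' i = (if i \<in> B then b i else 0)" for i
  have "(\<Sum>i\<in>A \<union> B. \<Sum>j\<in>A \<union> B. a' i * cnj (b' j) * c i j) = (\<Sum>i\<in>A. \<Sum>j\<in>A \<union> B. a i * cnj (b' j) * c i j)"
   using AB by (intro sum.mono_neutral_cong_right) (auto simp: a'_def)
  also have "... = (\<Sum>i\<in>A. \<Sum>j\<in>B. a i * cnj (b j) * c i j)"
   using AB by (intro sum.cong refl sum.mono_neutral_cong_right) (auto simp: b'_def)
  finally have 1: "(\<Sum>i\<in>A \<union> B. \<Sum>j\<in>A \<union> B. a' i * cnj (b' j) * c i j) = ..." .
  have 2: "(\<Sum>i\<in>A \<union> B. a' i *\<^sub>C e i) = (\<Sum>i\<in>A. a i *\<^sub>C e i)" "(\<Sum>i\<in>A \<union> B. b' i *\<^sub>C e i) = (\<Sum>i\<in>B. b i *\<^sub>C e i)"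
   using AB by (auto intro!: sum.mono_neutral_cong_right simp: a'_def b'_def)
  show ?thesis
   using bound[of "A \<union> B" a' b'] AB unfolding 1 2 by simp
 qed
 have "EX f. \<forall>i\<in>I. c i j = cip (e i) f" if j: "j \<in> I" for j
 proof -
  obtain L where L: "cbounded_linear L" "!!i. i \<in> I ==> L (e i) = c i j"
  proof (rule contraction_extends[OF total, where C="norm (e j)" and f="%i. c i j"])
   fix A r assume "finite (A :: 'i set)" "A <= I"
   then show "norm (\<Sum>i\<in>A. r i *\<^sub>C c i j) <= norm (e j) * norm (\<Sum>i\<in>A. r i *\<^sub>C e i)"
    using bound2[of A "{j}" r "%_. 1"] j by (simp add: scaleC_complex_def mult.commute)
  qed (rule that, auto)
  from riesz_representation[OF L(1)] L(2) show ?thesis by metis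
 qed
 then obtain f where f: "!!i j. i \<in> I ==> j \<in> I ==> c i j = cip (e i) (f j)" by metis
 obtain K where K: "cbounded_linear K" "!!j. j \<in> I ==> K (e j) = f j"
 proof (rule contraction_extends[OF total, where C=1 and f=f])
  fix B b assume B: "finite (B :: 'i set)" "B <= I"
  define y z where "y = (\<Sum>j\<in>B. b j *\<^sub>C f j)" and "z = (\<Sum>j\<in>B. b j *\<^sub>C e j)"
  \<comment> \<open>The norm of \<open>y\<close> is recovered by duality: the estimate against
    vectors of the dense span is afterwards applied in the limit to \<open>y\<close> itself.\<close>
  have le: "cmod (cip x y) <= norm x * norm z" if x: "x \<in> cspan (e ` I)" for x
  proof -
   obtain A a where A: "finite A" "A <= I" "x = (\<Sum>i\<in>A. a i *\<^sub>C e i)"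
    using span_range_explicit[OF x] by metis
   have "cip x y = (\<Sum>i\<in>A. \<Sum>j\<in>B. a i * cnj (b j) * c i j)"
    unfolding A(3) y_def cip.sum_left cip.sum_right
   proof (subst sum.swap, intro sum.cong refl)
    fix i j assume "i \<in> A" "j \<in> B"
    then have "c i j = cip (e i) (f j)" using A B by (intro f) auto
    then show "cip (a i *\<^sub>C e i) (b j *\<^sub>C f j) = a i * cnj (b j) * c i j"
     by (simp add: cip_scaleC_left cip_scaleC_right)
   qed
   then show ?thesis
    using bound2[OF A(1,2) B, of a b] A(3) z_def by simp
  qed
  have "y \<in> closure (cspan (e ` I))" using total by simp
  then obtain u where u: "!!n. u n \<in> cspan (e ` I)" "u \<longlonglongrightarrow> y"
   unfolding closure_sequential by blast
  have "cmod (cip y y) <= norm y * norm z"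
  proof (rule LIMSEQ_le)
   show "(%n. cmod (cip (u n) y)) \<longlonglongrightarrow> cmod (cip y y)" "(%n. norm (u n) * norm z) \<longlonglongrightarrow> norm y * norm z"
    by (intro tendsto_intros cip.tendsto u)+
  qed (use le u in blast)
  then have "norm y * norm y <= norm y * norm z"
   by (simp add: cip_self norm_mult power2_eq_square)
  then have "norm y <= norm z"
   by (cases "norm y = 0") (auto simp: mult_le_cancel_left)
  then show "norm (\<Sum>i\<in>B. b i *\<^sub>C f i) <= 1 * norm (\<Sum>i\<in>B. b i *\<^sub>C e i)"
   by (simp add: y_def z_def)
 qed (rule that, auto)
 have "cbounded_linear (%x::'a. x)"
  by (auto simp: cbounded_linear_def bounded_linear_ident)
 from sesquilinear_compose[OF sesquilinear_cip this K(1)] show ?thesis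
  using that[of "%x y. cip x (K y)"] f K(2) by auto
qed

declare cip.zero_left [simp] cip.zero_right [simp]

subsection \<open>Unitary operators and cyclic vectors\<close>

lemma zpow_0 [simp]: "zpow T 0 x = x"
 by (simp add: zpow_def)

lemma zpow_of_nat: "zpow T (int n) = T ^^ n"
 by (simp add: zpow_def)

lemma zpow_succ:
 assumes "bij T"
 shows "zpow T (k + 1) x = T (zpow T k x)"
proof (cases "k >= 0")
 case True
 then have "nat (k + 1) = Suc (nat k)" by simp
 with True show ?thesis by (simp add: zpow_def)
next
 case False
 then have "nat (- k) = Suc (nat (- (k + 1)))" by simp
 then have "T (zpow T k x) = (inv T ^^ nat (- (k + 1))) x"
  using False assms by (simp add: zpow_def bij_is_surj surj_f_inv_f)
 with False show ?thesis
  by (cases "k = -1") (auto simp: zpow_def)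
qed

lemma zpow_pred: "bij T ==> zpow T (k - 1) x = inv T (zpow T k x)"
 using zpow_succ[of T "k - 1" x] by (simp add: bij_is_inj inv_f_f)

lemma zpow_add:
 assumes "bij T"
 shows "zpow T (j + k) x = zpow T j (zpow T k x)"
proof (induction j rule: int_induct[where k=0])
 case (step1 i)
 have "zpow T (i + 1 + k) x = T (zpow T (i + k) x)"
  using zpow_succ[OF assms, of "i + k" x] by (simp add: algebra_simps)
 with step1 show ?case by (simp add: zpow_succ[OF assms])
next
 case (step2 i)
 have "zpow T (i - 1 + k) x = inv T (zpow T (i + k) x)"
  using zpow_pred[OF assms, of "i + k" x] by (simp add: algebra_simps)
 with step2 show ?case by (simp add: zpow_pred[OF assms])
qed simp

lemma zpow_1: "zpow T 1 = T" "zpow T (-1) = inv T"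
 by (auto simp: zpow_def)

lemma zpow_minus_cancel: "bij T ==> zpow T (- k) (zpow T k x) = x" "bij T ==> zpow T k (zpow T (- k) x) = x"
 by (simp_all add: zpow_add[symmetric])

definition unitary :: "('a::complex_hilbert => 'a) => bool" where
 "unitary U \<longleftrightarrow> surj U & (ALL x y. U (x + y) = U x + U y) & (ALL c x. U (c *\<^sub>C x) = c *\<^sub>C U x)
   & (ALL x y. cip (U x) (U y) = cip x y)"

context
 fixes U :: "'a::complex_hilbert => 'a"
 assumes U: "unitary U"
begin

lemma unitary_add: "U (x + y) = U x + U y"
 and unitary_scaleC: "U (c *\<^sub>C x) = c *\<^sub>C U x"
 and unitary_cip: "cip (U x) (U y) = cip x y"
 using U by (auto simp: unitary_def)

lemma unitary_norm: "norm (U x) = norm x"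
 using unitary_cip[of x x] unfolding cip_self
 by (metis norm_ge_zero of_real_eq_iff power2_eq_imp_eq)

lemma unitary_cbounded_linear: "cbounded_linear U"
 by (rule cbounded_linearI[where K=1]) (auto simp: unitary_add unitary_scaleC unitary_norm)

lemma unitary_bij: "bij U"
proof -
 interpret bounded_linear U
  using unitary_cbounded_linear by (simp add: cbounded_linear_def)
 have "inj U"
 proof (rule injI)
  fix x y assume "U x = U y"
  then have "norm (U (x - y)) = 0" by (simp add: diff)
  then show "x = y" by (simp add: unitary_norm)
 qed
 then show ?thesis
  using U by (simp add: bij_def unitary_def)
qed

lemma unitary_inv_apply: "U (inv U x) = x" "inv U (U x) = x"
 using unitary_bij by (auto simp: bij_is_surj surj_f_inv_f bij_is_inj)

lemma unitary_inv: "unitary (inv U)"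
 unfolding unitary_def
proof (intro conjI allI)
 show "surj (inv U)"
  using unitary_bij bij_imp_bij_inv bij_is_surj by blast
 show "inv U (x + y) = inv U x + inv U y" for x y
  by (metis unitary_add unitary_inv_apply)
 show "inv U (c *\<^sub>C x) = c *\<^sub>C inv U x" for c x
  by (metis unitary_scaleC unitary_inv_apply)
 show "cip (inv U x) (inv U y) = cip x y" for x y
  by (metis unitary_cip unitary_inv_apply)
qed

end

lemma unitary_funpow: "unitary U ==> unitary (U ^^ n)"
proof (induction n)
 case 0
 then show ?case by (simp add: unitary_def id_def)
next
 case (Suc n)
 then show ?case
  unfolding unitary_def funpow.simps
  by (auto simp: comp_surj[of "U ^^ n" U, unfolded comp_def])
qed

lemma unitary_zpow: "unitary U ==> unitary (zpow U k)"
 by (simp add: zpow_def unitary_funpow unitary_inv)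

lemma form_zpow_invariant:
 assumes "bij U" "!!x y. \<beta> (U x) (U y) = \<beta> x y"
 shows "\<beta> (zpow U k x) (zpow U k y) = \<beta> x y"
proof (induction k rule: int_induct[where k=0])
 case (step2 i)
 have "\<beta> (zpow U (i - 1) x) (zpow U (i - 1) y) = \<beta> (U (zpow U (i - 1) x)) (U (zpow U (i - 1) y))"
  by (simp add: assms(2))
 also have "... = \<beta> (zpow U i x) (zpow U i y)"
  using zpow_succ[OF assms(1), of "i - 1"] by simp
 finally show ?case using step2 by simp
qed (simp_all add: zpow_succ assms)

lemma form_zpow_shift:
 assumes "bij U" "!!x y. \<beta> (U x) (U y) = \<beta> x y"
 shows "\<beta> (zpow U k x) y = \<beta> x (zpow U (- k) y)"
 using form_zpow_invariant[of U \<beta> k x "zpow U (- k) y", OF assms] by (simp add: zpow_minus_cancel assms)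

definition orbit :: "('a => 'a) => 'a => 'a set" where
 "orbit U f = range (%k. zpow U k f)"

definition cyclic :: "('a::complex_hilbert => 'a) => 'a => bool" where
 "cyclic U f \<longleftrightarrow> closure (cspan (orbit U f)) = UNIV"

lemma cyclic_space_contains: "f \<in> closure (cspan (orbit U f))"
proof -
 have "f \<in> orbit U f"
  by (metis orbit_def rangeI zpow_0)
 then show ?thesis
  using closure_subset complex_vs.span_base by blast
qed

lemma csubspace_cyclic_space: "csubspace (closure (cspan (orbit U f)))"
 by (intro csubspace_closure complex_vs.subspace_span)

lemma invariant_preimage:
 assumes P: "cbounded_linear P" and "closed W" "csubspace W" "!!b. b \<in> B ==> P b \<in> W"
  and x: "x \<in> closure (cspan B)"
 shows "P x \<in> W"
proof -
 interpret bounded_linear P using P by (simp add: cbounded_linear_def)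
 have "csubspace {x. P x \<in> W}"
  using P assms(3) by (intro complex_vs.subspaceI)
   (auto simp: add zero cbounded_linear_def complex_vs.subspace_0 complex_vs.subspace_add complex_vs.subspace_scale)
 moreover have "B <= {x. P x \<in> W}" using assms by auto
 ultimately have "cspan B <= {x. P x \<in> W}"
  by (intro complex_vs.span_minimal)
 moreover have "closed {x. P x \<in> W}"
  using continuous_closed_vimage[OF \<open>closed W\<close>, of P] by (simp add: vimage_def continuous_on continuous_at_imp_continuous_on isCont linear_continuous_at bounded_linear_axioms)
 ultimately have "closure (cspan B) <= {x. P x \<in> W}"
  by (rule closure_minimal)
 with x show ?thesis by blast
qed

lemma cyclic_space_invariant:
 assumes U: "unitary U" and x: "x \<in> closure (cspan (orbit U f))"
 shows "zpow U k x \<in> closure (cspan (orbit U f))"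
proof (rule invariant_preimage[OF unitary_cbounded_linear[OF unitary_zpow[OF U]] closed_closure csubspace_cyclic_space _ x])
 fix b assume "b \<in> orbit U f"
 then have "zpow U k b \<in> orbit U f"
  by (auto simp: orbit_def zpow_add[OF unitary_bij[OF U], symmetric])
 then show "zpow U k b \<in> closure (cspan (orbit U f))"
  using closure_subset complex_vs.span_base by blast
qed

lemma cyclic_space_minimal:
 assumes "closed W" "csubspace W" "!!k. zpow U k f \<in> W"
 shows "closure (cspan (orbit U f)) <= W"
 using assms by (intro closure_minimal complex_vs.span_minimal) (auto simp: orbit_def)

text \<open>The map \<open>r(U)F \<mapsto> r(U)\<^sup>*F\<close> is isometric and carries \<open>RF\<close> to \<open>R\<^sup>*F\<close> for every \<open>R\<close>
 commuting with \<open>U\<close>; this replaces the functional calculus of \<open>U\<close>.\<close>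

lemma form_commute:
 fixes U :: "'a::complex_hilbert => 'a"
 assumes U: "unitary U" and F: "cyclic U F"
  and b: "sesquilinear \<beta>" and bU: "!!x y. \<beta> (U x) (U y) = \<beta> x y"
  and g: "sesquilinear \<gamma>" and gU: "!!x y. \<gamma> (U x) (U y) = \<gamma> x y"
  and x': "!!z. \<gamma> x z = cip x' z" and y': "!!z. \<gamma> z y = cip z y'"
 shows "\<beta> x' y = \<beta> x y'"
proof -
 note bij = unitary_bij[OF U]
 interpret b: bounded_bilinear \<beta> using b by (rule sesquilinear_bb)
 obtain R where R: "cbounded_linear R" "!!x y. \<gamma> x y = cip (R x) y"
  using sesquilinear_operator[OF g] by metis
 obtain R' where R': "cbounded_linear R'" "!!x y. \<gamma> x y = cip x (R' y)"
  using sesquilinear_adjoint[OF g] by metis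
 define u where "u k = zpow U k F" for k
 have u_add: "zpow U j (u k) = u (j + k)" for j k
  by (simp add: u_def zpow_add[OF bij])
 have total: "closure (cspan (range u)) = UNIV"
  using F by (simp add: cyclic_def orbit_def u_def[abs_def])
 note bz = form_zpow_shift[of U \<beta>, OF bij bU]
 note gz = form_zpow_shift[of U \<gamma>, OF bij gU]
 note cz = form_zpow_shift[of U cip, OF bij unitary_cip[OF U]]
 have RU: "R (zpow U k z) = zpow U k (R z)" for k z
  by (subst cip_eq_iff[symmetric]) (simp add: R(2)[symmetric] gz cz)
 have R'U: "R' (zpow U k z) = zpow U k (R' z)" for k z
 proof -
  have "cip t (R' (zpow U k z)) = cip t (zpow U k (R' z))" for t
   using gz[of "- k" t z] cz[of "- k" t "R' z"] by (simp add: R'(2)[symmetric])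
  then show ?thesis using cip_eq_iff_right by blast
 qed
 \<comment> \<open>\<open>R'\<close> is the adjoint of \<open>R\<close>, so \<open>H\<close> should
   be the image of \<open>G\<close> under the conjugation. \<open>sym1\<close> and
   \<open>sym2\<close> say so for the coefficients along the orbit of \<open>F\<close>.\<close>
 define G H where "G = R F" and "H = R' F"
 have sym1: "cip H (u a) = cip (u (- a)) G" for a
 proof -
  have "cip H (u a) = cnj (\<gamma> (u a) F)"
   by (simp add: R'(2) H_def) (metis cip_commute)
  also have "... = cnj (\<gamma> F (u (- a)))"
   by (simp add: u_def gz)
  also have "... = cip (u (- a)) G"
   by (simp add: R(2) G_def) (metis cip_commute)
  finally show ?thesis .
 qed
 have sym2: "cip G (u a) = cip (u (- a)) H" for a
  using sym1[of "- a"] by (metis cip_commute minus_minus)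
 \<comment> \<open>A relation rather than a function, since the coefficients of \<open>X\<close> are
   not unique; by \<open>star_norm\<close> it preserves norms.\<close>
 define star where "star X Y \<longleftrightarrow> (EX A r. finite A & X = (\<Sum>a\<in>A. r a *\<^sub>C u a) & Y = (\<Sum>a\<in>A. cnj (r a) *\<^sub>C u (- a)))" for X Y
 have star_norm: "norm Y = norm X" if "star X Y" for X Y
 proof -
  from that obtain A r where A: "X = (\<Sum>a\<in>A. r a *\<^sub>C u a)" "Y = (\<Sum>a\<in>A. cnj (r a) *\<^sub>C u (- a))"
   by (auto simp: star_def)
  have swap: "cip (u (- a)) (u (- b)) = cip (u b) (u a)" for a b
   using cz[of "- a" F "u (- b)"] cz[of b F "u a"] unfolding u_def[of "- a"] u_def[of b] by (simp add: u_add)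
  have "cip Y Y = (\<Sum>a\<in>A. \<Sum>b\<in>A. r b * cnj (r a) * cip (u b) (u a))"
   unfolding A cip.sum_left cip.sum_right
   by (subst sum.swap) (simp add: cip_scaleC_left cip_scaleC_right swap mult.assoc mult.left_commute)
  also have "... = cip X X"
   unfolding A cip.sum_left cip.sum_right
   by (simp add: cip_scaleC_left cip_scaleC_right mult.assoc mult.left_commute)
  finally have "(norm Y)\<^sup>2 = (norm X)\<^sup>2"
   by (simp add: cip_self flip: of_real_power)
  then show ?thesis by simp
 qed
 have star_H: "cip H X = cip Y G" and star_G: "cip G X = cip Y H" if "star X Y" for X Y
  using that by (auto simp: star_def cip.sum_left cip.sum_right cip_scaleC_left cip_scaleC_right sym1 sym2)
 have star_b: "\<beta> (zpow U k X) F = \<beta> (u k) Y" if "star X Y" for X Y k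
 proof -
  from that obtain A r where A: "X = (\<Sum>a\<in>A. r a *\<^sub>C u a)" "Y = (\<Sum>a\<in>A. cnj (r a) *\<^sub>C u (- a))"
   by (auto simp: star_def)
  interpret Z: bounded_linear "zpow U k"
   using unitary_cbounded_linear[OF unitary_zpow[OF U]] by (simp add: cbounded_linear_def)
  have "\<beta> (zpow U k X) F = (\<Sum>a\<in>A. r a * \<beta> (u (k + a)) F)"
   by (simp add: A Z.sum unitary_scaleC[OF unitary_zpow[OF U]] u_add b.sum_left sesquilinear_left[OF b])
  moreover have "\<beta> (u (k + a)) F = \<beta> (u k) (u (- a))" for a
   using bz[of a "u k" F] by (simp add: u_add add.commute) (simp add: u_def)
  ultimately show ?thesis
   by (simp add: A b.sum_right sesquilinear_right[OF b])
 qed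
 have approx: "EX X Y. (ALL n. star (X n) (Y n)) & X \<longlonglongrightarrow> z" for z
 proof -
  obtain X where X: "!!n. X n \<in> cspan (range u)" "X \<longlonglongrightarrow> z"
   using total closure_sequential[of z "cspan (range u)"] by auto
  have "EX Y. star (X n) Y" for n
   using span_range_explicit[OF X(1)[of n]] unfolding star_def by metis
  with X show ?thesis by metis
 qed
 \<comment> \<open>Together with \<open>GH\<close>: \<open>R F\<close> and \<open>R' F\<close> have
   equal norm, as they must if \<open>R\<close> is normal. Approximating \<open>H\<close> by
   \<open>X n\<close> moves the pairing with \<open>H\<close> to one with \<open>G\<close> without
   loss of norm.\<close>
 have HG: "norm H <= norm G"
 proof -
  obtain X Y where XY: "!!n. star (X n) (Y n)" "X \<longlonglongrightarrow> H" using approx by metis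
  have "cmod (cip H H) <= norm H * norm G"
  proof (rule LIMSEQ_le)
   show "(%n. cmod (cip H (X n))) \<longlonglongrightarrow> cmod (cip H H)" "(%n. norm (X n) * norm G) \<longlonglongrightarrow> norm H * norm G"
    by (intro tendsto_intros cip.tendsto XY)+
   show "EX N. \<forall>n\<ge>N. cmod (cip H (X n)) <= norm (X n) * norm G"
    using cip_bound[of "Y _" G] star_H[OF XY(1)] star_norm[OF XY(1)] by metis
  qed
  then show ?thesis
   by (cases "H = 0") (auto simp: cip_self norm_mult power2_eq_square)
 qed
 have GH: "norm G <= norm H"
 proof -
  obtain X Y where XY: "!!n. star (X n) (Y n)" "X \<longlonglongrightarrow> G" using approx by metis
  have "cmod (cip G G) <= norm G * norm H"
  proof (rule LIMSEQ_le)
   show "(%n. cmod (cip G (X n))) \<longlonglongrightarrow> cmod (cip G G)" "(%n. norm (X n) * norm H) \<longlonglongrightarrow> norm G * norm H"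
    by (intro tendsto_intros cip.tendsto XY)+
   show "EX N. \<forall>n\<ge>N. cmod (cip G (X n)) <= norm (X n) * norm H"
    using cip_bound[of "Y _" H] star_G[OF XY(1)] star_norm[OF XY(1)] by metis
  qed
  then show ?thesis
   by (cases "G = 0") (auto simp: cip_self norm_mult power2_eq_square)
 qed
 have main: "\<beta> (zpow U k G) F = \<beta> (u k) H" for k
 proof -
  obtain X Y where XY: "!!n. star (X n) (Y n)" "X \<longlonglongrightarrow> G" using approx by metis
  \<comment> \<open>Expanded so that only \<open>X n\<close> remains on the right. In the limit the
    right side is the difference of the squared norms of \<open>H\<close> and \<open>G\<close>,
    which is 0, and so \<open>Y\<close> converges to \<open>H\<close>.\<close>
  have norm_eq: "(norm (Y n - H))\<^sup>2 = (norm (X n))\<^sup>2 - 2 * Re (cip G (X n)) + (norm H)\<^sup>2" for n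
  proof -
   have "(norm (Y n - H))\<^sup>2 = (norm (Y n))\<^sup>2 - 2 * Re (cip (Y n) H) + (norm H)\<^sup>2"
    by (simp only: power2_norm_eq_inner inner_cip[symmetric])
     (simp add: inner_diff_left inner_diff_right inner_commute)
   then show ?thesis by (simp add: star_norm[OF XY(1)] star_G[OF XY(1)])
  qed
  have "(%n. (norm (X n))\<^sup>2 - 2 * Re (cip G (X n)) + (norm H)\<^sup>2) \<longlonglongrightarrow> (norm G)\<^sup>2 - 2 * Re (cip G G) + (norm H)\<^sup>2"
   by (intro tendsto_intros cip.tendsto XY)
  moreover have "(norm G)\<^sup>2 - 2 * Re (cip G G) + (norm H)\<^sup>2 = 0"
   using HG GH by (simp add: cip_self)
  ultimately have "(%n. (norm (Y n - H))\<^sup>2) \<longlonglongrightarrow> 0"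
   by (simp add: norm_eq)
  then have "(%n. sqrt ((norm (Y n - H))\<^sup>2)) \<longlonglongrightarrow> sqrt 0"
   by (rule tendsto_real_sqrt)
  then have Y: "Y \<longlonglongrightarrow> H"
   by (simp add: tendsto_norm_zero_iff LIM_zero_iff)
  interpret Z: bounded_linear "zpow U k"
   using unitary_cbounded_linear[OF unitary_zpow[OF U]] by (simp add: cbounded_linear_def)
  have "(%n. \<beta> (zpow U k (X n)) F) \<longlonglongrightarrow> \<beta> (zpow U k G) F"
   by (intro b.tendsto Z.tendsto XY tendsto_const)
  moreover have "(%n. \<beta> (u k) (Y n)) \<longlonglongrightarrow> \<beta> (u k) H"
   by (intro b.tendsto Y tendsto_const)
  ultimately show ?thesis
   using star_b[OF XY(1)] LIMSEQ_unique by simp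
 qed
 have main2: "\<beta> (zpow U a G) (u c) = \<beta> (u a) (zpow U c H)" for a c
 proof -
  have "\<beta> (zpow U a G) (u c) = \<beta> (zpow U (- c) (zpow U a G)) F"
   using bz[of "- c" "zpow U a G" F] by (simp add: u_def)
  also have "... = \<beta> (u (- c + a)) H"
   using main[of "- c + a"] by (simp add: zpow_add[OF bij, symmetric])
  also have "... = \<beta> (u a) (zpow U c H)"
   using bz[of "- c" "u a" H] by (simp add: u_add)
  finally show ?thesis .
 qed
 \<comment> \<open>From the orbit of \<open>F\<close> to arbitrary first arguments, and below to
   arbitrary second ones; that \<open>R\<close> commutes with \<open>U\<close> settles the orbit
   itself.\<close>
 have R_b: "\<beta> (R z) (u c) = \<beta> z (zpow U c H)" for z c
 proof (rule cbounded_linear_eq_on_total[OF _ _ total, of "%z. \<beta> (R z) (u c)" "%z. \<beta> z (zpow U c H)"])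
  have "cbounded_linear (%x::'a. x)"
   by (auto simp: cbounded_linear_def bounded_linear_ident)
  then show "cbounded_linear (%z. \<beta> (R z) (u c))"
   by (rule cbounded_linear_sesquilinear[OF sesquilinear_compose[OF b R(1)]])
  show "cbounded_linear (%z. \<beta> z (zpow U c H))"
   by (rule cbounded_linear_sesquilinear[OF b])
  show "\<beta> (R v) (u c) = \<beta> v (zpow U c H)" if "v \<in> range u" for v
   using that main2 by (auto simp: u_def RU G_def)
 qed
 have "cnj (\<beta> (R x) z) = cnj (\<beta> x (R' z))" for z
 proof (rule cbounded_linear_eq_on_total[OF _ _ total, of "%z. cnj (\<beta> (R x) z)" "%z. cnj (\<beta> x (R' z))"])
  show "cbounded_linear (%z. cnj (\<beta> (R x) z))"
   by (rule cbounded_linear_sesquilinear_cnj[OF b])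
  have "cbounded_linear (%x::'a. x)"
   by (auto simp: cbounded_linear_def bounded_linear_ident)
  then show "cbounded_linear (%z. cnj (\<beta> x (R' z)))"
   by (rule cbounded_linear_sesquilinear_cnj[OF sesquilinear_compose[OF b _ R'(1)]])
  show "cnj (\<beta> (R x) v) = cnj (\<beta> x (R' v))" if "v \<in> range u" for v
   using that R_b by (auto simp: u_def R'U H_def)
 qed
 moreover have "R x = x'" using x' R(2) cip_eq_iff by metis
 moreover have "R' y = y'" using y' R'(2) cip_eq_iff_right by metis
 ultimately show ?thesis by (metis complex_cnj_cancel_iff)
qed

text \<open>The projection \<open>Q\<close> onto the cyclic space \<open>W\<close> of
  \<open>F\<close> under \<open>U ^^ n\<close> gives a form \<open>q\<close> invariant under
  \<open>U ^^ n\<close>. Its Fourier components over the n-th roots of unity are twisted forms; the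
  hypothesis kills all but the trivial one. So \<open>q\<close> is invariant under \<open>U\<close>,
  and \<open>W\<close> contains the whole \<open>U\<close>-orbit of \<open>F\<close>.\<close>

lemma cyclic_power:
 fixes U :: "'a::complex_hilbert => 'a"
 assumes U: "unitary U" and F: "cyclic U F" and n: "n >= 1"
  and no_form: "!!\<zeta> \<beta>. \<zeta> ^ n = 1 ==> \<zeta> ~= 1 ==> sesquilinear \<beta> ==>
   (!!x y. \<beta> (U x) (U y) = \<zeta> * \<beta> x y) ==> (!!x y. \<beta> x y = 0)"
 shows "cyclic (U ^^ n) F"
proof -
 let ?V = "U ^^ n"
 note V = unitary_funpow[OF U, of n]
 define W where "W = closure (cspan (orbit ?V F))"
 have W: "closed W" "csubspace W" "F \<in> W"
  by (auto simp: W_def csubspace_cyclic_space cyclic_space_contains)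
 have VW: "?V x \<in> W" "inv ?V x \<in> W" if "x \<in> W" for x
  using cyclic_space_invariant[OF V, of x F 1] cyclic_space_invariant[OF V, of x F "-1"] that
  by (auto simp: W_def zpow_1)
 have "EX w. w \<in> W & (\<forall>z\<in>W. cip (x - w) z = 0)" for x
  using orthogonal_projection_exists[OF W(1,2), of x] by metis
 then obtain Q where Q: "!!x. Q x \<in> W" "!!x z. z \<in> W ==> cip (x - Q x) z = 0"
  by metis
 \<comment> \<open>The characterisation from which linearity of \<open>Q\<close> and its commutation
   with \<open>U ^^ n\<close> are read off.\<close>
 have Q_unique: "Q x = w" if w: "w \<in> W" "!!z. z \<in> W ==> cip (x - w) z = 0" for x w
 proof -
  have "cip (w - Q x) (w - Q x) = cip (x - Q x) (w - Q x) - cip (x - w) (w - Q x)"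
   by (simp add: cip.diff_left)
  also have "... = 0"
   using Q w W by (simp add: complex_vs.subspace_diff)
  finally show ?thesis by (simp add: cip_self)
 qed
 have Q_add: "Q (x + y) = Q x + Q y" for x y
 proof (rule Q_unique)
  have eq: "x + y - (Q x + Q y) = (x - Q x) + (y - Q y)" by simp
  show "cip (x + y - (Q x + Q y)) z = 0" if "z \<in> W" for z
   unfolding eq using that by (simp add: cip_add_left Q)
 qed (use W Q in \<open>auto intro: complex_vs.subspace_add\<close>)
 have Q_scale: "Q (c *\<^sub>C x) = c *\<^sub>C Q x" for c x
 proof (rule Q_unique)
  have eq: "c *\<^sub>C x - c *\<^sub>C Q x = c *\<^sub>C (x - Q x)"
   by (simp add: complex_vs.scale_right_diff_distrib)
  show "cip (c *\<^sub>C x - c *\<^sub>C Q x) z = 0" if "z \<in> W" for z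
   unfolding eq using that by (simp add: cip_scaleC_left Q)
 qed (use W Q in \<open>auto intro: complex_vs.subspace_scale\<close>)
 have Q_pyth: "(norm x)\<^sup>2 = (norm (Q x))\<^sup>2 + (norm (x - Q x))\<^sup>2" for x
 proof -
  have 0: "inner (x - Q x) (Q x) = 0"
   using Q by (simp add: inner_cip)
  have "(norm ((x - Q x) + Q x))\<^sup>2 = (norm (Q x))\<^sup>2 + (norm (x - Q x))\<^sup>2"
   unfolding power2_norm_eq_inner inner_add_left inner_add_right using 0 by (simp add: inner_commute)
  then show ?thesis by simp
 qed
 have Q_norm: "norm (Q x) <= norm x" for x
  using Q_pyth[of x] by (metis le_add_same_cancel1 norm_ge_zero power2_le_imp_le zero_le_power2)
 have Q_lin: "cbounded_linear Q"
  by (rule cbounded_linearI[where K=1]) (auto simp: Q_add Q_scale Q_norm)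
 have QV: "Q (?V x) = ?V (Q x)" for x
 proof (rule Q_unique)
  show "cip (?V x - ?V (Q x)) z = 0" if z: "z \<in> W" for z
  proof -
   interpret V: bounded_linear ?V
    using unitary_cbounded_linear[OF V] by (simp add: cbounded_linear_def)
   have "cip (?V x - ?V (Q x)) z = cip (?V (x - Q x)) (?V (inv ?V z))"
    by (simp add: V.diff unitary_inv_apply[OF V])
   also have "... = 0"
    using VW(2)[OF z] Q by (simp add: unitary_cip[OF V])
   finally show ?thesis .
  qed
 qed (use VW Q in auto)
 define q where "q x y = cip (Q x) y" for x y
 have ident: "cbounded_linear (%x::'a. x)"
  by (auto simp: cbounded_linear_def bounded_linear_ident)
 have q: "sesquilinear q"
  unfolding q_def[abs_def] by (rule sesquilinear_compose[OF sesquilinear_cip Q_lin ident])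
 have qV: "q (?V x) (?V y) = q x y" for x y
  by (simp add: q_def QV unitary_cip[OF V])
 define \<omega> where "\<omega> = exp (2 * of_real pi * \<i> / of_nat n)"
 have \<omega>_pow: "\<omega> ^ j = exp (2 * of_real pi * \<i> * of_nat j / of_nat n)" for j
  unfolding \<omega>_def exp_of_nat_mult[symmetric] by (simp add: mult.commute)
 have \<omega>_n: "(\<omega> ^ j) ^ n = 1" for j
  using complex_root_unity[of n j] n by (simp add: \<omega>_pow)
 have \<omega>_ne: "\<omega> ^ j ~= 1" if "0 < j" "j < n" for j
  using complex_root_unity_eq[of n j 0] n that by (simp add: \<omega>_pow cong_def)
 \<comment> \<open>Up to the factor \<open>n\<close>, the Fourier coefficient with index
   \<open>j\<close> of the n-periodic sequence \<open>q ((U ^^ m) x) ((U ^^ m) y)\<close>.\<close>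
 define \<beta> where "\<beta> j x y = (\<Sum>m<n. \<omega> ^ (j * m) * q ((U ^^ m) x) ((U ^^ m) y))" for j x y
 have \<beta>_ses: "sesquilinear (\<beta> j)" for j
 proof -
  have 1: "sesquilinear (%x y. q ((U ^^ m) x) ((U ^^ m) y))" for m
   by (rule sesquilinear_compose[OF q unitary_cbounded_linear[OF unitary_funpow[OF U]] unitary_cbounded_linear[OF unitary_funpow[OF U]]])
  have "EX K. ALL x y. cmod (q ((U ^^ m) x) ((U ^^ m) y)) <= norm x * norm y * K" for m
   using bounded_bilinear.bounded[OF sesquilinear_bb[OF 1[of m]]] .
  then obtain K where K: "!!m x y. cmod (q ((U ^^ m) x) ((U ^^ m) y)) <= norm x * norm y * K m"
   by metis
  have \<omega>1: "cmod \<omega> = 1"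
   by (simp add: \<omega>_def norm_exp_eq_Re)
  interpret q: bounded_bilinear q using q by (rule sesquilinear_bb)
  show ?thesis
  proof (rule sesquilinearI[where K="\<Sum>m<n. K m"])
   show "cmod (\<beta> j x y) <= norm x * norm y * (\<Sum>m<n. K m)" for x y
    unfolding \<beta>_def sum_distrib_left
    by (rule order_trans[OF norm_sum sum_mono]) (simp add: norm_mult norm_power \<omega>1 K)
   show "\<beta> j (x + y) z = \<beta> j x z + \<beta> j y z" "\<beta> j x (y + z) = \<beta> j x y + \<beta> j x z" for x y z
    by (simp_all add: \<beta>_def unitary_add[OF unitary_funpow[OF U]] q.add_left q.add_right ring_distribs sum.distrib)
   show "\<beta> j (c *\<^sub>C x) y = c * \<beta> j x y" "\<beta> j x (c *\<^sub>C y) = cnj c * \<beta> j x y" for c x y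
    by (simp_all add: \<beta>_def unitary_scaleC[OF unitary_funpow[OF U]] sesquilinear_left[OF q]
      sesquilinear_right[OF q] sum_distrib_left mult.left_commute)
  qed
 qed
 have \<beta>_U: "\<omega> ^ j * \<beta> j (U x) (U y) = \<beta> j x y" for j x y
 proof -
  let ?t = "%m. \<omega> ^ (j * m) * q ((U ^^ m) x) ((U ^^ m) y)"
  have "\<omega> ^ j * \<beta> j (U x) (U y) = (\<Sum>m<n. ?t (Suc m))"
   by (simp add: \<beta>_def sum_distrib_left power_add mult.assoc funpow_swap1)
  also have "... = (\<Sum>m<Suc n. ?t m) - ?t 0"
   unfolding sum.lessThan_Suc_shift by simp
  also have "... = (\<Sum>m<n. ?t m) + ?t n - ?t 0"
   by simp
  also have "?t n = ?t 0"
   using \<omega>_n[of j] by (simp add: power_mult qV)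
  finally show ?thesis by (simp add: \<beta>_def)
 qed
 \<comment> \<open>The twist is the inverse root: shifting the summation index by one gains a factor
   \<open>\<omega> ^ j\<close>.\<close>
 have \<beta>_zero: "\<beta> j x y = 0" if j: "0 < j" "j < n" for j x y
 proof (rule no_form[of "inverse (\<omega> ^ j)" "\<beta> j"])
  show "inverse (\<omega> ^ j) ^ n = 1"
   by (metis power_inverse \<omega>_n inverse_1)
  show "inverse (\<omega> ^ j) ~= 1"
   using \<omega>_ne[OF j] by (metis inverse_eq_1_iff)
  show "\<beta> j (U x) (U y) = inverse (\<omega> ^ j) * \<beta> j x y" for x y
   using \<beta>_U[of j x y] by (simp add: field_simps \<omega>_def)
 qed (rule \<beta>_ses)
 have \<beta>_0: "\<beta> 0 x y = of_nat n * q x y" for x y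
 proof -
  \<comment> \<open>Fourier inversion at \<open>m = 0\<close>: summing over all \<open>j\<close>
    leaves only the term \<open>n * q x y\<close>, while the components with \<open>j > 0\<close>
    vanish.\<close>
  have "\<beta> 0 x y = (\<Sum>j<n. \<beta> j x y)"
   using n \<beta>_zero by (subst sum.remove[of _ 0]) auto
  also have "... = (\<Sum>m<n. (\<Sum>j<n. (\<omega> ^ m) ^ j) * q ((U ^^ m) x) ((U ^^ m) y))"
   unfolding \<beta>_def by (subst sum.swap) (simp add: sum_distrib_right power_mult[symmetric] mult.commute)
  also have "... = (\<Sum>m<n. if m = 0 then of_nat n * q x y else 0)"
  proof (rule sum.cong[OF refl])
   fix m assume "m \<in> {..<n}"
   then show "(\<Sum>j<n. (\<omega> ^ m) ^ j) * q ((U ^^ m) x) ((U ^^ m) y) = (if m = 0 then of_nat n * q x y else 0)"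
    using \<omega>_ne[of m] \<omega>_n[of m] geometric_sum[of "\<omega> ^ m" n] by (cases "m = 0") auto
  qed
  also have "... = of_nat n * q x y"
   using n by simp
  finally show ?thesis .
 qed
 have qU: "q (U x) (U y) = q x y" for x y
  using \<beta>_U[of 0 x y] n by (simp add: \<beta>_0)
 \<comment> \<open>Membership in \<open>W\<close> is equality in Pythagoras: \<open>q z z\<close> is
   the squared norm of \<open>z\<close>. Both sides are preserved by \<open>U\<close> and
   \<open>inv U\<close>.\<close>
 have stay: "z \<in> W" if z: "x \<in> W" "q z z = q x x" "norm z = norm x" for x z
 proof -
  have "Q x = x"
   using z(1) by (intro Q_unique) simp_all
  then have "q z z = of_real ((norm z)\<^sup>2)"
   using z by (simp add: q_def cip_self)
  moreover have "q z z = cip (Q z) (Q z)"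
  proof -
   have "cip (z - Q z) (Q z) = 0" using Q by blast
   then have "cip (Q z) (z - Q z) = 0" by (metis cip_commute complex_cnj_zero)
   then show ?thesis by (simp add: q_def cip.diff_right)
  qed
  ultimately have "(norm (Q z))\<^sup>2 = (norm z)\<^sup>2"
   by (simp add: cip_self flip: of_real_power)
  with Q_pyth[of z] have "z = Q z" by simp
  then show ?thesis using Q by metis
 qed
 have "U x \<in> W" "inv U x \<in> W" if "x \<in> W" for x
  using stay[OF that, of "U x"] stay[OF that, of "inv U x"] qU[of x x] qU[of "inv U x" "inv U x"]
  by (simp_all add: unitary_norm[OF U] unitary_norm[OF unitary_inv[OF U]] unitary_inv_apply[OF U])
 then have "zpow U k F \<in> W" for k
 proof (induction k rule: int_induct[where k=0])
  case (step2 i)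
  then show ?case by (simp add: zpow_pred[OF unitary_bij[OF U]])
 qed (use W in \<open>auto simp: zpow_succ[OF unitary_bij[OF U]]\<close>)
 then have "closure (cspan (orbit U F)) <= W"
  using W by (intro cyclic_space_minimal)
 then show ?thesis
  using F unfolding cyclic_def W_def by blast
qed

section \<open>Polynomials in a unitary operator and the existence of cyclic vectors\<close>

lemma contraction_fixed_mem:
 fixes W :: "'a::complex_hilbert set"
 assumes P: "unitary P" and W: "closed W" "csubspace W" "!!x. x \<in> W ==> P x \<in> W"
  and c: "cmod c < 1" and y: "y - c *\<^sub>C P y \<in> W"
 shows "y \<in> W"
proof -
 have PJ: "unitary (P ^^ J)" for J using P by (rule unitary_funpow)
 have PJW: "(P ^^ J) x \<in> W" if "x \<in> W" for J x
  using that W by (induction J) auto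
 \<comment> \<open>Partial sums of the Neumann series for the inverse of \<open>1 - c P\<close>; the
   remainder tends to 0 because \<open>c\<close> has modulus below 1.\<close>
 have "y - (c ^ J) *\<^sub>C (P ^^ J) y \<in> W" for J
 proof (induction J)
  case 0
  then show ?case using W by (simp add: complex_vs.subspace_0)
 next
  case (Suc J)
  interpret B: bounded_linear "P ^^ J"
   using unitary_cbounded_linear[OF PJ] by (simp add: cbounded_linear_def)
  have "y - (c ^ Suc J) *\<^sub>C (P ^^ Suc J) y = (y - (c ^ J) *\<^sub>C (P ^^ J) y) + (c ^ J) *\<^sub>C (P ^^ J) (y - c *\<^sub>C P y)"
   by (simp add: B.diff unitary_scaleC[OF PJ] complex_vs.scale_right_diff_distrib scaleC_scaleC funpow_swap1 mult.commute)
  also have "... \<in> W"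
   using Suc W y PJW by (intro complex_vs.subspace_add complex_vs.subspace_scale) auto
  finally show ?case .
 qed
 moreover have "(%J. y - (c ^ J) *\<^sub>C (P ^^ J) y) \<longlonglongrightarrow> y - 0"
 proof (intro tendsto_intros)
  have "(%J. cmod c ^ J * norm y) \<longlonglongrightarrow> 0 * norm y"
   using c by (intro tendsto_mult LIMSEQ_realpow_zero tendsto_const) auto
  then have "(%J. norm ((c ^ J) *\<^sub>C (P ^^ J) y)) \<longlonglongrightarrow> 0"
   by (simp add: norm_scaleC norm_power unitary_norm[OF PJ])
  then show "(%J. (c ^ J) *\<^sub>C (P ^^ J) y) \<longlonglongrightarrow> 0"
   by (rule tendsto_norm_zero_cancel)
 qed
 ultimately show ?thesis
  using closed_sequentially[OF W(1)] by fastforce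
qed

text \<open>Off the unit circle \<open>U - a\<close> is inverted by a geometric series, in
  \<open>inv U\<close> when \<open>a\<close> has modulus below 1 and in \<open>U\<close> when it has
  modulus above 1. Both series stay in \<open>W\<close>.\<close>

lemma linear_factor_mem:
 fixes W :: "'a::complex_hilbert set"
 assumes U: "unitary U" and W: "closed W" "csubspace W" "!!x. x \<in> W ==> U x \<in> W" "!!x. x \<in> W ==> inv U x \<in> W"
  and a: "cmod a ~= 1" and y: "U y - a *\<^sub>C y \<in> W"
 shows "y \<in> W"
proof (cases "cmod a < 1")
 case True
 interpret B: bounded_linear "inv U"
  using unitary_cbounded_linear[OF unitary_inv[OF U]] by (simp add: cbounded_linear_def)
 have "inv U (U y - a *\<^sub>C y) = y - a *\<^sub>C inv U y"
  by (simp add: B.diff unitary_inv_apply[OF U] unitary_scaleC[OF unitary_inv[OF U]])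
 then have "y - a *\<^sub>C inv U y \<in> W"
  using W(4)[OF y] by simp
 from contraction_fixed_mem[OF unitary_inv[OF U] W(1,2) _ True this] W(4) show ?thesis
  by blast
next
 case False
 with a have a1: "cmod a > 1" by simp
 have "(- inverse a) *\<^sub>C (U y - a *\<^sub>C y) = y - inverse a *\<^sub>C U y"
 proof -
  have "inverse a * a = 1" using a1 by (metis left_inverse norm_zero not_one_less_zero)
  then show ?thesis
   by (simp add: complex_vs.scale_right_diff_distrib scaleC_scaleC complex_vs.scale_minus_left)
 qed
 then have "y - inverse a *\<^sub>C U y \<in> W"
  using complex_vs.subspace_scale[OF W(2) y] by metis
 moreover have "cmod (inverse a) < 1"
  using a1 by (simp add: norm_inverse inverse_less_1_iff)
 ultimately show ?thesis
  using contraction_fixed_mem[OF U W(1,2) _ _ _] W(3) by blast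
qed

text \<open>Horner's scheme for the polynomial in \<open>U\<close> applied to \<open>x\<close>,
  which makes recursion on \<open>pCons\<close> immediate.\<close>

definition poly_act :: "('a::complex_hilbert => 'a) => complex poly => 'a => 'a" where
 "poly_act U p x = fold_coeffs (%a y. a *\<^sub>C x + U y) p 0"

context
 fixes U :: "'a::complex_hilbert => 'a"
 assumes U: "unitary U"
begin

lemma unitary_zero: "U 0 = 0"
 using unitary_norm[OF U, of 0] by simp

lemma poly_act_0 [simp]: "poly_act U 0 x = 0"
 by (simp add: poly_act_def)

lemma poly_act_pCons: "poly_act U (pCons a p) x = a *\<^sub>C x + U (poly_act U p x)"
 by (cases "p = 0 & a = 0") (auto simp: poly_act_def unitary_zero fold_coeffs_pCons_not_0_0_eq fold_coeffs_pCons_coeff_not_0_eq)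

lemma poly_act_add: "poly_act U (p + q) x = poly_act U p x + poly_act U q x"
 by (induction p q rule: poly_induct2)
  (simp_all add: poly_act_pCons scaleC_add_left unitary_add[OF U])

lemma poly_act_smult: "poly_act U (smult c p) x = c *\<^sub>C poly_act U p x"
 by (induction p) (simp_all add: poly_act_pCons scaleC_add_right scaleC_scaleC unitary_scaleC[OF U])

lemma poly_act_monom: "poly_act U (monom c n) x = c *\<^sub>C (U ^^ n) x"
 by (induction n) (simp_all add: monom_0 monom_Suc poly_act_pCons unitary_zero unitary_scaleC[OF U])

lemma poly_act_sum: "poly_act U (\<Sum>i\<in>A. p i) x = (\<Sum>i\<in>A. poly_act U (p i) x)"
 by (induction A rule: infinite_finite_induct) (simp_all add: poly_act_add)

text \<open>Splits off the complex linear factors one at a time; each can be undone inside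
  \<open>W\<close> because no root has modulus 1.\<close>

lemma poly_act_mem_imp_mem:
 fixes W :: "'a set"
 assumes W: "closed W" "csubspace W" "!!x. x \<in> W ==> U x \<in> W" "!!x. x \<in> W ==> inv U x \<in> W"
 shows "p ~= 0 ==> (!!z. cmod z = 1 ==> poly p z ~= 0) ==> poly_act U p b \<in> W ==> b \<in> W"
proof (induction "degree p" arbitrary: p)
 case 0
 then obtain c where p: "p = [:c:]"
  by (metis degree_eq_zeroE)
 with 0 have "c ~= 0" by auto
 moreover have "c *\<^sub>C b \<in> W"
  using 0 by (simp add: p poly_act_pCons unitary_zero)
 ultimately have "(inverse c * c) *\<^sub>C b \<in> W"
  using complex_vs.subspace_scale[OF W(2)] by (metis scaleC_scaleC)
 with \<open>c ~= 0\<close> show ?case by simp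
next
 case (Suc d)
 then obtain a where a: "poly p a = 0"
  using alg_closed_imp_poly_has_root[of p] by auto
 then obtain q where q: "p = [:- a, 1:] * q"
  by (metis dvdE poly_eq_0_iff_dvd)
 then have q0: "q ~= 0" using Suc by auto
 have "degree p = Suc (degree q)"
  unfolding q using q0 by (subst degree_mult_eq) auto
 moreover have "cmod z = 1 ==> poly q z ~= 0" for z
  using Suc.prems(2)[of z] by (auto simp: q)
 moreover have "poly_act U q b \<in> W"
 proof (rule linear_factor_mem[OF U W])
  show "cmod a ~= 1" using a Suc.prems(2) by blast
  have "p = smult (- a) q + pCons 0 q"
   by (simp add: q mult_pCons_left)
  then have "poly_act U p b = U (poly_act U q b) - a *\<^sub>C poly_act U q b"
   by (simp add: poly_act_add poly_act_smult poly_act_pCons complex_vs.scale_minus_left del: smult_minus_left)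
  with Suc.prems(3) show "U (poly_act U q b) - a *\<^sub>C poly_act U q b \<in> W" by simp
 qed
 ultimately show ?case
  using Suc.hyps(1)[of q] Suc.hyps(2) q0 by simp
qed

lemma poly_act_dilation_continuous: "isCont (%r. poly_act U (pcompose p [:0, complex_of_real r:]) b) 1"
proof (induction p)
 case (pCons a p)
 have "poly_act U (pcompose (pCons a p) [:0, complex_of_real r:]) b
   = a *\<^sub>C b + complex_of_real r *\<^sub>C U (poly_act U (pcompose p [:0, complex_of_real r:]) b)" for r
  by (simp add: pcompose_pCons poly_act_add poly_act_pCons unitary_zero poly_act_smult unitary_scaleC[OF U])
 moreover have "bounded_linear U"
  using unitary_cbounded_linear[OF U] by (simp add: cbounded_linear_def)
 ultimately show ?case
  using scaleC.isCont[OF isCont_of_real[OF continuous_ident] bounded_linear.isCont[OF _ pCons.IH], of U]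
  by (simp add: continuous_add)
qed simp

text \<open>Negative powers are absorbed into the base vector, which generates the same cyclic space
  as \<open>b\<close>.\<close>

lemma span_orbit_poly:
 assumes "x \<in> cspan (orbit U b)"
 obtains N p where "x = poly_act U p (zpow U (- int N) b)"
proof -
 note bij = unitary_bij[OF U]
 obtain A r where A: "finite A" "x = (\<Sum>a\<in>A. r a *\<^sub>C zpow U a b)"
  using assms unfolding orbit_def by (rule span_range_explicit)
 define N where "N = (\<Sum>a\<in>A. nat \<bar>a\<bar>)"
 have N: "a + int N >= 0" if "a \<in> A" for a
 proof -
  have "nat \<bar>a\<bar> <= N" unfolding N_def using A that by (intro member_le_sum) auto
  then show ?thesis by linarith
 qed
 have eq: "zpow U a b = (U ^^ nat (a + int N)) (zpow U (- int N) b)" if "a \<in> A" for a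
  using N[OF that] zpow_add[OF bij, of "a + int N" "- int N" b] by (simp add: zpow_def)
 have "x = poly_act U (\<Sum>a\<in>A. monom (r a) (nat (a + int N))) (zpow U (- int N) b)"
  unfolding A(2) poly_act_sum poly_act_monom using eq by (intro sum.cong) auto
 then show ?thesis using that by blast
qed

end

text \<open>Vectors whose cyclic space nearly contains a given vector form an open dense set: a vector
  \<open>p(U)b\<close> is perturbed to \<open>p(rU)b\<close>, where \<open>p(rz)\<close> has no zero on the unit circle, and then
  generates the same cyclic space as \<open>b\<close>.\<close>

lemma cyclic_vector_exists:
 fixes U :: "'a::complex_hilbert => 'a" and v :: "nat => 'a"
 assumes U: "unitary U" and total: "closure (cspan (range v)) = UNIV"
  and approx: "!!x y e. e > 0 ==> EX b x' y'. x' \<in> cspan (orbit U b) & y' \<in> cspan (orbit U b)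
   & norm (x - x') < e & norm (y - y') < (e :: real)"
 shows "EX F. cyclic U F"
proof -
 note bij = unitary_bij[OF U]
 \<comment> \<open>Vectors whose cyclic space comes within \<open>1 / (m + 1)\<close> of
   \<open>v k\<close>. A vector in all of these sets is cyclic, since the \<open>v k\<close> are
   total.\<close>
 define G where "G k m = {f. \<exists>z\<in>cspan (orbit U f). norm (v k - z) < 1 / real (Suc m)}" for k m
 have "open (G k m)" for k m
 proof (subst open_subopen, intro ballI)
  fix f assume "f \<in> G k m"
  then obtain z where z: "z \<in> cspan (orbit U f)" "norm (v k - z) < 1 / real (Suc m)"
   by (auto simp: G_def)
  obtain A r where A: "finite A" "z = (\<Sum>a\<in>A. r a *\<^sub>C zpow U a f)"
   using z(1) unfolding orbit_def by (rule span_range_explicit)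
  define h where "h g = norm (v k - (\<Sum>a\<in>A. r a *\<^sub>C zpow U a g))" for g
  have "continuous_on UNIV h"
  proof -
   have "continuous_on UNIV (zpow U a)" for a
    using unitary_cbounded_linear[OF unitary_zpow[OF U, of a]] linear_continuous_on
    by (auto simp: cbounded_linear_def)
   then show ?thesis
    unfolding h_def by (intro continuous_intros bounded_bilinear.continuous_on[OF scaleC.bounded_bilinear_axioms])
  qed
  then have "open {g. h g < 1 / real (Suc m)}"
   by (intro open_Collect_less continuous_on_const)
  moreover have "{g. h g < 1 / real (Suc m)} <= G k m"
  proof
   fix g assume "g \<in> {g. h g < 1 / real (Suc m)}"
   moreover have "(\<Sum>a\<in>A. r a *\<^sub>C zpow U a g) \<in> cspan (orbit U g)"
    by (intro complex_vs.span_sum complex_vs.span_scale complex_vs.span_base) (auto simp: orbit_def)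
   ultimately show "g \<in> G k m"
    unfolding G_def h_def by blast
  qed
  ultimately show "EX T. open T & f \<in> T & T <= G k m"
   using z A by (intro exI[of _ "{g. h g < 1 / real (Suc m)}"]) (auto simp: h_def)
 qed
 moreover have "closure (G k m) = UNIV" for k m
 proof -
  have "\<exists>f\<in>G k m. dist f g < e" if e: "e > 0" for g e
  proof -
   \<comment> \<open>Two errors of size \<open>e'\<close> must fit both into \<open>e\<close>, the
     distance to \<open>g\<close>, and into \<open>1 / (m + 1)\<close>, the distance to
     \<open>v k\<close>.\<close>
   define e' where "e' = min (e / 3) (1 / real (Suc m) / 2)"
   have e': "e' > 0" using e by (simp add: e'_def)
   obtain b x y where b: "x \<in> cspan (orbit U b)" "y \<in> cspan (orbit U b)" "norm (g - x) < e'" "norm (v k - y) < e'"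
    using approx[OF e', of g "v k"] by blast
   obtain N p where p: "x = poly_act U p (zpow U (- int N) b)"
    using span_orbit_poly[OF U b(1)] by metis
   define b' where "b' = zpow U (- int N) b"
   have "EX p'. p' ~= 0 & (ALL z. cmod z = 1 --> poly p' z ~= 0) & norm (poly_act U p' b' - x) < e'"
   proof (cases "p = 0")
    \<comment> \<open>Every dilation of the zero polynomial is zero, so a small nonzero constant
      replaces it.\<close>
    case True
    define c where "c = e' / (norm b' + 1)"
    have "c > 0" using e' by (simp add: c_def add_nonneg_pos)
    have "c * norm b' < c * (norm b' + 1)"
     using \<open>c > 0\<close> by simp
    also have "... = e'"
    proof -
     have "norm b' + 1 ~= 0" using norm_ge_zero[of b'] by linarith
     then show ?thesis by (simp add: c_def)
    qed
    finally have "norm (c *\<^sub>R b') < e'"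
     using \<open>c > 0\<close> by simp
    with True \<open>c > 0\<close> show ?thesis
     by (intro exI[of _ "[:complex_of_real c:]"])
      (auto simp: p poly_act_pCons[OF U] unitary_zero[OF U] scaleR_scaleC poly_act_0[OF U])
   next
    case False
    let ?q = "%r. pcompose p [:0, complex_of_real r:]"
    have "isCont (%r. poly_act U (?q r) b') 1"
     by (rule poly_act_dilation_continuous[OF U])
    then obtain d where d: "d > 0" "!!r. dist r 1 < d ==> dist (poly_act U (?q r) b') (poly_act U (?q 1) b') < e'"
     using e' unfolding continuous_at_eps_delta by (metis dist_norm)
    \<comment> \<open>A dilation factor close to 1 that avoids the finitely many moduli of roots of
      \<open>p\<close>.\<close>
    have "infinite ({1<..<1 + d} - cmod ` {z. poly p z = 0})"
     using d poly_roots_finite[OF False] by (intro Diff_infinite_finite finite_imageI) (auto simp: infinite_Ioo)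
    then obtain r where r: "1 < r" "r < 1 + d" "!!z. poly p z = 0 ==> r ~= cmod z"
    proof -
     from \<open>infinite _\<close> obtain r where "r \<in> {1<..<1 + d} - cmod ` {z. poly p z = 0}"
      by (metis all_not_in_conv finite.emptyI)
     then show thesis by (intro that[of r]) auto
    qed
    have no_root: "poly (?q r) z ~= 0" if "cmod z = 1" for z
     using r(3)[of "z * complex_of_real r"] r(1) that by (auto simp: poly_pcompose norm_mult)
    then have "?q r ~= 0" by (metis norm_one poly_0)
    moreover have "?q 1 = p" by (simp add: pcompose_idR)
    then have "norm (poly_act U (?q r) b' - x) < e'"
     using d(2)[of r] r p by (simp add: dist_norm b'_def)
    ultimately show ?thesis using no_root by blast
   qed
   then obtain p' where p': "p' ~= 0" "!!z. cmod z = 1 ==> poly p' z ~= 0" "norm (poly_act U p' b' - x) < e'"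
    by blast
   define f where "f = poly_act U p' b'"
   define W where "W = closure (cspan (orbit U f))"
   have W: "closed W" "csubspace W" "f \<in> W"
    by (auto simp: W_def csubspace_cyclic_space cyclic_space_contains)
   have WU: "zpow U k z \<in> W" if "z \<in> W" for z k
    using cyclic_space_invariant[OF U, of z f k] that by (simp add: W_def)
   have "b' \<in> W"
   proof (rule poly_act_mem_imp_mem[OF U W(1,2) _ _ p'(1,2)])
    show "U z \<in> W" "inv U z \<in> W" if "z \<in> W" for z
     using WU[OF that, of 1] WU[OF that, of "-1"] by (simp_all add: zpow_1)
   qed (use W in \<open>auto simp: f_def\<close>)
   then have "zpow U k b \<in> W" for k
    using WU[of b' "k + int N"] by (simp add: b'_def zpow_add[OF bij, symmetric])
   then have "cspan (orbit U b) <= W"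
    using W by (intro complex_vs.span_minimal) (auto simp: orbit_def)
   with b have "y \<in> closure (cspan (orbit U f))" unfolding W_def by blast
   then obtain z where z: "z \<in> cspan (orbit U f)" "dist z y < e'"
    using e' closure_approachable by blast
   have "norm (v k - z) <= norm (v k - y) + norm (z - y)"
    by (metis norm_minus_commute norm_triangle_ineq add_diff_cancel diff_add_cancel add_diff_eq)
   also have "... < 1 / real (Suc m)"
   proof -
    have "e' + e' <= 1 / real (Suc m)" by (simp add: e'_def min_def field_simps)
    then show ?thesis using z b by (simp add: dist_norm)
   qed
   finally have "f \<in> G k m" using z unfolding G_def by blast
   moreover have "dist f g < e"
   proof -
    have "dist f g <= dist f x + dist x g" by (rule dist_triangle)
    also have "... < e' + e'" using p'(3) b(3) by (simp add: f_def dist_norm norm_minus_commute)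
    also have "... <= e" using e by (simp add: e'_def min_def field_simps)
    finally show ?thesis .
   qed
   ultimately show ?thesis by blast
  qed
  then have "g \<in> closure (G k m)" for g
   by (simp add: closure_approachable)
  then show ?thesis by blast
 qed
 ultimately have "euclidean closure_of (\<Inter>(range (%(k, m). G k m))) = topspace (euclidean :: 'a topology)"
  by (intro Baire_category) (auto simp: completely_metrizable_space_euclidean)
 then have "\<Inter>(range (%(k, m). G k m)) ~= {}"
  by (metis UNIV_not_empty closure_of_empty topspace_euclidean)
 then obtain F where F: "!!k m. F \<in> G k m"
  by blast
 have "v k \<in> closure (cspan (orbit U F))" for k
  unfolding closure_approachable
 proof (intro allI impI)
  fix e :: real assume "e > 0"
  then obtain m where m: "1 / real (Suc m) < e"
   using reals_Archimedean by (metis inverse_eq_divide)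
  obtain z where "z \<in> cspan (orbit U F)" "norm (v k - z) < 1 / real (Suc m)"
   using F[of k m] by (auto simp: G_def)
  with m show "\<exists>z\<in>cspan (orbit U F). dist z (v k) < e"
   by (intro bexI[of _ z]) (auto simp: dist_norm norm_minus_commute)
 qed
 then have "x \<in> closure (cspan (orbit U F))" for x
  by (intro total_induct[OF total]) (auto simp: csubspace_cyclic_space)
 then show ?thesis
  unfolding cyclic_def by blast
qed

subsection \<open>Products of positive semidefinite kernels\<close>

definition psd :: "'i set => ('i => 'i => complex) => bool" where
 "psd I P \<longleftrightarrow> (\<forall>i\<in>I. \<forall>j\<in>I. P j i = cnj (P i j)) &
   (ALL A a. finite A & A <= I --> 0 <= Re (\<Sum>i\<in>A. \<Sum>j\<in>A. a i * cnj (a j) * P i j))"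

lemma psd_herm: "psd I P ==> i \<in> I ==> j \<in> I ==> P j i = cnj (P i j)"
 unfolding psd_def by blast

lemma psd_pos: "psd I P ==> finite A ==> A <= I ==> 0 <= Re (\<Sum>i\<in>A. \<Sum>j\<in>A. a i * cnj (a j) * P i j)"
 unfolding psd_def by blast

lemma psdI:
 assumes "!!i j. i \<in> I ==> j \<in> I ==> P j i = cnj (P i j)"
  and "!!A a. finite A ==> A <= I ==> 0 <= Re (\<Sum>i\<in>A. \<Sum>j\<in>A. a i * cnj (a j) * P i j)"
 shows "psd I P"
 unfolding psd_def using assms by blast

lemma psd_subset:
 assumes "psd I P" "J <= I"
 shows "psd J P"
proof (rule psdI)
 show "P j i = cnj (P i j)" if "i \<in> J" "j \<in> J" for i j
  by (rule psd_herm[OF assms(1)]) (use assms that in auto)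
 show "0 <= Re (\<Sum>i\<in>A. \<Sum>j\<in>A. a i * cnj (a j) * P i j)" if "finite A" "A <= J" for A a
  by (rule psd_pos[OF assms(1)]) (use assms that in auto)
qed

text \<open>Cholesky decomposition by induction on the index set: a positive pivot is split off and
  the Schur complement \<open>P'\<close> is again positive semidefinite; a zero pivot has a zero
  row.\<close>

lemma psd_finite_gram:
 assumes "finite A" "psd A P"
 shows "\<exists>v :: nat => 'i => complex. EX m. \<forall>i\<in>A. \<forall>j\<in>A. P i j = (\<Sum>k<m. v k i * cnj (v k j))"
 using assms
proof (induction A arbitrary: P rule: finite_induct)
 case (insert x A)
 have herm: "P j i = cnj (P i j)" if "i \<in> insert x A" "j \<in> insert x A" for i j
  by (rule psd_herm[OF insert.prems that])
 have pos: "0 <= Re (\<Sum>i\<in>insert x A. \<Sum>j\<in>insert x A. a i * cnj (a j) * P i j)" for a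
  by (rule psd_pos[OF insert.prems]) (use insert.hyps in auto)
 have pos2: "0 <= Re (\<Sum>i\<in>B. \<Sum>j\<in>B. a i * cnj (a j) * P i j)" if "B <= insert x A" for a B
  by (rule psd_pos[OF insert.prems finite_subset[OF that]]) (use insert.hyps that in auto)
 define d where "d = Re (P x x)"
 have Pxx: "P x x = of_real d"
  using herm[of x x] by (simp add: d_def complex_eq_iff)
 have d: "d >= 0"
  using pos2[of "{x}" "%_. 1"] by (simp add: d_def)
 show ?case
 proof (cases "d = 0")
  case True
  have zero: "P i x = 0" if i: "i \<in> A" for i
  proof (rule ccontr)
   assume ne: "P i x ~= 0"
   then have xi: "x ~= i" using insert i by auto
   \<comment> \<open>Chosen so that the form takes the value -1 on the vector with entry 1 at
     \<open>i\<close> and entry \<open>t * P i x\<close> at \<open>x\<close>.\<close>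
   define t where "t = - (Re (P i i) + 1) / (2 * (cmod (P i x))\<^sup>2)"
   have "0 <= Re (\<Sum>k\<in>{i, x}. \<Sum>j\<in>{i, x}. (if k = i then 1 else t * P i x) * cnj (if j = i then 1 else t * P i x) * P k j)"
    using i by (intro pos2) auto
   also have "(\<Sum>k\<in>{i, x}. \<Sum>j\<in>{i, x}. (if k = i then 1 else t * P i x) * cnj (if j = i then 1 else t * P i x) * P k j)
     = P i i + cnj (t * P i x) * P i x + t * P i x * cnj (P i x)"
    using xi Pxx True herm[of i x] i by simp
   also have "cnj (of_real t * P i x) * P i x = of_real (t * (cmod (P i x))\<^sup>2)"
    by (simp add: complex_norm_square[symmetric] mult.assoc mult.commute[of "cnj _"] del: of_real_power)
   also have "of_real t * P i x * cnj (P i x) = of_real (t * (cmod (P i x))\<^sup>2)"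
    by (simp add: complex_norm_square[symmetric] mult.assoc del: of_real_power)
   finally have "0 <= Re (P i i) + 2 * (t * (cmod (P i x))\<^sup>2)" by simp
   also have "2 * (t * (cmod (P i x))\<^sup>2) = - (Re (P i i) + 1)"
    using ne by (simp add: t_def field_simps)
   finally show False by simp
  qed
  have "psd A P"
   using insert.prems by (rule psd_subset) auto
  from insert.IH[OF this] obtain v m where v: "\<forall>i\<in>A. \<forall>j\<in>A. P i j = (\<Sum>k<(m::nat). v k i * cnj (v k j))"
   by blast
  have "P i j = (\<Sum>k<m. (if i = x then 0 else v k i) * cnj (if j = x then 0 else v k j))"
   if "i \<in> insert x A" "j \<in> insert x A" for i j
  proof (cases "i = x \<or> j = x")
   case True
   then have "P i j = 0"
    using that zero Pxx \<open>d = 0\<close> herm[of i j] herm[of j i] by auto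
   moreover have "(\<Sum>k<m. (if i = x then 0 else v k i) * cnj (if j = x then 0 else v k j)) = 0"
    using True by (intro sum.neutral) auto
   ultimately show ?thesis by simp
  next
   case False
   then show ?thesis using that v by auto
  qed
  then show ?thesis
   by (intro exI[of _ "%k i. if i = x then 0 else v k i"] exI[of _ m]) auto
 next
  case False
  with d have d0: "d > 0" by simp
  define P' where "P' i j = P i j - P i x * cnj (P j x) / of_real d" for i j
  have "psd A P'"
  proof (rule psdI)
   show "P' j i = cnj (P' i j)" if "i \<in> A" "j \<in> A" for i j
    using herm[of i j] that by (simp add: P'_def)
   fix B and a :: "'i => complex" assume B: "finite B" "B <= A"
   then have xB: "x \<notin> B" using insert by auto
   define s where "s = (\<Sum>i\<in>B. a i * P i x)"
   \<comment> \<open>The entry at \<open>x\<close> that minimises the form when the other entries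
     are fixed; the minimum is the value of the Schur complement.\<close>
   define a' where "a' i = (if i = x then - s / of_real d else a i)" for i
   define Q where "Q = (\<Sum>i\<in>B. \<Sum>j\<in>B. a i * cnj (a j) * P i j)"
   have 0: "0 <= Re (\<Sum>i\<in>insert x B. \<Sum>j\<in>insert x B. a' i * cnj (a' j) * P i j)"
    using B by (intro pos2) auto
   have 1: "(\<Sum>i\<in>B. a' i * cnj (a' x) * P i x) = cnj (a' x) * s"
    using xB unfolding s_def sum_distrib_left by (intro sum.cong) (auto simp: a'_def)
   have 2: "(\<Sum>j\<in>B. a' x * cnj (a' j) * P x j) = a' x * cnj s"
    unfolding s_def cnj_sum sum_distrib_left
   proof (intro sum.cong refl)
    fix j assume j: "j \<in> B"
    then have "P x j = cnj (P j x)" using herm[of j x] B by auto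
    moreover have "j ~= x" using j xB by auto
    ultimately show "a' x * cnj (a' j) * P x j = a' x * cnj (a j * P j x)"
     by (simp add: a'_def)
   qed
   have 3: "(\<Sum>i\<in>B. \<Sum>j\<in>B. a' i * cnj (a' j) * P i j) = Q"
    unfolding Q_def using xB by (intro sum.cong) (auto simp: a'_def)
   have "(\<Sum>i\<in>insert x B. \<Sum>j\<in>insert x B. a' i * cnj (a' j) * P i j)
    = a' x * cnj (a' x) * P x x + (\<Sum>j\<in>B. a' x * cnj (a' j) * P x j)
     + ((\<Sum>i\<in>B. a' i * cnj (a' x) * P i x) + (\<Sum>i\<in>B. \<Sum>j\<in>B. a' i * cnj (a' j) * P i j))"
    using B xB by (simp add: sum.distrib)
   also have "... = Q - s * cnj s / of_real d"
    unfolding 1 2 3 using d0 by (simp add: a'_def Pxx field_simps)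
   also have "... = (\<Sum>i\<in>B. \<Sum>j\<in>B. a i * cnj (a j) * P' i j)"
   proof -
    have "s * cnj s / of_real d = (\<Sum>i\<in>B. \<Sum>j\<in>B. a i * P i x * cnj (a j * P j x) / of_real d)"
     unfolding s_def cnj_sum sum_product sum_divide_distrib ..
    moreover have "a i * cnj (a j) * P i j - a i * P i x * cnj (a j * P j x) / of_real d = a i * cnj (a j) * P' i j" for i j
     by (simp add: P'_def right_diff_distrib mult_ac)
    ultimately show ?thesis
     unfolding Q_def by (simp only: sum_subtractf[symmetric])
   qed
   finally show "0 <= Re (\<Sum>i\<in>B. \<Sum>j\<in>B. a i * cnj (a j) * P' i j)"
    using 0 by simp
  qed
  then obtain v m where v: "\<forall>i\<in>A. \<forall>j\<in>A. P' i j = (\<Sum>k<(m::nat). v k i * cnj (v k j))"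
   using insert.IH[of P'] by metis
  \<comment> \<open>The new vector, with index \<open>m\<close>, is the pivot column divided by
    \<open>sqrt d\<close>; the old vectors are extended by 0 at \<open>x\<close>.\<close>
  define w where "w k i = (if k = m then P i x / of_real (sqrt d) else if i = x then 0 else v k i)" for k i
  have "P i j = (\<Sum>k<Suc m. w k i * cnj (w k j))" if ij: "i \<in> insert x A" "j \<in> insert x A" for i j
  proof -
   have "(\<Sum>k<Suc m. w k i * cnj (w k j)) = (\<Sum>k<m. w k i * cnj (w k j)) + P i x * cnj (P j x) / of_real d"
   proof -
    have "complex_of_real (sqrt d) * complex_of_real (sqrt d) = of_real d"
     using d0 by (simp flip: of_real_mult)
    then show ?thesis by (simp add: w_def)
   qed
   also have "(\<Sum>k<m. w k i * cnj (w k j)) = P' i j"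
   proof (cases "i = x \<or> j = x")
    case True
    then have "(\<Sum>k<m. w k i * cnj (w k j)) = 0"
     by (intro sum.neutral) (auto simp: w_def)
    moreover have "P' i j = 0"
     using True d0 Pxx herm[OF ij(2), of x] by (auto simp: P'_def)
    ultimately show ?thesis by simp
   next
    case False
    then have "(\<Sum>k<m. w k i * cnj (w k j)) = (\<Sum>k<m. v k i * cnj (v k j))"
     by (intro sum.cong) (auto simp: w_def)
    then show ?thesis using v ij False by auto
   qed
   finally show ?thesis by (simp add: P'_def)
  qed
  then show ?thesis by blast
 qed
qed auto

text \<open>Schur's product theorem. A Gram decomposition of \<open>P\<close> turns the form of the
  product into a sum of values of the form of \<open>Q\<close> at the vectors
  \<open>a i * v k i\<close>.\<close>

lemma psd_mult:
 assumes P: "psd I P" and Q: "psd I Q"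
 shows "psd I (%i j. P i j * Q i j)"
proof (rule psdI)
 show "P j i * Q j i = cnj (P i j * Q i j)" if "i \<in> I" "j \<in> I" for i j
 proof -
  have "P j i = cnj (P i j)" "Q j i = cnj (Q i j)"
   by (rule psd_herm[OF P that], rule psd_herm[OF Q that])
  then show ?thesis by simp
 qed
 fix A and a :: "'a => complex" assume A: "finite A" "A <= I"
 have "psd A P"
  by (rule psd_subset[OF P A(2)])
 from psd_finite_gram[OF A(1) this]
 obtain v m where v: "\<forall>i\<in>A. \<forall>j\<in>A. P i j = (\<Sum>k<(m::nat). v k i * cnj (v k j))"
  by blast
 have "(\<Sum>i\<in>A. \<Sum>j\<in>A. a i * cnj (a j) * (P i j * Q i j))
   = (\<Sum>i\<in>A. \<Sum>j\<in>A. \<Sum>k<m. (a i * v k i) * cnj (a j * v k j) * Q i j)"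
 proof (intro sum.cong refl)
  fix i j assume "i \<in> A" "j \<in> A"
  then have "P i j = (\<Sum>k<m. v k i * cnj (v k j))" using v by blast
  then show "a i * cnj (a j) * (P i j * Q i j) = (\<Sum>k<m. (a i * v k i) * cnj (a j * v k j) * Q i j)"
   by (simp add: sum_distrib_left sum_distrib_right mult_ac)
 qed
 also have "... = (\<Sum>i\<in>A. \<Sum>k<m. \<Sum>j\<in>A. (a i * v k i) * cnj (a j * v k j) * Q i j)"
  by (intro sum.cong refl sum.swap)
 also have "... = (\<Sum>k<m. \<Sum>i\<in>A. \<Sum>j\<in>A. (a i * v k i) * cnj (a j * v k j) * Q i j)"
  by (rule sum.swap)
 finally have "Re (\<Sum>i\<in>A. \<Sum>j\<in>A. a i * cnj (a j) * (P i j * Q i j))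
   = (\<Sum>k<m. Re (\<Sum>i\<in>A. \<Sum>j\<in>A. (a i * v k i) * cnj (a j * v k j) * Q i j))"
  by simp
 also have "... >= 0"
 proof (rule sum_nonneg)
  show "0 <= Re (\<Sum>i\<in>A. \<Sum>j\<in>A. (a i * v k i) * cnj (a j * v k j) * Q i j)" for k
   by (rule psd_pos[OF Q A])
 qed
 finally show "0 <= Re (\<Sum>i\<in>A. \<Sum>j\<in>A. a i * cnj (a j) * (P i j * Q i j))" .
qed

section \<open>Coordinates on standard probability spaces\<close>

text \<open>A point is coded by the 0/1 sequence that records which balls around a countable dense
  set contain it, written in base 4. The tail then contributes at most 1/3, so digits are read off
  without ambiguity as parities of floors, and both directions are Borel.\<close>

lemma polish_code_exists:
 obtains code :: "'a::polish_space => real" and decode :: "real => 'a"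
 where "code \<in> borel_measurable borel" "decode \<in> borel_measurable borel"
  "!!x. decode (code x) = x" "!!x. 0 <= code x" "!!x. code x < 1"
proof -
 obtain D :: "'a set" where D: "countable D" "!!X. open X ==> X ~= {} ==> \<exists>d\<in>D. d \<in> X"
  by (rule countable_dense_setE) blast
 have "D ~= {}" using D(2)[of UNIV] by auto
 define d where "d = from_nat_into D"
 have d: "range d = D"
  unfolding d_def using D(1) \<open>D ~= {}\<close> by (rule range_from_nat_into[rotated])
 define V where "V k = (case prod_decode k of (i, m) => ball (d i) (1 / real (Suc m)))" for k
 define b :: "nat => 'a => real" where "b k x = indicator (V k) x" for k x
 have b01: "0 <= b k x" "b k x <= 1" for k x
  by (auto simp: b_def indicator_def)
 have V_open: "open (V k)" for k
  by (auto simp: V_def split: prod.split)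
 have [measurable]: "b k \<in> borel_measurable borel" for k
  unfolding b_def using V_open by (intro borel_measurable_indicator) auto
 define code where "code x = (\<Sum>k. b k x * (1/4) ^ Suc k)" for x
 have geo: "(%k. (1/4::real) ^ Suc k) sums (1/3)"
  using sums_mult[OF geometric_sums[of "1/4::real"], of "1/4"] by simp
 have summ: "summable (%k. b (k + n) x * (1/4) ^ Suc k)" for x n
 proof (rule summable_comparison_test')
  show "summable (%k. (1/4::real) ^ Suc k)" using geo sums_summable by blast
  show "norm (b (k + n) x * (1/4) ^ Suc k) <= (1/4) ^ Suc k" if "k >= 0" for k
   using b01[of "k + n" x] by (simp add: mult_left_le_one_le)
 qed
 have tail: "0 <= (\<Sum>k. b (k + n) x * (1/4) ^ Suc k)" "(\<Sum>k. b (k + n) x * (1/4) ^ Suc k) <= 1/3" for x n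
 proof -
  show "0 <= (\<Sum>k. b (k + n) x * (1/4) ^ Suc k)"
   using summ[of n x] b01 by (intro suminf_nonneg) auto
  have "(\<Sum>k. b (k + n) x * (1/4) ^ Suc k) <= (\<Sum>k. (1/4::real) ^ Suc k)"
   using summ geo b01 by (intro suminf_le) (auto simp: sums_iff mult_left_le_one_le)
  then show "(\<Sum>k. b (k + n) x * (1/4) ^ Suc k) <= 1/3"
   using geo by (simp add: sums_iff)
 qed
 have "code \<in> borel_measurable borel"
  unfolding code_def by measurable
 define bit where "bit k r \<longleftrightarrow> odd \<lfloor>4 ^ Suc k * r :: real\<rfloor>" for k r
 \<comment> \<open>After multiplication by \<open>4 ^ Suc k\<close> the earlier digits contribute
   multiples of 4, digit \<open>k\<close> contributes 0 or 1, and the tail stays below 1.\<close>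
 have bit_code: "bit k (code x) \<longleftrightarrow> x \<in> V k" for k x
 proof -
  have s0: "summable (%k. b k x * (1/4) ^ Suc k)" using summ[of 0 x] by simp
  have "code x = (\<Sum>j. b (j + Suc k) x * (1/4) ^ Suc (j + Suc k)) + (\<Sum>j<Suc k. b j x * (1/4) ^ Suc j)"
   unfolding code_def by (rule suminf_split_initial_segment[OF s0])
  also have "(\<Sum>j. b (j + Suc k) x * (1/4) ^ Suc (j + Suc k)) = (1/4) ^ Suc k * (\<Sum>j. b (j + Suc k) x * (1/4) ^ Suc j)"
   using suminf_mult[OF summ[of "Suc k" x], of "(1/4) ^ Suc k"] by (simp add: power_add mult_ac)
  finally have "4 ^ Suc k * code x = (\<Sum>j. b (j + Suc k) x * (1/4) ^ Suc j) + 4 ^ Suc k * (\<Sum>j<Suc k. b j x * (1/4) ^ Suc j)"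
   by (simp add: distrib_left power_one_over)
  also have "4 ^ Suc k * (\<Sum>j<Suc k. b j x * (1/4) ^ Suc j) = (\<Sum>j<Suc k. b j x * 4 ^ (k - j))"
   unfolding sum_distrib_left
  proof (intro sum.cong refl)
   fix j assume "j \<in> {..<Suc k}"
   then have "(4::real) ^ Suc k = 4 ^ (k - j) * 4 ^ Suc j"
    by (subst power_add[symmetric]) auto
   then show "4 ^ Suc k * (b j x * (1/4) ^ Suc j) = b j x * 4 ^ (k - j)"
    by (simp add: power_one_over del: power_Suc)
  qed
  also have "... = of_int (\<Sum>j<Suc k. (if x \<in> V j then 1 else 0) * 4 ^ (k - j))"
   unfolding of_int_sum by (intro sum.cong refl) (auto simp: b_def)
  finally have "\<lfloor>4 ^ Suc k * code x\<rfloor> = (\<Sum>j<Suc k. (if x \<in> V j then 1 else 0) * 4 ^ (k - j))"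
   using tail[where n="Suc k" and x=x] by (intro floor_unique) auto
  also have "... = (\<Sum>j<k. (if x \<in> V j then 1 else 0) * 4 ^ (k - j)) + (if x \<in> V k then 1 else 0)"
   by simp
  finally have "\<lfloor>4 ^ Suc k * code x\<rfloor> = (\<Sum>j<k. (if x \<in> V j then 1 else 0) * 4 ^ (k - j)) + (if x \<in> V k then 1 else 0)" .
  moreover have "even (\<Sum>j<k. (if x \<in> V j then 1 else 0) * 4 ^ (k - j) :: int)"
   by (intro dvd_sum) auto
  ultimately show ?thesis by (auto simp: bit_def)
 qed
 have [measurable]: "Measurable.pred borel (bit k)" for k
 proof -
  have "(%r::real. \<lfloor>4 ^ Suc k * r\<rfloor>) \<in> borel \<rightarrow>\<^sub>M count_space UNIV" by measurable
  from measurable_compose[OF this, of odd "count_space UNIV"] show ?thesis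
   by (simp add: bit_def[abs_def])
 qed
 \<comment> \<open>Centre of the first recorded ball of radius \<open>1 / (m + 1)\<close>; at a code
   it lies within that distance of the coded point.\<close>
 define p where "p m r = d (LEAST i. bit (prod_encode (i, m)) r)" for m r
 have [measurable]: "p m \<in> borel_measurable borel" for m
 proof -
  have "(%r. LEAST i. bit (prod_encode (i, m)) r) \<in> borel \<rightarrow>\<^sub>M count_space UNIV"
   by measurable
  then show ?thesis unfolding p_def by (rule measurable_compose) simp
 qed
 have p_code: "(%m. p m (code x)) \<longlonglongrightarrow> x" for x
 proof (rule metric_LIMSEQ_I)
  fix e :: real assume "e > 0"
  then obtain N where N: "1 / real (Suc N) < e"
   using reals_Archimedean by (metis inverse_eq_divide)
  have "dist (p m (code x)) x < e" if m: "m >= N" for m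
  proof -
   have "EX i. bit (prod_encode (i, m)) (code x)"
   proof -
    have "open (ball x (1 / real (Suc m)))" "ball x (1 / real (Suc m)) ~= {}" by auto
    then obtain y where "y \<in> D" "y \<in> ball x (1 / real (Suc m))" using D(2) by blast
    then obtain i where "d i \<in> ball x (1 / real (Suc m))" using d by blast
    then show ?thesis by (auto simp: bit_code V_def dist_commute intro!: exI[of _ i])
   qed
   then have "bit (prod_encode (LEAST i. bit (prod_encode (i, m)) (code x), m)) (code x)"
    by (rule LeastI_ex)
   then have "dist (p m (code x)) x < 1 / real (Suc m)"
    by (simp add: bit_code V_def p_def)
   also have "... <= 1 / real (Suc N)" using m by (simp add: field_simps)
   finally show ?thesis using N by simp
  qed
  then show "EX no. \<forall>n\<ge>no. dist (p n (code x)) x < e" by blast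
 qed
 \<comment> \<open>Where the centres do not form a Cauchy sequence, the fixed value
   \<open>d 0\<close> keeps \<open>decode\<close> total and Borel.\<close>
 define decode where "decode r = (if Cauchy (%m. p m r) then lim (%m. p m r) else d 0)" for r
 have "decode \<in> borel_measurable borel"
 proof (rule borel_measurable_LIMSEQ_metric)
  have [measurable]: "Measurable.pred borel (%r. Cauchy (%m. p m r))"
   using sets_Collect_Cauchy[of p borel] by (simp add: pred_def)
  show "(%r. if Cauchy (%m. p m r) then p i r else d 0) \<in> borel_measurable borel" for i
   by measurable
  show "(%i. if Cauchy (%m. p m r) then p i r else d 0) \<longlonglongrightarrow> decode r" for r
   by (auto simp: decode_def Cauchy_convergent_iff convergent_LIMSEQ_iff)
 qed
 moreover have "decode (code x) = x" for x
  using p_code[of x] LIMSEQ_imp_Cauchy[OF p_code] by (simp add: decode_def limI)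
 moreover have "0 <= code x" "code x < 1" for x
  using tail[where n=0 and x=x] by (auto simp: code_def)
 ultimately show ?thesis
  using that \<open>code \<in> borel_measurable borel\<close> by blast
qed

text \<open>The uniform law on (0,1), kept as a measure on the whole line so that it is itself a
  standard space in the sense of \<open>std_nonatomic\<close>.\<close>

definition unif :: "real measure" where
 "unif = density lborel (indicator {0<..<1})"

lemma space_unif [simp]: "space unif = UNIV" and sets_unif [simp, measurable_cong]: "sets unif = sets borel"
 by (auto simp: unif_def)

lemma emeasure_unif: "A \<in> sets borel ==> emeasure unif A = emeasure lborel (A \<inter> {0<..<1})"
proof -
 assume A: "A \<in> sets borel"
 then have "emeasure unif A = (\<integral>\<^sup>+x. indicator {0<..<1} x * indicator A x \<partial>lborel)"
  unfolding unif_def by (intro emeasure_density) auto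
 also have "(%x. indicator {0<..<1} x * indicator A x) = (indicator (A \<inter> {0<..<1}) :: real => ennreal)"
  by (auto simp: fun_eq_iff split: split_indicator)
 finally show ?thesis
  using A by (simp only: nn_integral_indicator sets_lborel sets.Int greaterThanLessThan_borel)
qed

interpretation unif: prob_space unif
 by standard (simp add: emeasure_unif)

lemma AE_unif: "AE u in unif. 0 < u & u < 1"
 unfolding unif_def by (subst AE_density) (auto simp: indicator_def)

lemma measure_unif_atMost: "0 <= c ==> c <= 1 ==> measure unif {..c} = c"
proof -
 assume c: "0 <= c" "c <= 1"
 have "emeasure unif {..c} = emeasure lborel {0<..<c}"
  unfolding emeasure_unif[OF atMost_borel]
  by (intro emeasure_eq_AE) (use c AE_lborel_singleton[of c] in auto)
 then show ?thesis using c by (simp add: measure_def)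
qed

lemma unif_singleton: "emeasure unif {x} = 0"
proof -
 have "emeasure lborel ({x} \<inter> {0<..<1}) <= emeasure lborel {x}" by (rule emeasure_mono) auto
 then show ?thesis by (simp add: emeasure_unif)
qed

lemma std_nonatomic_unif: "std_nonatomic unif"
 using unif_singleton by (simp add: std_nonatomic_def unif.prob_space_axioms)

lemma pred_eq_metric [measurable (raw)]:
 fixes f g :: "'a => 'b::{metric_space, second_countable_topology}"
 assumes [measurable]: "f \<in> borel_measurable M" "g \<in> borel_measurable M"
 shows "Measurable.pred M (%x. f x = g x)"
proof -
 have "Measurable.pred M (%x. dist (f x) (g x) = 0)" by measurable
 then show ?thesis by simp
qed

locale std_space =
 fixes M :: "'a::polish_space measure"
 assumes std: "std_nonatomic M"
begin

sublocale prob_space M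
 using std by (simp add: std_nonatomic_def)

lemma space_M [simp]: "space M = UNIV" and sets_M [simp, measurable_cong]: "sets M = sets borel"
 and singleton_M: "emeasure M {x} = 0"
 using std by (auto simp: std_nonatomic_def)

text \<open>A real code without atoms has a continuous distribution function. Applied to the code it
  gives a uniform variable, and the quantile function followed by decoding inverts it almost
  everywhere. The label \<open>part\<close> enters as the integer part of the code, so the
  coordinate arranges the pieces in order along (0,1), which is the last clause.\<close>

lemma coordinate_exists:
 fixes part :: "'a => nat"
 assumes part [measurable]: "part \<in> borel \<rightarrow>\<^sub>M count_space UNIV"
 obtains \<phi> :: "'a => real" and \<kappa> :: "real => 'a"
 where "\<phi> \<in> borel_measurable borel" "\<kappa> \<in> borel_measurable borel"
  "distr M borel \<phi> = unif" "distr unif M \<kappa> = M"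
  "AE x in M. \<kappa> (\<phi> x) = x" "AE u in unif. \<phi> (\<kappa> u) = u"
  "!!l. AE x in M. part x < l \<longleftrightarrow> \<phi> x <= prob {x. part x < l}"
proof -
 obtain code0 :: "'a => real" and decode0 where c0 [measurable]: "code0 \<in> borel_measurable borel" "decode0 \<in> borel_measurable borel"
  and dc0: "!!x. decode0 (code0 x) = x" and c01: "!!x. 0 <= code0 x" "!!x. code0 x < 1"
  using polish_code_exists by metis
 define code where "code x = real (part x) + code0 x" for x
 define decode where "decode r = decode0 (r - of_int \<lfloor>r\<rfloor>)" for r
 have [measurable]: "code \<in> borel_measurable borel" "decode \<in> borel_measurable borel"
  unfolding code_def[abs_def] decode_def[abs_def] by measurable
 have dc: "decode (code x) = x" for x
 proof -
  have "\<lfloor>code x\<rfloor> = int (part x)"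
   unfolding code_def using c01[of x] by (intro floor_unique) auto
  then show ?thesis by (simp add: decode_def code_def dc0)
 qed
 have code_less: "code x < real l \<longleftrightarrow> part x < l" for x l
  using c01[of x] by (auto simp: code_def)
 define N where "N = distr M borel code"
 interpret N: cdf_distribution N
 proof -
  have "prob_space N" unfolding N_def by (intro prob_space_distr) measurable
  then show "cdf_distribution N"
   by (simp add: cdf_distribution_def real_distribution_def real_distribution_axioms_def N_def)
 qed
 have N_atom: "measure N {r} = 0" for r
 proof -
  have "code -` {r} <= {decode r}" using dc by auto
  then have "emeasure M (code -` {r} \<inter> space M) <= emeasure M {decode r}"
   by (intro emeasure_mono) auto
  then have "emeasure N {r} = 0"
   unfolding N_def by (subst emeasure_distr) (auto simp: singleton_M)
  then show ?thesis by (simp add: measure_def)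
 qed
 let ?F = "cdf N"
 \<comment> \<open>The quantile function; the value 0 is assigned outside (0,1), on a null set of
   \<open>unif\<close>.\<close>
 define G where "G u = (if 0 < u & u < 1 then N.I u else 0)" for u
 have [measurable]: "G \<in> borel_measurable borel"
 proof -
  have "(%u. if u \<in> {0<..<1} then N.I u else 0) \<in> borel_measurable borel"
   by (rule measurable_restrict_space_iff[THEN iffD1]) (use N.measurable_CI in auto)
  then show ?thesis by (simp add: G_def[abs_def])
 qed
 have distr_G: "distr unif borel G = N"
 proof (rule measure_eqI)
  fix A assume "A \<in> sets (distr unif borel G)"
  then have [measurable]: "A \<in> sets borel" by simp
  have "emeasure (distr unif borel G) A = emeasure lborel (G -` A \<inter> {0<..<1})"
   by (subst emeasure_distr) (auto simp: emeasure_unif intro!: emeasure_unif measurable_sets_borel[of G borel])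
  also have "G -` A \<inter> {0<..<1} = N.I -` A \<inter> {0<..<1}"
   by (auto simp: G_def)
  also have "emeasure lborel ... = emeasure (distr (restrict_space lborel {0<..<1}) borel N.I) A"
  proof (subst emeasure_distr)
   have "N.I \<in> borel_measurable (restrict_space borel {0<..<1})" by measurable
   then show "N.I \<in> restrict_space lborel {0<..<1} \<rightarrow>\<^sub>M borel"
    by (simp cong: measurable_cong_sets add: sets_restrict_space)
  qed (auto simp: emeasure_restrict_space space_restrict_space)
  finally show "emeasure (distr unif borel G) A = emeasure N A"
   by (simp add: N.distr_I_eq_M)
 qed (simp add: N_def)
 \<comment> \<open>Here the absence of atoms is used: a jump of the distribution function would make
   the composition overshoot \<open>u\<close>.\<close>
 have FG: "?F (G u) = u" if u: "0 < u" "u < 1" for u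
 proof (rule antisym)
  have cont: "isCont ?F (N.I u)" using N.isCont_cdf N_atom by simp
  show "u <= ?F (G u)"
   using N.pseudoinverse[of u "N.I u"] u by (simp add: G_def)
  have "?F x <= u" if "x < N.I u" for x
   using N.pseudoinverse[of u x] u that by auto
  then have "eventually (%x. ?F x <= u) (at_left (N.I u))"
   by (auto simp: eventually_at_left_field intro: exI[of _ "N.I u - 1"])
  moreover have "(?F \<longlongrightarrow> ?F (N.I u)) (at_left (N.I u))"
   using cont by (simp add: isCont_def filterlim_at_split)
  ultimately have "?F (N.I u) <= u"
   by (intro tendsto_upperbound) auto
  then show "?F (G u) <= u" using u by (simp add: G_def)
 qed
 define \<phi> where "\<phi> x = ?F (code x)" for x
 define \<kappa> where "\<kappa> u = decode (G u)" for u
 have [measurable]: "\<phi> \<in> borel_measurable borel" "\<kappa> \<in> borel_measurable borel"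
  unfolding \<phi>_def[abs_def] \<kappa>_def[abs_def] by measurable
 have "AE r in N. code (decode r) = r"
  unfolding N_def by (subst AE_distr_iff) (auto simp: dc)
 then have "AE u in unif. code (decode (G u)) = G u"
  unfolding distr_G[symmetric] by (subst (asm) AE_distr_iff) auto
 with AE_unif have pk: "AE u in unif. \<phi> (\<kappa> u) = u"
  by eventually_elim (simp add: \<phi>_def \<kappa>_def FG)
 have dk: "distr unif M \<kappa> = M"
 proof -
  have "distr unif M \<kappa> = distr (distr unif borel G) M decode"
   by (subst distr_distr) (auto simp: \<kappa>_def[abs_def] comp_def)
  also have "... = distr M M (%x. decode (code x))"
   unfolding distr_G unfolding N_def by (subst distr_distr) (auto simp: comp_def)
  also have "... = M" by (simp add: dc distr_id2)
  finally show ?thesis .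
 qed
 have dp: "distr M borel \<phi> = unif"
 proof -
  have "distr M borel \<phi> = distr unif borel (%u. \<phi> (\<kappa> u))"
   by (subst dk[symmetric], subst distr_distr) (auto simp: comp_def)
  also have "... = distr unif borel (%u. u)"
   by (rule distr_cong_AE) (use pk in auto)
  also have "... = unif" by (rule distr_id2) simp
  finally show ?thesis .
 qed
 have kp: "AE x in M. \<kappa> (\<phi> x) = x"
 proof -
  have "AE x in distr unif M \<kappa>. \<kappa> (\<phi> x) = x"
   by (subst AE_distr_iff) (use pk in \<open>auto elim: eventually_mono\<close>)
  then show ?thesis unfolding dk .
 qed
 have "AE x in M. part x < l \<longleftrightarrow> \<phi> x <= prob {x. part x < l}" for l
 proof -
  \<comment> \<open>One inclusion holds everywhere by monotonicity, and both sets have measure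
    \<open>c\<close>; hence they agree almost everywhere.\<close>
  define c where "c = prob {x. part x < l}"
  have [measurable]: "Measurable.pred borel (%x. part x < l)" by measurable
  have sub: "\<phi> x <= c" if "part x < l" for x
  proof -
   have "\<phi> x = prob (code -` {..code x})"
    unfolding \<phi>_def cdf_def N_def by (subst measure_distr) auto
   also have "... <= c"
    unfolding c_def
   proof (rule finite_measure_mono)
    show "code -` {..code x} <= {x. part x < l}"
     using code_less[of x l] that by (auto simp: code_less[symmetric])
   qed measurable
   finally show ?thesis .
  qed
  have "prob {x. \<phi> x <= c} = measure unif {..c}"
   unfolding dp[symmetric] by (subst measure_distr) (auto simp: vimage_def)
  also have "... = c"
   by (rule measure_unif_atMost) (auto simp: c_def)
  finally have eq: "prob {x. \<phi> x <= c} = c" .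
  have "prob ({x. \<phi> x <= c} - {x. part x < l}) = prob {x. \<phi> x <= c} - prob {x. part x < l}"
   by (rule finite_measure_Diff) (use sub in auto)
  also have "... = 0" using eq unfolding c_def by simp
  finally have "AE x in M. x \<notin> {x. \<phi> x <= c} - {x. part x < l}"
   by (intro AE_not_in null_setsI) (auto simp: emeasure_eq_measure)
  then show ?thesis
   unfolding c_def[symmetric] by eventually_elim (use sub in auto)
 qed
 with dp dk kp pk show ?thesis
  using that[of \<phi> \<kappa>] by simp
qed

end

section \<open>The Hilbert space of square integrable functions\<close>

lemma cnj_borel_measurable [measurable]: "cnj \<in> borel_measurable borel"
 by (intro borel_measurable_continuous_onI continuous_on_cnj continuous_on_id)

lemma integral_prod_commute: "(\<integral>x. f x * cnj (g x) \<partial>M) = cnj (\<integral>x. g x * cnj (f x) \<partial>M)"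
proof -
 have "cnj (\<integral>x. g x * cnj (f x) \<partial>M) = (\<integral>x. cnj (g x * cnj (f x)) \<partial>M)"
  by (rule Bochner_Integration.integral_cnj[symmetric])
 also have "(%x. cnj (g x * cnj (f x))) = (%x. f x * cnj (g x))"
  by (simp add: fun_eq_iff)
 finally show ?thesis by simp
qed

lemma square_integrable_measurable: "square_integrable M f ==> f \<in> borel_measurable M"
 by (simp add: square_integrable_def)

lemma square_integrable_prod:
 assumes "square_integrable M f" "square_integrable M g"
 shows "integrable M (%x. f x * cnj (g x))"
proof (rule Bochner_Integration.integrable_bound)
 show "integrable M (%x. (cmod (f x))\<^sup>2 + (cmod (g x))\<^sup>2)"
  using assms by (auto simp: square_integrable_def)
 show "(%x. f x * cnj (g x)) \<in> borel_measurable M"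
  using assms[THEN square_integrable_measurable] by measurable
 have "a * b <= a\<^sup>2 + b\<^sup>2" if "0 <= a" "0 <= b" for a b :: real
  using that sum_squares_bound[of a b] mult_nonneg_nonneg[OF that] by linarith
 then show "AE x in M. norm (f x * cnj (g x)) <= norm ((cmod (f x))\<^sup>2 + (cmod (g x))\<^sup>2)"
  by (auto simp: norm_mult)
qed

lemma square_integrable_add:
 assumes "square_integrable M f" "square_integrable M g"
 shows "square_integrable M (%x. f x + g x)"
 unfolding square_integrable_def
proof
 note [measurable] = assms[THEN square_integrable_measurable]
 show "(%x. f x + g x) \<in> borel_measurable M"
  by measurable
 show "integrable M (%x. (cmod (f x + g x))\<^sup>2)"
 proof (rule Bochner_Integration.integrable_bound[of M "%x. 2 * (cmod (f x))\<^sup>2 + 2 * (cmod (g x))\<^sup>2"])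
  show "(%x. (cmod (f x + g x))\<^sup>2) \<in> borel_measurable M"
   by measurable
  show "integrable M (%x. 2 * (cmod (f x))\<^sup>2 + 2 * (cmod (g x))\<^sup>2)"
   using assms by (auto simp: square_integrable_def)
  have "(cmod (a + b))\<^sup>2 <= 2 * (cmod a)\<^sup>2 + 2 * (cmod b)\<^sup>2" for a b
  proof -
   have "(cmod (a + b))\<^sup>2 <= (cmod a + cmod b)\<^sup>2" by (intro power_mono norm_triangle_ineq) auto
   also have "... <= 2 * (cmod a)\<^sup>2 + 2 * (cmod b)\<^sup>2"
    using sum_squares_bound[of "cmod a" "cmod b"] by (simp add: power2_sum)
   finally show ?thesis .
  qed
  then show "AE x in M. norm ((cmod (f x + g x))\<^sup>2) <= norm (2 * (cmod (f x))\<^sup>2 + 2 * (cmod (g x))\<^sup>2)"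
   by auto
 qed
qed

lemma square_integrable_scale: "square_integrable M f ==> square_integrable M (%x. c * f x)"
 by (auto simp: square_integrable_def norm_mult power_mult_distrib)

lemma square_integrable_zero: "square_integrable M (%x. 0)"
 by (simp add: square_integrable_def)

lemma square_integrable_uminus: "square_integrable M f ==> square_integrable M (%x. - f x)"
 using square_integrable_scale[of M f "-1"] by simp

lemma square_integrable_diff:
 "square_integrable M f ==> square_integrable M g ==> square_integrable M (%x. f x - g x)"
 using square_integrable_add[of M f "%x. - g x"] square_integrable_uminus[of M g] by simp

text \<open>A partial equivalence: only square integrable functions are related to themselves, so
  the quotient contains nothing else.\<close>

definition l2_rel :: "(real => complex) => (real => complex) => bool" where
 "l2_rel f g \<longleftrightarrow> square_integrable unif f & square_integrable unif g & (AE u in unif. f u = g u)"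

quotient_type l2 = "real => complex" / partial: l2_rel
proof (rule part_equivpI)
 show "EX x. l2_rel x x"
  by (auto simp: l2_rel_def intro: square_integrable_zero)
 show "symp l2_rel"
  by (auto simp: symp_def l2_rel_def elim: eventually_mono)
 show "transp l2_rel"
  by (auto simp: transp_def l2_rel_def elim: eventually_elim2)
qed

text \<open>Riesz--Fischer, along a subsequence converging geometrically fast.\<close>

lemma square_integrable_limit_exists:
 fixes f :: "nat => 'a => complex"
 assumes "prob_space M" and f: "!!n. square_integrable M (f n)"
  and fast: "!!n m. n <= m ==> (\<integral>x. (cmod (f m x - f n x))\<^sup>2 \<partial>M) <= (1/4) ^ n"
 obtains g where "square_integrable M g" "!!n. (\<integral>x. (cmod (g x - f n x))\<^sup>2 \<partial>M) <= (1/4) ^ n"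
proof -
 interpret prob_space M by fact
 have [measurable]: "f n \<in> borel_measurable M" for n using f by (rule square_integrable_measurable)
 define d where "d n x = f (Suc n) x - f n x" for n x
 have [measurable]: "d n \<in> borel_measurable M" for n unfolding d_def by measurable
 have d2: "integrable M (%x. (cmod (f m x - f n x))\<^sup>2)" for m n
  using square_integrable_diff[OF f f, of m n] by (simp add: square_integrable_def)
 \<comment> \<open>The arithmetic-geometric inequality with weight \<open>2 ^ n\<close> turns the
   bound \<open>(1/4) ^ n\<close> on the squared norm into the summable bound
   \<open>(1/2) ^ n\<close> on the first moment.\<close>
 have d1: "(\<integral>\<^sup>+x. ennreal (cmod (d n x)) \<partial>M) <= ennreal ((1/2) ^ n)" for n
 proof -
  have "(\<integral>\<^sup>+x. ennreal (cmod (d n x)) \<partial>M) <= (\<integral>\<^sup>+x. ennreal (2 ^ n * (cmod (d n x))\<^sup>2 / 2 + (1/2) ^ n / 2) \<partial>M)"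
  proof (intro nn_integral_mono ennreal_leI)
   fix x
   have "0 <= (2 ^ n * cmod (d n x) - 1)\<^sup>2 / (2 ^ n * 2)" by simp
   also have "... = 2 ^ n * (cmod (d n x))\<^sup>2 / 2 - cmod (d n x) + (1/2) ^ n / 2"
    by (simp add: power2_diff power_one_over field_simps power2_eq_square)
   finally show "cmod (d n x) <= 2 ^ n * (cmod (d n x))\<^sup>2 / 2 + (1/2) ^ n / 2" by simp
  qed
  also have "... = ennreal (\<integral>x. 2 ^ n * (cmod (d n x))\<^sup>2 / 2 + (1/2) ^ n / 2 \<partial>M)"
   using d2[of "Suc n" n] by (intro nn_integral_eq_integral) (auto simp: d_def)
  also have "(\<integral>x. 2 ^ n * (cmod (d n x))\<^sup>2 / 2 + (1/2) ^ n / 2 \<partial>M) = 2 ^ n / 2 * (\<integral>x. (cmod (d n x))\<^sup>2 \<partial>M) + (1/2) ^ n / 2"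
   using d2[of "Suc n" n] by (subst Bochner_Integration.integral_add) (auto simp: d_def prob_space)
  also have "... <= 2 ^ n / 2 * (1/4) ^ n + (1/2) ^ n / 2"
   using fast[of n "Suc n"] by (simp add: d_def)
  also have "... = (1/2) ^ n"
   by (simp add: power_one_over power_mult_distrib[symmetric] flip: power_divide)
    (simp add: power_divide field_simps flip: power_mult_distrib)
  finally show ?thesis by (simp add: ennreal_leI)
 qed
 have "(\<integral>\<^sup>+x. (\<Sum>n. ennreal (cmod (d n x))) \<partial>M) = (\<Sum>n. \<integral>\<^sup>+x. ennreal (cmod (d n x)) \<partial>M)"
  by (rule nn_integral_suminf) measurable
 also have "... <= (\<Sum>n. ennreal ((1/2) ^ n))"
  by (intro suminf_le d1) auto
 also have "... = ennreal (\<Sum>n. (1/2) ^ n)"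
  by (intro suminf_ennreal2) auto
 also have "... < \<infinity>" by simp
 finally have "AE x in M. (\<Sum>n. ennreal (cmod (d n x))) ~= \<infinity>"
  by (intro nn_integral_noteq_infinite) auto
 then have conv: "AE x in M. convergent (%n. f n x)"
 proof eventually_elim
  case (elim x)
  then have "summable (%n. cmod (d n x))"
   by (intro summable_suminf_not_top) auto
  then have "summable (%n. d n x)" by (rule summable_norm_cancel)
  then have "convergent (%n. \<Sum>k<n. d k x)" by (simp add: summable_iff_convergent)
  then have "convergent (%n. f 0 x + (\<Sum>k<n. d k x))" by (intro convergent_add convergent_const)
  moreover have "f 0 x + (\<Sum>k<n. d k x) = f n x" for n
   unfolding d_def using sum_lessThan_telescope[of "%n. f n x" n] by simp
  ultimately show ?case by simp
 qed
 define g where "g x = lim (%n. f n x)" for x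
 have [measurable]: "g \<in> borel_measurable M" unfolding g_def by measurable
 have lim: "AE x in M. (%n. f n x) \<longlonglongrightarrow> g x"
  using conv by eventually_elim (simp add: g_def convergent_LIMSEQ_iff)
 \<comment> \<open>Fatou's lemma transfers the distance estimates to the pointwise limit and gives
   its integrability together with the rate.\<close>
 have fatou: "(\<integral>\<^sup>+x. ennreal ((cmod (g x - f n x))\<^sup>2) \<partial>M) <= ennreal ((1/4) ^ n)" for n
 proof -
  have "(\<integral>\<^sup>+x. ennreal ((cmod (g x - f n x))\<^sup>2) \<partial>M) = (\<integral>\<^sup>+x. liminf (%m. ennreal ((cmod (f m x - f n x))\<^sup>2)) \<partial>M)"
  proof (rule nn_integral_cong_AE, use lim in eventually_elim)
   case (elim x)
   have "(%m. ennreal ((cmod (f m x - f n x))\<^sup>2)) \<longlonglongrightarrow> ennreal ((cmod (g x - f n x))\<^sup>2)"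
    by (intro tendsto_ennrealI tendsto_intros elim)
   then show ?case by (intro lim_imp_Liminf[symmetric]) auto
  qed
  also have "... <= liminf (%m. \<integral>\<^sup>+x. ennreal ((cmod (f m x - f n x))\<^sup>2) \<partial>M)"
   by (rule nn_integral_liminf) measurable
  also have "... <= liminf (%m. ennreal ((1/4) ^ n))"
  proof (rule Liminf_mono, rule eventually_sequentiallyI)
   fix m assume "n <= m"
   have "(\<integral>\<^sup>+x. ennreal ((cmod (f m x - f n x))\<^sup>2) \<partial>M) = ennreal (\<integral>x. (cmod (f m x - f n x))\<^sup>2 \<partial>M)"
    by (intro nn_integral_eq_integral d2) auto
   then show "(\<integral>\<^sup>+x. ennreal ((cmod (f m x - f n x))\<^sup>2) \<partial>M) <= ennreal ((1/4) ^ n)"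
    using fast[OF \<open>n <= m\<close>] by (simp add: ennreal_leI)
  qed
  also have "... = ennreal ((1/4) ^ n)" by (simp add: Liminf_const)
  finally show ?thesis .
 qed
 have sq: "square_integrable M (%x. g x - f n x)" for n
  unfolding square_integrable_def
 proof
  show "integrable M (%x. (cmod (g x - f n x))\<^sup>2)"
   using order.strict_trans1[OF fatou[of n] ennreal_less_top]
   by (intro integrableI_nonneg) (auto simp: top.not_eq_extremum)
 qed measurable
 have "square_integrable M g"
  using square_integrable_add[OF sq[of 0] f[of 0]] by simp
 moreover have "(\<integral>x. (cmod (g x - f n x))\<^sup>2 \<partial>M) <= (1/4) ^ n" for n
 proof -
  have "(\<integral>\<^sup>+x. ennreal ((cmod (g x - f n x))\<^sup>2) \<partial>M) = ennreal (\<integral>x. (cmod (g x - f n x))\<^sup>2 \<partial>M)"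
   using sq[of n] by (intro nn_integral_eq_integral) (auto simp: square_integrable_def)
  with fatou[of n] show ?thesis by (simp add: ennreal_le_iff)
 qed
 ultimately show ?thesis using that by blast
qed

lemma l2_rel_refl [simp]: "l2_rel f f \<longleftrightarrow> square_integrable unif f"
 by (auto simp: l2_rel_def)

lemma l2_cases:
 obtains f where "square_integrable unif f" "x = abs_l2 f"
 using Quotient_abs_rep[OF Quotient_l2, of x] Quotient_rep_reflp[OF Quotient_l2, of x]
 by (metis l2_rel_refl)

lemma abs_l2_eqI:
 "square_integrable unif f ==> square_integrable unif g ==> AE u in unif. f u = g u ==> abs_l2 f = abs_l2 g"
 using Quotient_rel_abs[OF Quotient_l2] by (auto simp: l2_rel_def)

instantiation l2 :: complex_inner
begin

lift_definition zero_l2 :: l2 is "%_. 0"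
 by (simp add: l2_rel_def square_integrable_zero)

lift_definition plus_l2 :: "l2 => l2 => l2" is "%f g u. f u + g u"
 by (auto simp: l2_rel_def square_integrable_add elim: eventually_elim2)

lift_definition minus_l2 :: "l2 => l2 => l2" is "%f g u. f u - g u"
 by (auto simp: l2_rel_def square_integrable_diff elim: eventually_elim2)

lift_definition uminus_l2 :: "l2 => l2" is "%f u. - f u"
 by (auto simp: l2_rel_def square_integrable_uminus elim: eventually_mono)

lift_definition scaleC_l2 :: "complex => l2 => l2" is "%c f u. c * f u"
 by (auto simp: l2_rel_def square_integrable_scale elim: eventually_mono)

definition scaleR_l2_def: "scaleR_l2 r (x :: l2) = complex_of_real r *\<^sub>C x"

lift_definition cip_l2 :: "l2 => l2 => complex" is "%f g. \<integral>u. f u * cnj (g u) \<partial>unif"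
proof (rule integral_cong_AE)
 fix f f' g g' assume *: "l2_rel f f'" "l2_rel g g'"
 then have [measurable]: "f \<in> borel_measurable unif" "f' \<in> borel_measurable unif"
   "g \<in> borel_measurable unif" "g' \<in> borel_measurable unif"
  by (auto simp: l2_rel_def square_integrable_def)
 show "(%u. f u * cnj (g u)) \<in> borel_measurable unif" "(%u. f' u * cnj (g' u)) \<in> borel_measurable unif"
  by measurable
 from * have "AE u in unif. f u = f' u" "AE u in unif. g u = g' u" by (auto simp: l2_rel_def)
 then show "AE u in unif. f u * cnj (g u) = f' u * cnj (g' u)" by eventually_elim simp
qed

definition inner_l2_def: "inner_l2 (x :: l2) y = Re (cip x y)"
definition norm_l2_def: "norm_l2 (x :: l2) = sqrt (inner x x)"
definition sgn_l2_def: "sgn_l2 (x :: l2) = scaleR (inverse (norm x)) x"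
definition dist_l2_def: "dist_l2 (x :: l2) y = norm (x - y)"
definition uniformity_l2_def: "(uniformity :: (l2 \<times> l2) filter) = (INF e\<in>{0 <..}. principal {(x, y). dist x y < e})"
definition open_l2_def: "open_l2 (S :: l2 set) \<longleftrightarrow> (\<forall>x\<in>S. \<forall>\<^sub>F (x', y) in uniformity. x' = x --> y \<in> S)"

lemma l2_scaleC_props:
 fixes x y z :: l2
 shows "c *\<^sub>C (x + y) = c *\<^sub>C x + c *\<^sub>C y" "(c + d) *\<^sub>C x = c *\<^sub>C x + d *\<^sub>C x"
  "c *\<^sub>C (d *\<^sub>C x) = (c * d) *\<^sub>C x" "1 *\<^sub>C x = x"
 by (transfer; simp add: l2_rel_def algebra_simps square_integrable_add square_integrable_scale)+

lemma l2_group_props: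
 fixes x y z :: l2
 shows "x + y + z = x + (y + z)" "x + y = y + x" "0 + x = x" "- x + x = 0" "x - y = x + - y"
 by (transfer; simp add: l2_rel_def add.assoc add.commute square_integrable_add square_integrable_diff
   square_integrable_uminus square_integrable_zero)+

lemma l2_cip_props:
 fixes x y z :: l2
 shows "cip (x + y) z = cip x z + cip y z" "cip (c *\<^sub>C x) y = c * cip x y" "cip x y = cnj (cip y x)"
proof -
 obtain f where f: "square_integrable unif f" "x = abs_l2 f" by (rule l2_cases)
 obtain g where g: "square_integrable unif g" "y = abs_l2 g" by (rule l2_cases)
 obtain h where h: "square_integrable unif h" "z = abs_l2 h" by (rule l2_cases)
 show "cip (x + y) z = cip x z + cip y z"
  using f g h by (simp add: cip_l2.abs_eq plus_l2.abs_eq square_integrable_add distrib_right square_integrable_prod)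
 show "cip (c *\<^sub>C x) y = c * cip x y"
  using f g by (simp add: cip_l2.abs_eq scaleC_l2.abs_eq square_integrable_scale mult.assoc)
 show "cip x y = cnj (cip y x)"
  unfolding f(2) g(2) using f(1) g(1) integral_prod_commute[of unif f g] by (simp only: cip_l2.abs_eq l2_rel_refl)
qed

lemma l2_inner_self:
 fixes x :: l2
 shows "0 <= inner x x" "inner x x = 0 \<longleftrightarrow> x = 0"
proof -
 have 1: "Re (\<integral>u. f u * cnj (f u) \<partial>unif) = (\<integral>u. (cmod (f u))\<^sup>2 \<partial>unif)" if "square_integrable unif f" for f
  using integral_Re[OF square_integrable_prod[OF that that]] by (simp add: complex_norm_square[symmetric] del: of_real_power)
 obtain f where f: "square_integrable unif f" "x = abs_l2 f" by (rule l2_cases)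
 have inner_eq: "inner x x = (\<integral>u. (cmod (f u))\<^sup>2 \<partial>unif)"
  unfolding f(2) inner_l2_def using f(1) 1 by (simp only: cip_l2.abs_eq l2_rel_refl)
 then show "0 <= inner x x" by simp
 have "(\<integral>u. (cmod (f u))\<^sup>2 \<partial>unif) = 0 \<longleftrightarrow> (AE u in unif. (cmod (f u))\<^sup>2 = 0)"
  using f by (intro integral_nonneg_eq_0_iff_AE) (auto simp: square_integrable_def)
 also have "... \<longleftrightarrow> l2_rel f (%_. 0)"
  using f(1) by (simp add: l2_rel_def square_integrable_zero)
 also have "... \<longleftrightarrow> x = 0"
  unfolding f(2) zero_l2_def using Quotient_rel[OF Quotient_l2, of f "%_. 0"] f(1)
  by (simp add: square_integrable_zero)
 finally show "inner x x = 0 \<longleftrightarrow> x = 0" by (simp add: inner_eq)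
qed

instance
proof
 fix x y z :: l2 and a b :: real and c d :: complex
 show "x + y + z = x + (y + z)" "x + y = y + x" "0 + x = x" "- x + x = 0" "x - y = x + - y"
  by (rule l2_group_props)+
 show "c *\<^sub>C (x + y) = c *\<^sub>C x + c *\<^sub>C y" "(c + d) *\<^sub>C x = c *\<^sub>C x + d *\<^sub>C x"
  "c *\<^sub>C (d *\<^sub>C x) = (c * d) *\<^sub>C x"
  by (rule l2_scaleC_props)+
 show "a *\<^sub>R (x + y) = a *\<^sub>R x + a *\<^sub>R y" "(a + b) *\<^sub>R x = a *\<^sub>R x + b *\<^sub>R x"
  "a *\<^sub>R b *\<^sub>R x = (a * b) *\<^sub>R x" "1 *\<^sub>R x = x"
  by (simp_all add: scaleR_l2_def l2_scaleC_props)
 show "a *\<^sub>R x = complex_of_real a *\<^sub>C x" by (rule scaleR_l2_def)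
 show "sgn x = scaleR (inverse (norm x)) x" by (rule sgn_l2_def)
 show "dist x y = norm (x - y)" by (rule dist_l2_def)
 show "(uniformity :: (l2 \<times> l2) filter) = (INF e\<in>{0 <..}. principal {(x, y). dist x y < e})"
  by (rule uniformity_l2_def)
 show "open S \<longleftrightarrow> (\<forall>x\<in>S. \<forall>\<^sub>F (x', y) in uniformity. x' = x --> y \<in> S)" for S :: "l2 set"
  by (rule open_l2_def)
 show "cip (x + y) z = cip x z + cip y z" "cip (c *\<^sub>C x) y = c * cip x y" "cip x y = cnj (cip y x)"
  by (rule l2_cip_props)+
 show "inner x y = Re (cip x y)" by (rule inner_l2_def)
 show "inner x y = inner y x"
  unfolding inner_l2_def by (subst l2_cip_props(3)) simp
 show "inner (x + y) z = inner x z + inner y z" "inner (a *\<^sub>R x) y = a * inner x y"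
  by (simp_all add: inner_l2_def l2_cip_props(1,2) scaleR_l2_def)
 show "0 <= inner x x" "inner x x = 0 \<longleftrightarrow> x = 0"
  by (rule l2_inner_self)+
 show "norm x = sqrt (inner x x)" by (rule norm_l2_def)
qed

end

instance l2 :: complex_hilbert
proof
 show "Cauchy X ==> convergent X" for X :: "nat => l2"
 proof -
  assume X: "Cauchy X"
  have "EX N. \<forall>m\<ge>N. \<forall>n\<ge>N. dist (X m) (X n) < (1/2) ^ k" for k
   using metric_CauchyD[OF X, of "(1/2) ^ k"] by simp
  then obtain N where N: "!!k m n. m >= N k ==> n >= N k ==> dist (X m) (X n) < (1/2) ^ k"
   by metis
  \<comment> \<open>Strictly increasing, and beyond \<open>N i\<close> for every \<open>i\<close> up
    to \<open>k\<close>, so that the terms of the subsequence from index \<open>k\<close> on are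
    within \<open>(1/2) ^ k\<close> of each other.\<close>
  define r where "r k = (\<Sum>i\<le>k. N i) + k" for k
  have r: "strict_mono r" by (auto simp: strict_mono_Suc_iff r_def)
  have rN: "r m >= N k" if "k <= m" for k m
  proof -
   have "N k <= (\<Sum>i\<le>m. N i)" using that by (intro member_le_sum) auto
   then show ?thesis by (simp add: r_def)
  qed
  have "EX f. square_integrable unif f & X (r n) = abs_l2 f" for n
   using l2_cases[of "X (r n)"] by metis
  then obtain f where f: "!!n. square_integrable unif (f n)" "!!n. X (r n) = abs_l2 (f n)" by metis
  have norm_abs: "(norm (abs_l2 h))\<^sup>2 = (\<integral>u. (cmod (h u))\<^sup>2 \<partial>unif)" if h: "square_integrable unif h" for h
  proof -
   have "inner (abs_l2 h) (abs_l2 h) = (\<integral>u. (cmod (h u))\<^sup>2 \<partial>unif)"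
    using integral_Re[OF square_integrable_prod[OF h h]] h
    by (simp add: inner_l2_def cip_l2.abs_eq complex_norm_square[symmetric] del: of_real_power)
   then show ?thesis by (simp add: norm_l2_def l2_inner_self)
  qed
  have dist_abs: "(dist (abs_l2 h) (abs_l2 k))\<^sup>2 = (\<integral>u. (cmod (h u - k u))\<^sup>2 \<partial>unif)"
   if "square_integrable unif h" "square_integrable unif k" for h k
   using that norm_abs[OF square_integrable_diff[OF that]] by (simp add: dist_l2_def minus_l2.abs_eq)
  obtain g where g: "square_integrable unif g" "!!n. (\<integral>u. (cmod (g u - f n u))\<^sup>2 \<partial>unif) <= (1/4) ^ n"
  proof (rule square_integrable_limit_exists[OF unif.prob_space_axioms f(1)])
   fix n m :: nat assume nm: "n <= m"
   have "(\<integral>u. (cmod (f m u - f n u))\<^sup>2 \<partial>unif) = (dist (X (r m)) (X (r n)))\<^sup>2"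
    using f by (simp add: dist_abs)
   also have "... <= ((1/2) ^ n)\<^sup>2"
    using N[OF rN[OF nm] rN[OF order_refl]] by (intro power_mono) (auto intro: less_imp_le)
   also have "... = (1/4) ^ n" by (simp add: power2_eq_square flip: power_mult_distrib)
   finally show "(\<integral>u. (cmod (f m u - f n u))\<^sup>2 \<partial>unif) <= (1/4) ^ n" .
  qed (rule that, auto)
  have dg: "dist (abs_l2 g) (X (r n)) <= (1/2) ^ n" for n
  proof (rule power2_le_imp_le)
   have "((1/2::real) ^ n)\<^sup>2 = (1/4) ^ n" by (simp add: power2_eq_square flip: power_mult_distrib)
   then show "(dist (abs_l2 g) (X (r n)))\<^sup>2 <= ((1/2) ^ n)\<^sup>2"
    using g(2)[of n] unfolding f(2) dist_abs[OF g(1) f(1)] by simp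
  qed simp
  have "(%n. X (r n)) \<longlonglongrightarrow> abs_l2 g"
  proof (rule metric_tendsto_imp_tendsto[where f="%n. (1/2::real) ^ n" and a=0])
   show "(%n. (1/2::real) ^ n) \<longlonglongrightarrow> 0" by (rule LIMSEQ_realpow_zero) auto
   show "\<forall>\<^sub>F n in sequentially. dist (X (r n)) (abs_l2 g) <= dist ((1/2::real) ^ n) 0"
    using dg by (auto simp: dist_commute)
  qed
  then have "X \<longlonglongrightarrow> abs_l2 g"
   using Cauchy_converges_subseq[OF X r] by (simp add: comp_def)
  then show "convergent X" by (rule convergentI)
 qed
qed

section \<open>Automorphisms, coordinates and the passage from functions to vectors\<close>

lemma distr_ident: "distr M M id = M"
 using distr_id[of M] by (simp add: id_def)

lemma aut_bij: "T \<in> aut M ==> bij T"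
 and aut_measurable: "T \<in> aut M ==> T \<in> M \<rightarrow>\<^sub>M M"
 and aut_measurable_inv: "T \<in> aut M ==> inv T \<in> M \<rightarrow>\<^sub>M M"
 and aut_distr: "T \<in> aut M ==> distr M M T = M"
 by (auto simp: aut_def)

lemma aut_inv: "T \<in> aut M ==> inv T \<in> aut M"
proof -
 assume T: "T \<in> aut M"
 then have m: "T \<in> M \<rightarrow>\<^sub>M M" "inv T \<in> M \<rightarrow>\<^sub>M M" "bij T" by (auto simp: aut_def)
 have "distr M M (inv T) = distr (distr M M T) M (inv T)" using T by (simp add: aut_distr)
 also have "... = distr M M (inv T \<circ> T)" using m by (intro distr_distr)
 also have "... = M" using m by (simp add: bij_is_inj distr_ident)
 finally show ?thesis
  using m by (simp add: aut_def bij_imp_bij_inv inv_inv_eq)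
qed

lemma aut_comp: "S \<in> aut M ==> T \<in> aut M ==> S \<circ> T \<in> aut M"
proof -
 assume S: "S \<in> aut M" and T: "T \<in> aut M"
 have "distr M M (S \<circ> T) = distr (distr M M T) M S"
  using S T by (intro distr_distr[symmetric]) (auto simp: aut_def)
 then show ?thesis
  using S T by (auto simp: aut_def bij_comp o_inv_distrib intro: measurable_comp)
qed

lemma aut_funpow: "T \<in> aut M ==> T ^^ n \<in> aut M"
proof (induction n)
 case 0
 then show ?case by (simp add: aut_def distr_ident flip: id_def)
qed (auto intro: aut_comp)

lemma aut_zpow: "T \<in> aut M ==> zpow T k \<in> aut M"
 by (simp add: zpow_def aut_funpow aut_inv)

lemma aut_measure_vimage: "T \<in> aut M ==> A \<in> sets M ==> measure M (T -` A \<inter> space M) = measure M A"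
 by (metis aut_distr aut_measurable measure_distr)

lemma aut_AE: "T \<in> aut M ==> AE x in M. P x ==> AE x in M. P (T x)"
 by (metis AE_distrD aut_distr aut_measurable)

lemma distr_AE: "T \<in> M \<rightarrow>\<^sub>M N ==> distr M N T = N ==> AE x in N. P x ==> AE x in M. P (T x)"
 by (metis AE_distrD)

locale coordinates = std_space M for M :: "'a::polish_space measure" +
 fixes \<phi> :: "'a => real" and \<kappa> :: "real => 'a"
 assumes phi_meas [measurable]: "\<phi> \<in> borel_measurable borel"
  and kappa_meas [measurable]: "\<kappa> \<in> borel_measurable borel"
  and distr_phi: "distr M borel \<phi> = unif" and distr_kappa: "distr unif M \<kappa> = M"
  and kappa_phi: "AE x in M. \<kappa> (\<phi> x) = x" and phi_kappa: "AE u in unif. \<phi> (\<kappa> u) = u"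
begin

abbreviation "sq \<equiv> square_integrable M"

text \<open>The unitary identification of square integrable functions on \<open>M\<close> with
  \<open>l2\<close>; it is onto because \<open>\<phi>\<close> and \<open>\<kappa>\<close> are
  mutually inverse almost everywhere.\<close>

definition vec :: "('a => complex) => l2" where
 "vec f = abs_l2 (%u. f (\<kappa> u))"

lemma kappa_meas' [measurable]: "\<kappa> \<in> unif \<rightarrow>\<^sub>M M"
 by (simp cong: measurable_cong_sets)

lemma sq_kappa:
 assumes "sq f"
 shows "square_integrable unif (%u. f (\<kappa> u))"
proof -
 have [measurable]: "f \<in> borel_measurable M" using assms by (rule square_integrable_measurable)
 have "integrable (distr unif M \<kappa>) (%x. (cmod (f x))\<^sup>2)"
  using assms unfolding distr_kappa by (simp add: square_integrable_def)
 then show ?thesis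
  unfolding square_integrable_def by (intro conjI integrable_distr[of \<kappa> unif M]) auto
qed

lemma vec_add: "sq f ==> sq g ==> vec (%x. f x + g x) = vec f + vec g"
 by (simp add: vec_def plus_l2.abs_eq sq_kappa)

lemma vec_diff: "sq f ==> sq g ==> vec (%x. f x - g x) = vec f - vec g"
 by (simp add: vec_def minus_l2.abs_eq sq_kappa)

lemma vec_scale: "sq f ==> vec (%x. c * f x) = c *\<^sub>C vec f"
 by (simp add: vec_def scaleC_l2.abs_eq sq_kappa)

lemma vec_zero: "vec (%x. 0) = 0"
 by (simp add: vec_def zero_l2.abs_eq)

lemma sq_sum: "(!!i. i \<in> A ==> sq (f i)) ==> sq (%x. \<Sum>i\<in>A. c i * f i x)"
proof (induction A rule: infinite_finite_induct)
 case (insert i A)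
 then have "sq (%x. c i * f i x + (\<Sum>i\<in>A. c i * f i x))"
  by (intro square_integrable_add square_integrable_scale) auto
 with insert show ?case by simp
qed (simp_all add: square_integrable_zero)

lemma vec_sum: "(!!i. i \<in> A ==> sq (f i)) ==> vec (%x. \<Sum>i\<in>A. c i * f i x) = (\<Sum>i\<in>A. c i *\<^sub>C vec (f i))"
proof (induction A rule: infinite_finite_induct)
 case (insert i A)
 then have "vec (%x. c i * f i x + (\<Sum>i\<in>A. c i * f i x)) = c i *\<^sub>C vec (f i) + (\<Sum>i\<in>A. c i *\<^sub>C vec (f i))"
  by (simp add: vec_add vec_scale square_integrable_scale sq_sum)
 with insert show ?case by simp
qed (simp_all add: vec_zero)

lemma cip_vec:
 assumes "sq f" "sq g"
 shows "cip (vec f) (vec g) = (\<integral>x. f x * cnj (g x) \<partial>M)"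
proof -
 note [measurable] = assms[THEN square_integrable_measurable]
 have "cip (vec f) (vec g) = (\<integral>u. f (\<kappa> u) * cnj (g (\<kappa> u)) \<partial>unif)"
  using assms by (simp add: vec_def cip_l2.abs_eq sq_kappa)
 also have "... = (\<integral>x. f x * cnj (g x) \<partial>distr unif M \<kappa>)"
  by (rule integral_distr[symmetric]) measurable
 finally show ?thesis by (simp add: distr_kappa)
qed

lemma norm_vec: "sq f ==> (norm (vec f))\<^sup>2 = (\<integral>x. (cmod (f x))\<^sup>2 \<partial>M)"
proof -
 assume f: "sq f"
 have "complex_of_real ((norm (vec f))\<^sup>2) = (\<integral>x. f x * cnj (f x) \<partial>M)"
  using f by (simp only: cip_self[symmetric] cip_vec)
 also have "... = (\<integral>x. complex_of_real ((cmod (f x))\<^sup>2) \<partial>M)"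
  by (simp only: complex_norm_square)
 also have "... = complex_of_real (\<integral>x. (cmod (f x))\<^sup>2 \<partial>M)"
  by (rule integral_complex_of_real)
 finally show ?thesis using of_real_eq_iff by blast
qed

lemma norm_vec_diff: "sq f ==> sq g ==> (norm (vec f - vec g))\<^sup>2 = (\<integral>x. (cmod (f x - g x))\<^sup>2 \<partial>M)"
 using norm_vec[OF square_integrable_diff] by (simp add: vec_diff)

lemma vec_cong_AE:
 assumes "sq f" "sq g" "AE x in M. f x = g x"
 shows "vec f = vec g"
proof -
 have "(\<integral>x. (cmod (f x - g x))\<^sup>2 \<partial>M) = (\<integral>x. 0 \<partial>M)"
  using assms(1,2)[THEN square_integrable_measurable] assms(3)
  by (intro integral_cong_AE) (auto elim: eventually_mono)
 then have "(norm (vec f - vec g))\<^sup>2 = 0"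
  using assms by (simp add: norm_vec_diff)
 then show ?thesis by simp
qed

lemma vec_eq_imp_AE:
 assumes "sq f" "sq g" "vec f = vec g"
 shows "AE x in M. f x = g x"
proof -
 have "(\<integral>x. (cmod (f x - g x))\<^sup>2 \<partial>M) = 0"
  using norm_vec_diff[OF assms(1,2)] assms(3) by simp
 then have "AE x in M. (cmod (f x - g x))\<^sup>2 = 0"
  using square_integrable_diff[OF assms(1,2)]
  by (subst (asm) integral_nonneg_eq_0_iff_AE) (auto simp: square_integrable_def)
 then show ?thesis by (auto elim: eventually_mono)
qed

lemma phi_meas' [measurable]: "\<phi> \<in> borel_measurable M"
 by (simp cong: measurable_cong_sets)

lemma vec_surj:
 obtains f where "sq f" "vec f = v"
proof -
 obtain g where g: "square_integrable unif g" "v = abs_l2 g" by (rule l2_cases)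
 have [measurable]: "g \<in> borel_measurable unif" using g by (simp add: square_integrable_def)
 have [measurable]: "g \<in> borel_measurable borel" using g by (simp add: square_integrable_def cong: measurable_cong_sets)
 have "integrable (distr M borel \<phi>) (%u. (cmod (g u))\<^sup>2)"
  using g unfolding distr_phi by (simp add: square_integrable_def)
 then have sq: "sq (%x. g (\<phi> x))"
  unfolding square_integrable_def by (intro conjI integrable_distr[of \<phi> M borel]) auto
 have "vec (%x. g (\<phi> x)) = abs_l2 g"
  unfolding vec_def using g sq_kappa[OF sq] phi_kappa by (intro abs_l2_eqI) (auto elim: eventually_mono)
 with sq g that show ?thesis by blast
qed

lemma sq_bounded:
 assumes [measurable]: "f \<in> borel_measurable M" and "!!x. cmod (f x) <= c"
 shows "sq f"
 unfolding square_integrable_def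
proof
 show "integrable M (%x. (cmod (f x))\<^sup>2)"
  using assms(2) by (intro integrable_const_bound[where B="c\<^sup>2"]) (auto intro!: power_mono AE_I2)
qed measurable

abbreviation ind :: "'a set => l2" where
 "ind A \<equiv> vec (indicator A)"

lemma sq_indicator: "A \<in> sets M ==> sq (indicator A)"
 by (rule sq_bounded[where c=1]) (auto simp: indicator_def)

lemma symdiff_sets [measurable]: "A \<in> sets N ==> B \<in> sets N ==> symdiff A B \<in> sets N"
 by (auto simp: symdiff_def)

lemma ind_empty [simp]: "ind {} = 0"
proof -
 have "indicator {} = (%x::'a. 0 :: complex)" by (simp add: fun_eq_iff)
 then show ?thesis using vec_zero by simp
qed

lemma norm_ind_diff: "A \<in> sets M ==> B \<in> sets M ==> (norm (ind A - ind B))\<^sup>2 = prob (symdiff A B)"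
proof -
 assume AB: "A \<in> sets M" "B \<in> sets M"
 have "(norm (ind A - ind B))\<^sup>2 = (\<integral>x. (cmod (indicator A x - indicator B x))\<^sup>2 \<partial>M)"
  using AB by (intro norm_vec_diff sq_indicator)
 also have "... = (\<integral>x. indicator (symdiff A B) x \<partial>M)"
  by (intro Bochner_Integration.integral_cong) (auto simp: indicator_def symdiff_def)
 also have "... = prob (symdiff A B)" by simp
 finally show ?thesis .
qed

lemma cip_ind: "A \<in> sets M ==> B \<in> sets M ==> cip (ind A) (ind B) = complex_of_real (prob (A \<inter> B))"
proof -
 assume AB: "A \<in> sets M" "B \<in> sets M"
 have "cip (ind A) (ind B) = (\<integral>x. complex_of_real (indicator (A \<inter> B) x) \<partial>M)"
 proof -
  have "indicator A x * cnj (indicator B x) = complex_of_real (indicator (A \<inter> B) x)" for x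
   by (auto simp: indicator_def)
  then show ?thesis using AB by (simp only: cip_vec sq_indicator)
 qed
 also have "... = complex_of_real (prob (A \<inter> B))"
  using AB by (subst integral_complex_of_real) simp
 finally show ?thesis .
qed

lemma ind_disjoint_Un: "A \<in> sets M ==> B \<in> sets M ==> A \<inter> B = {} ==> ind (A \<union> B) = ind A + ind B"
proof -
 assume AB: "A \<in> sets M" "B \<in> sets M" "A \<inter> B = {}"
 have "indicator (A \<union> B) = (%x. indicator A x + indicator B x :: complex)"
  using AB by (auto simp: indicator_def fun_eq_iff)
 then show ?thesis using AB by (simp add: vec_add[symmetric] sq_indicator)
qed

lemma ind_UN:
 assumes "finite J" "disjoint_family_on A J" "!!i. i \<in> J ==> A i \<in> sets M"
 shows "ind (\<Union>i\<in>J. A i) = (\<Sum>i\<in>J. ind (A i))"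
 using assms
proof (induction J rule: finite_induct)
 case (insert i J)
 have "A i \<inter> (\<Union>i\<in>J. A i) = {}"
  using insert.hyps insert.prems(1) by (auto simp: disjoint_family_on_def)
 then have "ind (A i \<union> (\<Union>i\<in>J. A i)) = ind (A i) + ind (\<Union>i\<in>J. A i)"
  using insert.hyps insert.prems by (intro ind_disjoint_Un) auto
 moreover have "disjoint_family_on A J"
  using insert.prems(1) by (auto simp: disjoint_family_on_def)
 ultimately show ?case using insert by simp
qed simp

lemma indicators_total: "closure (cspan (ind ` sets M)) = UNIV"
proof -
 let ?W = "closure (cspan (ind ` sets M))"
 have W: "csubspace ?W" by (intro csubspace_closure complex_vs.subspace_span)
 have ind_W: "ind A \<in> ?W" if "A \<in> sets M" for A
  using that closure_subset[of "cspan (ind ` sets M)"] complex_vs.span_base[of "ind A" "ind ` sets M"] by blast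
 have "vec f \<in> ?W" if f: "sq f" for f
 proof -
  have [measurable]: "f \<in> borel_measurable M" using f by (rule square_integrable_measurable)
  obtain F where F: "!!i. simple_function M (F i)" "!!x. (%i. F i x) \<longlonglongrightarrow> f x" "!!i x. dist (F i x) 0 <= 2 * dist (f x) 0"
   using borel_measurable_implies_sequence_metric[of f M 0] by auto
  have [measurable]: "F i \<in> borel_measurable M" for i using F(1) by (rule borel_measurable_simple_function)
  have sqF: "sq (F i)" for i
  proof -
   have fin: "finite (range (F i))" using F(1)[of i] by (simp add: simple_function_def)
   then obtain c where "!!y. y \<in> range (F i) ==> cmod y <= c"
    using finite_imp_bounded[OF fin] by (auto simp: bounded_iff)
   then show ?thesis by (intro sq_bounded[where c=c]) auto
  qed
  have "vec (F i) \<in> ?W" for i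
  proof -
   have fin: "finite (range (F i))" using F(1)[of i] by (simp add: simple_function_def)
   have sets: "F i -` {y} \<in> sets M" for y
    using F(1)[of i] measurable_sets[of "F i" M borel "{y}"] by simp
   have "F i = (%x. \<Sum>y\<in>range (F i). y * indicator (F i -` {y}) x)"
   proof
    fix x
    have "(\<Sum>y\<in>range (F i). y * indicator (F i -` {y}) x) = (\<Sum>y\<in>range (F i). if y = F i x then y else 0)"
     by (intro sum.cong) (auto simp: indicator_def)
    also have "... = F i x" using fin by simp
    finally show "F i x = (\<Sum>y\<in>range (F i). y * indicator (F i -` {y}) x)" ..
   qed
   then have "vec (F i) = (\<Sum>y\<in>range (F i). y *\<^sub>C ind (F i -` {y}))"
    using vec_sum[of "range (F i)" "%y. indicator (F i -` {y})" "%y. y"] sets sq_indicator by simp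
   also have "... \<in> ?W"
    using W sets ind_W by (intro complex_vs.subspace_sum complex_vs.subspace_scale) auto
   finally show ?thesis .
  qed
  moreover have "(%i. vec (F i)) \<longlonglongrightarrow> vec f"
  proof -
   \<comment> \<open>The simple functions satisfy \<open>cmod (F i x) <= 2 * cmod (f x)\<close>, so
     the difference is at most three times \<open>cmod (f x)\<close>; this is the origin of the
     factor 9.\<close>
   have "(%i. \<integral>x. (cmod (F i x - f x))\<^sup>2 \<partial>M) \<longlonglongrightarrow> (\<integral>x. 0 \<partial>M)"
   proof (rule integral_dominated_convergence[where w="%x. 9 * (cmod (f x))\<^sup>2"])
    show "integrable M (%x. 9 * (cmod (f x))\<^sup>2)" using f by (simp add: square_integrable_def)
    have "(%i. (cmod (F i x - f x))\<^sup>2) \<longlonglongrightarrow> (cmod (f x - f x))\<^sup>2" for x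
     by (intro tendsto_intros F)
    then show "AE x in M. (%i. (cmod (F i x - f x))\<^sup>2) \<longlonglongrightarrow> 0" by simp
    show "AE x in M. norm ((cmod (F i x - f x))\<^sup>2) <= 9 * (cmod (f x))\<^sup>2" for i
    proof (rule AE_I2)
     fix x
     have "cmod (F i x - f x) <= 3 * cmod (f x)"
      using norm_triangle_ineq4[of "F i x" "f x"] F(3)[of i x] by simp
     then have "(cmod (F i x - f x))\<^sup>2 <= (3 * cmod (f x))\<^sup>2" by (rule power_mono) simp
     then show "norm ((cmod (F i x - f x))\<^sup>2) <= 9 * (cmod (f x))\<^sup>2" by (simp add: power_mult_distrib)
    qed
   qed measurable
   then have "(%i. (norm (vec (F i) - vec f))\<^sup>2) \<longlonglongrightarrow> 0"
    by (simp add: norm_vec_diff sqF f)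
   then have "(%i. sqrt ((norm (vec (F i) - vec f))\<^sup>2)) \<longlonglongrightarrow> sqrt 0" by (rule tendsto_real_sqrt)
   then show ?thesis by (simp add: tendsto_norm_zero_iff LIM_zero_iff)
  qed
  ultimately show ?thesis using closed_sequentially[of ?W "%i. vec (F i)"] by simp
 qed
 then show ?thesis using vec_surj by (metis UNIV_eq_I)
qed

lemma prob_phi_interval: "a <= b ==> prob {x. a <= \<phi> x & \<phi> x < b} <= b - a"
proof -
 assume ab: "a <= b"
 have "emeasure M {x. a <= \<phi> x & \<phi> x < b} = emeasure (distr M borel \<phi>) {a..<b}"
  by (subst emeasure_distr) (auto intro!: arg_cong[where f="emeasure M"])
 also have "... <= emeasure lborel {a..<b}"
  unfolding distr_phi by (subst emeasure_unif) (auto intro!: emeasure_mono)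
 also have "... = ennreal (b - a)" using ab by simp
 finally show ?thesis
  using ab by (simp add: emeasure_eq_measure ennreal_le_iff)
qed

text \<open>Half-lines are an intersection-stable generator, and the sets with indicator in
  \<open>W\<close> are stable under complements and disjoint unions; the cut at 1 is almost the
  whole space. Later density and convergence questions are thereby reduced to cuts of a single
  function.\<close>

lemma phi_cuts_total:
 assumes W: "closed W" "csubspace W" and cut: "!!q. ind {x. \<phi> x < q} \<in> W" and A: "A \<in> sets M"
 shows "ind A \<in> W"
proof -
 have ind_vimage: "ind (\<phi> -` E) \<in> W" if "E \<in> sets borel" for E
 proof -
  have sets_vi: "\<phi> -` E \<in> sets M" if "E \<in> sets borel" for E
   using measurable_sets[OF phi_meas' that] by simp
  have borel: "sets borel = sigma_sets UNIV (range (%a::real. {..<a}))"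
   by (subst borel_Iio) simp
  have top: "ind UNIV \<in> W"
  proof -
   have "AE x in M. \<phi> x < 1"
   proof -
    have "AE u in distr M borel \<phi>. 0 < u & u < 1" unfolding distr_phi by (rule AE_unif)
    then show ?thesis by (subst (asm) AE_distr_iff) auto
   qed
   then have "ind UNIV = ind {x. \<phi> x < 1}"
    by (intro vec_cong_AE sq_indicator) (auto simp: indicator_def elim: eventually_mono)
   then show ?thesis using cut by metis
  qed
  have "Int_stable (range (%a::real. {..<a}))"
  proof (rule Int_stableI_image)
   show "\<exists>k\<in>UNIV. {..<i} \<inter> {..<j} = {..<k}" for i j :: real
    by (intro bexI[of _ "min i j"]) auto
  qed
  moreover have "range (%a::real. {..<a}) <= Pow UNIV" by simp
  ultimately show ?thesis using that unfolding borel
  proof (induction E rule: sigma_sets_induct_disjoint)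
   case (basic E)
   then obtain a where "E = {..<a}" by auto
   then have "\<phi> -` E = {x. \<phi> x < a}" by auto
   then show ?case using cut by metis
  next
   case (compl E)
   then have s: "\<phi> -` E \<in> sets M" using sets_vi borel by auto
   have "ind (\<phi> -` E \<union> \<phi> -` (UNIV - E)) = ind (\<phi> -` E) + ind (\<phi> -` (UNIV - E))"
    using s by (intro ind_disjoint_Un) (auto simp: vimage_Diff)
   moreover have "\<phi> -` E \<union> \<phi> -` (UNIV - E) = UNIV" by auto
   ultimately have "ind (\<phi> -` (UNIV - E)) = ind UNIV - ind (\<phi> -` E)" by simp
   then show ?case using complex_vs.subspace_diff[OF W(2) top compl(2)] by simp
  next
   case (union E)
   have s: "\<phi> -` E i \<in> sets M" for i using union(2) sets_vi borel by auto
   define B where "B n = (\<Union>i<n. \<phi> -` E i)" for n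
   have Bs: "B n \<in> sets M" for n using s by (auto simp: B_def)
   have "ind (B n) \<in> W" for n
   proof -
    have "ind (B n) = (\<Sum>i<n. ind (\<phi> -` E i))"
     unfolding B_def using union(1) s by (intro ind_UN) (auto simp: disjoint_family_on_def)
    then show ?thesis using union(3) by (simp add: complex_vs.subspace_sum[OF W(2)])
   qed
   moreover have "(%n. ind (B n)) \<longlonglongrightarrow> ind (\<phi> -` (\<Union>i. E i))"
   proof -
    have un: "(\<Union>n. B n) = \<phi> -` (\<Union>i. E i)" by (auto simp: B_def)
    have us: "\<phi> -` (\<Union>i. E i) \<in> sets M" using Bs un by (metis sets.countable_UN image_subset_iff)
    have "(%n. prob (B n)) \<longlonglongrightarrow> prob (\<Union>n. B n)"
    proof (rule finite_Lim_measure_incseq)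
     show "incseq B" unfolding incseq_def B_def by (intro allI impI UN_mono) auto
    qed (use Bs in auto)
    then have "(%n. prob (\<phi> -` (\<Union>i. E i)) - prob (B n)) \<longlonglongrightarrow> prob (\<phi> -` (\<Union>i. E i)) - prob (\<phi> -` (\<Union>i. E i))"
     unfolding un by (intro tendsto_intros)
    moreover have "(norm (ind (B n) - ind (\<phi> -` (\<Union>i. E i))))\<^sup>2 = prob (\<phi> -` (\<Union>i. E i)) - prob (B n)" for n
    proof -
     have "symdiff (B n) (\<phi> -` (\<Union>i. E i)) = \<phi> -` (\<Union>i. E i) - B n"
      by (auto simp: symdiff_def B_def)
     then show ?thesis
      using us Bs[of n] by (simp add: norm_ind_diff) (intro finite_measure_Diff, auto simp: B_def)
    qed
    ultimately have "(%n. sqrt ((norm (ind (B n) - ind (\<phi> -` (\<Union>i. E i))))\<^sup>2)) \<longlonglongrightarrow> sqrt 0"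
     by (intro tendsto_real_sqrt) simp
    then show ?thesis by (simp add: tendsto_norm_zero_iff LIM_zero_iff)
   qed
   ultimately show ?case using closed_sequentially[OF W(1), of "%n. ind (B n)"] by blast
  qed (use W in \<open>auto simp: complex_vs.subspace_0 vec_zero\<close>)
 qed
 have "\<kappa> -` A \<in> sets borel" using A measurable_sets[OF kappa_meas, of A] by simp
 then have "ind (\<phi> -` (\<kappa> -` A)) \<in> W" by (rule ind_vimage)
 moreover have "ind (\<phi> -` (\<kappa> -` A)) = ind A"
 proof (intro vec_cong_AE sq_indicator)
  show "\<phi> -` \<kappa> -` A \<in> sets M" using measurable_sets[OF phi_meas' \<open>\<kappa> -` A \<in> sets borel\<close>] by simp
  show "AE x in M. indicator (\<phi> -` \<kappa> -` A) x = (indicator A x :: complex)"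
   using kappa_phi by eventually_elim (simp add: indicator_def)
 qed (use A in auto)
 ultimately show ?thesis by metis
qed

text \<open>Rational cuts suffice, since moving a cut by \<open>e\<^sup>2\<close> moves its
  indicator by at most \<open>e\<close> in norm.\<close>

lemma countable_total: "\<exists>v :: nat => l2. closure (cspan (range v)) = UNIV"
proof -
 define v where "v n = ind {x. \<phi> x < real_of_rat (nat_to_rat_surj n)}" for n
 let ?W = "closure (cspan (range v))"
 have W: "closed ?W" "csubspace ?W" by (auto intro: csubspace_closure complex_vs.subspace_span)
 have "ind {x. \<phi> x < q} \<in> ?W" for q
  unfolding closure_approachable
 proof (intro allI impI)
  fix e :: real assume e: "e > 0"
  obtain r where r: "q - e\<^sup>2 < of_rat r" "of_rat r < q"
   using of_rat_dense[of "q - e\<^sup>2" q] e by auto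
  obtain n where n: "nat_to_rat_surj n = r" using surj_nat_to_rat_surj by (metis surjD)
  have "symdiff {x. \<phi> x < of_rat r} {x. \<phi> x < q} = {x. of_rat r <= \<phi> x & \<phi> x < q}"
   using r by (auto simp: symdiff_def)
  then have "(norm (v n - ind {x. \<phi> x < q}))\<^sup>2 <= q - of_rat r"
   using prob_phi_interval[of "of_rat r" q] r by (simp add: v_def n norm_ind_diff)
  also have "... < e\<^sup>2" using r by simp
  finally have "dist (v n) (ind {x. \<phi> x < q}) < e"
   using e by (simp add: dist_norm power2_less_imp_less)
  then show "\<exists>y\<in>cspan (range v). dist y (ind {x. \<phi> x < q}) < e"
   by (intro bexI[of _ "v n"]) (auto intro: complex_vs.span_base)
 qed
 then have "ind ` sets M <= ?W"
  using phi_cuts_total[OF W] by blast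
 then have "x \<in> ?W" for x
  by (rule total_induct[OF indicators_total W])
 then show ?thesis by blast
qed

section \<open>Koopman operators, simple spectrum and rank one\<close>

definition koop :: "('a => 'a) => l2 => l2" where
 "koop T v = vec (%x. (SOME f. sq f & vec f = v) (T x))"

lemma sq_mp:
 assumes T [measurable]: "T \<in> M \<rightarrow>\<^sub>M M" and d: "distr M M T = M" and f: "sq f"
 shows "sq (%x. f (T x))"
proof -
 have [measurable]: "f \<in> borel_measurable M" using f by (rule square_integrable_measurable)
 have "integrable (distr M M T) (%x. (cmod (f x))\<^sup>2)"
  using f unfolding d by (simp add: square_integrable_def)
 then show ?thesis
  unfolding square_integrable_def by (intro conjI integrable_distr[of T M M]) auto
qed

lemma koop_mp:
 assumes T: "T \<in> M \<rightarrow>\<^sub>M M" "distr M M T = M" and f: "sq f"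
 shows "koop T (vec f) = vec (%x. f (T x))"
proof -
 define g where "g = (SOME g. sq g & vec g = vec f)"
 have g: "sq g" "vec g = vec f"
  unfolding g_def using f by (metis (mono_tags, lifting) someI_ex)+
 then have "AE x in M. g x = f x" using f by (intro vec_eq_imp_AE)
 then have "AE x in M. g (T x) = f (T x)" by (rule distr_AE[OF T])
 then have "vec (%x. g (T x)) = vec (%x. f (T x))"
  using g f by (intro vec_cong_AE sq_mp[OF T])
 then show ?thesis by (simp add: koop_def g_def)
qed

lemma sq_aut: "T \<in> aut M ==> sq f ==> sq (%x. f (T x))"
 by (rule sq_mp[OF aut_measurable aut_distr])

lemma koop_vec: "T \<in> aut M ==> sq f ==> koop T (vec f) = vec (%x. f (T x))"
 by (rule koop_mp[OF aut_measurable aut_distr])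

lemma koop_inverse:
 assumes T: "T \<in> aut M"
 shows "koop T (koop (inv T) v) = v" "koop (inv T) (koop T v) = v"
proof -
 obtain f where f: "sq f" "vec f = v" by (rule vec_surj)
 note bij = aut_bij[OF T]
 have "koop T (koop (inv T) (vec f)) = vec f" "koop (inv T) (koop T (vec f)) = vec f"
  using f(1) T by (simp_all add: koop_vec aut_inv sq_aut bij_is_inj[OF bij] surj_f_inv_f[OF bij_is_surj[OF bij]])
 with f show "koop T (koop (inv T) v) = v" "koop (inv T) (koop T v) = v" by auto
qed

lemma unitary_koop:
 assumes T: "T \<in> aut M"
 shows "unitary (koop T)"
 unfolding unitary_def
proof (intro conjI allI)
 show "surj (koop T)" using koop_inverse[OF T] by (metis surjI)
 fix v w c
 obtain f where f: "sq f" "vec f = v" by (rule vec_surj)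
 obtain g where g: "sq g" "vec g = w" by (rule vec_surj)
 show "koop T (v + w) = koop T v + koop T w"
  unfolding f(2)[symmetric] g(2)[symmetric] using f(1) g(1)
  by (simp add: vec_add[symmetric] koop_vec[OF T] square_integrable_add sq_aut[OF T])
 show "koop T (c *\<^sub>C v) = c *\<^sub>C koop T v"
  unfolding f(2)[symmetric] using f(1)
  by (simp add: vec_scale[symmetric] koop_vec[OF T] square_integrable_scale sq_aut[OF T])
 note [measurable] = square_integrable_measurable[OF f(1)] square_integrable_measurable[OF g(1)] aut_measurable[OF T]
 have "cip (koop T (vec f)) (koop T (vec g)) = (\<integral>x. f (T x) * cnj (g (T x)) \<partial>M)"
  using f(1) g(1) by (simp add: koop_vec[OF T] cip_vec sq_aut[OF T])
 also have "... = (\<integral>x. f x * cnj (g x) \<partial>distr M M T)"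
  by (rule integral_distr[symmetric]) measurable
 also have "... = cip (vec f) (vec g)"
  using f(1) g(1) by (simp add: aut_distr[OF T] cip_vec)
 finally show "cip (koop T v) (koop T w) = cip v w" by (simp add: f g)
qed

lemma inv_koop: "T \<in> aut M ==> inv (koop T) = koop (inv T)"
 using koop_inverse by (intro inv_equality) auto

lemma zpow_koop:
 assumes T: "T \<in> aut M" and f: "sq f"
 shows "zpow (koop T) k (vec f) = vec (%x. f (zpow T k x))"
proof (induction k rule: int_induct[where k=0])
 case (step1 i)
 have "zpow T (i + 1) x = zpow T i (T x)" for x
  using zpow_add[OF aut_bij[OF T], of i 1] by (simp add: zpow_1)
 then show ?case
  using step1 f by (simp add: zpow_succ[OF unitary_bij[OF unitary_koop[OF T]]] koop_vec[OF T] sq_aut[OF aut_zpow[OF T]])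
next
 case (step2 i)
 have "zpow T (i - 1) x = zpow T i (inv T x)" for x
  using zpow_add[OF aut_bij[OF T], of i "-1"] by (simp add: zpow_1)
 then show ?case
  using step2 f by (simp add: zpow_pred[OF unitary_bij[OF unitary_koop[OF T]]] inv_koop[OF T]
    koop_vec[OF aut_inv[OF T]] sq_aut[OF aut_zpow[OF T]])
qed simp

lemma koop_funpow: "T \<in> aut M ==> koop T ^^ n = koop (T ^^ n)"
proof
 fix v assume T: "T \<in> aut M"
 obtain f where f: "sq f" "vec f = v" by (rule vec_surj)
 show "(koop T ^^ n) v = koop (T ^^ n) v"
  using zpow_koop[OF T f(1), of "int n"] koop_vec[OF aut_funpow[OF T] f(1), of n] f(2) by (simp add: zpow_of_nat)
qed

lemma simple_spectrum_iff_cyclic: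
 assumes T: "T \<in> aut M"
 shows "simple_spectrum M T \<longleftrightarrow> (EX F. cyclic (koop T) F)"
proof
 assume "simple_spectrum M T"
 then obtain f where f: "sq f" and ap: "!!g e. sq g ==> e > 0 ==>
   EX F c. finite (F :: int set) & (\<integral>x. (cmod (g x - (\<Sum>k\<in>F. c k * f (zpow T k x))))\<^sup>2 \<partial>M) < e"
  unfolding simple_spectrum_def by blast
 have "v \<in> closure (cspan (orbit (koop T) (vec f)))" for v
  unfolding closure_approachable
 proof (intro allI impI)
  fix e :: real assume e: "e > 0"
  obtain g where g: "sq g" "vec g = v" by (rule vec_surj)
  obtain F c where F: "finite (F :: int set)" "(\<integral>x. (cmod (g x - (\<Sum>k\<in>F. c k * f (zpow T k x))))\<^sup>2 \<partial>M) < e\<^sup>2"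
   using ap[OF g(1), of "e\<^sup>2"] e by auto
  have sqz: "sq (%x. f (zpow T k x))" for k by (rule sq_aut[OF aut_zpow[OF T] f])
  let ?z = "\<Sum>k\<in>F. c k *\<^sub>C zpow (koop T) k (vec f)"
  have "?z = vec (%x. \<Sum>k\<in>F. c k * f (zpow T k x))"
   using vec_sum[of F "%k x. f (zpow T k x)" c] sqz by (simp add: zpow_koop[OF T f])
  then have "(norm (v - ?z))\<^sup>2 < e\<^sup>2"
   using F norm_vec_diff[OF g(1) sq_sum[of F "%k x. f (zpow T k x)" c]] sqz g(2) by simp
  then have "dist ?z v < e"
   using e by (simp add: dist_norm norm_minus_commute power2_less_imp_less)
  moreover have "?z \<in> cspan (orbit (koop T) (vec f))"
   by (intro complex_vs.span_sum complex_vs.span_scale complex_vs.span_base) (auto simp: orbit_def)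
  ultimately show "\<exists>y\<in>cspan (orbit (koop T) (vec f)). dist y v < e" by blast
 qed
 then show "EX F. cyclic (koop T) F" unfolding cyclic_def by blast
next
 assume "EX F. cyclic (koop T) F"
 then obtain F where F: "cyclic (koop T) F" by blast
 obtain f where f: "sq f" "vec f = F" by (rule vec_surj)
 have "EX F c. finite (F :: int set) & (\<integral>x. (cmod (g x - (\<Sum>k\<in>F. c k * f (zpow T k x))))\<^sup>2 \<partial>M) < e"
  if g: "sq g" and e: "e > 0" for g e
 proof -
  have "vec g \<in> closure (cspan (orbit (koop T) F))" using F by (simp add: cyclic_def)
  then obtain z where z: "z \<in> cspan (orbit (koop T) F)" "dist z (vec g) < sqrt e"
   using e unfolding closure_approachable by (meson real_sqrt_gt_zero)
  obtain A c where A: "finite A" "z = (\<Sum>k\<in>A. c k *\<^sub>C zpow (koop T) k F)"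
   using z(1) unfolding orbit_def by (rule span_range_explicit)
  have sqz: "sq (%x. f (zpow T k x))" for k by (rule sq_aut[OF aut_zpow[OF T] f(1)])
  have "z = vec (%x. \<Sum>k\<in>A. c k * f (zpow T k x))"
   using vec_sum[of A "%k x. f (zpow T k x)" c] sqz A by (simp add: zpow_koop[OF T f(1)] f(2)[symmetric])
  then have "(\<integral>x. (cmod (g x - (\<Sum>k\<in>A. c k * f (zpow T k x))))\<^sup>2 \<partial>M) = (dist z (vec g))\<^sup>2"
   using norm_vec_diff[OF g sq_sum[of A "%k x. f (zpow T k x)" c]] sqz by (simp add: dist_norm norm_minus_commute)
  also have "... < (sqrt e)\<^sup>2" using z(2) by (intro power_strict_mono) auto
  also have "... = e" using e by simp
  finally show ?thesis using A(1) by blast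
 qed
 then show "simple_spectrum M T" unfolding simple_spectrum_def using f(1) by blast
qed

lemma aut_image_vimage: "T \<in> aut M ==> T ` A = inv T -` A"
 by (simp add: aut_bij bij_vimage_eq_inv_image bij_imp_bij_inv inv_inv_eq)

lemma aut_image_sets: "T \<in> aut M ==> A \<in> sets M ==> T ` A \<in> sets M"
 using measurable_sets[OF aut_measurable_inv, of T M A] by (simp add: aut_image_vimage)

text \<open>Puts all levels of a tower with base \<open>A\<close> into the orbit of
  \<open>ind A\<close>. The exponent is negative because the operator composes with the map, which
  takes preimages.\<close>

lemma zpow_koop_ind:
 assumes T: "T \<in> aut M" and A: "A \<in> sets M"
 shows "zpow (koop T) (- int i) (ind A) = ind ((T ^^ i) ` A)"
proof -
 have "indicator A (zpow T (- int i) x) = (indicator ((T ^^ i) ` A) x :: complex)" for x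
 proof -
  have "x \<in> (T ^^ i) ` A \<longleftrightarrow> zpow T (- int i) x \<in> A"
   using zpow_minus_cancel[OF aut_bij[OF T], of "int i"] by (auto simp: zpow_of_nat image_iff) (metis zpow_of_nat)+
  then show ?thesis by (simp add: indicator_def)
 qed
 then show ?thesis using A by (simp add: zpow_koop[OF T] sq_indicator)
qed

text \<open>Any two vectors are approximated by simple functions, and those by unions of levels of
  one common tower. All of these lie in the cyclic span of the indicator of the base, which is the
  hypothesis of \<open>cyclic_vector_exists\<close>.\<close>

lemma rank_one_imp_simple_spectrum:
 assumes T: "T \<in> aut M" and r1: "rank_one M T"
 shows "simple_spectrum M T"
proof -
 have simple_approx: "EX As c. finite As & As <= sets M & norm (v - (\<Sum>A\<in>As. c A *\<^sub>C ind A)) < e" if e: "e > 0" for v e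
 proof -
  have "v \<in> closure (cspan (ind ` sets M))" using indicators_total by blast
  then obtain z where z: "z \<in> cspan (ind ` sets M)" "dist z v < e"
   using e by (auto simp: closure_approachable)
  obtain As c where "finite As" "As <= sets M" "z = (\<Sum>A\<in>As. c A *\<^sub>C ind A)"
   using z(1) by (rule span_range_explicit)
  with z show ?thesis by (auto simp: dist_norm norm_minus_commute)
 qed
 obtain v :: "nat => l2" where v: "closure (cspan (range v)) = UNIV" using countable_total by blast
 have "EX F. cyclic (koop T) F"
 proof (rule cyclic_vector_exists[OF unitary_koop[OF T] v])
  fix x y :: l2 and e :: real assume e: "e > 0"
  obtain As c where As: "finite As" "As <= sets M" "norm (x - (\<Sum>A\<in>As. c A *\<^sub>C ind A)) < e / 2"
   using simple_approx[of "e / 2" x] e by auto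
  obtain Bs d where Bs: "finite Bs" "Bs <= sets M" "norm (y - (\<Sum>A\<in>Bs. d A *\<^sub>C ind A)) < e / 2"
   using simple_approx[of "e / 2" y] e by auto
  define K where "K = (\<Sum>A\<in>As. cmod (c A)) + (\<Sum>A\<in>Bs. cmod (d A)) + 1"
  have K: "(\<Sum>A\<in>As. cmod (c A)) < K" "(\<Sum>A\<in>Bs. cmod (d A)) < K" "K > 0"
   unfolding K_def by (simp_all add: sum_nonneg add_nonneg_pos add_nonneg_nonneg add.commute[of _ 1] add_strict_increasing)
  \<comment> \<open>A square, because the measure of a symmetric difference is the squared distance
    of the indicators. \<open>K\<close> bounds both sums of coefficients, and its summand 1 keeps it
    positive.\<close>
  define \<delta> where "\<delta> = (e / (2 * K))\<^sup>2"
  have \<delta>: "\<delta> > 0" "sqrt \<delta> = e / (2 * K)" using e K by (simp_all add: \<delta>_def)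
  obtain B h where B: "B \<in> sets M" "disjoint_family_on (%i. (T ^^ i) ` B) {..<h}"
   and J: "\<forall>A\<in>As \<union> Bs. \<exists>J\<subseteq>{..<h}. prob (symdiff A (\<Union>i\<in>J. (T ^^ i) ` B)) < \<delta>"
   using r1[unfolded rank_one_def, rule_format, of "As \<union> Bs" \<delta>] As Bs \<delta>(1) by auto
  obtain J where J: "!!A. A \<in> As \<union> Bs ==> J A <= {..<h}"
    "!!A. A \<in> As \<union> Bs ==> prob (symdiff A (\<Union>i\<in>J A. (T ^^ i) ` B)) < \<delta>"
   using J by metis
  have lev: "(T ^^ i) ` B \<in> sets M" for i by (rule aut_image_sets[OF aut_funpow[OF T] B(1)])
  let ?u = "%A. ind (\<Union>i\<in>J A. (T ^^ i) ` B)"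
  have span_u: "?u A \<in> cspan (orbit (koop T) (ind B))" if A: "A \<in> As \<union> Bs" for A
  proof -
   have "?u A = (\<Sum>i\<in>J A. zpow (koop T) (- int i) (ind B))"
    unfolding zpow_koop_ind[OF T B(1)]
    using disjoint_family_on_mono[OF J(1)[OF A] B(2)] J(1)[OF A] lev by (intro ind_UN) (auto intro: finite_subset)
   also have "... \<in> cspan (orbit (koop T) (ind B))"
    by (intro complex_vs.span_sum complex_vs.span_base) (auto simp: orbit_def)
   finally show ?thesis .
  qed
  have close_u: "norm (ind A - ?u A) <= e / (2 * K)" if A: "A \<in> As \<union> Bs" for A
  proof -
   have "(\<Union>i\<in>J A. (T ^^ i) ` B) \<in> sets M"
    using J(1)[OF A] lev by (intro sets.finite_UN) (auto intro: finite_subset)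
   then have "(norm (ind A - ?u A))\<^sup>2 < \<delta>"
    using J(2)[OF A] A As(2) Bs(2) by (subst norm_ind_diff) auto
   then show ?thesis unfolding \<delta>(2)[symmetric] by (simp add: real_le_rsqrt less_imp_le)
  qed
  have close: "norm (z - (\<Sum>A\<in>Cs. a A *\<^sub>C ?u A)) < e"
   if Cs: "finite Cs" "Cs <= As \<union> Bs" "norm (z - (\<Sum>A\<in>Cs. a A *\<^sub>C ind A)) < e / 2" "(\<Sum>A\<in>Cs. cmod (a A)) < K" for z Cs a
  proof -
   have "norm ((\<Sum>A\<in>Cs. a A *\<^sub>C ind A) - (\<Sum>A\<in>Cs. a A *\<^sub>C ?u A)) = norm (\<Sum>A\<in>Cs. a A *\<^sub>C (ind A - ?u A))"
    by (simp add: sum_subtractf complex_vs.scale_right_diff_distrib)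
   also have "... <= (\<Sum>A\<in>Cs. cmod (a A) * (e / (2 * K)))"
   proof (rule order_trans[OF norm_sum sum_mono])
    fix A assume "A \<in> Cs"
    then have "norm (ind A - ?u A) <= e / (2 * K)" using Cs(2) close_u by blast
    then show "norm (a A *\<^sub>C (ind A - ?u A)) <= cmod (a A) * (e / (2 * K))"
     by (simp only: norm_scaleC mult_left_mono norm_ge_zero)
   qed
   also have "... = (\<Sum>A\<in>Cs. cmod (a A)) * (e / (2 * K))" by (rule sum_distrib_right[symmetric])
   also have "... <= K * (e / (2 * K))" using Cs(4) e K by (intro mult_right_mono) auto
   also have "... = e / 2" using K by simp
   finally show ?thesis
    using Cs(3) norm_triangle_ineq[of "z - (\<Sum>A\<in>Cs. a A *\<^sub>C ind A)" "(\<Sum>A\<in>Cs. a A *\<^sub>C ind A) - (\<Sum>A\<in>Cs. a A *\<^sub>C ?u A)"]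
    by simp
  qed
  show "EX b x' y'. x' \<in> cspan (orbit (koop T) b) & y' \<in> cspan (orbit (koop T) b) & norm (x - x') < e & norm (y - y') < e"
  proof (intro exI conjI)
   show "(\<Sum>A\<in>As. c A *\<^sub>C ?u A) \<in> cspan (orbit (koop T) (ind B))" "(\<Sum>A\<in>Bs. d A *\<^sub>C ?u A) \<in> cspan (orbit (koop T) (ind B))"
    using span_u by (auto intro!: complex_vs.span_sum complex_vs.span_scale)
   show "norm (x - (\<Sum>A\<in>As. c A *\<^sub>C ?u A)) < e" "norm (y - (\<Sum>A\<in>Bs. d A *\<^sub>C ?u A)) < e"
    using As Bs K by (auto intro!: close)
  qed
 qed
 then show ?thesis using simple_spectrum_iff_cyclic[OF T] by blast
qed

end

section \<open>Couplings\<close>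

lemma C2_sets: "\<rho> \<in> C2 M ==> sets \<rho> = sets (M \<Otimes>\<^sub>M M)"
 and C2_prob_space: "\<rho> \<in> C2 M ==> prob_space \<rho>"
 and C2_fst: "\<rho> \<in> C2 M ==> distr \<rho> M fst = M"
 and C2_snd: "\<rho> \<in> C2 M ==> distr \<rho> M snd = M"
 by (auto simp: C2_def)

lemma coupling_eqI:
 assumes "prob_space \<rho>" "sets \<rho> = sets (M \<Otimes>\<^sub>M M)" "prob_space \<sigma>" "sets \<sigma> = sets (M \<Otimes>\<^sub>M M)"
  and eq: "!!A B. A \<in> sets M ==> B \<in> sets M ==> measure \<rho> (A \<times> B) = measure \<sigma> (A \<times> B)"
 shows "\<rho> = \<sigma>"
proof -
 interpret \<rho>: prob_space \<rho> by fact
 interpret \<sigma>: prob_space \<sigma> by fact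
 let ?E = "{A \<times> B | A B. A \<in> sets M & B \<in> sets M}"
 have sub: "?E <= Pow (space M \<times> space M)" by (auto dest: sets.sets_into_space)
 show ?thesis
 proof (rule measure_eqI_generator_eq[OF Int_stable_pair_measure_generator sub, where A="%_. space M \<times> space M"])
  show "emeasure \<rho> X = emeasure \<sigma> X" if "X \<in> ?E" for X
   using that eq by (auto simp: \<rho>.emeasure_eq_measure \<sigma>.emeasure_eq_measure)
  show "sets \<rho> = sigma_sets (space M \<times> space M) ?E" "sets \<sigma> = sigma_sets (space M \<times> space M) ?E"
   using assms by (simp_all add: sets_pair_measure)
 qed auto
qed

lemma topspace_C2_top: "topspace (C2_top M) = C2 M"
 unfolding C2_top_def topology_generated_by_topspace by auto

lemma openin_C2_top_rectangle:
 "A \<in> sets M ==> B \<in> sets M ==> open U ==> openin (C2_top M) {\<sigma> \<in> C2 M. measure \<sigma> (A \<times> B) \<in> U}"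
 unfolding C2_top_def by (rule topology_generated_by_Basis) blast

context std_space
begin

lemma space_pair [simp]: "space (M \<Otimes>\<^sub>M M) = UNIV"
 by (simp add: space_pair_measure)

lemma map_prod_measurable: "T \<in> M \<rightarrow>\<^sub>M M ==> map_prod T T \<in> M \<Otimes>\<^sub>M M \<rightarrow>\<^sub>M M \<Otimes>\<^sub>M M"
 using measurable_Pair[OF measurable_compose[OF measurable_fst] measurable_compose[OF measurable_snd], of T M M T M M]
 by (simp add: map_prod_def case_prod_beta')

lemma map_prod_measurable': "sets \<rho> = sets (M \<Otimes>\<^sub>M M) ==> T \<in> M \<rightarrow>\<^sub>M M ==> map_prod T T \<in> \<rho> \<rightarrow>\<^sub>M M \<Otimes>\<^sub>M M"
 using map_prod_measurable by (simp cong: measurable_cong_sets)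

lemma lens_funpow:
 assumes T: "T \<in> aut M" and \<rho>: "sets \<rho> = sets (M \<Otimes>\<^sub>M M)"
 shows "(lens M T ^^ n) \<rho> = distr \<rho> (M \<Otimes>\<^sub>M M) (map_prod (T ^^ n) (T ^^ n))"
proof (induction n)
 case 0
 have "map_prod id id = (id :: 'a \<times> 'a => _)" by (rule map_prod.id)
 then show ?case using distr_id2[OF \<rho>[symmetric]] by (simp add: id_def)
next
 case (Suc n)
 have m: "map_prod (T ^^ n) (T ^^ n) \<in> \<rho> \<rightarrow>\<^sub>M M \<Otimes>\<^sub>M M"
  by (rule map_prod_measurable'[OF \<rho> aut_measurable[OF aut_funpow[OF T]]])
 have "(lens M T ^^ Suc n) \<rho> = distr (distr \<rho> (M \<Otimes>\<^sub>M M) (map_prod (T ^^ n) (T ^^ n))) (M \<Otimes>\<^sub>M M) (map_prod T T)"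
  by (simp add: Suc) (simp add: lens_def)
 also have "... = distr \<rho> (M \<Otimes>\<^sub>M M) (map_prod T T \<circ> map_prod (T ^^ n) (T ^^ n))"
  by (rule distr_distr[OF map_prod_measurable[OF aut_measurable[OF T]] m])
 also have "map_prod T T \<circ> map_prod (T ^^ n) (T ^^ n) = map_prod (T ^^ Suc n) (T ^^ Suc n)"
  by (simp add: map_prod_compose)
 finally show ?case .
qed

lemma periodic_pts_eq_Jinf: "T \<in> aut M ==> periodic_pts M T = Jinf M T"
 by (auto simp: periodic_pts_def Jinf_def J2_def lens_funpow C2_sets)

lemma C2_space: "\<rho> \<in> C2 M ==> space \<rho> = UNIV"
 using sets_eq_imp_space_eq[OF C2_sets[of \<rho> M]] by simp

lemma J2_measure:
 assumes T: "T \<in> aut M" and \<rho>: "\<rho> \<in> C2 M" and AB: "A \<in> sets M" "B \<in> sets M"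
 shows "measure (distr \<rho> (M \<Otimes>\<^sub>M M) (map_prod T T)) (A \<times> B) = measure \<rho> (T -` A \<times> T -` B)"
proof -
 have "map_prod T T -` (A \<times> B) \<inter> space \<rho> = T -` A \<times> T -` B"
  using \<rho> by (auto simp: C2_space)
 then show ?thesis
  using map_prod_measurable'[OF C2_sets[OF \<rho>] aut_measurable[OF T]] AB by (simp add: measure_distr)
qed

lemma J2_iff:
 assumes T: "T \<in> aut M"
 shows "\<rho> \<in> J2 M T \<longleftrightarrow> \<rho> \<in> C2 M & (\<forall>A\<in>sets M. \<forall>B\<in>sets M. measure \<rho> (T -` A \<times> T -` B) = measure \<rho> (A \<times> B))"
proof safe
 assume "\<rho> \<in> J2 M T"
 then show "\<rho> \<in> C2 M" by (simp add: J2_def)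
 fix A B assume "A \<in> sets M" "B \<in> sets M"
 with \<open>\<rho> \<in> J2 M T\<close> show "measure \<rho> (T -` A \<times> T -` B) = measure \<rho> (A \<times> B)"
  using J2_measure[OF T, of \<rho> A B] by (simp add: J2_def)
next
 assume \<rho>: "\<rho> \<in> C2 M" and eq: "\<forall>A\<in>sets M. \<forall>B\<in>sets M. measure \<rho> (T -` A \<times> T -` B) = measure \<rho> (A \<times> B)"
 interpret \<rho>: prob_space \<rho> using \<rho> by (rule C2_prob_space)
 have "distr \<rho> (M \<Otimes>\<^sub>M M) (map_prod T T) = \<rho>"
 proof (rule coupling_eqI)
  show "prob_space (distr \<rho> (M \<Otimes>\<^sub>M M) (map_prod T T))"
   by (rule \<rho>.prob_space_distr[OF map_prod_measurable'[OF C2_sets[OF \<rho>] aut_measurable[OF T]]])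
 qed (use \<rho> eq in \<open>auto simp: J2_measure[OF T] C2_sets \<rho>.prob_space_axioms\<close>)
 with \<rho> show "\<rho> \<in> J2 M T" by (simp add: J2_def)
qed

text \<open>Failure of invariance shows in two rectangles of different mass, and the mass of a fixed
  rectangle is continuous by the very definition of the topology.\<close>

lemma closedin_J2:
 assumes T: "T \<in> aut M"
 shows "closedin (C2_top M) (J2 M T)"
 unfolding closedin_def topspace_C2_top
proof
 show "J2 M T <= C2 M" by (auto simp: J2_def)
 show "openin (C2_top M) (C2 M - J2 M T)"
 proof (subst openin_subopen, intro ballI)
  fix \<rho> assume "\<rho> \<in> C2 M - J2 M T"
  then obtain A B where \<rho>: "\<rho> \<in> C2 M" and AB: "A \<in> sets M" "B \<in> sets M"
   and ne: "measure \<rho> (T -` A \<times> T -` B) ~= measure \<rho> (A \<times> B)"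
   using J2_iff[OF T] by auto
  have TAB: "T -` A \<in> sets M" "T -` B \<in> sets M"
   using measurable_sets[OF aut_measurable[OF T]] AB by auto
  obtain U V where UV: "open U" "open V" "measure \<rho> (T -` A \<times> T -` B) \<in> U" "measure \<rho> (A \<times> B) \<in> V" "U \<inter> V = {}"
   using hausdorff[OF ne] by blast
  let ?O = "{\<sigma> \<in> C2 M. measure \<sigma> (T -` A \<times> T -` B) \<in> U} \<inter> {\<sigma> \<in> C2 M. measure \<sigma> (A \<times> B) \<in> V}"
  have "openin (C2_top M) ?O"
   using UV AB TAB by (intro openin_Int openin_C2_top_rectangle)
  moreover have "\<rho> \<in> ?O" using \<rho> UV by simp
  moreover have "?O <= C2 M - J2 M T"
  proof
   fix \<sigma> assume \<sigma>: "\<sigma> \<in> ?O"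
   have "\<sigma> \<notin> J2 M T"
   proof
    assume "\<sigma> \<in> J2 M T"
    then have "measure \<sigma> (T -` A \<times> T -` B) = measure \<sigma> (A \<times> B)"
     using J2_iff[OF T] AB by blast
    with \<sigma> UV(5) show False by auto
   qed
   with \<sigma> show "\<sigma> \<in> C2 M - J2 M T" by auto
  qed
  ultimately show "EX O'. openin (C2_top M) O' & \<rho> \<in> O' & O' <= C2 M - J2 M T" by blast
 qed
qed

definition mix :: "real => ('a \<times> 'a) measure => ('a \<times> 'a) measure => ('a \<times> 'a) measure" where
 "mix t \<rho> \<sigma> = measure_of UNIV (sets (M \<Otimes>\<^sub>M M)) (%A. ennreal (1 - t) * emeasure \<rho> A + ennreal t * emeasure \<sigma> A)"

lemma sets_mix: "sets (mix t \<rho> \<sigma>) = sets (M \<Otimes>\<^sub>M M)"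
 unfolding mix_def using sets.space_closed[of "M \<Otimes>\<^sub>M M"] sets.sigma_sets_eq[of "M \<Otimes>\<^sub>M M"] by simp

lemma emeasure_mix:
 assumes "sets \<rho> = sets (M \<Otimes>\<^sub>M M)" "sets \<sigma> = sets (M \<Otimes>\<^sub>M M)" and A: "A \<in> sets (M \<Otimes>\<^sub>M M)"
 shows "emeasure (mix t \<rho> \<sigma>) A = ennreal (1 - t) * emeasure \<rho> A + ennreal t * emeasure \<sigma> A"
proof (rule emeasure_measure_of[OF mix_def[THEN eq_reflection, THEN meta_eq_to_obj_eq]])
 show "positive (sets (mix t \<rho> \<sigma>)) (%A. ennreal (1 - t) * emeasure \<rho> A + ennreal t * emeasure \<sigma> A)"
  by (simp add: positive_def)
 show "countably_additive (sets (mix t \<rho> \<sigma>)) (%A. ennreal (1 - t) * emeasure \<rho> A + ennreal t * emeasure \<sigma> A)"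
  unfolding countably_additive_def sets_mix
 proof (intro allI impI)
  fix E :: "nat => ('a \<times> 'a) set" assume E: "range E <= sets (M \<Otimes>\<^sub>M M)" "disjoint_family E"
  have "(\<Sum>i. ennreal (1 - t) * emeasure \<rho> (E i) + ennreal t * emeasure \<sigma> (E i))
   = ennreal (1 - t) * (\<Sum>i. emeasure \<rho> (E i)) + ennreal t * (\<Sum>i. emeasure \<sigma> (E i))"
   by (subst suminf_add[symmetric]) (auto simp: ennreal_suminf_cmult)
  also have "(\<Sum>i. emeasure \<rho> (E i)) = emeasure \<rho> (\<Union> (range E))"
   using E assms by (intro suminf_emeasure) auto
  also have "(\<Sum>i. emeasure \<sigma> (E i)) = emeasure \<sigma> (\<Union> (range E))"
   using E assms by (intro suminf_emeasure) auto
  finally show "(\<Sum>i. ennreal (1 - t) * emeasure \<rho> (E i) + ennreal t * emeasure \<sigma> (E i))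
   = ennreal (1 - t) * emeasure \<rho> (\<Union> (range E)) + ennreal t * emeasure \<sigma> (\<Union> (range E))" .
 qed
qed (use A in \<open>auto simp: sets_mix\<close>)

lemma measure_mix:
 assumes "prob_space \<rho>" "prob_space \<sigma>" "sets \<rho> = sets (M \<Otimes>\<^sub>M M)" "sets \<sigma> = sets (M \<Otimes>\<^sub>M M)"
  and A: "A \<in> sets (M \<Otimes>\<^sub>M M)" and t: "0 <= t" "t <= 1"
 shows "measure (mix t \<rho> \<sigma>) A = (1 - t) * measure \<rho> A + t * measure \<sigma> A"
  "emeasure (mix t \<rho> \<sigma>) A = ennreal ((1 - t) * measure \<rho> A + t * measure \<sigma> A)"
proof -
 interpret \<rho>: prob_space \<rho> by fact
 interpret \<sigma>: prob_space \<sigma> by fact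
 show e: "emeasure (mix t \<rho> \<sigma>) A = ennreal ((1 - t) * measure \<rho> A + t * measure \<sigma> A)"
  using emeasure_mix[OF assms(3,4) A, of t] t
  by (simp add: \<rho>.emeasure_eq_measure \<sigma>.emeasure_eq_measure ennreal_mult ennreal_plus)
 then show "measure (mix t \<rho> \<sigma>) A = (1 - t) * measure \<rho> A + t * measure \<sigma> A"
  using t by (intro measure_eq_emeasure_eq_ennreal) auto
qed

text \<open>Only the mixture is asked to have the right marginals:
  \<open>non_invariant_coupling\<close> mixes two product measures that are not couplings
  themselves.\<close>

lemma mix_C2I:
 assumes "prob_space \<rho>" "prob_space \<sigma>" "sets \<rho> = sets (M \<Otimes>\<^sub>M M)" "sets \<sigma> = sets (M \<Otimes>\<^sub>M M)"
  and t: "0 <= t" "t <= 1"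
  and marg: "!!A. A \<in> sets M ==> (1 - t) * measure \<rho> (A \<times> UNIV) + t * measure \<sigma> (A \<times> UNIV) = prob A"
   "!!A. A \<in> sets M ==> (1 - t) * measure \<rho> (UNIV \<times> A) + t * measure \<sigma> (UNIV \<times> A) = prob A"
 shows "mix t \<rho> \<sigma> \<in> C2 M"
proof -
 interpret \<rho>: prob_space \<rho> by fact
 interpret \<sigma>: prob_space \<sigma> by fact
 let ?m = "mix t \<rho> \<sigma>"
 note mm = measure_mix[OF assms(1-4) _ t]
 have sp: "space ?m = UNIV" "space \<rho> = UNIV" "space \<sigma> = UNIV"
  using sets_eq_imp_space_eq[OF sets_mix] sets_eq_imp_space_eq[OF assms(3)] sets_eq_imp_space_eq[OF assms(4)] by simp_all
 have "emeasure ?m (space ?m) = 1"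
  using mm(2)[of UNIV] \<rho>.prob_space \<sigma>.prob_space sets.top[of "M \<Otimes>\<^sub>M M"] sp by simp
 then have p: "prob_space ?m" by (rule prob_spaceI)
 have mf: "fst \<in> ?m \<rightarrow>\<^sub>M M" "snd \<in> ?m \<rightarrow>\<^sub>M M"
  unfolding measurable_cong_sets[OF sets_mix refl] by simp_all
 have "distr ?m M fst = M" "distr ?m M snd = M"
 proof (rule_tac [!] measure_eqI)
  fix A assume "A \<in> sets (distr ?m M fst)"
  then have A: "A \<in> sets M" by simp
  have "fst -` A \<inter> space ?m = A \<times> UNIV" by (auto simp: sp)
  then show "emeasure (distr ?m M fst) A = emeasure M A"
   using A mf mm(2)[of "A \<times> UNIV"] marg(1)[OF A] by (simp add: emeasure_distr emeasure_eq_measure)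
 next
  fix A assume "A \<in> sets (distr ?m M snd)"
  then have A: "A \<in> sets M" by simp
  have "snd -` A \<inter> space ?m = UNIV \<times> A" by (auto simp: sp)
  then show "emeasure (distr ?m M snd) A = emeasure M A"
   using A mf mm(2)[of "UNIV \<times> A"] marg(2)[OF A] by (simp add: emeasure_distr emeasure_eq_measure)
 qed simp_all
 with p show ?thesis by (simp add: C2_def sets_mix)
qed

lemma C2_marginals:
 assumes \<rho>: "\<rho> \<in> C2 M" and A: "A \<in> sets M"
 shows "measure \<rho> (A \<times> UNIV) = prob A" "measure \<rho> (UNIV \<times> A) = prob A"
proof -
 have m: "fst \<in> \<rho> \<rightarrow>\<^sub>M M" "snd \<in> \<rho> \<rightarrow>\<^sub>M M"
  unfolding measurable_cong_sets[OF C2_sets[OF \<rho>] refl] by simp_all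
 have "fst -` A \<inter> space \<rho> = A \<times> UNIV" "snd -` A \<inter> space \<rho> = UNIV \<times> A"
  by (auto simp: C2_space[OF \<rho>])
 then show "measure \<rho> (A \<times> UNIV) = prob A" "measure \<rho> (UNIV \<times> A) = prob A"
  using measure_distr[OF m(1) A] measure_distr[OF m(2) A] by (simp_all add: C2_fst[OF \<rho>] C2_snd[OF \<rho>])
qed

lemma mix_C2: "\<rho> \<in> C2 M ==> \<sigma> \<in> C2 M ==> 0 <= t ==> t <= 1 ==> mix t \<rho> \<sigma> \<in> C2 M"
 by (rule mix_C2I) (auto simp: C2_prob_space C2_sets C2_marginals algebra_simps)

text \<open>The coupling which is the product of \<open>\<mu>\<close> conditioned on \<open>A\<close>, respectively on its complement.\<close>

lemma non_invariant_coupling: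
 assumes T: "T \<in> aut M" and A: "A \<in> sets M" "0 < prob A" "prob A < 1/2" "prob (T -` A - A) > 0"
 shows "\<exists>\<sigma>\<in>C2 M. \<sigma> \<notin> J2 M T"
proof -
 define p where "p = prob A"
 have p: "0 < p" "p < 1/2" using A by (simp_all add: p_def)
 have Ac: "UNIV - A \<in> sets M" "prob (UNIV - A) = 1 - p"
  using A prob_compl[of A] by (auto simp: p_def)
 let ?N = "uniform_measure M A" and ?N' = "uniform_measure M (UNIV - A)"
 have pr: "prob_space ?N" "prob_space ?N'"
  using A Ac p by (auto intro!: prob_space_uniform_measure simp: emeasure_eq_measure p_def)
 interpret N: prob_space ?N by (rule pr)
 interpret N': prob_space ?N' by (rule pr)
 interpret NN: pair_prob_space ?N ?N ..
 interpret NN': pair_prob_space ?N' ?N' ..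
 have mN: "measure ?N C = prob (A \<inter> C) / p" "measure ?N' C = prob ((UNIV - A) \<inter> C) / (1 - p)" if "C \<in> sets M" for C
  using that A Ac p by (auto simp: measure_uniform_measure emeasure_eq_measure p_def)
 have sets_N: "sets (?N \<Otimes>\<^sub>M ?N) = sets (M \<Otimes>\<^sub>M M)" "sets (?N' \<Otimes>\<^sub>M ?N') = sets (M \<Otimes>\<^sub>M M)"
  by (auto intro!: sets_pair_measure_cong)
 have rect: "measure (?N \<Otimes>\<^sub>M ?N) (C \<times> D) = measure ?N C * measure ?N D"
  "measure (?N' \<Otimes>\<^sub>M ?N') (C \<times> D) = measure ?N' C * measure ?N' D" if "C \<in> sets M" "D \<in> sets M" for C D
  using that by (simp_all add: measure_def N.emeasure_pair_measure_Times N'.emeasure_pair_measure_Times enn2real_mult)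
 \<comment> \<open>\<open>mix\<close> puts its parameter on the second measure, so the product over
   \<open>A\<close> gets weight \<open>p\<close> and the marginals recombine to
   \<open>M\<close>.\<close>
 define \<sigma> where "\<sigma> = mix (1 - p) (?N \<Otimes>\<^sub>M ?N) (?N' \<Otimes>\<^sub>M ?N')"
 have m\<sigma>: "measure \<sigma> (C \<times> D) = p * (measure ?N C * measure ?N D) + (1 - p) * (measure ?N' C * measure ?N' D)"
  if "C \<in> sets M" "D \<in> sets M" for C D
  unfolding \<sigma>_def using that p
  by (subst measure_mix[OF NN.prob_space_axioms NN'.prob_space_axioms sets_N]) (auto simp: rect)
 have UNIV1: "measure ?N UNIV = 1" "measure ?N' UNIV = 1"
  using N.prob_space N'.prob_space by auto
 have split: "prob (A \<inter> C) + prob ((UNIV - A) \<inter> C) = prob C" if "C \<in> sets M" for C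
 proof -
  have "prob ((A \<inter> C) \<union> ((UNIV - A) \<inter> C)) = prob (A \<inter> C) + prob ((UNIV - A) \<inter> C)"
   using that A by (intro finite_measure_Union) auto
  moreover have "(A \<inter> C) \<union> ((UNIV - A) \<inter> C) = C" by auto
  ultimately show ?thesis by simp
 qed
 have "\<sigma> \<in> C2 M"
  unfolding \<sigma>_def
 proof (rule mix_C2I[OF NN.prob_space_axioms NN'.prob_space_axioms sets_N])
  fix C assume C: "C \<in> sets M"
  have UNIVM: "UNIV \<in> sets M" by simp
  show "(1 - (1 - p)) * measure (?N \<Otimes>\<^sub>M ?N) (C \<times> UNIV) + (1 - p) * measure (?N' \<Otimes>\<^sub>M ?N') (C \<times> UNIV) = prob C"
   "(1 - (1 - p)) * measure (?N \<Otimes>\<^sub>M ?N) (UNIV \<times> C) + (1 - p) * measure (?N' \<Otimes>\<^sub>M ?N') (UNIV \<times> C) = prob C"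
   using p split[OF C] by (simp_all add: rect[OF C UNIVM] rect[OF UNIVM C] UNIV1 mN[OF C])
 qed (use p in auto)
 moreover have "\<sigma> \<notin> J2 M T"
 proof
  assume "\<sigma> \<in> J2 M T"
  then have "measure \<sigma> (T -` A \<times> T -` (UNIV - A)) = measure \<sigma> (A \<times> (UNIV - A))"
   using J2_iff[OF T] A Ac by blast
  moreover have TA: "T -` A \<in> sets M" "T -` (UNIV - A) \<in> sets M"
   using measurable_sets[OF aut_measurable[OF T]] A Ac by auto
  moreover have "measure ?N (UNIV - A) = 0" "measure ?N' A = 0"
  proof -
   have "A \<inter> (UNIV - A) = {}" "(UNIV - A) \<inter> A = {}" by auto
   then show "measure ?N (UNIV - A) = 0" "measure ?N' A = 0"
    using mN(1)[OF Ac(1)] mN(2)[OF A(1)] by simp_all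
  qed
  ultimately have "p * (measure ?N (T -` A) * measure ?N (T -` (UNIV - A)))
    + (1 - p) * (measure ?N' (T -` A) * measure ?N' (T -` (UNIV - A))) = 0"
   using A Ac by (simp add: m\<sigma>)
  moreover have "0 <= p * (measure ?N (T -` A) * measure ?N (T -` (UNIV - A)))" using p by simp
  \<comment> \<open>The rectangle of \<open>A\<close> with its complement is null, but its preimage
    is charged by the product over the complement: part of the preimage of \<open>A\<close> lies
    outside \<open>A\<close>, and as \<open>A\<close> has measure below 1/2, it cannot cover the
    space together with its preimage.\<close>
  moreover have "(1 - p) * (measure ?N' (T -` A) * measure ?N' (T -` (UNIV - A))) > 0"
  proof -
   have "(UNIV - A) \<inter> T -` A = T -` A - A" by auto
   then have 1: "measure ?N' (T -` A) > 0" using A p by (simp add: mN[OF TA(1)])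
   have pT: "prob (T -` A) = p" using aut_measure_vimage[OF T A(1)] by (simp add: p_def)
   have "prob (A \<union> T -` A) <= p + p"
    using measure_Un_le[OF A(1) TA(1)] pT by (simp add: p_def)
   moreover have "prob (UNIV - (A \<union> T -` A)) = 1 - prob (A \<union> T -` A)"
    using prob_compl[of "A \<union> T -` A"] A TA by simp
   moreover have "(UNIV - A) \<inter> T -` (UNIV - A) = UNIV - (A \<union> T -` A)" by auto
   ultimately have "prob ((UNIV - A) \<inter> T -` (UNIV - A)) > 0" using p by simp
   then have "measure ?N' (T -` (UNIV - A)) > 0" using p by (simp add: mN[OF TA(2)])
   with 1 p show ?thesis by simp
  qed
  ultimately show False by linarith
 qed
 ultimately show ?thesis by blast
qed

text \<open>Couplings form a convex set and invariance is an affine condition. From an interior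
  point the segment towards \<open>\<sigma>\<close> would stay in \<open>J2\<close> for a while,
  which forces \<open>\<sigma>\<close> itself to be invariant.\<close>

lemma nowhere_dense_J2:
 assumes T: "T \<in> aut M" and \<sigma>: "\<sigma> \<in> C2 M" "\<sigma> \<notin> J2 M T"
 shows "(C2_top M) interior_of (J2 M T) = {}"
proof (rule ccontr)
 assume "(C2_top M) interior_of (J2 M T) ~= {}"
 then obtain W \<rho> where W: "openin (C2_top M) W" "W <= J2 M T" "\<rho> \<in> W"
  unfolding interior_of_def by blast
 then have \<rho>: "\<rho> \<in> C2 M" "\<rho> \<in> J2 M T" using openin_subset topspace_C2_top by (blast, blast)
 note mm = measure_mix(1)[OF C2_prob_space[OF \<rho>(1)] C2_prob_space[OF \<sigma>(1)] C2_sets[OF \<rho>(1)] C2_sets[OF \<sigma>(1)]]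
 have "continuous_map (top_of_set {0..1}) (C2_top M) (%t. mix t \<rho> \<sigma>)"
  unfolding C2_top_def
 proof (rule continuous_on_generated_topo)
  fix O' assume "O' \<in> insert (C2 M) {{\<sigma> \<in> C2 M. measure \<sigma> (A \<times> B) \<in> U} |A B U. A \<in> sets M & B \<in> sets M & open U}"
  then consider "O' = C2 M" | A B U where "O' = {\<sigma> \<in> C2 M. measure \<sigma> (A \<times> B) \<in> U}" "A \<in> sets M" "B \<in> sets M" "open U"
   by blast
  then show "openin (top_of_set {0..1}) ((%t. mix t \<rho> \<sigma>) -` O' \<inter> topspace (top_of_set {0..1}))"
  proof cases
   case 1
   then have "(%t. mix t \<rho> \<sigma>) -` O' \<inter> topspace (top_of_set {0..1}) = {0..1}"
    using mix_C2[OF \<rho>(1) \<sigma>(1)] by auto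
   then show ?thesis by simp
  next
   case 2
   have cont: "continuous_on {0..1} (%t. (1 - t) * measure \<rho> (A \<times> B) + t * measure \<sigma> (A \<times> B))"
    by (intro continuous_intros)
   have "(%t. mix t \<rho> \<sigma>) -` O' \<inter> topspace (top_of_set {0..1})
     = {0..1} \<inter> (%t. (1 - t) * measure \<rho> (A \<times> B) + t * measure \<sigma> (A \<times> B)) -` U"
    using 2 mix_C2[OF \<rho>(1) \<sigma>(1)] mm[of "A \<times> B"] by (auto simp: pair_measureI)
   then show ?thesis
    using continuous_openin_preimage_gen[OF cont \<open>open U\<close>] by simp
  qed
 qed (use mix_C2[OF \<rho>(1) \<sigma>(1)] in auto)
 then have op: "openin (top_of_set {0..1}) {t \<in> {0..1}. mix t \<rho> \<sigma> \<in> W}"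
  using openin_continuous_map_preimage[OF _ W(1)] by fastforce
 have mix0: "mix 0 \<rho> \<sigma> = \<rho>"
  using C2_prob_space[OF mix_C2[OF \<rho>(1) \<sigma>(1), of 0]] C2_prob_space[OF \<rho>(1)] mm[of _ 0]
  by (intro coupling_eqI[of _ M]) (auto simp: sets_mix C2_sets[OF \<rho>(1)] pair_measureI)
 obtain e where e: "e > 0" "!!t. t \<in> {0..1} ==> dist t 0 < e ==> mix t \<rho> \<sigma> \<in> W"
  using op mix0 W(3) unfolding openin_euclidean_subtopology_iff by force
 define t where "t = min (e / 2) 1"
 have t: "0 < t" "t <= 1" "t < e" using e by (auto simp: t_def)
 then have "mix t \<rho> \<sigma> \<in> J2 M T"
  using e(2)[of t] W(2) by auto
 then have inv: "measure (mix t \<rho> \<sigma>) (T -` A \<times> T -` B) = measure (mix t \<rho> \<sigma>) (A \<times> B)" if "A \<in> sets M" "B \<in> sets M" for A B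
  using J2_iff[OF T] that by blast
 have "measure \<sigma> (T -` A \<times> T -` B) = measure \<sigma> (A \<times> B)" if AB: "A \<in> sets M" "B \<in> sets M" for A B
 proof -
  have TAB: "T -` A \<in> sets M" "T -` B \<in> sets M"
   using measurable_sets[OF aut_measurable[OF T]] AB by auto
  have "measure \<rho> (T -` A \<times> T -` B) = measure \<rho> (A \<times> B)"
   using \<rho>(2) J2_iff[OF T] AB by blast
  with inv[OF AB] mm[OF pair_measureI[OF TAB], of t] mm[OF pair_measureI[OF AB], of t] t show ?thesis by simp
 qed
 then have "\<sigma> \<in> J2 M T" using \<sigma>(1) J2_iff[OF T] by blast
 with \<sigma>(2) show False by blast
qed

end

context coordinates
begin

lemma vec_rep: "EX f. sq f & vec f = v"
 using vec_surj by metis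

text \<open>The Markov operator of a coupling, as a sesquilinear form.\<close>

lemma coupling_form:
 assumes \<rho>: "\<rho> \<in> C2 M"
 obtains \<beta> where "sesquilinear \<beta>"
  "!!f g. sq f ==> sq g ==> \<beta> (vec f) (vec g) = (\<integral>p. f (fst p) * cnj (g (snd p)) \<partial>\<rho>)"
proof -
 interpret \<rho>: prob_space \<rho> using \<rho> by (rule C2_prob_space)
 have [measurable_cong]: "sets \<rho> = sets (M \<Otimes>\<^sub>M M)" by (rule C2_sets[OF \<rho>])
 have m [measurable]: "fst \<in> \<rho> \<rightarrow>\<^sub>M M" "snd \<in> \<rho> \<rightarrow>\<^sub>M M"
  unfolding measurable_cong_sets[OF C2_sets[OF \<rho>] refl] by simp_all
 have sqf: "square_integrable \<rho> (%p. f (fst p))" "square_integrable \<rho> (%p. f (snd p))"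
  and nf: "(\<integral>p. (cmod (f (fst p)))\<^sup>2 \<partial>\<rho>) = (norm (vec f))\<^sup>2" "(\<integral>p. (cmod (f (snd p)))\<^sup>2 \<partial>\<rho>) = (norm (vec f))\<^sup>2" if f: "sq f" for f
 proof -
  have fm [measurable]: "f \<in> borel_measurable M" using f by (rule square_integrable_measurable)
  have i: "integrable (distr \<rho> M fst) (%x. (cmod (f x))\<^sup>2)" "integrable (distr \<rho> M snd) (%x. (cmod (f x))\<^sup>2)"
   using f unfolding C2_fst[OF \<rho>] C2_snd[OF \<rho>] by (simp_all add: square_integrable_def)
  show "square_integrable \<rho> (%p. f (fst p))" "square_integrable \<rho> (%p. f (snd p))"
   unfolding square_integrable_def
   using integrable_distr[OF m(1) i(1)] integrable_distr[OF m(2) i(2)] measurable_compose[OF m(1) fm] measurable_compose[OF m(2) fm] by auto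
  have nm: "(%x. (cmod (f x))\<^sup>2) \<in> borel_measurable M" by measurable
  show "(\<integral>p. (cmod (f (fst p)))\<^sup>2 \<partial>\<rho>) = (norm (vec f))\<^sup>2" "(\<integral>p. (cmod (f (snd p)))\<^sup>2 \<partial>\<rho>) = (norm (vec f))\<^sup>2"
   using integral_distr[OF m(1) nm] integral_distr[OF m(2) nm] norm_vec[OF f] C2_fst[OF \<rho>] C2_snd[OF \<rho>] by simp_all
 qed
 \<comment> \<open>Representatives are chosen once; \<open>\<beta>_vec\<close> shows that the choice
   does not matter, because both marginals are \<open>M\<close> and so null sets pull back to null
   sets.\<close>
 define r where "r v = (SOME f. sq f & vec f = v)" for v
 have r: "sq (r v)" "vec (r v) = v" for v
  using someI_ex[OF vec_rep[of v]] by (simp_all add: r_def)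
 define \<beta> where "\<beta> v w = (\<integral>p. r v (fst p) * cnj (r w (snd p)) \<partial>\<rho>)" for v w
 have \<beta>_vec: "\<beta> (vec f) (vec g) = (\<integral>p. f (fst p) * cnj (g (snd p)) \<partial>\<rho>)" if f: "sq f" and g: "sq g" for f g
  unfolding \<beta>_def
 proof (rule integral_cong_AE)
  have "AE x in M. r (vec f) x = f x" "AE x in M. r (vec g) x = g x"
   using f g r by (auto intro!: vec_eq_imp_AE)
  then have "AE x in distr \<rho> M fst. r (vec f) x = f x" "AE x in distr \<rho> M snd. r (vec g) x = g x"
   by (simp_all only: C2_fst[OF \<rho>] C2_snd[OF \<rho>])
  then have "AE p in \<rho>. r (vec f) (fst p) = f (fst p)" "AE p in \<rho>. r (vec g) (snd p) = g (snd p)"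
   using AE_distrD[OF m(1)] AE_distrD[OF m(2)] by blast+
  then show "AE p in \<rho>. r (vec f) (fst p) * cnj (r (vec g) (snd p)) = f (fst p) * cnj (g (snd p))"
   by eventually_elim simp
  show "(%p. r (vec f) (fst p) * cnj (r (vec g) (snd p))) \<in> borel_measurable \<rho>"
   "(%p. f (fst p) * cnj (g (snd p))) \<in> borel_measurable \<rho>"
   using square_integrable_prod[OF sqf(1) sqf(2)] r(1) f g by (auto intro: borel_measurable_integrable)
 qed
 have add_l: "\<beta> (u + v) w = \<beta> u w + \<beta> v w" for u v w
 proof -
  have "\<beta> (vec (%x. r u x + r v x)) (vec (r w)) = \<beta> (vec (r u)) (vec (r w)) + \<beta> (vec (r v)) (vec (r w))"
   unfolding \<beta>_vec[OF square_integrable_add[OF r(1) r(1)] r(1)] \<beta>_vec[OF r(1) r(1)]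
   by (subst Bochner_Integration.integral_add[symmetric])
    (auto simp: distrib_right intro!: square_integrable_prod sqf r)
  then show ?thesis by (simp add: vec_add[OF r(1) r(1)] r)
 qed
 have add_r: "\<beta> u (v + w) = \<beta> u v + \<beta> u w" for u v w
 proof -
  have "\<beta> (vec (r u)) (vec (%x. r v x + r w x)) = \<beta> (vec (r u)) (vec (r v)) + \<beta> (vec (r u)) (vec (r w))"
   unfolding \<beta>_vec[OF r(1) square_integrable_add[OF r(1) r(1)]] \<beta>_vec[OF r(1) r(1)]
   by (subst Bochner_Integration.integral_add[symmetric])
    (auto simp: distrib_left intro!: square_integrable_prod sqf r)
  then show ?thesis by (simp add: vec_add[OF r(1) r(1)] r)
 qed
 have sc_l: "\<beta> (c *\<^sub>C u) w = c * \<beta> u w" for c u w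
 proof -
  have "\<beta> (vec (%x. c * r u x)) (vec (r w)) = c * \<beta> (vec (r u)) (vec (r w))"
   unfolding \<beta>_vec[OF square_integrable_scale[OF r(1)] r(1)] \<beta>_vec[OF r(1) r(1)] by (simp add: mult.assoc)
  then show ?thesis by (simp add: vec_scale[OF r(1)] r)
 qed
 have sc_r: "\<beta> u (c *\<^sub>C w) = cnj c * \<beta> u w" for c u w
 proof -
  have "\<beta> (vec (r u)) (vec (%x. c * r w x)) = cnj c * \<beta> (vec (r u)) (vec (r w))"
   unfolding \<beta>_vec[OF r(1) square_integrable_scale[OF r(1)]] \<beta>_vec[OF r(1) r(1)] by (simp add: mult.left_commute)
  then show ?thesis by (simp add: vec_scale[OF r(1)] r)
 qed
 \<comment> \<open>The elementary bound by half the sum of squares is not homogeneous; normalising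
   both vectors turns it into the product bound.\<close>
 have bound1: "cmod (\<beta> u w) <= ((norm u)\<^sup>2 + (norm w)\<^sup>2) / 2" for u w
 proof -
  have i: "integrable \<rho> (%p. (cmod (r u (fst p)))\<^sup>2)" "integrable \<rho> (%p. (cmod (r w (snd p)))\<^sup>2)"
   using sqf[OF r(1)] by (auto simp: square_integrable_def)
  have "cmod (\<beta> u w) <= (\<integral>p. cmod (r u (fst p) * cnj (r w (snd p))) \<partial>\<rho>)"
   unfolding \<beta>_def by (rule integral_norm_bound)
  also have "... <= (\<integral>p. ((cmod (r u (fst p)))\<^sup>2 + (cmod (r w (snd p)))\<^sup>2) / 2 \<partial>\<rho>)"
  proof (rule integral_mono)
   show "cmod (r u (fst p) * cnj (r w (snd p))) <= ((cmod (r u (fst p)))\<^sup>2 + (cmod (r w (snd p)))\<^sup>2) / 2" for p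
    using sum_squares_bound[of "cmod (r u (fst p))" "cmod (r w (snd p))"] by (simp add: norm_mult)
  qed (use i square_integrable_prod[OF sqf(1)[OF r(1)] sqf(2)[OF r(1)]] in auto)
  also have "... = ((norm u)\<^sup>2 + (norm w)\<^sup>2) / 2"
   using i nf(1)[OF r(1)[of u]] nf(2)[OF r(1)[of w]] by (simp add: r)
  finally show ?thesis .
 qed
 have bound: "cmod (\<beta> u w) <= norm u * norm w * 1" for u w
 proof (cases "u = 0 \<or> w = 0")
  case True
  then show ?thesis using sc_l[of 0 u w] sc_r[of u 0 w] by auto
 next
  case False
  define a b where "a = complex_of_real (1 / norm u)" and "b = complex_of_real (1 / norm w)"
  have "cmod (\<beta> (a *\<^sub>C u) (b *\<^sub>C w)) <= 1"
   using bound1[of "a *\<^sub>C u" "b *\<^sub>C w"] False by (simp add: norm_scaleC a_def b_def norm_divide)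
  then show ?thesis
   using False by (simp add: sc_l sc_r a_def b_def norm_mult norm_divide field_simps)
 qed
 have "sesquilinear \<beta>"
  by (rule sesquilinearI[OF add_l add_r sc_l sc_r bound])
 with \<beta>_vec that show ?thesis by blast
qed

lemma koop_ind: "T \<in> aut M ==> C \<in> sets M ==> koop T (ind C) = ind (T -` C)"
proof -
 assume "T \<in> aut M" "C \<in> sets M"
 moreover have "(%x. indicator C (T x)) = (indicator (T -` C) :: 'a => complex)"
  by (auto simp: fun_eq_iff indicator_def)
 ultimately show ?thesis using koop_vec[OF _ sq_indicator] by metis
qed

text \<open>\<open>form_commute\<close> for the operator of \<open>T ^^ n\<close>: the form of the
  coupling and the form \<open>cip (koop T v) w\<close> are both invariant under it, hence commute,
  and this makes the coupling invariant under \<open>T\<close> itself.\<close>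

lemma J2_power_subset:
 assumes T: "T \<in> aut M" and ss: "simple_spectrum M (T ^^ n)" and \<rho>: "\<rho> \<in> J2 M (T ^^ n)"
 shows "\<rho> \<in> J2 M T"
proof -
 let ?S = "T ^^ n"
 have S: "?S \<in> aut M" by (rule aut_funpow[OF T])
 have \<rho>C: "\<rho> \<in> C2 M" using \<rho> by (simp add: J2_def)
 obtain \<beta> where \<beta>: "sesquilinear \<beta>" and \<beta>_vec: "!!f g. sq f ==> sq g ==> \<beta> (vec f) (vec g) = (\<integral>p. f (fst p) * cnj (g (snd p)) \<partial>\<rho>)"
  using coupling_form[OF \<rho>C] by metis
 obtain F where F: "cyclic (koop ?S) F" using ss simple_spectrum_iff_cyclic[OF S] by blast
 have inv: "\<beta> (koop ?S v) (koop ?S w) = \<beta> v w" for v w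
 proof -
  obtain f where f: "sq f" "vec f = v" by (rule vec_surj)
  obtain g where g: "sq g" "vec g = w" by (rule vec_surj)
  have fg [measurable]: "f \<in> borel_measurable M" "g \<in> borel_measurable M"
   using f g by (auto intro: square_integrable_measurable)
  have "\<beta> (koop ?S (vec f)) (koop ?S (vec g)) = (\<integral>p. f (?S (fst p)) * cnj (g (?S (snd p))) \<partial>\<rho>)"
   using f(1) g(1) by (simp add: koop_vec[OF S] \<beta>_vec sq_aut[OF S])
  also have "... = (\<integral>p. f (fst (map_prod ?S ?S p)) * cnj (g (snd (map_prod ?S ?S p))) \<partial>\<rho>)"
   by (simp add: map_prod_def case_prod_beta)
  also have "... = (\<integral>p. f (fst p) * cnj (g (snd p)) \<partial>distr \<rho> (M \<Otimes>\<^sub>M M) (map_prod ?S ?S))"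
   by (rule integral_distr[symmetric, OF map_prod_measurable'[OF C2_sets[OF \<rho>C] aut_measurable[OF S]]]) measurable
  also have "... = \<beta> (vec f) (vec g)"
   using \<rho> f g by (simp add: J2_def \<beta>_vec[OF f(1) g(1), unfolded f g])
  finally show ?thesis by (simp add: f g)
 qed
 note U = unitary_koop[OF T] and V = unitary_koop[OF S]
 have comm: "koop T (koop ?S v) = koop ?S (koop T v)" for v
  unfolding koop_funpow[OF T, symmetric] by (simp add: funpow_swap1)
 define \<gamma> where "\<gamma> v w = cip (koop T v) w" for v w
 have ident: "cbounded_linear (%x::l2. x)" by (auto simp: cbounded_linear_def bounded_linear_ident)
 have \<gamma>: "sesquilinear \<gamma>"
  unfolding \<gamma>_def[abs_def] by (rule sesquilinear_compose[OF sesquilinear_cip unitary_cbounded_linear[OF U] ident])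
 have main: "\<beta> (koop T v) (koop T w) = \<beta> v w" for v w
 proof -
  \<comment> \<open>The adjoint of \<open>koop T\<close> is its inverse, so taking
    \<open>koop T w\<close> in the second place turns commutation into invariance.\<close>
  have "\<beta> (koop T v) (koop T w) = \<beta> v (koop (inv T) (koop T w))"
  proof (rule form_commute[OF V F \<beta> inv \<gamma>])
   show "\<gamma> (koop ?S x) (koop ?S y) = \<gamma> x y" for x y
    by (simp add: \<gamma>_def comm unitary_cip[OF V])
   show "\<gamma> v z = cip (koop T v) z" for z by (simp add: \<gamma>_def)
   show "\<gamma> z (koop T w) = cip z (koop (inv T) (koop T w))" for z
    by (simp add: \<gamma>_def unitary_cip[OF U] koop_inverse[OF T])
  qed
  then show ?thesis by (simp add: koop_inverse[OF T])
 qed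
 have rect: "\<beta> (ind A) (ind B) = complex_of_real (measure \<rho> (A \<times> B))" if "A \<in> sets M" "B \<in> sets M" for A B
 proof -
  have AB: "A \<times> B \<in> sets \<rho>" using that by (simp add: C2_sets[OF \<rho>C])
  have "\<beta> (ind A) (ind B) = (\<integral>p. complex_of_real (indicator (A \<times> B) p) \<partial>\<rho>)"
   unfolding \<beta>_vec[OF sq_indicator[OF that(1)] sq_indicator[OF that(2)]]
   by (intro Bochner_Integration.integral_cong) (auto simp: indicator_def)
  also have "... = complex_of_real (measure \<rho> (A \<times> B))"
   using AB by (simp only: integral_complex_of_real) (simp add: C2_space[OF \<rho>C])
  finally show ?thesis .
 qed
 have "measure \<rho> (T -` A \<times> T -` B) = measure \<rho> (A \<times> B)" if AB: "A \<in> sets M" "B \<in> sets M" for A B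
 proof -
  have TAB: "T -` A \<in> sets M" "T -` B \<in> sets M"
   using measurable_sets[OF aut_measurable[OF T]] AB by auto
  show ?thesis
   using main[of "ind A" "ind B"] rect[OF AB] rect[OF TAB] AB by (simp add: koop_ind[OF T])
 qed
 then show ?thesis using J2_iff[OF T] \<rho>C by blast
qed

text \<open>If no set of measure below 1/2 moved, the Koopman operator would be the identity. Its
  cyclic spaces are lines, whereas two disjoint sets of measure 1/2 give two independent
  vectors.\<close>

lemma simple_spectrum_moves_set:
 assumes T: "T \<in> aut M" and ss: "simple_spectrum M T"
 shows "\<exists>A\<in>sets M. 0 < prob A & prob A < 1/2 & prob (T -` A - A) > 0"
proof (rule ccontr)
 assume neg: "\<not> ?thesis"
 have small: "prob (T -` A - A) = 0" if "A \<in> sets M" "prob A < 1/2" for A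
 proof (cases "prob A = 0")
  case True
  have "prob (T -` A - A) <= prob (T -` A)"
   using measurable_sets[OF aut_measurable[OF T] that(1)] by (intro finite_measure_mono) auto
  also have "... = 0" using aut_measure_vimage[OF T that(1)] True by simp
  finally show ?thesis using measure_nonneg[of M "T -` A - A"] by linarith
 next
  case False
  then have "0 < prob A" using measure_nonneg[of M A] by linarith
  with neg that have "\<not> prob (T -` A - A) > 0" by blast
  then show ?thesis using measure_nonneg[of M "T -` A - A"] by linarith
 qed
 have fix_small: "koop T (ind A) = ind A" if A: "A \<in> sets M" "prob A < 1/2" for A
 proof -
  have TA: "T -` A \<in> sets M" using measurable_sets[OF aut_measurable[OF T] A(1)] by simp
  have "prob (T -` A \<inter> A) = prob (T -` A) - prob (T -` A - A)"
   using finite_measure_Diff'[OF TA A(1)] by simp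
  also have "... = prob A" using small[OF A] aut_measure_vimage[OF T A(1)] by simp
  finally have "prob (A - T -` A) = 0"
   using TA A by (simp add: finite_measure_Diff' Int_commute)
  then have "prob (symdiff (T -` A) A) = 0"
   using measure_Un_le[of "T -` A - A" M "A - T -` A"] small[OF A] TA A
   by (auto simp: symdiff_def measure_le_0_iff)
  then show ?thesis
   using norm_ind_diff[OF TA A(1)] koop_ind[OF T A(1)] by simp
 qed
 have cell: "prob {x. a <= \<phi> x & \<phi> x < a + 1/4} <= 1/4" for a
  using prob_phi_interval[of a "a + 1/4"] by simp
 have fix_all: "koop T (ind A) = ind A" if A: "A \<in> sets M" for A
 proof -
  \<comment> \<open>Four pieces of measure at most 1/4 bring an arbitrary set below the threshold
    1/2.\<close>
  define P where "P i = A \<inter> {x. real i / 4 <= \<phi> x & \<phi> x < real i / 4 + 1/4}" for i :: nat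
  have P: "P i \<in> sets M" for i using A by (auto simp: P_def)
  have Pi: "koop T (ind (P i)) = ind (P i)" for i
  proof (rule fix_small[OF P])
   have "prob (P i) <= prob {x. real i / 4 <= \<phi> x & \<phi> x < real i / 4 + 1/4}"
    by (intro finite_measure_mono) (auto simp: P_def)
   with cell[of "real i / 4"] show "prob (P i) < 1/2" by simp
  qed
  have disj: "disjoint_family_on P {..<4}"
  proof (unfold disjoint_family_on_def, intro ballI impI)
   fix m n :: nat assume "m ~= n"
   then show "P m \<inter> P n = {}"
    by (cases "m < n") (auto simp: P_def field_simps)
  qed
  have "AE x in M. 0 < \<phi> x & \<phi> x < 1"
  proof -
   have "AE u in distr M borel \<phi>. 0 < u & u < 1" unfolding distr_phi by (rule AE_unif)
   then show ?thesis by (subst (asm) AE_distr_iff) auto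
  qed
  then have "AE x in M. indicator A x = (indicator (\<Union>i<4. P i) x :: complex)"
  proof eventually_elim
   case (elim x)
   define i where "i = nat \<lfloor>4 * \<phi> x\<rfloor>"
   have "i < 4" "real i / 4 <= \<phi> x" "\<phi> x < real i / 4 + 1/4"
    using elim unfolding i_def by linarith+
   then have "x \<in> A \<longleftrightarrow> x \<in> (\<Union>i<4. P i)" by (auto simp: P_def)
   then show ?case by (simp add: indicator_def)
  qed
  then have "ind A = ind (\<Union>i<4. P i)" using A P by (intro vec_cong_AE sq_indicator) auto
  also have "... = (\<Sum>i<4. ind (P i))" using disj P by (intro ind_UN) auto
  finally have eq: "ind A = (\<Sum>i<4. ind (P i))" .
  interpret B: bounded_linear "koop T"
   using unitary_cbounded_linear[OF unitary_koop[OF T]] by (simp add: cbounded_linear_def)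
  show ?thesis unfolding eq by (simp add: B.sum Pi)
 qed
 have id: "koop T v = v" for v
  by (rule cbounded_linear_eq_on_total[OF unitary_cbounded_linear[OF unitary_koop[OF T]] _ indicators_total])
   (use fix_all in \<open>auto simp: cbounded_linear_def bounded_linear_ident\<close>)
 obtain F where F: "cyclic (koop T) F" using ss simple_spectrum_iff_cyclic[OF T] by blast
 have orb: "zpow (koop T) k F = F" for k
 proof (induction k rule: int_induct[where k=0])
  case (step2 i)
  then show ?case by (metis zpow_pred[OF unitary_bij[OF unitary_koop[OF T]]] inv_koop[OF T] koop_inverse(2)[OF T] id)
 next
  case (step1 i)
  then show ?case by (metis zpow_succ[OF unitary_bij[OF unitary_koop[OF T]]] id)
 qed simp
 have perp: "w = 0" if w: "cip F w = 0" for w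
 proof -
  have "w \<in> {v. cip v w = 0}"
  proof (rule total_induct[OF F[unfolded cyclic_def]])
   show "closed {v. cip v w = 0}"
    by (intro closed_Collect_eq continuous_intros cip.continuous_on)
   show "csubspace {v. cip v w = 0}"
    by (intro complex_vs.subspaceI) (auto simp: cip_add_left cip_scaleC_left)
   show "orbit (koop T) F <= {v. cip v w = 0}" using w by (auto simp: orbit_def orb)
  qed
  then show ?thesis by (simp add: cip_self)
 qed
 let ?A = "{x. \<phi> x < 1/2}" and ?B = "{x. \<not> \<phi> x < 1/2}"
 have AB: "?A \<in> sets M" "?B \<in> sets M" by auto
 have probA: "prob ?A = 1/2"
 proof -
  have "prob ?A = measure unif {..<1/2}"
   unfolding distr_phi[symmetric] by (subst measure_distr) (auto intro!: arg_cong[where f=prob])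
  also have "... = measure unif {..1/2}"
  proof -
   have "{..1/2::real} = {..<1/2} \<union> {1/2}" by auto
   moreover have "measure unif ({..<1/2} \<union> {1/2}) = measure unif {..<1/2} + measure unif {1/2}"
    by (intro unif.finite_measure_Union) auto
   moreover have "measure unif {1/2} = 0" by (simp add: measure_def unif_singleton)
   ultimately show ?thesis by simp
  qed
  also have "... = 1/2" by (rule measure_unif_atMost) auto
  finally show ?thesis .
 qed
 have "?B = space M - ?A" by auto
 then have probB: "prob ?B = 1/2" using prob_compl[OF AB(1)] probA by simp
 have orth: "cip (ind ?A) (ind ?B) = 0" "cip (ind ?B) (ind ?A) = 0"
  using AB by (simp_all add: cip_ind Int_def conj_ac)
 \<comment> \<open>The combination of the two halves that is orthogonal to \<open>F\<close>; it has
   to vanish, and with it both coefficients.\<close>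
 define w' where "w' = cnj (cip F (ind ?B)) *\<^sub>C ind ?A - cnj (cip F (ind ?A)) *\<^sub>C ind ?B"
 have "cip F w' = 0" by (simp add: w'_def cip.diff_right cip_scaleC_right mult.commute)
 then have "w' = 0" by (rule perp)
 then have "cip w' (ind ?A) = 0" "cip w' (ind ?B) = 0" by simp_all
 then have "cip F (ind ?A) = 0"
  using AB probA probB orth by (simp_all add: w'_def cip.diff_left cip_scaleC_left cip_ind)
 then have "ind ?A = 0" by (rule perp)
 then have "cip (ind ?A) (ind ?A) = 0" by simp
 then show False using AB probA by (simp add: cip_ind)
qed

lemma simple_powers_consequences:
 assumes T: "T \<in> aut M" and ss: "!!n. n >= 1 ==> simple_spectrum M (T ^^ n)"
 shows "Jinf M T = J2 M T" "closedin (C2_top M) (periodic_pts M T)"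
  "nowhere_dense_in (C2_top M) (periodic_pts M T)" "\<not> P_system M T"
proof -
 show J: "Jinf M T = J2 M T"
 proof
  show "J2 M T <= Jinf M T"
   unfolding Jinf_def by (rule order_trans[OF _ UN_upper[of 1]]) auto
  show "Jinf M T <= J2 M T"
   unfolding Jinf_def using J2_power_subset[OF T ss] by auto
 qed
 then have per: "periodic_pts M T = J2 M T" using periodic_pts_eq_Jinf[OF T] by simp
 show closed: "closedin (C2_top M) (periodic_pts M T)"
  unfolding per by (rule closedin_J2[OF T])
 have "simple_spectrum M T" using ss[of 1] by simp
 from simple_spectrum_moves_set[OF T this]
 obtain A where A: "A \<in> sets M" "0 < prob A" "prob A < 1/2" "prob (T -` A - A) > 0" by blast
 obtain \<sigma> where \<sigma>: "\<sigma> \<in> C2 M" "\<sigma> \<notin> J2 M T"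
  using non_invariant_coupling[OF T A] by blast
 show "nowhere_dense_in (C2_top M) (periodic_pts M T)"
  unfolding nowhere_dense_in_def closure_of_closedin[OF closed] unfolding per
  by (rule nowhere_dense_J2[OF T \<sigma>])
 have "C2_top M closure_of periodic_pts M T ~= topspace (C2_top M)"
  using closure_of_closedin[OF closed] \<sigma> unfolding topspace_C2_top per by auto
 then show "\<not> P_system M T" by (simp add: P_system_def)
qed

end

section \<open>Gaussian systems\<close>

lemma sesquilinear_eq_on_total:
 assumes b: "sesquilinear \<beta>" and g: "sesquilinear \<gamma>" and total: "closure (cspan B) = UNIV"
  and eq: "!!x y. x \<in> B ==> y \<in> B ==> \<beta> x y = \<gamma> x y"
 shows "\<beta> x y = \<gamma> x y"
proof -
 have 1: "\<beta> x y = \<gamma> x y" if "y \<in> B" for x y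
  by (rule cbounded_linear_eq_on_total[OF cbounded_linear_sesquilinear[OF b] cbounded_linear_sesquilinear[OF g] total eq[OF _ that]])
 have "cnj (\<beta> x y) = cnj (\<gamma> x y)"
  by (rule cbounded_linear_eq_on_total[OF cbounded_linear_sesquilinear_cnj[OF b] cbounded_linear_sesquilinear_cnj[OF g] total])
   (simp add: 1)
 then show ?thesis by simp
qed

text \<open>A two-by-two operator matrix as one kernel on pairs: \<open>G\<close> on the diagonal,
  \<open>c\<close> and its adjoint off it, with \<open>False\<close> for the first row. Its
  positivity expresses that \<open>c\<close> is a contraction relative to \<open>G\<close>, in a
  form that is stable under entrywise products.\<close>

definition block :: "('i => 'i => complex) => ('i => 'i => complex) => 'i \<times> bool => 'i \<times> bool => complex" where
 "block G c p q = (if snd p = snd q then G (fst p) (fst q)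
   else if snd q then c (fst p) (fst q) else cnj (c (fst q) (fst p)))"

lemma block_mult: "block G c p q * block G' c' p q = block (%i j. G i j * G' i j) (%i j. c i j * c' i j) p q"
 by (simp add: block_def)

text \<open>The quadratic form of the block is the sum of the squared norms of \<open>X\<close> and
  \<open>Y\<close> and twice the real part of \<open>\<beta> X Y\<close>, which is nonnegative for a
  contractive form.\<close>

lemma block_form_psd:
 fixes e :: "'i => 'a::complex_hilbert"
 assumes b: "sesquilinear \<beta>" and bound: "!!x y. cmod (\<beta> x y) <= norm x * norm y"
 shows "psd UNIV (block (%i j. cip (e i) (e j)) (%i j. \<beta> (e i) (e j)))"
proof (rule psdI)
 show "block (%i j. cip (e i) (e j)) (%i j. \<beta> (e i) (e j)) q p = cnj (block (%i j. cip (e i) (e j)) (%i j. \<beta> (e i) (e j)) p q)" for p q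
  using cip_commute[of "e (fst q)" "e (fst p)"] by (auto simp: block_def)
 interpret b: bounded_bilinear \<beta> using b by (rule sesquilinear_bb)
 fix A :: "('i \<times> bool) set" and a :: "'i \<times> bool => complex" assume "finite A"
 define a0 a1 where "a0 p = (if snd p then 0 else a p)" and "a1 p = (if snd p then a p else 0)" for p
 define X Y where "X = (\<Sum>p\<in>A. a0 p *\<^sub>C e (fst p))" and "Y = (\<Sum>p\<in>A. a1 p *\<^sub>C e (fst p))"
 have 1: "cip Z Z = (\<Sum>p\<in>A. \<Sum>q\<in>A. z p * cnj (z q) * cip (e (fst p)) (e (fst q)))"
  if "Z = (\<Sum>p\<in>A. z p *\<^sub>C e (fst p))" for Z z
  unfolding that cip.sum_left cip.sum_right by (subst sum.swap) (simp add: cip_scaleC_left cip_scaleC_right mult.assoc mult.left_commute)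
 have 2: "\<beta> X Y = (\<Sum>p\<in>A. \<Sum>q\<in>A. a0 p * cnj (a1 q) * \<beta> (e (fst p)) (e (fst q)))"
  unfolding X_def Y_def b.sum_left b.sum_right
  by (subst sum.swap) (simp add: sesquilinear_left[OF b] sesquilinear_right[OF b] mult.assoc mult.left_commute)
 have 3: "cnj (\<beta> X Y) = (\<Sum>p\<in>A. \<Sum>q\<in>A. a1 p * cnj (a0 q) * cnj (\<beta> (e (fst q)) (e (fst p))))"
  unfolding 2 cnj_sum by (subst sum.swap) (simp add: mult.commute)
 have "(\<Sum>p\<in>A. \<Sum>q\<in>A. a p * cnj (a q) * block (%i j. cip (e i) (e j)) (%i j. \<beta> (e i) (e j)) p q)
   = cip X X + cip Y Y + \<beta> X Y + cnj (\<beta> X Y)"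
  by (subst 3, subst 2, subst 1[OF X_def], subst 1[OF Y_def], unfold sum.distrib[symmetric], intro sum.cong refl)
   (auto simp: block_def a0_def a1_def)
 also have "Re ... = (norm X)\<^sup>2 + (norm Y)\<^sup>2 + 2 * Re (\<beta> X Y)"
  by (simp add: cip_self)
 also have "... >= 0"
 proof -
  have "- Re (\<beta> X Y) <= norm X * norm Y"
   using bound[of X Y] abs_Re_le_cmod[of "\<beta> X Y"] by linarith
  then show ?thesis using sum_squares_bound[of "norm X" "norm Y"] by linarith
 qed
 finally show "0 <= Re (\<Sum>p\<in>A. \<Sum>q\<in>A. a p * cnj (a q) * block (%i j. cip (e i) (e j)) (%i j. \<beta> (e i) (e j)) p q)" .
qed

text \<open>Converse to \<open>block_form_psd\<close>: positivity on the vector with parts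
  \<open>s a\<close> and \<open>t b\<close> is a quadratic inequality in \<open>s\<close> and
  \<open>t\<close>, exploited with a suitable phase and with the two norms exchanged as
  weights.\<close>

lemma block_contractive:
 fixes e :: "'i => 'a::complex_hilbert"
 assumes psd: "psd (I \<times> UNIV) (block G c)" and G: "!!i j. i \<in> I ==> j \<in> I ==> G i j = cip (e i) (e j)"
  and A: "finite A" "A <= I"
 shows "cmod (\<Sum>i\<in>A. \<Sum>j\<in>A. a i * cnj (b j) * c i j) <= norm (\<Sum>i\<in>A. a i *\<^sub>C e i) * norm (\<Sum>j\<in>A. b j *\<^sub>C e j)"
proof -
 define S where "S = (\<Sum>i\<in>A. \<Sum>j\<in>A. a i * cnj (b j) * c i j)"
 define x y where "x = (\<Sum>i\<in>A. a i *\<^sub>C e i)" and "y = (\<Sum>j\<in>A. b j *\<^sub>C e j)"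
 have nrm: "(\<Sum>i\<in>A. \<Sum>j\<in>A. z i * cnj (z j) * G i j) = of_real ((norm (\<Sum>i\<in>A. z i *\<^sub>C e i))\<^sup>2)" for z
 proof -
  have "of_real ((norm (\<Sum>i\<in>A. z i *\<^sub>C e i))\<^sup>2) = (\<Sum>i\<in>A. \<Sum>j\<in>A. z i * cnj (z j) * cip (e i) (e j))"
   unfolding cip_self[symmetric] cip.sum_left cip.sum_right
   by (subst sum.swap) (simp add: cip_scaleC_left cip_scaleC_right mult.assoc mult.left_commute)
  also have "... = (\<Sum>i\<in>A. \<Sum>j\<in>A. z i * cnj (z j) * G i j)"
  proof (intro sum.cong refl)
   fix i j assume "i \<in> A" "j \<in> A"
   then have "G i j = cip (e i) (e j)" using A by (intro G) auto
   then show "z i * cnj (z j) * cip (e i) (e j) = z i * cnj (z j) * G i j" by simp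
  qed
  finally show ?thesis ..
 qed
 have pos: "0 <= (cmod s)\<^sup>2 * (norm x)\<^sup>2 + (cmod t)\<^sup>2 * (norm y)\<^sup>2 + 2 * Re (s * cnj t * S)" for s t
 proof -
  define d where "d p = (if snd p then t * b (fst p) else s * a (fst p))" for p
  have split: "(\<Sum>p\<in>A \<times> UNIV. f p) = (\<Sum>i\<in>A. f (i, False)) + (\<Sum>i\<in>A. f (i, True))" for f :: "'i \<times> bool => complex"
   by (simp add: sum.cartesian_product' UNIV_bool sum.distrib add.commute)
  have "0 <= Re (\<Sum>p\<in>A \<times> UNIV. \<Sum>q\<in>A \<times> UNIV. d p * cnj (d q) * block G c p q)"
   using A by (intro psd_pos[OF psd]) auto
  also have "(\<Sum>p\<in>A \<times> UNIV. \<Sum>q\<in>A \<times> UNIV. d p * cnj (d q) * block G c p q)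
   = (\<Sum>i\<in>A. \<Sum>j\<in>A. (s * a i) * cnj (s * a j) * G i j) + (\<Sum>i\<in>A. \<Sum>j\<in>A. (s * a i) * cnj (t * b j) * c i j)
    + ((\<Sum>i\<in>A. \<Sum>j\<in>A. (t * b i) * cnj (s * a j) * cnj (c j i)) + (\<Sum>i\<in>A. \<Sum>j\<in>A. (t * b i) * cnj (t * b j) * G i j))"
   unfolding split by (simp add: block_def d_def sum.distrib)
  also have "(\<Sum>i\<in>A. \<Sum>j\<in>A. (s * a i) * cnj (t * b j) * c i j) = s * cnj t * S"
   unfolding S_def by (simp add: sum_distrib_left mult_ac)
  also have "(\<Sum>i\<in>A. \<Sum>j\<in>A. (t * b i) * cnj (s * a j) * cnj (c j i)) = cnj (s * cnj t * S)"
   unfolding S_def sum_distrib_left cnj_sum by (subst sum.swap) (simp add: mult_ac)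
  also have "(\<Sum>i\<in>A. \<Sum>j\<in>A. (s * a i) * cnj (s * a j) * G i j) = of_real ((cmod s * norm x)\<^sup>2)"
  proof -
   have "(\<Sum>i\<in>A. (s * a i) *\<^sub>C e i) = s *\<^sub>C x"
    by (simp add: x_def complex_vs.scale_sum_right scaleC_scaleC)
   then show ?thesis using nrm[of "%i. s * a i"] by (simp only: norm_scaleC)
  qed
  also have "(\<Sum>i\<in>A. \<Sum>j\<in>A. (t * b i) * cnj (t * b j) * G i j) = of_real ((cmod t * norm y)\<^sup>2)"
  proof -
   have "(\<Sum>i\<in>A. (t * b i) *\<^sub>C e i) = t *\<^sub>C y"
    by (simp add: y_def complex_vs.scale_sum_right scaleC_scaleC)
   then show ?thesis using nrm[of "%i. t * b i"] by (simp only: norm_scaleC)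
  qed
  finally have "0 <= Re (of_real ((cmod s * norm x)\<^sup>2) + s * cnj t * S + (cnj (s * cnj t * S) + of_real ((cmod t * norm y)\<^sup>2)))" .
  moreover have "Re (of_real u + w + (cnj w + of_real v)) = u + v + 2 * Re w" for u v w by simp
  ultimately show ?thesis by (simp only: power_mult_distrib)
 qed
 \<comment> \<open>The added \<open>\<epsilon>\<close> avoids the case of vanishing norms and is
   removed by a limit at the end.\<close>
 have le: "cmod S <= (norm x + \<epsilon>) * (norm y + \<epsilon>)" if \<epsilon>: "\<epsilon> > 0" for \<epsilon>
 proof -
  define X Y where "X = norm x + \<epsilon>" and "Y = norm y + \<epsilon>"
  have XY: "X > 0" "Y > 0" "norm x <= X" "norm y <= Y" using \<epsilon> by (simp_all add: X_def Y_def add_nonneg_pos)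
  \<comment> \<open>The phase makes the cross term equal to minus its modulus; the weights
    \<open>Y\<close> and \<open>X\<close> balance the two squares.\<close>
  define s where "s = - (cnj (sgn S) * of_real Y)"
  have "s * cnj (of_real X) * S = - of_real (X * Y * cmod S)"
  proof -
   have "cnj (sgn S) * S = of_real (cmod S)"
    by (cases "S = 0") (simp_all add: sgn_eq complex_norm_square[symmetric] power2_eq_square mult.commute)
   then show ?thesis by (simp add: s_def mult_ac)
  qed
  moreover have "cmod s <= Y" using XY by (simp add: s_def norm_mult norm_sgn)
  then have "(cmod s)\<^sup>2 * (norm x)\<^sup>2 <= Y\<^sup>2 * X\<^sup>2" using XY by (intro mult_mono power_mono) auto
  moreover have "(cmod (of_real X))\<^sup>2 * (norm y)\<^sup>2 <= X\<^sup>2 * Y\<^sup>2" using XY by (intro mult_mono power_mono) auto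
  ultimately have "2 * (X * Y * cmod S) <= 2 * (X\<^sup>2 * Y\<^sup>2)"
   using pos[of s "of_real X"] by (simp add: mult.commute)
  then have "(X * Y) * cmod S <= (X * Y) * (X * Y)" by (simp add: power2_eq_square mult_ac)
  then show ?thesis using XY by (simp add: X_def[symmetric] Y_def[symmetric])
 qed
 have "((%\<epsilon>. (norm x + \<epsilon>) * (norm y + \<epsilon>)) \<longlongrightarrow> (norm x + 0) * (norm y + 0)) (at_right 0)"
  by (intro tendsto_intros)
 then have "cmod S <= (norm x + 0) * (norm y + 0)"
  by (rule tendsto_lowerbound) (use le in \<open>auto simp: eventually_at_filter\<close>)
 then show ?thesis by (simp add: S_def x_def y_def)
qed

text \<open>Near 0, where \<open>B\<close> does not vanish, the quotient \<open>A / B\<close> is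
  continuous on an interval with values among the n-th roots of unity, hence constantly 1; the
  identity theorem extends the equality to the plane.\<close>

lemma nth_power_identity:
 assumes A: "A holomorphic_on UNIV" and B: "B holomorphic_on UNIV" and n: "n >= 1"
  and eq: "!!t::real. 0 <= t ==> t <= 1 ==> A (of_real t) ^ n = B (of_real t) ^ n"
  and init: "A 0 = B 0" "B 0 ~= 0"
 shows "A z = B z"
proof -
 have contB: "continuous_on UNIV B" and contA: "continuous_on UNIV A"
  using A B holomorphic_on_imp_continuous_on by blast+
 have contB': "continuous_on UNIV (%t::real. B (of_real t))" and contA': "continuous_on UNIV (%t::real. A (of_real t))"
  by (rule continuous_on_compose2[OF contB continuous_on_of_real[OF continuous_on_id]], simp)
   (rule continuous_on_compose2[OF contA continuous_on_of_real[OF continuous_on_id]], simp)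
 have op: "open {t::real. B (of_real t) ~= 0}"
  by (rule open_Collect_neq[OF contB' continuous_on_const])
 have "0 \<in> {t::real. B (of_real t) ~= 0}" using init(2) by simp
 then obtain d where d: "d > 0" "!!t. dist t 0 < d ==> B (complex_of_real t) ~= 0"
  using bspec[OF op[unfolded open_dist]] by blast
 define \<delta> where "\<delta> = min 1 (d / 2)"
 have \<delta>: "0 < \<delta>" "\<delta> <= 1" "\<delta> < d" using d by (auto simp: \<delta>_def)
 have Bne: "B (of_real t) ~= 0" if "t \<in> {0..\<delta>}" for t using d(2)[of t] that \<delta> by auto
 define r where "r t = A (of_real t) / B (of_real t)" for t :: real
 have contr: "continuous_on {0..\<delta>} r"
  unfolding r_def using Bne
  by (intro continuous_on_divide continuous_on_subset[OF contA'] continuous_on_subset[OF contB']) auto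
 have "r t ^ n = 1" if "t \<in> {0..\<delta>}" for t
  using eq[of t] Bne[OF that] that \<delta> by (simp add: r_def power_divide)
 then have "r ` {0..\<delta>} <= {z. z ^ n = 1}" by auto
 then have "finite (r ` {0..\<delta>})"
  using finite_roots_unity[OF n] finite_subset by blast
 then have "r constant_on {0..\<delta>}"
  using continuous_finite_range_constant[OF connected_Icc contr] by simp
 then have "r t = r 0" if "t \<in> {0..\<delta>}" for t
  using that \<delta> unfolding constant_on_def by force
 then have AB: "A (of_real t) - B (of_real t) = 0" if "t \<in> {0..\<delta>}" for t
  using that Bne[OF that] init by (simp add: r_def)
 have "A z - B z = 0"
 proof (rule analytic_continuation[where f="%z. A z - B z" and U="of_real ` {0..\<delta>}" and S=UNIV and \<xi>=0])
  show "(%z. A z - B z) holomorphic_on UNIV" using A B by (intro holomorphic_intros)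
  show "0 islimpt (complex_of_real ` {0..\<delta>})"
   unfolding islimpt_approachable
  proof (intro allI impI)
   fix e :: real assume "e > 0"
   then have "min \<delta> (e / 2) \<in> {0..\<delta>}" "min \<delta> (e / 2) ~= 0" "dist (complex_of_real (min \<delta> (e / 2))) 0 < e"
    using \<delta> by auto
   then show "\<exists>x'\<in>complex_of_real ` {0..\<delta>}. x' ~= 0 & dist x' 0 < e" by force
  qed
 qed (use AB in auto)
 then show ?thesis by simp
qed

section \<open>Moments of Gaussian variables\<close>

lemma gaussian_standardize:
 assumes "prob_space M" and f: "f \<in> borel_measurable M" and \<sigma>: "\<sigma> > 0"
  and d: "distr M borel f = density lborel (normal_density 0 \<sigma>)"
 shows "distr M borel (%x. f x / \<sigma>) = std_normal_distribution"
proof -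
 interpret prob_space M by fact
 have "distr M lborel f = density lborel (normal_density 0 \<sigma>)"
  using d by (simp cong: distr_cong)
 then have "distributed M lborel f (normal_density 0 \<sigma>)"
  using f by (simp add: distributed_def)
 then have "distributed M lborel (%x. (f x - 0) / \<sigma>) std_normal_density"
  using normal_standard_normal_convert[OF \<sigma>, of f 0] by simp
 then have "distr M lborel (%x. f x / \<sigma>) = density lborel std_normal_density"
  by (simp add: distributed_def)
 then show ?thesis by (simp cong: distr_cong)
qed

text \<open>Completing the square: the tilted density is a multiple of a shifted normal
  density.\<close>

lemma std_normal_exp_integrable: "integrable std_normal_distribution (%x. exp (t * x))"
proof -
 have "std_normal_density x * exp (t * x) = exp (t\<^sup>2 / 2) * normal_density t 1 x" for x
  unfolding normal_density_def
  by (simp add: exp_add[symmetric] algebra_simps power2_eq_square) (simp add: field_simps flip: exp_add)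
 then have "integrable lborel (%x. std_normal_density x *\<^sub>R exp (t * x))"
  by (simp add: integrable_normal_density)
 then show ?thesis
  by (subst integrable_density) (auto simp: normal_density_nonneg)
qed

text \<open>The characteristic function is taken at 1 only, since a Gaussian space is closed under
  scaling. The point mass at 0 has no density and is treated apart.\<close>

lemma gaussian_rv_facts:
 assumes "prob_space M" and f: "gaussian_rv M f"
 shows "f \<in> borel_measurable M" "integrable M (%x. (f x)\<^sup>2)"
  "(\<integral>x. exp (\<i> * of_real (f x)) \<partial>M) = exp (of_real (- (\<integral>x. (f x)\<^sup>2 \<partial>M) / 2))"
  "!!s. integrable M (%x. exp (s * \<bar>f x\<bar>))"
proof -
 interpret prob_space M by fact
 show fm [measurable]: "f \<in> borel_measurable M" using f by (simp add: gaussian_rv_def)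
 have "integrable M (%x. (f x)\<^sup>2) & (\<integral>x. exp (\<i> * of_real (f x)) \<partial>M) = exp (of_real (- (\<integral>x. (f x)\<^sup>2 \<partial>M) / 2))
   & (ALL s. integrable M (%x. exp (s * \<bar>f x\<bar>)))"
 proof (cases "distr M borel f = return borel 0")
  case True
  have "AE y in return borel (0::real). y = 0" by (subst AE_return) auto
  then have "AE x in M. f x = 0" unfolding True[symmetric] by (rule AE_distrD[OF fm])
  then have ae: "AE x in M. (f x)\<^sup>2 = 0" "AE x in M. exp (\<i> * of_real (f x)) = 1" "AE x in M. exp (s * \<bar>f x\<bar>) = 1" for s
   by (auto elim: eventually_mono)
  have "integrable M (%x. (f x)\<^sup>2)" "(\<integral>x. (f x)\<^sup>2 \<partial>M) = 0"
   using integrable_cong_AE[OF _ _ ae(1)] integral_cong_AE[OF _ _ ae(1)] by simp_all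
  moreover have "(\<integral>x. exp (\<i> * of_real (f x)) \<partial>M) = 1"
   using integral_cong_AE[OF _ _ ae(2)] by (simp add: prob_space)
  moreover have "integrable M (%x. exp (s * \<bar>f x\<bar>))" for s
   using integrable_cong_AE[OF _ _ ae(3)[of s]] by simp
  ultimately show ?thesis by simp
 next
  case False
  then obtain \<sigma> where \<sigma>: "\<sigma> > 0" "distr M borel f = density lborel (normal_density 0 \<sigma>)"
   using f by (auto simp: gaussian_rv_def)
  define Y where "Y x = f x / \<sigma>" for x
  have Ym [measurable]: "Y \<in> borel_measurable M" unfolding Y_def by measurable
  have Yd: "distr M borel Y = std_normal_distribution"
   unfolding Y_def by (rule gaussian_standardize[OF assms(1) fm \<sigma>])
  have fY: "f x = \<sigma> * Y x" for x using \<sigma> by (simp add: Y_def)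
  have "integrable std_normal_distribution (%x. x ^ (2 * 1))" "(\<integral>x. x ^ (2 * 1) \<partial>std_normal_distribution) = fact (2 * 1) / (2 ^ 1 * fact 1)"
   using std_normal_distribution_even_moments[of 1] by auto
  then have "integrable (distr M borel Y) (%x. x\<^sup>2)" "(\<integral>x. x\<^sup>2 \<partial>distr M borel Y) = 1"
   by (simp_all add: Yd)
  then have Y2: "integrable M (%x. (Y x)\<^sup>2)" "(\<integral>x. (Y x)\<^sup>2 \<partial>M) = 1"
   using integrable_distr[OF Ym, of "%x. x\<^sup>2"] integral_distr[OF Ym, of "%x. x\<^sup>2"] by simp_all
  then have 1: "integrable M (%x. (f x)\<^sup>2)" "(\<integral>x. (f x)\<^sup>2 \<partial>M) = \<sigma>\<^sup>2"
   by (simp_all add: fY power_mult_distrib)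
  have "(\<integral>x. exp (\<i> * of_real (f x)) \<partial>M) = (\<integral>y. iexp (\<sigma> * y) \<partial>distr M borel Y)"
   by (subst integral_distr[OF Ym]) (auto simp: fY)
  also have "... = char std_normal_distribution \<sigma>" by (simp add: Yd char_def)
  also have "... = of_real (exp (- (\<sigma>\<^sup>2) / 2))" by (simp add: char_std_normal_distribution)
  also have "... = exp (of_real (- (\<integral>x. (f x)\<^sup>2 \<partial>M) / 2))" by (simp only: 1 exp_of_real)
  finally have 2: "(\<integral>x. exp (\<i> * of_real (f x)) \<partial>M) = exp (of_real (- (\<integral>x. (f x)\<^sup>2 \<partial>M) / 2))" .
  have eint: "integrable M (%x. exp (t * Y x))" for t
   using integrable_distr[OF Ym, of "%y. exp (t * y)"] std_normal_exp_integrable[of t] by (simp add: Yd)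
  have "integrable M (%x. exp (s * \<bar>f x\<bar>))" for s
  proof (rule Bochner_Integration.integrable_bound)
   show "integrable M (%x. exp ((s * \<sigma>) * Y x) + exp ((- s * \<sigma>) * Y x))" by (intro Bochner_Integration.integrable_add eint)
   have "exp (s * \<bar>f x\<bar>) <= exp ((s * \<sigma>) * Y x) + exp ((- s * \<sigma>) * Y x)" for x
    by (cases "f x >= 0") (auto simp: fY mult.assoc abs_if)
   then show "AE x in M. norm (exp (s * \<bar>f x\<bar>)) <= norm (exp ((s * \<sigma>) * Y x) + exp ((- s * \<sigma>) * Y x))"
    by (auto intro!: AE_I2 order_trans[OF _ abs_ge_self])
  qed measurable
  with 1 2 show ?thesis by blast
 qed
 then show "integrable M (%x. (f x)\<^sup>2)"
  "(\<integral>x. exp (\<i> * of_real (f x)) \<partial>M) = exp (of_real (- (\<integral>x. (f x)\<^sup>2 \<partial>M) / 2))"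
  "!!s. integrable M (%x. exp (s * \<bar>f x\<bar>))" by auto
qed

section \<open>Gaussian spaces and the totality of exponential vectors\<close>

locale gaussian_space = coordinates M \<phi> \<kappa> for M :: "'a::polish_space measure" and \<phi> \<kappa> +
 fixes H :: "('a => real) set"
 assumes H_zero: "(%x. 0) \<in> H"
  and H_add: "!!f g. f \<in> H ==> g \<in> H ==> (%x. f x + g x) \<in> H"
  and H_scale: "!!f c. f \<in> H ==> (%x. c * f x) \<in> H"
  and H_gauss: "!!f. f \<in> H ==> gaussian_rv M f"
  and H_gen: "!!A. A \<in> sets M ==> \<exists>A'\<in>sigma_sets (space M) (\<Union>f\<in>H. {f -` U \<inter> space M | U. U \<in> sets borel}).
    emeasure M (symdiff A A') = 0"
begin

lemma H_meas: "f \<in> H ==> f \<in> borel_measurable M"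
 and H_sq: "f \<in> H ==> integrable M (%x. (f x)\<^sup>2)"
 and H_char: "f \<in> H ==> (\<integral>x. exp (\<i> * of_real (f x)) \<partial>M) = exp (of_real (- (\<integral>x. (f x)\<^sup>2 \<partial>M) / 2))"
 and H_exp: "f \<in> H ==> integrable M (%x. exp (s * \<bar>f x\<bar>))"
 using gaussian_rv_facts[OF prob_space_axioms H_gauss] by auto

definition q :: "('a => real) => ('a => real) => real" where
 "q f g = (\<integral>x. f x * g x \<partial>M)"

lemma H_prod: "f \<in> H ==> g \<in> H ==> integrable M (%x. f x * g x)"
proof (rule Bochner_Integration.integrable_bound)
 assume fg: "f \<in> H" "g \<in> H"
 show "integrable M (%x. (f x)\<^sup>2 + (g x)\<^sup>2)" using fg by (intro Bochner_Integration.integrable_add H_sq)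
 show "(%x. f x * g x) \<in> borel_measurable M" using fg[THEN H_meas] by measurable
 have "\<bar>a * b\<bar> <= a\<^sup>2 + b\<^sup>2" for a b :: real
 proof -
  have "2 * \<bar>a\<bar> * \<bar>b\<bar> <= \<bar>a\<bar>\<^sup>2 + \<bar>b\<bar>\<^sup>2" by (rule sum_squares_bound)
  moreover have "0 <= \<bar>a\<bar> * \<bar>b\<bar>" by simp
  ultimately show ?thesis unfolding abs_mult power2_abs by linarith
 qed
 then show "AE x in M. norm (f x * g x) <= norm ((f x)\<^sup>2 + (g x)\<^sup>2)" by auto
qed

lemma q_commute: "q f g = q g f"
 by (simp add: q_def mult.commute)

lemma q_add: "f \<in> H ==> g \<in> H ==> h \<in> H ==> q (%x. f x + g x) h = q f h + q g h"
 by (simp add: q_def distrib_right H_prod)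

lemma q_scale: "q (%x. c * f x) h = c * q f h"
 by (simp add: q_def mult.assoc)

lemma q_lin:
 assumes "f \<in> H" "g \<in> H" "h \<in> H"
 shows "q (%x. a * f x + b * g x) h = a * q f h + b * q g h"
  "q h (%x. a * f x + b * g x) = a * q h f + b * q h g"
proof -
 show 1: "q (%x. a * f x + b * g x) h = a * q f h + b * q g h"
  using q_add[OF H_scale[OF assms(1)] H_scale[OF assms(2)] assms(3), of a b] by (simp add: q_scale)
 then show "q h (%x. a * f x + b * g x) = a * q h f + b * q h g"
  by (simp add: q_commute[of h])
qed

lemma H_lin: "f \<in> H ==> g \<in> H ==> (%x. a * f x + b * g x) \<in> H"
 by (intro H_add H_scale)

definition wave :: "('a => real) => 'a => complex" where
 "wave h x = exp (\<i> * of_real (h x))"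

lemma norm_wave [simp]: "cmod (wave h x) = 1"
 by (simp add: wave_def)

lemma wave_meas: "h \<in> H ==> wave h \<in> borel_measurable M"
proof -
 assume "h \<in> H"
 then have [measurable]: "h \<in> borel_measurable M" by (rule H_meas)
 show ?thesis unfolding wave_def[abs_def] by measurable
qed

lemma sq_wave: "h \<in> H ==> sq (wave h)"
 by (rule sq_bounded[where c=1]) (auto dest: wave_meas)

text \<open>Normalised so that the Gram kernel is \<open>exp \<langle>h, g\<rangle>\<close>.\<close>

definition E :: "('a => real) => l2" where
 "E h = exp (q h h / 2) *\<^sub>R vec (wave h)"

lemma cip_wave:
 assumes "h \<in> H" "g \<in> H"
 shows "cip (vec (wave h)) (vec (wave g)) = of_real (exp (- (q h h - 2 * q h g + q g g) / 2))"
proof -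
 define d where "d x = 1 * h x + (-1) * g x" for x
 have d: "d \<in> H" unfolding d_def using assms by (rule H_lin)
 have "wave h x * cnj (wave g x) = exp (\<i> * of_real (d x))" for x
  by (simp add: wave_def d_def exp_cnj exp_add[symmetric] algebra_simps)
 then have "cip (vec (wave h)) (vec (wave g)) = (\<integral>x. exp (\<i> * of_real (d x)) \<partial>M)"
  using assms by (simp add: cip_vec sq_wave)
 also have "... = exp (of_real (- q d d / 2))"
  using H_char[OF d] by (simp add: q_def power2_eq_square)
 also have "q d d = q h h - 2 * q h g + q g g"
  unfolding d_def using assms H_lin[OF assms, of 1 "-1"] by (simp only: q_lin) (simp add: q_commute[of g h])
 finally show ?thesis by (simp only: exp_of_real)
qed

lemma cip_E: "h \<in> H ==> g \<in> H ==> cip (E h) (E g) = of_real (exp (q h g))"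
proof -
 assume hg: "h \<in> H" "g \<in> H"
 have "cip (E h) (E g) = of_real (exp (q h h / 2) * exp (q g g / 2) * exp (- (q h h - 2 * q h g + q g g) / 2))"
  by (simp add: E_def cip.scaleR_left cip.scaleR_right cip_wave[OF hg] scaleR_conv_of_real)
 also have "exp (q h h / 2) * exp (q g g / 2) * exp (- (q h h - 2 * q h g + q g g) / 2) = exp (q h g)"
  by (simp add: exp_add[symmetric] field_simps)
 finally show ?thesis .
qed

text \<open>For a closed subspace \<open>W\<close> these functions form an algebra closed under
  bounded pointwise limits. They carry a monotone class argument from the waves to the indicators of
  all sets generated by \<open>H\<close>.\<close>

definition multipliers :: "l2 set => ('a => complex) set" where
 "multipliers W = {\<psi> \<in> borel_measurable M. (EX c. ALL x. cmod (\<psi> x) <= c) & (ALL f. sq f --> vec f \<in> W --> vec (%x. \<psi> x * f x) \<in> W)}"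

lemma sq_mult:
 assumes [measurable]: "\<psi> \<in> borel_measurable M" and "!!x. cmod (\<psi> x) <= c" and f: "sq f"
 shows "sq (%x. \<psi> x * f x)"
 unfolding square_integrable_def
proof
 have [measurable]: "f \<in> borel_measurable M" using f by (rule square_integrable_measurable)
 show "(%x. \<psi> x * f x) \<in> borel_measurable M" by measurable
 show "integrable M (%x. (cmod (\<psi> x * f x))\<^sup>2)"
 proof (rule Bochner_Integration.integrable_bound[of M "%x. c\<^sup>2 * (cmod (f x))\<^sup>2"])
  show "integrable M (%x. c\<^sup>2 * (cmod (f x))\<^sup>2)" using f by (simp add: square_integrable_def)
  have "(cmod (\<psi> x * f x))\<^sup>2 <= c\<^sup>2 * (cmod (f x))\<^sup>2" for x
   unfolding norm_mult power_mult_distrib using assms(2)[of x] by (intro mult_right_mono power_mono) auto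
  then show "AE x in M. norm ((cmod (\<psi> x * f x))\<^sup>2) <= norm (c\<^sup>2 * (cmod (f x))\<^sup>2)" by auto
 qed measurable
qed

lemma multiplier_operator:
 assumes m: "\<psi> \<in> borel_measurable M" and c: "!!x. cmod (\<psi> x) <= c"
 obtains P where "cbounded_linear P" "!!f. sq f ==> P (vec f) = vec (%x. \<psi> x * f x)"
proof -
 note sqm = sq_mult[OF m c]
 define r where "r v = (SOME f. sq f & vec f = v)" for v
 have r: "sq (r v)" "vec (r v) = v" for v
  using someI_ex[OF vec_rep[of v]] by (simp_all add: r_def)
 define P where "P v = vec (%x. \<psi> x * r v x)" for v
 have P: "P (vec f) = vec (%x. \<psi> x * f x)" if f: "sq f" for f
 proof -
  have "AE x in M. r (vec f) x = f x" using f r by (intro vec_eq_imp_AE) auto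
  then have "AE x in M. \<psi> x * r (vec f) x = \<psi> x * f x" by eventually_elim simp
  then show ?thesis unfolding P_def using sqm r f by (intro vec_cong_AE) auto
 qed
 have "cbounded_linear P"
 proof (rule cbounded_linearI)
  fix u v :: l2 and a
  have "P (vec (%x. r u x + r v x)) = P (vec (r u)) + P (vec (r v))"
   unfolding P[OF square_integrable_add[OF r(1) r(1)]] P[OF r(1)]
   by (simp add: distrib_left vec_add sqm r(1))
  then show "P (u + v) = P u + P v" by (simp add: vec_add[OF r(1) r(1)] r)
  have "P (vec (%x. a * r u x)) = a *\<^sub>C P (vec (r u))"
   unfolding P[OF square_integrable_scale[OF r(1)]] P[OF r(1)]
  proof -
   have "(%x. \<psi> x * (a * r u x)) = (%x. a * (\<psi> x * r u x))" by (simp add: mult_ac)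
   then show "vec (%x. \<psi> x * (a * r u x)) = a *\<^sub>C vec (%x. \<psi> x * r u x)"
    using vec_scale[OF sqm[OF r(1)]] by metis
  qed
  then show "P (a *\<^sub>C u) = a *\<^sub>C P u" by (simp add: vec_scale[OF r(1)] r)
  have c0: "0 <= c" using c[of undefined] norm_ge_zero order_trans by blast
  have "(norm (P u))\<^sup>2 = (\<integral>x. (cmod (\<psi> x * r u x))\<^sup>2 \<partial>M)"
   unfolding P_def by (rule norm_vec[OF sqm[OF r(1)]])
  also have "... <= (\<integral>x. c\<^sup>2 * (cmod (r u x))\<^sup>2 \<partial>M)"
  proof (rule integral_mono)
   show "(cmod (\<psi> x * r u x))\<^sup>2 <= c\<^sup>2 * (cmod (r u x))\<^sup>2" for x
    unfolding norm_mult power_mult_distrib using c[of x] by (intro mult_right_mono power_mono) auto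
  qed (use sqm[OF r(1)] r(1) in \<open>auto simp: square_integrable_def\<close>)
  also have "... = (norm u * c)\<^sup>2" using norm_vec[OF r(1)[of u]] by (simp add: r power_mult_distrib)
  finally show "norm (P u) <= norm u * c" by (rule power2_le_imp_le) (simp add: c0)
 qed
 with P that show ?thesis by blast
qed

lemma multipliersI:
 "\<psi> \<in> borel_measurable M ==> (!!x. cmod (\<psi> x) <= c) ==> (!!f. sq f ==> vec f \<in> W ==> vec (%x. \<psi> x * f x) \<in> W) ==> \<psi> \<in> multipliers W"
 by (auto simp: multipliers_def)

context
 fixes W :: "l2 set"
 assumes W: "closed W" "csubspace W"
begin

lemma multipliers_const: "(%x. c) \<in> multipliers W"
 using W by (intro multipliersI[where c="cmod c"]) (auto simp: vec_scale complex_vs.subspace_scale)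

lemma multipliers_mult: "\<psi> \<in> multipliers W ==> \<eta> \<in> multipliers W ==> (%x. \<psi> x * \<eta> x) \<in> multipliers W"
proof -
 assume *: "\<psi> \<in> multipliers W" "\<eta> \<in> multipliers W"
 then obtain c d where cd: "!!x. cmod (\<psi> x) <= c" "!!x. cmod (\<eta> x) <= d"
  and [measurable]: "\<psi> \<in> borel_measurable M" "\<eta> \<in> borel_measurable M" by (auto simp: multipliers_def)
 show ?thesis
 proof (rule multipliersI[where c="c * d"])
  show "cmod (\<psi> x * \<eta> x) <= c * d" for x
   unfolding norm_mult using cd[of x] by (intro mult_mono) (auto intro: order_trans[OF norm_ge_zero])
  fix f assume f: "sq f" "vec f \<in> W"
  have "sq (%x. \<eta> x * f x)" by (rule sq_mult[OF _ cd(2) f(1)]) measurable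
  moreover have "vec (%x. \<eta> x * f x) \<in> W" using * f by (auto simp: multipliers_def)
  ultimately have "vec (%x. \<psi> x * (\<eta> x * f x)) \<in> W" using * by (auto simp: multipliers_def)
  then show "vec (%x. \<psi> x * \<eta> x * f x) \<in> W" by (simp add: mult.assoc)
 qed measurable
qed

lemma multipliers_add: "\<psi> \<in> multipliers W ==> \<eta> \<in> multipliers W ==> (%x. \<psi> x + \<eta> x) \<in> multipliers W"
proof -
 assume *: "\<psi> \<in> multipliers W" "\<eta> \<in> multipliers W"
 then obtain c d where cd: "!!x. cmod (\<psi> x) <= c" "!!x. cmod (\<eta> x) <= d"
  and [measurable]: "\<psi> \<in> borel_measurable M" "\<eta> \<in> borel_measurable M" by (auto simp: multipliers_def)
 show ?thesis
 proof (rule multipliersI[where c="c + d"])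
  show "cmod (\<psi> x + \<eta> x) <= c + d" for x
   using cd[of x] by (intro norm_triangle_le) linarith
  fix f assume f: "sq f" "vec f \<in> W"
  have "sq (%x. \<psi> x * f x)" "sq (%x. \<eta> x * f x)"
   by (rule sq_mult[OF _ cd(1) f(1)], measurable) (rule sq_mult[OF _ cd(2) f(1)], measurable)
  then have "vec (%x. (\<psi> x + \<eta> x) * f x) = vec (%x. \<psi> x * f x) + vec (%x. \<eta> x * f x)"
   by (simp add: distrib_right vec_add)
  also have "... \<in> W" using * f W by (intro complex_vs.subspace_add) (auto simp: multipliers_def)
  finally show "vec (%x. (\<psi> x + \<eta> x) * f x) \<in> W" .
 qed measurable
qed

lemma multipliers_limit:
 assumes \<psi>: "!!n. \<psi> n \<in> multipliers W" and c: "!!n x. cmod (\<psi> n x) <= c"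
  and lim: "!!x. (%n. \<psi> n x) \<longlonglongrightarrow> \<eta> x"
 shows "\<eta> \<in> multipliers W"
proof -
 have [measurable]: "\<psi> n \<in> borel_measurable M" for n using \<psi>[of n] by (simp add: multipliers_def)
 have [measurable]: "\<eta> \<in> borel_measurable M" by (rule borel_measurable_LIMSEQ_metric[OF _ lim]) measurable
 have c\<eta>: "cmod (\<eta> x) <= c" for x
  by (rule LIMSEQ_le_const2[OF tendsto_norm[OF lim[of x]]]) (use c in auto)
 show ?thesis
 proof (rule multipliersI[OF _ c\<eta>])
  fix f assume f: "sq f" "vec f \<in> W"
  have [measurable]: "f \<in> borel_measurable M" using f by (simp add: square_integrable_def)
  have sqn: "sq (%x. \<psi> n x * f x)" for n by (rule sq_mult[OF _ c f(1)]) measurable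
  have sq\<eta>: "sq (%x. \<eta> x * f x)" by (rule sq_mult[OF _ c\<eta> f(1)]) measurable
  have "(%n. \<integral>x. (cmod (\<psi> n x * f x - \<eta> x * f x))\<^sup>2 \<partial>M) \<longlonglongrightarrow> (\<integral>x. 0 \<partial>M)"
  proof (rule integral_dominated_convergence[where w="%x. (2 * c)\<^sup>2 * (cmod (f x))\<^sup>2"])
   show "integrable M (%x. (2 * c)\<^sup>2 * (cmod (f x))\<^sup>2)" using f by (simp add: square_integrable_def)
   have "(%n. (cmod (\<psi> n x * f x - \<eta> x * f x))\<^sup>2) \<longlonglongrightarrow> (cmod (\<eta> x * f x - \<eta> x * f x))\<^sup>2" for x
    by (intro tendsto_intros lim)
   then show "AE x in M. (%n. (cmod (\<psi> n x * f x - \<eta> x * f x))\<^sup>2) \<longlonglongrightarrow> 0" by simp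
   have "(cmod (\<psi> n x * f x - \<eta> x * f x))\<^sup>2 <= (2 * c)\<^sup>2 * (cmod (f x))\<^sup>2" for n x
   proof -
    have "cmod (\<psi> n x - \<eta> x) <= 2 * c"
     using norm_triangle_ineq4[of "\<psi> n x" "\<eta> x"] c[of n x] c\<eta>[of x] by linarith
    then have "cmod (\<psi> n x - \<eta> x) * cmod (f x) <= (2 * c) * cmod (f x)" by (rule mult_right_mono) simp
    then have "(cmod ((\<psi> n x - \<eta> x) * f x))\<^sup>2 <= ((2 * c) * cmod (f x))\<^sup>2" by (intro power_mono) (auto simp: norm_mult)
    then show ?thesis by (simp add: left_diff_distrib power_mult_distrib)
   qed
   then show "AE x in M. norm ((cmod (\<psi> n x * f x - \<eta> x * f x))\<^sup>2) <= (2 * c)\<^sup>2 * (cmod (f x))\<^sup>2" for n by simp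
  qed measurable
  then have "(%n. (norm (vec (%x. \<psi> n x * f x) - vec (%x. \<eta> x * f x)))\<^sup>2) \<longlonglongrightarrow> 0"
   by (simp add: norm_vec_diff[OF sqn sq\<eta>])
  then have "(%n. sqrt ((norm (vec (%x. \<psi> n x * f x) - vec (%x. \<eta> x * f x)))\<^sup>2)) \<longlonglongrightarrow> sqrt 0" by (rule tendsto_real_sqrt)
  then have "(%n. vec (%x. \<psi> n x * f x)) \<longlonglongrightarrow> vec (%x. \<eta> x * f x)" by (simp add: tendsto_norm_zero_iff LIM_zero_iff)
  moreover have "vec (%x. \<psi> n x * f x) \<in> W" for n using \<psi>[of n] f by (auto simp: multipliers_def)
  ultimately show "vec (%x. \<eta> x * f x) \<in> W"
   using closed_sequentially[OF W(1), of "%n. vec (%x. \<psi> n x * f x)"] by blast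
 qed measurable
qed

lemma multipliers_poly:
 assumes "real_polynomial_function p" and \<psi>: "(%x. of_real (\<psi> x)) \<in> multipliers W"
 shows "(%x. of_real (p (\<psi> x :: real))) \<in> multipliers W"
 using assms(1)
proof (induction p rule: real_polynomial_function.induct)
 case (linear f)
 then have lin: "f t = t * f 1" for t
  using linear_scale[OF bounded_linear.linear, of f t 1] by simp
 have "complex_of_real (f (\<psi> x)) = of_real (f 1) * of_real (\<psi> x)" for x
  by (subst lin) simp
 then show ?case using multipliers_mult[OF multipliers_const \<psi>, of "of_real (f 1)"] by simp
next
 case (add f g)
 then show ?case using multipliers_add[of "%x. of_real (f (\<psi> x))" "%x. of_real (g (\<psi> x))"] by simp
next
 case (mult f g)
 then show ?case using multipliers_mult[of "%x. of_real (f (\<psi> x))" "%x. of_real (g (\<psi> x))"] by simp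
qed (simp add: multipliers_const)

lemma multipliers_level_set:
 assumes \<psi>: "(%x. of_real (\<psi> x)) \<in> multipliers W" and bd: "!!x. \<bar>\<psi> x\<bar> <= 1"
 shows "indicator {x. a < \<psi> x} \<in> multipliers W"
proof -
 \<comment> \<open>Ramps of slope \<open>k\<close> that increase to the indicator of
   \<open>t > a\<close>. Each is replaced by a polynomial, because polynomials in a multiplier are
   multipliers.\<close>
 define g where "g k t = min 1 (real k * max 0 (t - a))" for k :: nat and t :: real
 have "EX p. real_polynomial_function p & (\<forall>t\<in>{-1..1}. \<bar>g k t - p t\<bar> < 1 / real (Suc k))" for k
 proof -
  have "continuous_on {-1..1} (g k)" unfolding g_def by (intro continuous_intros)
  then show ?thesis
   by (rule Stone_Weierstrass_real_polynomial_function[OF compact_Icc, of _ _ _ "1 / real (Suc k)"]) auto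
 qed
 then obtain p where p: "!!k. real_polynomial_function (p k)" "!!k t. t \<in> {-1..1} ==> \<bar>g k t - p k t\<bar> < 1 / real (Suc k)"
  by metis
 have \<psi>1: "\<psi> x \<in> {-1..1}" for x using bd[of x] by (auto simp: abs_le_iff)
 show ?thesis
 proof (rule multipliers_limit[of "%k x. of_real (p k (\<psi> x))" 2])
  show "(%x. of_real (p k (\<psi> x))) \<in> multipliers W" for k by (rule multipliers_poly[OF p(1) \<psi>])
  show "cmod (of_real (p k (\<psi> x))) <= 2" for k x
  proof -
   have "1 / real (Suc k) <= 1" by simp
   with p(2)[OF \<psi>1[of x], of k] have "\<bar>g k (\<psi> x) - p k (\<psi> x)\<bar> < 1" by (rule less_le_trans)
   moreover have "0 <= g k (\<psi> x)" "g k (\<psi> x) <= 1" by (auto simp: g_def)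
   ultimately show ?thesis unfolding norm_of_real by linarith
  qed
  show "(%k. complex_of_real (p k (\<psi> x))) \<longlonglongrightarrow> indicator {x. a < \<psi> x} x" for x
  proof -
   have "(%k. g k (\<psi> x)) \<longlonglongrightarrow> indicator {x. a < \<psi> x} x"
   proof (cases "a < \<psi> x")
    case True
    obtain N where N: "1 / (\<psi> x - a) < real N" using reals_Archimedean2 by blast
    have "g k (\<psi> x) = 1" if "k >= N" for k
    proof -
     have "1 / (\<psi> x - a) <= real k" using N that by linarith
     then have "1 <= real k * (\<psi> x - a)" using True by (simp add: field_simps)
     then show ?thesis using True by (simp add: g_def)
    qed
    then have "\<forall>\<^sub>F k in sequentially. g k (\<psi> x) = indicator {x. a < \<psi> x} x"
     using True eventually_sequentially by auto
    then show ?thesis by (rule tendsto_eventually)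
   next
    case False
    then show ?thesis by (simp add: g_def)
   qed
   moreover have "(%k. p k (\<psi> x) - g k (\<psi> x)) \<longlonglongrightarrow> 0"
   proof (rule Lim_null_comparison)
    show "\<forall>\<^sub>F k in sequentially. norm (p k (\<psi> x) - g k (\<psi> x)) <= 1 / real (Suc k)"
     using p(2)[OF \<psi>1[of x]] by (intro always_eventually) (auto simp: abs_minus_commute less_imp_le)
    show "(%k. 1 / real (Suc k)) \<longlonglongrightarrow> 0" using LIMSEQ_Suc[OF lim_1_over_n] by simp
   qed
   ultimately have "(%k. g k (\<psi> x) + (p k (\<psi> x) - g k (\<psi> x))) \<longlonglongrightarrow> indicator {x. a < \<psi> x} x + 0"
    by (rule tendsto_add)
   then have "(%k. complex_of_real (p k (\<psi> x))) \<longlonglongrightarrow> of_real (indicator {x. a < \<psi> x} x)"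
    by (intro tendsto_of_real) simp
   then show ?thesis by (cases "a < \<psi> x") simp_all
  qed
 qed
qed

lemma multipliers_sigma_algebra: "sigma_algebra UNIV {A \<in> sets M. indicator A \<in> multipliers W}"
proof -
 let ?S = "{A \<in> sets M. indicator A \<in> multipliers W}"
 have compl: "UNIV - A \<in> ?S" if "A \<in> ?S" for A
 proof -
  have "indicator (UNIV - A) = (%x. 1 + (-1) * indicator A x :: complex)" by (auto simp: indicator_def fun_eq_iff)
  moreover have "(%x. 1 + (-1) * indicator A x) \<in> multipliers W"
   using that by (intro multipliers_add multipliers_mult multipliers_const) auto
  ultimately show ?thesis using that by auto
 qed
 have empty: "{} \<in> ?S" using multipliers_const[of 0] by (auto simp: indicator_def[abs_def])
 have union: "(\<Union>i. A i) \<in> ?S" if A: "range A <= ?S" for A :: "nat => 'a set"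
 proof -
  have Ai: "A i \<in> ?S" for i using A by auto
  \<comment> \<open>The complement of the union is treated instead, as indicators of finite
    intersections are products.\<close>
  define \<psi> where "\<psi> n x = (\<Prod>i<n. indicator (UNIV - A i) x :: complex)" for n x
  have \<psi>: "\<psi> n \<in> multipliers W" for n
  proof (induction n)
   case 0
   then show ?case using multipliers_const[of 1] by (simp add: \<psi>_def[abs_def])
  next
   case (Suc n)
   have "indicator (UNIV - A n) \<in> multipliers W" using compl[OF Ai] by auto
   from multipliers_mult[OF Suc this] show ?case by (simp add: \<psi>_def[abs_def])
  qed
  have \<psi>_eq: "\<psi> n x = indicator (UNIV - (\<Union>i<n. A i)) x" for n x
   by (induction n) (auto simp: \<psi>_def indicator_def lessThan_Suc)
  have "indicator (UNIV - (\<Union>i. A i)) \<in> multipliers W"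
  proof (rule multipliers_limit[OF \<psi>, where c=1])
   show "cmod (\<psi> n x) <= 1" for n x by (simp add: \<psi>_eq indicator_def)
   show "(%n. \<psi> n x) \<longlonglongrightarrow> indicator (UNIV - (\<Union>i. A i)) x" for x
   proof (cases "x \<in> (\<Union>i. A i)")
    case True
    then obtain i where i: "x \<in> A i" by auto
    have "\<psi> n x = 0" if "n >= Suc i" for n using i that by (auto simp: \<psi>_eq indicator_def)
    then have "\<forall>\<^sub>F n in sequentially. \<psi> n x = indicator (UNIV - (\<Union>i. A i)) x"
     using True by (auto simp: eventually_sequentially indicator_def)
    then show ?thesis by (rule tendsto_eventually)
   next
    case False
    then show ?thesis by (simp add: \<psi>_eq indicator_def)
   qed
  qed
  moreover have "(\<Union>i. A i) \<in> sets M" using Ai by auto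
  ultimately have "UNIV - (\<Union>i. A i) \<in> ?S" by auto
  from compl[OF this] show ?thesis by (simp add: Diff_Diff_Int)
 qed
 show ?thesis
  unfolding sigma_algebra_iff2 using compl empty union by (auto simp del: UN_iff)
qed

end

text \<open>Products of waves are waves, so waves are multipliers of their closed span. Then so are
  the indicators of all sets generated by \<open>H\<close>; applied to the constant 1, the wave of
  0, they put every indicator into the span, up to null sets.\<close>

lemma waves_total: "closure (cspan ((%h. vec (wave h)) ` H)) = UNIV"
proof -
 let ?W = "closure (cspan ((%h. vec (wave h)) ` H))"
 have W: "closed ?W" "csubspace ?W" by (auto intro: csubspace_closure complex_vs.subspace_span)
 have wave_W: "vec (wave h) \<in> ?W" if "h \<in> H" for h
  using that closure_subset[of "cspan ((%h. vec (wave h)) ` H)"] complex_vs.span_base[of "vec (wave h)" "(%h. vec (wave h)) ` H"] by blast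
 have wave_mult: "wave h \<in> multipliers ?W" if h: "h \<in> H" for h
 proof (rule multipliersI[where c=1])
  show "wave h \<in> borel_measurable M" by (rule wave_meas[OF h])
  have wave1: "cmod (wave h x) <= 1" for x by simp
  obtain P where P: "cbounded_linear P" "!!f. sq f ==> P (vec f) = vec (%x. wave h x * f x)"
   by (rule multiplier_operator[OF wave_meas[OF h] wave1], rule that, auto)
  fix f assume f: "sq f" "vec f \<in> ?W"
  have "P (vec f) \<in> ?W"
  proof (rule invariant_preimage[OF P(1) W _ f(2)])
   fix v assume "v \<in> (%h. vec (wave h)) ` H"
   then obtain g where g: "g \<in> H" "v = vec (wave g)" by auto
   have "(%x. wave h x * wave g x) = wave (%x. h x + g x)"
    by (auto simp: wave_def exp_add[symmetric] distrib_left)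
   then show "P v \<in> ?W" using P(2)[OF sq_wave[OF g(1)]] wave_W[OF H_add[OF h g(1)]] g(2) by simp
  qed
  then show "vec (%x. wave h x * f x) \<in> ?W" using P(2)[OF f(1)] by simp
 qed simp
 define SS where "SS = {A \<in> sets M. indicator A \<in> multipliers ?W}"
 interpret S: sigma_algebra UNIV SS unfolding SS_def by (rule multipliers_sigma_algebra[OF W])
 have sets_S: "sets (sigma UNIV SS) = SS" by (rule S.sets_measure_of_eq)
 \<comment> \<open>Multipliers are bounded and \<open>h\<close> is not, so \<open>h\<close> is
   reached through \<open>sin (h x)\<close>, a combination of two waves, and then as the limit of
   rescaled sines.\<close>
 have sin_S: "(%x. sin (h x)) \<in> borel_measurable (sigma UNIV SS)" if h: "h \<in> H" for h
 proof (rule borel_measurable_iff_greater[THEN iffD2], rule allI)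
  fix a
  have [measurable]: "h \<in> borel_measurable M" using h by (rule H_meas)
  have m: "(%x. (- 1) * h x) \<in> H" using h by (rule H_scale)
  have "(%x. complex_of_real (sin (h x))) = (%x. (- \<i> / 2) * wave h x + (\<i> / 2) * wave (%x. (- 1) * h x) x)"
   by (auto simp: wave_def sin_exp_eq sin_of_real[symmetric] field_simps)
  moreover have "(%x. (- \<i> / 2) * wave h x + (\<i> / 2) * wave (%x. (- 1) * h x) x) \<in> multipliers ?W"
   by (intro multipliers_add[OF W] multipliers_mult[OF W] multipliers_const[OF W] wave_mult h m)
  ultimately have "indicator {x. a < sin (h x)} \<in> multipliers ?W"
   by (intro multipliers_level_set[OF W]) auto
  moreover have "{x. a < sin (h x)} \<in> sets M"
  proof -
   have "{x \<in> space M. a < sin (h x)} \<in> sets M" by measurable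
   then show ?thesis by simp
  qed
  ultimately show "{w \<in> space (sigma UNIV SS). a < sin (h w)} \<in> sets (sigma UNIV SS)"
   unfolding sets_S by (simp add: SS_def space_measure_of_conv)
 qed
 have h_S: "h \<in> borel_measurable (sigma UNIV SS)" if h: "h \<in> H" for h
 proof (rule borel_measurable_LIMSEQ_metric)
  show "(%x. real (Suc n) * sin (1 / real (Suc n) * h x)) \<in> borel_measurable (sigma UNIV SS)" for n
   using sin_S[OF H_scale[OF h, of "1 / real (Suc n)"]] by measurable
  fix x
  have "((%t. sin (t * h x) / t) \<longlongrightarrow> h x) (at 0)"
  proof -
   have "((%t. sin (t * h x)) has_field_derivative h x) (at 0)"
    by (auto intro!: derivative_eq_intros)
   then show ?thesis by (simp add: has_field_derivative_iff)
  qed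
  moreover have "filterlim (%n. 1 / real (Suc n)) (at 0) sequentially"
   using LIMSEQ_Suc[OF lim_1_over_n] by (auto simp: filterlim_at)
  ultimately have "(%n. sin (1 / real (Suc n) * h x) / (1 / real (Suc n))) \<longlonglongrightarrow> h x"
   by (rule filterlim_compose)
  then show "(%n. real (Suc n) * sin (1 / real (Suc n) * h x)) \<longlonglongrightarrow> h x"
   by (simp add: mult.commute)
 qed
 have "(\<Union>f\<in>H. {f -` U \<inter> space M | U. U \<in> sets borel}) <= SS"
 proof clarify
  fix f and U :: "real set" assume "f \<in> H" "U \<in> sets borel"
  then have "f -` U \<inter> space (sigma UNIV SS) \<in> sets (sigma UNIV SS)" by (intro measurable_sets[OF h_S])
  then have "f -` U \<in> SS" unfolding sets_S by (simp add: space_measure_of_conv)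
  then show "f -` U \<inter> space M \<in> SS" by simp
 qed
 then have gen: "sigma_sets (space M) (\<Union>f\<in>H. {f -` U \<inter> space M | U. U \<in> sets borel}) <= SS"
  using S.sigma_sets_subset[of "\<Union>f\<in>H. {f -` U \<inter> space M | U. U \<in> sets borel}"] unfolding space_M by blast
 have one: "sq (%x. 1)" "vec (%x. 1) \<in> ?W"
  using sq_wave[OF H_zero] wave_W[OF H_zero] by (simp_all add: wave_def[abs_def])
 have "ind ` sets M <= ?W"
 proof (rule image_subsetI)
  fix A assume A: "A \<in> sets M"
  obtain A' where A': "A' \<in> SS" "emeasure M (symdiff A A') = 0" using H_gen[OF A] gen by blast
  then have "vec (%x. indicator A' x * 1) \<in> ?W" using one by (auto simp: multipliers_def SS_def)
  moreover have "ind A = ind A'"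
   using norm_ind_diff[OF A, of A'] A' by (simp add: measure_def SS_def)
  ultimately show "ind A \<in> ?W" by simp
 qed
 then have "x \<in> ?W" for x by (rule total_induct[OF indicators_total W])
 then show ?thesis by blast
qed

lemma E_total: "closure (cspan (E ` H)) = UNIV"
proof -
 have "vec (wave h) \<in> cspan (E ` H)" if "h \<in> H" for h
 proof -
  have "vec (wave h) = complex_of_real (exp (- (q h h / 2))) *\<^sub>C E h"
   by (simp add: E_def flip: scaleR_scaleC exp_add)
  moreover have "E h \<in> cspan (E ` H)" using that by (intro complex_vs.span_base imageI)
  ultimately show ?thesis using complex_vs.span_scale by metis
 qed
 then have "cspan ((%h. vec (wave h)) ` H) <= cspan (E ` H)"
  by (intro complex_vs.span_minimal complex_vs.subspace_span) auto
 then show ?thesis using waves_total closure_mono by blast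
qed

end

lemma exp_partial_sum_le: "0 <= (y::real) ==> (\<Sum>m<N. y ^ m / fact m) <= exp y"
proof -
 assume y: "0 <= y"
 have "(\<Sum>m<N. y ^ m /\<^sub>R fact m) <= (\<Sum>m. y ^ m /\<^sub>R fact m)"
  using y by (intro sum_le_suminf summable_exp_generic) auto
 then show ?thesis by (simp add: exp_def divide_inverse mult.commute)
qed

context gaussian_space
begin

text \<open>Along a line the norming factor is the exponential of a quadratic polynomial, and the
  wave expands into a power series that converges in \<open>l2\<close> by dominated convergence,
  thanks to the exponential moments of \<open>k\<close>.\<close>

lemma E_line_entire:
 fixes L :: "l2 => complex"
 assumes h: "h \<in> H" and k: "k \<in> H" and L: "bounded_linear L"
 obtains A where "A holomorphic_on UNIV" "!!t::real. A (of_real t) = L (E (%x. h x + t * k x))"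
proof -
 interpret L: bounded_linear L by fact
 have [measurable]: "h \<in> borel_measurable M" "k \<in> borel_measurable M" "wave h \<in> borel_measurable M"
  using h k by (auto intro: H_meas wave_meas)
 define s where "s m x = wave h x * ((\<i> * of_real (k x)) ^ m / fact m)" for m x
 have [measurable]: "s m \<in> borel_measurable M" for m unfolding s_def by measurable
 have norm_s: "cmod (s m x) = \<bar>k x\<bar> ^ m / fact m" for m x
  by (simp add: s_def norm_mult norm_divide norm_power)
 have s_le: "cmod (s m x) <= exp \<bar>k x\<bar>" for m x
 proof -
  have "\<bar>k x\<bar> ^ m / fact m <= (\<Sum>j<Suc m. \<bar>k x\<bar> ^ j / fact j)"
   by (intro member_le_sum) auto
  also have "... <= exp \<bar>k x\<bar>" by (rule exp_partial_sum_le) simp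
  finally show ?thesis by (simp add: norm_s)
 qed
 have sq_s: "sq (s m)" for m
  unfolding square_integrable_def
 proof
  show "integrable M (%x. (cmod (s m x))\<^sup>2)"
  proof (rule Bochner_Integration.integrable_bound)
   show "integrable M (%x. exp (2 * \<bar>k x\<bar>))" by (rule H_exp[OF k])
   have "(cmod (s m x))\<^sup>2 <= exp (2 * \<bar>k x\<bar>)" for x
    using power_mono[OF s_le[of m x], of 2] by (simp add: exp_double[symmetric])
   then show "AE x in M. norm ((cmod (s m x))\<^sup>2) <= norm (exp (2 * \<bar>k x\<bar>))" by simp
  qed measurable
 qed measurable
 define S where "S m = vec (s m)" for m
 have sums_v: "(%m. t ^ m *\<^sub>R S m) sums vec (wave (%x. h x + t * k x))" for t
 proof -
  let ?v = "wave (%x. h x + t * k x)"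
  have tk: "(%x. h x + t * k x) \<in> H" using H_lin[OF h k, of 1 t] by simp
  define P where "P N x = (\<Sum>m<N. of_real (t ^ m) * s m x)" for N x
  have sqP: "sq (P N)" for N unfolding P_def by (rule sq_sum[OF sq_s])
  have [measurable]: "P N \<in> borel_measurable M" for N by (rule square_integrable_measurable[OF sqP])
  have [measurable]: "?v \<in> borel_measurable M" by (rule wave_meas[OF tk])
  have vecP: "vec (P N) = (\<Sum>m<N. t ^ m *\<^sub>R S m)" for N
   using vec_sum[of "{..<N}" s "%m. of_real (t ^ m)", OF sq_s] by (simp add: P_def[abs_def] S_def scaleR_scaleC)
  have P_eq: "P N x = wave h x * (\<Sum>m<N. (\<i> * of_real (t * k x)) ^ m / fact m)" for N x
   unfolding P_def s_def sum_distrib_left by (intro sum.cong) (auto simp: power_mult_distrib)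
  have v_eq: "?v x = wave h x * exp (\<i> * of_real (t * k x))" for x
   by (simp add: wave_def exp_add[symmetric] distrib_left)
  have lim: "(%N. P N x) \<longlonglongrightarrow> ?v x" for x
  proof -
   have "(%N. \<Sum>m<N. (\<i> * of_real (t * k x)) ^ m /\<^sub>R fact m) \<longlonglongrightarrow> exp (\<i> * of_real (t * k x))"
    using exp_converges[of "\<i> * of_real (t * k x)"] by (simp add: sums_def)
   then have "(%N. wave h x * (\<Sum>m<N. (\<i> * of_real (t * k x)) ^ m /\<^sub>R fact m)) \<longlonglongrightarrow> wave h x * exp (\<i> * of_real (t * k x))"
    by (intro tendsto_mult tendsto_const)
   then show ?thesis unfolding P_eq v_eq by (simp add: scaleR_conv_of_real divide_inverse mult.commute)
  qed
  have bound: "cmod (P N x - ?v x) <= 2 * exp (\<bar>t\<bar> * \<bar>k x\<bar>)" for N x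
  proof -
   have "cmod (P N x) <= (\<Sum>m<N. (\<bar>t\<bar> * \<bar>k x\<bar>) ^ m / fact m)"
    unfolding P_eq norm_mult norm_wave mult_1
    by (rule order_trans[OF norm_sum]) (simp add: norm_divide norm_power norm_mult abs_mult)
   also have "... <= exp (\<bar>t\<bar> * \<bar>k x\<bar>)" by (rule exp_partial_sum_le) simp
   finally have "cmod (P N x) <= exp (\<bar>t\<bar> * \<bar>k x\<bar>)" .
   moreover have "cmod (?v x) <= exp (\<bar>t\<bar> * \<bar>k x\<bar>)" by simp
   ultimately show ?thesis using norm_triangle_ineq4[of "P N x" "?v x"] by linarith
  qed
  have "(%N. \<integral>x. (cmod (P N x - ?v x))\<^sup>2 \<partial>M) \<longlonglongrightarrow> (\<integral>x. 0 \<partial>M)"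
  proof (rule integral_dominated_convergence[where w="%x. 4 * exp ((2 * \<bar>t\<bar>) * \<bar>k x\<bar>)"])
   show "integrable M (%x. 4 * exp ((2 * \<bar>t\<bar>) * \<bar>k x\<bar>))" using H_exp[OF k, of "2 * \<bar>t\<bar>"] by simp
   have "(%N. (cmod (P N x - ?v x))\<^sup>2) \<longlonglongrightarrow> (cmod (?v x - ?v x))\<^sup>2" for x
    by (intro tendsto_intros lim)
   then show "AE x in M. (%N. (cmod (P N x - ?v x))\<^sup>2) \<longlonglongrightarrow> 0" by simp
   have "(cmod (P N x - ?v x))\<^sup>2 <= 4 * exp ((2 * \<bar>t\<bar>) * \<bar>k x\<bar>)" for N x
   proof -
    have "(cmod (P N x - ?v x))\<^sup>2 <= (2 * exp (\<bar>t\<bar> * \<bar>k x\<bar>))\<^sup>2" by (rule power_mono[OF bound]) simp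
    also have "... = 4 * exp ((2 * \<bar>t\<bar>) * \<bar>k x\<bar>)"
     by (simp add: power_mult_distrib mult.assoc exp_double[symmetric])
    finally show ?thesis .
   qed
   then show "AE x in M. norm ((cmod (P N x - ?v x))\<^sup>2) <= 4 * exp ((2 * \<bar>t\<bar>) * \<bar>k x\<bar>)" for N by simp
  qed measurable
  then have "(%N. (norm (vec (P N) - vec ?v))\<^sup>2) \<longlonglongrightarrow> 0"
   by (simp add: norm_vec_diff[OF sqP sq_wave[OF tk]])
  then have "(%N. sqrt ((norm (vec (P N) - vec ?v))\<^sup>2)) \<longlonglongrightarrow> sqrt 0" by (rule tendsto_real_sqrt)
  then have "(%N. vec (P N)) \<longlonglongrightarrow> vec ?v" by (simp add: tendsto_norm_zero_iff LIM_zero_iff)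
  then show ?thesis by (simp add: sums_def vecP)
 qed
 define a where "a m = L (S m)" for m
 have sums_L: "(%m. a m * of_real t ^ m) sums L (vec (wave (%x. h x + t * k x)))" for t
  using L.sums[OF sums_v[of t]] by (simp add: L.scaleR a_def scaleR_conv_of_real mult.commute)
 have summ: "summable (%m. a m * z ^ m)" for z
 proof (rule powser_inside)
  show "summable (%m. a m * (of_real (cmod z + 1)) ^ m)" using sums_L[of "cmod z + 1"] by (simp add: sums_iff)
  show "norm z < norm (complex_of_real (cmod z + 1))" by (simp only: norm_of_real)
 qed
 \<comment> \<open>The form \<open>q\<close> is continued bilinearly in \<open>z\<close>, without
   conjugation, so that the norming factor is holomorphic.\<close>
 define A where "A z = exp ((of_real (q h h) + 2 * z * of_real (q h k) + z\<^sup>2 * of_real (q k k)) / 2) * (\<Sum>m. a m * z ^ m)" for z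
 have "A holomorphic_on UNIV"
 proof -
  have "(%z. \<Sum>m. a m * z ^ m) holomorphic_on UNIV"
   unfolding holomorphic_on_def using termdiffs_strong_converges_everywhere[OF summ]
   by (auto simp: field_differentiable_def)
  then show ?thesis unfolding A_def by (intro holomorphic_intros) auto
 qed
 moreover have "A (of_real t) = L (E (%x. h x + t * k x))" for t
 proof -
  have tk: "(%x. 1 * h x + t * k x) \<in> H" by (rule H_lin[OF h k])
  have "q (%x. 1 * h x + t * k x) (%x. 1 * h x + t * k x) = q h h + 2 * t * q h k + t\<^sup>2 * q k k"
   using q_lin(1)[OF h k tk, of 1 t] q_lin(2)[OF h k h, of 1 t] q_lin(2)[OF h k k, of 1 t]
   by (simp add: q_commute[of k h] power2_eq_square algebra_simps)
  then have "E (%x. h x + t * k x) = exp ((q h h + 2 * t * q h k + t\<^sup>2 * q k k) / 2) *\<^sub>R vec (wave (%x. h x + t * k x))"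
   by (simp add: E_def)
  then have "L (E (%x. h x + t * k x)) = of_real (exp ((q h h + 2 * t * q h k + t\<^sup>2 * q k k) / 2)) * (\<Sum>m. a m * of_real t ^ m)"
   using sums_L[of t] by (simp add: L.scaleR scaleR_conv_of_real sums_iff)
  then show ?thesis by (simp add: A_def flip: exp_of_real)
 qed
 ultimately show ?thesis using that by blast
qed

lemma koop_E:
 assumes T: "T \<in> aut M" and h: "h \<in> H" and hT: "(%x. h (T x)) \<in> H"
 shows "koop T (E h) = E (%x. h (T x))"
proof -
 have [measurable]: "h \<in> borel_measurable M" by (rule H_meas[OF h])
 have "q (%x. h (T x)) (%x. h (T x)) = (\<integral>x. h x * h x \<partial>distr M M T)"
  unfolding q_def by (rule integral_distr[symmetric, OF aut_measurable[OF T]]) measurable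
 then have "q (%x. h (T x)) (%x. h (T x)) = q h h" by (simp add: aut_distr[OF T] q_def)
 moreover have "koop T (vec (wave h)) = vec (wave (%x. h (T x)))"
  using koop_vec[OF T sq_wave[OF h]] by (simp add: wave_def[abs_def])
 ultimately show ?thesis
  by (simp add: E_def scaleR_scaleC unitary_scaleC[OF unitary_koop[OF T]])
qed

text \<open>Suppose \<open>\<beta>(Ux, Uy) = \<zeta> \<beta>(x, y)\<close> and put \<open>w(h, g) = \<beta>(E h, E g)\<close>. By Schur's theorem \<open>w\<^sup>n\<close> is the kernel
  of a bounded form, invariant because \<open>\<zeta>\<^sup>n = 1\<close>, which therefore commutes with the second quantisation of
  \<open>K\<^sub>t = (1 - t) + tU\<close>. Thus \<open>w(K\<^sub>t h, g)\<^sup>n = w(h, K\<^sub>t\<^sup>* g)\<^sup>n\<close>, and analyticity in \<open>t\<close> removes the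
  power, so that \<open>w\<close> is genuinely invariant under \<open>U\<close>.\<close>

lemma no_twisted_form:
 assumes T: "T \<in> aut M" and HT: "!!h. h \<in> H ==> (%x. h (T x)) \<in> H" and HT': "!!h. h \<in> H ==> (%x. h (inv T x)) \<in> H"
  and F: "cyclic (koop T) F" and n: "n >= 1" and \<zeta>: "\<zeta> ^ n = 1" "\<zeta> ~= 1"
  and \<beta>: "sesquilinear \<beta>" and \<beta>U: "!!x y. \<beta> (koop T x) (koop T y) = \<zeta> * \<beta> x y"
 shows "\<beta> x y = 0"
proof -
 let ?U = "koop T"
 note U = unitary_koop[OF T]
 have TT: "T (inv T x) = x" "inv T (T x) = x" for x
  using aut_bij[OF T] by (auto simp: bij_is_surj surj_f_inv_f bij_is_inj)
 have UE: "?U (E h) = E (%x. h (T x))" if "h \<in> H" for h by (rule koop_E[OF T that HT[OF that]])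
 interpret \<beta>: bounded_bilinear \<beta> using \<beta> by (rule sesquilinear_bb)
 obtain K0 where K0: "K0 > 0" "!!x y. cmod (\<beta> x y) <= norm x * norm y * K0"
  using \<beta>.pos_bounded by blast
 \<comment> \<open>Scaled to a contraction, as positivity of the block requires.\<close>
 define b where "b x y = \<beta> x y / of_real K0" for x y
 have b_bound: "cmod (b x y) <= norm x * norm y" for x y
  using K0(2)[of x y] K0(1) by (simp add: b_def norm_divide field_simps)
 have b: "sesquilinear b"
  by (rule sesquilinearI[where K=1]) (use b_bound in \<open>auto simp: b_def \<beta>.add_left \<beta>.add_right
    sesquilinear_left[OF \<beta>] sesquilinear_right[OF \<beta>] add_divide_distrib\<close>)
 interpret b: bounded_bilinear b using b by (rule sesquilinear_bb)
 have bU: "b (?U x) (?U y) = \<zeta> * b x y" for x y by (simp add: b_def \<beta>U)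
 define w where "w h g = b (E h) (E g)" for h g
 have wT: "w (%x. h (T x)) (%x. g (T x)) = \<zeta> * w h g" if "h \<in> H" "g \<in> H" for h g
  using bU[of "E h" "E g"] that by (simp add: w_def UE)
 \<comment> \<open>With \<open>sc h\<close> equal to \<open>h\<close> scaled by
   \<open>sqrt n\<close>, the Gram kernel of the vectors \<open>E (sc h)\<close> is the n-th power
   of that of the \<open>E h\<close>. So the kernel of n-th powers of \<open>w\<close> is
   contractive for a total family of the same Hilbert space.\<close>
 define c where "c = sqrt (real n)"
 have c: "c > 0" "c * c = real n" using n by (simp_all add: c_def)
 define sc where "sc h = (%x. c * h x)" for h :: "'a => real"
 have scH: "sc h \<in> H" if "h \<in> H" for h unfolding sc_def by (rule H_scale[OF that])
 have q_sc: "q (sc h) (sc g) = real n * q h g" for h g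
  unfolding sc_def q_scale q_commute[of h] by (simp add: q_scale q_commute[of g] c(2) flip: mult.assoc)
 have "(%h. E (sc h)) ` H = E ` H"
 proof
  show "(%h. E (sc h)) ` H <= E ` H" using scH by auto
  show "E ` H <= (%h. E (sc h)) ` H"
  proof (rule image_subsetI)
   fix h assume h: "h \<in> H"
   have "sc (%x. (1 / c) * h x) = h" using c by (auto simp: sc_def)
   then show "E h \<in> (%h. E (sc h)) ` H" using H_scale[OF h, of "1 / c"] by (metis image_eqI)
  qed
 qed
 then have total': "closure (cspan ((%h. E (sc h)) ` H)) = UNIV" using E_total by simp
 have psd_pow: "psd UNIV (block (%h g. cip (E h) (E g) ^ Suc m) (%h g. w h g ^ Suc m))" for m
 proof (induction m)
  case 0
  show ?case using block_form_psd[OF b b_bound, of E] by (simp add: w_def)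
 next
  case (Suc m)
  from psd_mult[OF block_form_psd[OF b b_bound, of E] Suc] show ?case
   unfolding block_mult by (simp add: w_def)
 qed
 obtain B where B: "sesquilinear B" "!!h g. h \<in> H ==> g \<in> H ==> B (E (sc h)) (E (sc g)) = w h g ^ n"
 proof (rule sesquilinear_from_kernel[OF total', of "%h g. w h g ^ n"])
  fix A and a d :: "('a => real) => complex" assume A: "finite A" "A <= H"
  obtain m where m: "n = Suc m" using n by (cases n) auto
  show "cmod (\<Sum>i\<in>A. \<Sum>j\<in>A. a i * cnj (d j) * w i j ^ n) <= norm (\<Sum>i\<in>A. a i *\<^sub>C E (sc i)) * norm (\<Sum>j\<in>A. d j *\<^sub>C E (sc j))"
  proof (rule block_contractive[OF psd_subset[OF psd_pow[of m, folded m] subset_UNIV] _ A])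
   fix h g assume "h \<in> H" "g \<in> H"
   then show "cip (E h) (E g) ^ n = cip (E (sc h)) (E (sc g))"
    by (simp add: cip_E scH q_sc exp_of_nat_mult flip: of_real_power)
  qed
 qed (rule that, auto)
 have BU: "B (?U x) (?U y) = B x y" for x y
 proof (rule sesquilinear_eq_on_total[OF _ B(1) total', of "%x y. B (?U x) (?U y)"])
  show "sesquilinear (%x y. B (?U x) (?U y))"
   by (rule sesquilinear_compose[OF B(1) unitary_cbounded_linear[OF U] unitary_cbounded_linear[OF U]])
  fix x y assume "x \<in> (%h. E (sc h)) ` H" "y \<in> (%h. E (sc h)) ` H"
  then obtain h g where hg: "h \<in> H" "x = E (sc h)" "g \<in> H" "y = E (sc g)" by auto
  have "?U (E (sc f)) = E (sc (%x. f (T x)))" if "f \<in> H" for f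
   using UE[OF scH[OF that]] by (simp add: sc_def)
  then show "B (?U x) (?U y) = B x y"
   using hg by (simp add: B(2) HT wT power_mult_distrib \<zeta>)
 qed
 \<comment> \<open>\<open>K t\<close> joins the identity to composition with \<open>T\<close>, and
   \<open>K' t\<close> is its adjoint for \<open>q\<close>. The form \<open>\<gamma>\<close> below
   is the second quantisation, contractive for \<open>t\<close> between 0 and 1.\<close>
 define K where "K t h = (%x. h x + t * (h (T x) - h x))" for t and h :: "'a => real"
 define K' where "K' t h = (%x. h x + t * (h (inv T x) - h x))" for t and h :: "'a => real"
 have K_lin: "K t h = (%x. (1 - t) * h x + t * h (T x))" "K' t h = (%x. (1 - t) * h x + t * h (inv T x))" for t h
  by (auto simp: K_def K'_def algebra_simps)
 have KH: "K t h \<in> H" "K' t h \<in> H" if "h \<in> H" for t h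
  unfolding K_lin using that by (auto intro!: H_lin HT HT')
 have q_shift: "q (%x. h (T x)) g = q h (%x. g (inv T x))" if hg: "h \<in> H" "g \<in> H" for h g
 proof -
  have [measurable]: "h \<in> borel_measurable M" "g \<in> borel_measurable M" "(%x. g (inv T x)) \<in> borel_measurable M"
   using hg HT' by (auto intro: H_meas)
  have "(\<integral>x. h x * g (inv T x) \<partial>distr M M T) = (\<integral>x. h (T x) * g (inv T (T x)) \<partial>M)"
   by (rule integral_distr[OF aut_measurable[OF T]]) measurable
  then show ?thesis by (simp add: q_def TT aut_distr[OF T])
 qed
 have qK: "q (K t h) g = (1 - t) * q h g + t * q (%x. h (T x)) g" "q h (K' t g) = (1 - t) * q h g + t * q (%x. h (T x)) g"
  if "h \<in> H" "g \<in> H" for t h g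
  unfolding K_lin using that by (simp_all add: q_lin HT HT' q_shift)
 have power_id: "w (K t h) g ^ n = w h (K' t g) ^ n" if t: "0 <= t" "t <= 1" and hg: "h \<in> H" "g \<in> H" for t h g
 proof -
  \<comment> \<open>The exponent \<open>(1 - t) * q h g + t * q (h \<circ> T) g\<close> is a sum, so
    the kernel is the product of the Gram kernel of \<open>e1\<close> with the form of the Koopman
    operator on \<open>e2\<close>. Both give positive blocks, and their diagonals multiply to the
    Gram kernel of \<open>E\<close>.\<close>
  define e1 e2 where "e1 h = E (%x. sqrt (1 - t) * h x)" and "e2 h = E (%x. sqrt t * h x)" for h
  have ident: "cbounded_linear (%x::l2. x)" by (auto simp: cbounded_linear_def bounded_linear_ident)
  have Uform: "sesquilinear (%x y. cip (?U x) y)"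
   by (rule sesquilinear_compose[OF sesquilinear_cip unitary_cbounded_linear[OF U] ident])
  have Ubound: "cmod (cip (?U x) y) <= norm x * norm y" for x y
   using cip_bound[of "?U x" y] by (simp add: unitary_norm[OF U])
  let ?G = "%h g. cip (e1 h) (e1 g) * cip (e2 h) (e2 g)" and ?c = "%h g. cip (e1 h) (e1 g) * cip (?U (e2 h)) (e2 g)"
  have psd: "psd UNIV (block ?G ?c)"
   using psd_mult[OF block_form_psd[OF sesquilinear_cip cip_bound, of e1] block_form_psd[OF Uform Ubound, of e2]]
   unfolding block_mult .
  have q2: "q (%x. s * h x) (%x. s * g x) = s * s * q h g" for s h g
   by (simp add: q_scale q_commute[of h] mult.assoc)
  have c1: "cip (e1 h) (e1 g) = of_real (exp ((1 - t) * q h g))" "cip (e2 h) (e2 g) = of_real (exp (t * q h g))"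
   "cip (?U (e2 h)) (e2 g) = of_real (exp (t * q (%x. h (T x)) g))" if "h \<in> H" "g \<in> H" for h g
   using that t by (simp_all add: e1_def e2_def UE H_scale HT cip_E q2)
  have cE: "?c h g = cip (E (K t h)) (E g)" "?c h g = cip (E h) (E (K' t g))" if "h \<in> H" "g \<in> H" for h g
   using that by (simp_all add: c1 cip_E KH qK exp_add)
  obtain \<gamma> where \<gamma>: "sesquilinear \<gamma>" "!!h g. h \<in> H ==> g \<in> H ==> \<gamma> (E h) (E g) = ?c h g"
  proof (rule sesquilinear_from_kernel[OF E_total, of ?c])
   fix A and a d :: "('a => real) => complex" assume A: "finite A" "A <= H"
   show "cmod (\<Sum>i\<in>A. \<Sum>j\<in>A. a i * cnj (d j) * ?c i j) <= norm (\<Sum>i\<in>A. a i *\<^sub>C E i) * norm (\<Sum>j\<in>A. d j *\<^sub>C E j)"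
   proof (rule block_contractive[OF psd_subset[OF psd subset_UNIV] _ A])
    fix h g assume "h \<in> H" "g \<in> H"
    then show "?G h g = cip (E h) (E g)"
     by (simp add: c1 cip_E flip: of_real_mult exp_add) (simp add: algebra_simps)
   qed
  qed (rule that, auto)
  have \<gamma>U: "\<gamma> (?U x) (?U y) = \<gamma> x y" for x y
  proof (rule sesquilinear_eq_on_total[OF _ \<gamma>(1) E_total, of "%x y. \<gamma> (?U x) (?U y)"])
   show "sesquilinear (%x y. \<gamma> (?U x) (?U y))"
    by (rule sesquilinear_compose[OF \<gamma>(1) unitary_cbounded_linear[OF U] unitary_cbounded_linear[OF U]])
   fix x y assume "x \<in> E ` H" "y \<in> E ` H"
   then obtain h g where hg: "h \<in> H" "x = E h" "g \<in> H" "y = E g" by auto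
   have "K t (%x. h (T x)) = (%x. K t h (T x))" by (simp add: K_def)
   then have "\<gamma> (?U x) (?U y) = cip (?U (E (K t h))) (?U (E g))"
    using hg KH(1)[OF hg(1), of t] by (simp only: UE \<gamma>(2) HT cE(1))
   also have "... = \<gamma> x y" using hg by (simp only: unitary_cip[OF U] \<gamma>(2) cE(1))
   finally show "\<gamma> (?U x) (?U y) = \<gamma> x y" .
  qed
  have left: "\<gamma> (E h) z = cip (E (K t h)) z" if "h \<in> H" for h z
  proof -
   have "cnj (\<gamma> (E h) z) = cnj (cip (E (K t h)) z)"
    by (rule cbounded_linear_eq_on_total[OF cbounded_linear_sesquilinear_cnj[OF \<gamma>(1)] cbounded_linear_sesquilinear_cnj[OF sesquilinear_cip] E_total])
     (use that in \<open>auto simp only: \<gamma>(2) cE(1) image_iff\<close>)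
   then show ?thesis by simp
  qed
  have right: "\<gamma> z (E g) = cip z (E (K' t g))" if "g \<in> H" for g z
   by (rule cbounded_linear_eq_on_total[OF cbounded_linear_sesquilinear[OF \<gamma>(1)] cbounded_linear_sesquilinear[OF sesquilinear_cip] E_total])
    (use that in \<open>auto simp only: \<gamma>(2) cE(2) image_iff\<close>)
  \<comment> \<open>Commutation of \<open>B\<close> with the second quantisation of
    \<open>K t\<close>, tested on the scaled exponential vectors.\<close>
  have "B (E (K t (sc h))) (E (sc g)) = B (E (sc h)) (E (K' t (sc g)))"
   by (rule form_commute[OF U F B(1) BU \<gamma>(1) \<gamma>U left[OF scH[OF hg(1)]] right[OF scH[OF hg(2)]]])
  moreover have "K t (sc h) = sc (K t h)" "K' t (sc g) = sc (K' t g)"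
   by (auto simp: K_def K'_def sc_def algebra_simps)
  ultimately show ?thesis using B(2) hg KH by simp
 qed
 have bl: "bounded_linear (%v. b v z)" "bounded_linear (%v. b z v)" for z
  by (rule b.bounded_linear_left, rule b.bounded_linear_right)
 have dH: "(%x. f x - g x) \<in> H" if "f \<in> H" "g \<in> H" for f g
  using H_lin[OF that, of 1 "-1"] by simp
 \<comment> \<open>If \<open>w h g\<close> is nonzero, the n-th root can be extracted from
   \<open>t = 0\<close> on, and at \<open>t = 1\<close> it gives
   \<open>w (h \<circ> T) g = w h (g \<circ> inv T)\<close>. But the left side is also
   \<open>\<zeta>\<close> times the right side, so both vanish.\<close>
 have dichotomy: "w h g = 0 \<or> w h (%x. g (inv T x)) = 0" if hg: "h \<in> H" "g \<in> H" for h g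
 proof (rule disjCI)
  assume "w h (%x. g (inv T x)) ~= 0"
  show "w h g = 0"
  proof (rule ccontr)
   assume ne: "w h g ~= 0"
   obtain A1 where A1: "A1 holomorphic_on UNIV" "!!t::real. A1 (of_real t) = w (K t h) g"
    using E_line_entire[OF hg(1) dH[OF HT[OF hg(1)] hg(1)] bl(1)[of "E g"]] unfolding w_def K_def by metis
   obtain A2 where A2: "A2 holomorphic_on UNIV" "!!t::real. A2 (of_real t) = w h (K' t g)"
    using E_line_entire[OF hg(2) dH[OF HT'[OF hg(2)] hg(2)] bl(2)[of "E h"]] unfolding w_def K'_def by metis
   have "A1 (of_real 1) = A2 (of_real 1)"
   proof (rule nth_power_identity[OF A1(1) A2(1) n])
    show "A1 (of_real t) ^ n = A2 (of_real t) ^ n" if "0 <= t" "t <= 1" for t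
     using power_id[OF that hg] by (simp add: A1 A2)
    have "A1 (of_real 0) = w h g" "A2 (of_real 0) = w h g"
     unfolding A1(2) A2(2) by (simp_all add: K_def K'_def)
    then show "A1 0 = A2 0" "A2 0 ~= 0" using ne by simp_all
   qed
   then have "w (%x. h (T x)) g = w h (%x. g (inv T x))"
    unfolding A1(2) A2(2) by (simp add: K_def K'_def)
   moreover have "w (%x. h (T x)) g = \<zeta> * w h (%x. g (inv T x))"
    using wT[OF hg(1) HT'[OF hg(2)]] by (simp add: TT)
   ultimately show False using \<zeta>(2) \<open>w h (%x. g (inv T x)) ~= 0\<close> by simp
  qed
 qed
 \<comment> \<open>The dichotomy is applied along the line from \<open>g\<close> to
   \<open>g \<circ> T\<close>: near 0 the function \<open>C\<close> is nonzero, so \<open>D\<close>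
   vanishes there and hence everywhere; but the value of \<open>D\<close> at 1 is
   \<open>w h g\<close>.\<close>
 have w0: "w h g = 0" if hg: "h \<in> H" "g \<in> H" for h g
 proof (rule ccontr)
  assume ne: "w h g ~= 0"
  let ?gT = "%x. g (T x)" and ?gI = "%x. g (inv T x)"
  obtain C where C: "C holomorphic_on UNIV" "!!t::real. C (of_real t) = w h (%x. g x + t * (?gT x - g x))"
   using E_line_entire[OF hg(2) dH[OF HT[OF hg(2)] hg(2)] bl(2)[of "E h"]] unfolding w_def by metis
  obtain D where D: "D holomorphic_on UNIV" "!!t::real. D (of_real t) = w h (%x. ?gI x + t * (g x - ?gI x))"
   using E_line_entire[OF HT'[OF hg(2)] dH[OF hg(2) HT'[OF hg(2)]] bl(2)[of "E h"]] unfolding w_def by metis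
  have CD: "C (of_real t) = 0 \<or> D (of_real t) = 0" for t :: real
  proof -
   have "(%x. g x + t * (?gT x - g x)) \<in> H"
    using H_lin[OF hg(2) dH[OF HT[OF hg(2)] hg(2)], of 1 t] by simp
   from dichotomy[OF hg(1) this] show ?thesis unfolding C(2) D(2) by (simp add: TT)
  qed
  have contC: "continuous_on UNIV C" using C(1) by (rule holomorphic_on_imp_continuous_on)
  have "continuous_on UNIV (%t::real. C (of_real t))"
   by (rule continuous_on_compose2[OF contC continuous_on_of_real[OF continuous_on_id]]) simp
  then have op: "open {t::real. C (of_real t) ~= 0}" by (rule open_Collect_neq[OF _ continuous_on_const])
  have "C (of_real 0) ~= 0" using ne unfolding C(2) by simp
  then have "0 \<in> {t::real. C (of_real t) ~= 0}" by simp
  then obtain d where d: "d > 0" "!!t. dist t 0 < d ==> C (complex_of_real t) ~= 0"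
   using bspec[OF op[unfolded open_dist]] by blast
  define \<delta> where "\<delta> = d / 2"
  have D0: "D (of_real t) = 0" if "0 <= t" "t <= \<delta>" for t
   using CD[of t] d(2)[of t] d(1) that by (auto simp: \<delta>_def)
  \<comment> \<open>The identity theorem is taken from \<open>nth_power_identity\<close> with
    exponent 1: adding 1 provides the nonzero initial value, and scaling by \<open>\<delta>\<close>
    fills the unit interval.\<close>
  have "1 + D (of_real \<delta> * of_real (1 / \<delta>)) = 1"
  proof (rule nth_power_identity[where A="%z. 1 + D (of_real \<delta> * z)" and B="%z. 1" and n=1])
   have "(%z. D (of_real \<delta> * z)) holomorphic_on UNIV"
    using holomorphic_on_compose_gen[of "%z. of_real \<delta> * z" UNIV D UNIV] D(1)
    by (auto simp: o_def intro!: holomorphic_intros)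
   then show "(%z. 1 + D (of_real \<delta> * z)) holomorphic_on UNIV" by (intro holomorphic_intros)
   show "(1 + D (of_real \<delta> * of_real t)) ^ 1 = 1 ^ 1" if "0 <= t" "t <= 1" for t :: real
    using D0[of "\<delta> * t"] that d(1) by (simp add: \<delta>_def)
   show "1 + D (of_real \<delta> * 0) = 1" using D0[of 0] d(1) by (simp add: \<delta>_def)
  qed auto
  then have "D (of_real 1) = 0" using d(1) by (simp add: \<delta>_def flip: of_real_mult)
  then show False using ne unfolding D(2) by simp
 qed
 have "b x y = (%x y. 0) x y"
 proof (rule sesquilinear_eq_on_total[OF b _ E_total])
  show "sesquilinear (%x y. 0)" by (rule sesquilinearI[where K=0]) auto
  show "b x y = 0" if "x \<in> E ` H" "y \<in> E ` H" for x y
   using that w0 by (auto simp: w_def)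
 qed
 then show ?thesis using K0(1) by (simp add: b_def)
qed

end

text \<open>The same vector stays cyclic for every power: \<open>no_twisted_form\<close> supplies
  the hypothesis of \<open>cyclic_power\<close>.\<close>

lemma (in coordinates) gaussian_simple_spectrum_power:
 assumes G: "gaussian_system M T" and ss: "simple_spectrum M T" and n: "n >= 1"
 shows "simple_spectrum M (T ^^ n)"
proof -
 have T: "T \<in> aut M" using G by (simp add: gaussian_system_def)
 obtain H where H: "(%x. 0) \<in> H" "\<forall>f\<in>H. \<forall>g\<in>H. (%x. f x + g x) \<in> H" "\<forall>f\<in>H. \<forall>c::real. (%x. c * f x) \<in> H"
   "\<forall>f\<in>H. gaussian_rv M f" "\<forall>f\<in>H. f \<circ> T \<in> H & f \<circ> inv T \<in> H"
   "\<forall>A\<in>sets M. \<exists>A' \<in> sigma_sets (space M) (\<Union>f\<in>H. {f -` U \<inter> space M | U. U \<in> sets borel}). emeasure M (symdiff A A') = 0"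
  using G unfolding gaussian_system_def by blast
 interpret gaussian_space M \<phi> \<kappa> H
  by unfold_locales (use H in blast)+
 obtain F where F: "cyclic (koop T) F" using ss simple_spectrum_iff_cyclic[OF T] by blast
 have "cyclic (koop T ^^ n) F"
 proof (rule cyclic_power[OF unitary_koop[OF T] F n])
  fix \<zeta> \<beta> x y assume "\<zeta> ^ n = 1" "\<zeta> ~= 1" "sesquilinear \<beta>" "!!x y. \<beta> (koop T x) (koop T y) = \<zeta> * \<beta> x y"
  then show "\<beta> x y = 0"
   using H(5) by (intro no_twisted_form[OF T _ _ F n]) (auto simp: comp_def)
 qed
 then show ?thesis
  using simple_spectrum_iff_cyclic[OF aut_funpow[OF T]] by (auto simp: koop_funpow[OF T])
qed

section \<open>The weak topology is a Baire topology\<close>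

lemma norm_diff_three: "norm (a - b) <= norm (c - a) + norm (c - d) + norm (d - b)" for a b c d :: "'a::real_normed_vector"
 by norm

lemma closure_of_meets: "x \<in> X closure_of A ==> openin X W ==> x \<in> W ==> EX y. y \<in> A & y \<in> W"
 by (auto simp: in_closure_of)

text \<open>\<open>aut M\<close> asks for true bijections. The maps are kept on the set of full
  measure where all their iterates satisfy both identities, which is invariant under both, and are
  replaced by the identity elsewhere.\<close>

lemma (in std_space) aut_of_AE_inverse:
 assumes S [measurable]: "S \<in> M \<rightarrow>\<^sub>M M" and S' [measurable]: "S' \<in> M \<rightarrow>\<^sub>M M"
  and dS: "distr M M S = M" and dS': "distr M M S' = M"
  and inv1: "AE x in M. S' (S x) = x" and inv2: "AE x in M. S (S' x) = x"
 obtains T where "T \<in> aut M" "AE x in M. T x = S x" "AE x in M. inv T x = S' x"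
proof -
 define good where "good x \<longleftrightarrow> S' (S x) = x & S (S' x) = x" for x
 define Z where "Z = {x. (ALL n. good ((S ^^ n) x)) & (ALL n. good ((S' ^^ n) x))}"
 have good: "AE x in M. good x" using inv1 inv2 by (simp add: good_def)
 have [measurable]: "S ^^ n \<in> M \<rightarrow>\<^sub>M M" "S' ^^ n \<in> M \<rightarrow>\<^sub>M M" for n by measurable
 have iter: "AE x in M. P ((R ^^ n) x)"
  if "R \<in> M \<rightarrow>\<^sub>M M" "distr M M R = M" "AE x in M. P x" for R n and P :: "'a => bool"
 proof (induction n)
  case (Suc n)
  then show ?case using distr_AE[OF that(1,2) Suc] by (simp add: funpow_swap1)
 qed (use that in simp)
 have Z: "AE x in M. x \<in> Z"
  unfolding Z_def by (simp add: AE_all_countable iter[OF S dS good] iter[OF S' dS' good])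
 have Zset: "Z \<in> sets M"
 proof -
  have "{x \<in> space M. good x} \<in> sets M"
  proof -
   have mm: "(%x. S' (S x)) \<in> M \<rightarrow>\<^sub>M M" "(%x. S (S' x)) \<in> M \<rightarrow>\<^sub>M M" by measurable
   have "Measurable.pred M (%x. S' (S x) = x)" "Measurable.pred M (%x. S (S' x) = x)"
    by (rule pred_eq_metric; use mm in \<open>simp cong: measurable_cong_sets\<close>)+
   then show ?thesis unfolding good_def by measurable
  qed
  then have [measurable]: "Measurable.pred M good" by (simp add: pred_def)
  have "{x \<in> space M. (ALL n. good ((S ^^ n) x)) & (ALL n. good ((S' ^^ n) x))} \<in> sets M"
   by measurable
  then show ?thesis by (simp add: Z_def)
 qed
 have g0: "good x" if "x \<in> Z" for x
 proof -
  have "good ((S ^^ 0) x)" using that unfolding Z_def by blast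
  then show ?thesis by simp
 qed
 have SZ: "S x \<in> Z" if "x \<in> Z" for x
 proof -
  have "good ((S ^^ n) (S x))" for n
  proof -
   have "good ((S ^^ Suc n) x)" using that unfolding Z_def by blast
   then show ?thesis by (simp add: funpow_swap1)
  qed
  moreover have "good ((S' ^^ n) (S x))" for n
  proof (cases n)
   case 0
   have "good ((S ^^ 1) x)" using that unfolding Z_def by blast
   then show ?thesis using 0 by simp
  next
   case (Suc m)
   have "good ((S' ^^ m) x)" using that unfolding Z_def by blast
   then show ?thesis using Suc g0[OF that] by (simp add: good_def funpow_swap1 del: funpow.simps) (simp add: funpow_swap1 good_def)
  qed
  ultimately show ?thesis by (simp add: Z_def)
 qed
 have S'Z: "S' x \<in> Z" if "x \<in> Z" for x
 proof -
  have "good ((S' ^^ n) (S' x))" for n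
  proof -
   have "good ((S' ^^ Suc n) x)" using that unfolding Z_def by blast
   then show ?thesis by (simp add: funpow_swap1)
  qed
  moreover have "good ((S ^^ n) (S' x))" for n
  proof (cases n)
   case 0
   have "good ((S' ^^ 1) x)" using that unfolding Z_def by blast
   then show ?thesis using 0 by simp
  next
   case (Suc m)
   have "good ((S ^^ m) x)" using that unfolding Z_def by blast
   then show ?thesis using Suc g0[OF that] by (simp add: good_def funpow_swap1 del: funpow.simps) (simp add: funpow_swap1 good_def)
  qed
  ultimately show ?thesis by (simp add: Z_def)
 qed
 define T where "T x = (if x \<in> Z then S x else x)" for x
 define T' where "T' x = (if x \<in> Z then S' x else x)" for x
 have TT: "T' (T x) = x" "T (T' x) = x" for x
  using SZ[of x] S'Z[of x] g0[of x] by (auto simp: T_def T'_def good_def)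
 then have bij: "bij T" and invT: "inv T = T'"
  by (metis o_bij[of T' T] comp_def id_def ext, intro inv_equality, auto)
 have [measurable]: "T \<in> M \<rightarrow>\<^sub>M M" "T' \<in> M \<rightarrow>\<^sub>M M"
  unfolding T_def[abs_def] T'_def[abs_def] by (intro measurable_If_set; use Zset in simp)+
 have AT: "AE x in M. T x = S x" and AT': "AE x in M. T' x = S' x"
  using Z by (auto simp: T_def T'_def elim: eventually_mono)
 have "distr M M T = distr M M S" by (rule distr_cong_AE) (use AT in auto)
 then have "T \<in> aut M" using bij invT dS by (simp add: aut_def)
 with AT AT' show thesis using that invT by simp
qed

context coordinates
begin

text \<open>Stated without invertibility, because these facts are applied to limit maps that are not
  yet known to be invertible.\<close>

lemma
 assumes T: "T \<in> M \<rightarrow>\<^sub>M M" "distr M M T = M"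
 shows koop_mp_add: "koop T (v + w) = koop T v + koop T w"
  and koop_mp_scale: "koop T (c *\<^sub>C v) = c *\<^sub>C koop T v"
  and koop_mp_diff: "koop T (v - w) = koop T v - koop T w"
  and norm_koop_mp: "norm (koop T v) = norm v"
proof -
 obtain f where f: "sq f" "vec f = v" by (rule vec_surj)
 obtain g where g: "sq g" "vec g = w" by (rule vec_surj)
 show "koop T (v + w) = koop T v + koop T w"
  unfolding f(2)[symmetric] g(2)[symmetric] using f(1) g(1)
  by (simp add: vec_add[symmetric] koop_mp[OF T] square_integrable_add sq_mp[OF T])
 show "koop T (v - w) = koop T v - koop T w"
  unfolding f(2)[symmetric] g(2)[symmetric] using f(1) g(1)
  by (simp add: vec_diff[symmetric] koop_mp[OF T] square_integrable_diff sq_mp[OF T])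
 show "koop T (c *\<^sub>C v) = c *\<^sub>C koop T v"
  unfolding f(2)[symmetric] using f(1)
  by (simp add: vec_scale[symmetric] koop_mp[OF T] square_integrable_scale sq_mp[OF T])
 note [measurable] = square_integrable_measurable[OF f(1)] T(1)
 have "(norm (koop T (vec f)))\<^sup>2 = (\<integral>x. (cmod (f (T x)))\<^sup>2 \<partial>M)"
  using f(1) by (simp add: koop_mp[OF T] norm_vec sq_mp[OF T])
 also have "... = (\<integral>x. (cmod (f x))\<^sup>2 \<partial>distr M M T)"
  by (rule integral_distr[symmetric]) measurable
 also have "... = (norm (vec f))\<^sup>2" using f(1) by (simp add: T(2) norm_vec)
 finally show "norm (koop T v) = norm v" by (simp add: f)
qed

lemma koop_ind_mp: "T \<in> M \<rightarrow>\<^sub>M M ==> distr M M T = M ==> A \<in> sets M ==> koop T (ind A) = ind (T -` A)"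
proof -
 assume T: "T \<in> M \<rightarrow>\<^sub>M M" "distr M M T = M" "A \<in> sets M"
 have "(%x. indicator A (T x)) = (indicator (T -` A) :: 'a => complex)" by (auto simp: indicator_def)
 then show ?thesis using T by (simp add: koop_mp sq_indicator)
qed

lemma ind_tendsto_iff:
 assumes "!!n. A n \<in> sets M" "B \<in> sets M"
 shows "(%n. ind (A n)) \<longlonglongrightarrow> ind B \<longleftrightarrow> (%n. prob (symdiff (A n) B)) \<longlonglongrightarrow> 0"
proof -
 have "prob (symdiff (A n) B) = (norm (ind (A n) - ind B))\<^sup>2" for n
  using assms by (simp add: norm_ind_diff)
 moreover have "(%n. (norm (ind (A n) - ind B))\<^sup>2) \<longlonglongrightarrow> 0 \<longleftrightarrow> (%n. norm (ind (A n) - ind B)) \<longlonglongrightarrow> 0"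
  by (simp add: power_tendsto_0_iff)
 ultimately show ?thesis by (simp add: tendsto_norm_zero_iff LIM_zero_iff)
qed

text \<open>Koopman operators are linear isometries, so the vectors on which they converge form a
  closed subspace.\<close>

lemma koop_tendsto_of_cuts:
 assumes S: "!!n. S n \<in> M \<rightarrow>\<^sub>M M" "!!n. distr M M (S n) = M" and T: "T \<in> M \<rightarrow>\<^sub>M M" "distr M M T = M"
  and cuts: "!!q. (%n. koop (S n) (ind {x. \<phi> x < q})) \<longlonglongrightarrow> koop T (ind {x. \<phi> x < q})"
 shows "(%n. koop (S n) v) \<longlonglongrightarrow> koop T v"
proof -
 define W where "W = {v. (%n. koop (S n) v) \<longlonglongrightarrow> koop T v}"
 have sub: "csubspace W"
 proof (rule complex_vs.subspaceI)
  have "koop R 0 = 0" if "R \<in> M \<rightarrow>\<^sub>M M" "distr M M R = M" for R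
   using koop_mp_diff[OF that, of 0 0] by simp
  then show "0 \<in> W" using S T by (simp add: W_def)
  show "x + y \<in> W" if "x \<in> W" "y \<in> W" for x y
   using that S T by (auto simp: W_def koop_mp_add intro: tendsto_add)
  show "c *\<^sub>C x \<in> W" if "x \<in> W" for c x
  proof -
   have "(%n. koop (S n) x - koop T x) \<longlonglongrightarrow> 0" using that by (simp add: W_def LIM_zero_iff)
   then have "(%n. cmod c * norm (koop (S n) x - koop T x)) \<longlonglongrightarrow> cmod c * 0"
    by (intro tendsto_mult tendsto_const) (simp add: tendsto_norm_zero_iff)
   then have "(%n. norm (koop (S n) (c *\<^sub>C x - 0) - koop T (c *\<^sub>C x))) \<longlonglongrightarrow> 0"
    using S T by (simp add: koop_mp_scale norm_scaleC[symmetric] complex_vs.scale_right_diff_distrib)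
   then show ?thesis by (simp add: W_def tendsto_norm_zero_iff LIM_zero_iff)
  qed
 qed
 have cl: "closed W"
 proof (rule closed_sequential_limits[THEN iffD2], intro allI impI, elim conjE)
  fix w v assume w: "ALL k. w k \<in> W" "w \<longlonglongrightarrow> v"
  show "v \<in> W"
   unfolding W_def mem_Collect_eq
  proof (rule metric_LIMSEQ_I)
   fix e :: real assume e: "e > 0"
   then obtain k where k: "norm (w k - v) < e / 3"
    using w(2) by (metis LIMSEQ_def dist_norm divide_pos_pos order_refl zero_less_numeral)
   have "(%n. koop (S n) (w k)) \<longlonglongrightarrow> koop T (w k)" using w(1) by (simp add: W_def)
   then obtain N where N: "!!n. n >= N ==> norm (koop (S n) (w k) - koop T (w k)) < e / 3"
    using e by (metis LIMSEQ_def dist_norm divide_pos_pos zero_less_numeral)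
   have "dist (koop (S n) v) (koop T v) < e" if "n >= N" for n
   proof -
    have "norm (koop (S n) (w k) - koop (S n) v) = norm (w k - v)"
     "norm (koop T (w k) - koop T v) = norm (w k - v)"
     using S T by (simp_all add: koop_mp_diff[symmetric] norm_koop_mp)
    then have "norm (koop (S n) v - koop T v) <= norm (w k - v) + norm (koop (S n) (w k) - koop T (w k)) + norm (w k - v)"
     using norm_diff_three[of "koop (S n) v" "koop T v" "koop (S n) (w k)" "koop T (w k)"] by simp
    with N[OF that] k show ?thesis by (simp add: dist_norm)
   qed
   then show "EX N. \<forall>n\<ge>N. dist (koop (S n) v) (koop T v) < e" by blast
  qed
 qed
 have "ind A \<in> W" if "A \<in> sets M" for A
  by (rule phi_cuts_total[OF cl sub _ that]) (simp add: W_def cuts)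
 then have "cspan (ind ` sets M) <= W" by (intro complex_vs.span_minimal sub) auto
 then have "closure (cspan (ind ` sets M)) <= W" by (rule closure_minimal) (rule cl)
 then show ?thesis unfolding indicators_total by (auto simp: W_def)
qed

lemma sq_unif:
 assumes f [measurable]: "f \<in> borel_measurable M" and d: "distr M borel f = unif"
 shows "sq (%x. complex_of_real (f x))"
 unfolding square_integrable_def
proof
 have "AE u in distr M borel f. 0 < u & u < 1" unfolding d by (rule AE_unif)
 then have "AE x in M. 0 < f x & f x < 1" by (subst (asm) AE_distr_iff) auto
 then have "AE x in M. norm ((cmod (complex_of_real (f x)))\<^sup>2) <= 1"
  by eventually_elim (simp add: abs_square_le_1)
 then show "integrable M (%x. (cmod (complex_of_real (f x)))\<^sup>2)"
  by (intro integrable_const_bound[of _ 1]) auto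
qed measurable

text \<open>Norm convergence does not control cuts in general. Here it does, since the law of
  \<open>f n\<close> is uniform and gives mass at most \<open>2 * \<eta>\<close> to a strip around
  \<open>q\<close>; outside the strip a disagreement needs \<open>f n\<close> and \<open>g\<close>
  to differ by at least \<open>\<eta>\<close>, which Chebyshev's inequality bounds.\<close>

lemma cut_tendsto:
 assumes f [measurable]: "!!n. f n \<in> borel_measurable M" and d: "!!n. distr M borel (f n) = unif"
  and g [measurable]: "g \<in> borel_measurable M" and sq: "sq (%x. complex_of_real (g x))"
  and lim: "(%n. vec (%x. complex_of_real (f n x))) \<longlonglongrightarrow> vec (%x. complex_of_real (g x))"
 shows "(%n. ind {x. f n x < q}) \<longlonglongrightarrow> ind {x. g x < q}"
proof -
 have m [measurable]: "{x. f n x < q} \<in> sets M" "{x. g x < q} \<in> sets M" for n q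
  using measurable_sets[OF f, of "{..<q}" n] measurable_sets[OF g, of "{..<q}"] by (simp_all add: vimage_def)
 define I where "I n = (norm (vec (%x. complex_of_real (f n x)) - vec (%x. complex_of_real (g x))))\<^sup>2" for n
 have I0: "I \<longlonglongrightarrow> 0"
  unfolding I_def power_tendsto_0_iff[of 2, simplified] using lim by (simp add: tendsto_norm_zero_iff LIM_zero_iff)
 have bound: "prob (symdiff {x. f n x < q} {x. g x < q}) <= 2 * \<eta> + I n / \<eta>\<^sup>2" if \<eta>: "\<eta> > 0" for n \<eta>
 proof -
  have sqd: "sq (%x. complex_of_real (f n x) - complex_of_real (g x))"
   by (intro square_integrable_diff sq sq_unif f d)
  then have int: "integrable M (%x. (f n x - g x)\<^sup>2)"
   by (simp add: square_integrable_def flip: of_real_diff)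
  have I: "I n = (\<integral>x. (f n x - g x)\<^sup>2 \<partial>M)"
   unfolding I_def by (subst norm_vec_diff) (auto intro: sq sq_unif f d simp flip: of_real_diff)
  let ?A = "{x. q - \<eta> <= f n x & f n x < q + \<eta>}" and ?B = "{x. \<eta>\<^sup>2 <= (f n x - g x)\<^sup>2}"
  have AB: "?A \<in> sets M" "?B \<in> sets M"
  proof -
   have "{x \<in> space M. q - \<eta> <= f n x & f n x < q + \<eta>} \<in> sets M" "{x \<in> space M. \<eta>\<^sup>2 <= (f n x - g x)\<^sup>2} \<in> sets M"
    by measurable
   then show "?A \<in> sets M" "?B \<in> sets M" by simp_all
  qed
  have "symdiff {x. f n x < q} {x. g x < q} <= ?A \<union> ?B"
  proof
   fix x assume x: "x \<in> symdiff {x. f n x < q} {x. g x < q}"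
   show "x \<in> ?A \<union> ?B"
   proof (cases "\<eta> <= \<bar>f n x - g x\<bar>")
    case True
    then show ?thesis using \<eta> power_mono[of \<eta> "\<bar>f n x - g x\<bar>" 2] by simp
   qed (use x in \<open>auto simp: symdiff_def\<close>)
  qed
  then have "prob (symdiff {x. f n x < q} {x. g x < q}) <= prob (?A \<union> ?B)"
   using AB by (intro finite_measure_mono) auto
  also have "... <= prob ?A + prob ?B" using AB by (intro measure_Un_le) auto
  also have "prob ?A <= 2 * \<eta>"
  proof -
   have "emeasure M ?A = emeasure (distr M borel (f n)) {q - \<eta>..<q + \<eta>}"
    by (subst emeasure_distr) (auto intro!: arg_cong[where f="emeasure M"])
   also have "... <= emeasure lborel {q - \<eta>..<q + \<eta>}"
    unfolding d by (subst emeasure_unif) (auto intro!: emeasure_mono)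
   also have "... = ennreal (2 * \<eta>)" using \<eta> by simp
   finally show ?thesis using \<eta> by (simp add: emeasure_eq_measure ennreal_le_iff)
  qed
  also have "prob ?B <= I n / \<eta>\<^sup>2"
   unfolding I using integral_Markov_inequality_measure[OF int, of "{}" "\<eta>\<^sup>2"] \<eta> by simp
  finally show ?thesis by simp
 qed
 have "(%n. prob (symdiff {x. f n x < q} {x. g x < q})) \<longlonglongrightarrow> 0"
 proof (rule metric_LIMSEQ_I)
  fix e :: real assume e: "e > 0"
  \<comment> \<open>Strip and Chebyshev term together stay below \<open>3 * \<eta>\<close>.\<close>
  define \<eta> where "\<eta> = e / 4"
  have \<eta>: "\<eta> > 0" using e by (simp add: \<eta>_def)
  then obtain N where N: "!!n. n >= N ==> \<bar>I n\<bar> < \<eta> * \<eta>\<^sup>2"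
   using I0 by (metis LIMSEQ_def dist_real_def diff_zero mult_pos_pos zero_less_power)
  have "prob (symdiff {x. f n x < q} {x. g x < q}) < e" if "n >= N" for n
  proof -
   have "I n / \<eta>\<^sup>2 < \<eta>" using N[OF that] \<eta> by (simp add: divide_less_eq)
   moreover have "e = 4 * \<eta>" by (simp add: \<eta>_def)
   ultimately show ?thesis using bound[OF \<eta>, of n] \<eta> by linarith
  qed
  then show "EX N. \<forall>n\<ge>N. dist (prob (symdiff {x. f n x < q} {x. g x < q})) 0 < e" by (auto simp: dist_real_def)
 qed
 then show ?thesis by (simp add: ind_tendsto_iff)
qed

text \<open>The coordinate as a vector. Its cuts are total, so its image under a Koopman operator
  determines the map almost everywhere.\<close>

definition phi_vec :: l2 where
 "phi_vec = vec (%x. complex_of_real (\<phi> x))"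

lemma sq_phi: "sq (%x. complex_of_real (\<phi> x))"
 by (intro sq_unif distr_phi) simp

lemma distr_phi_mp:
 assumes "T \<in> M \<rightarrow>\<^sub>M M" "distr M M T = M"
 shows "distr M borel (%x. \<phi> (T x)) = unif"
proof -
 have "distr M borel (\<phi> \<circ> T) = distr (distr M M T) borel \<phi>"
  by (rule distr_distr[symmetric]) (use assms in auto)
 then show ?thesis by (simp add: assms distr_phi o_def)
qed

lemma koop_tendsto:
 assumes S: "!!n. S n \<in> M \<rightarrow>\<^sub>M M" "!!n. distr M M (S n) = M" and T: "T \<in> M \<rightarrow>\<^sub>M M" "distr M M T = M"
  and lim: "(%n. koop (S n) phi_vec) \<longlonglongrightarrow> koop T phi_vec"
 shows "(%n. koop (S n) v) \<longlonglongrightarrow> koop T v"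
proof (rule koop_tendsto_of_cuts[OF S T])
 fix q
 have [measurable]: "(%x. \<phi> (S n x)) \<in> borel_measurable M" "(%x. \<phi> (T x)) \<in> borel_measurable M" for n
  using S(1)[of n] T(1) by measurable
 have D: "{x. \<phi> x < q} \<in> sets M" using measurable_sets[OF phi_meas', of "{..<q}"] by (simp add: vimage_def)
 have "(%n. ind {x. \<phi> (S n x) < q}) \<longlonglongrightarrow> ind {x. \<phi> (T x) < q}"
 proof (rule cut_tendsto)
  show "sq (%x. complex_of_real (\<phi> (T x)))" by (intro sq_unif distr_phi_mp T) simp
  show "(%n. vec (%x. complex_of_real (\<phi> (S n x)))) \<longlonglongrightarrow> vec (%x. complex_of_real (\<phi> (T x)))"
   using lim S T by (simp add: phi_vec_def koop_mp sq_phi)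
 qed (simp_all add: distr_phi_mp S T)
 then show "(%n. koop (S n) (ind {x. \<phi> x < q})) \<longlonglongrightarrow> koop T (ind {x. \<phi> x < q})"
  using S T D by (simp add: koop_ind_mp vimage_def)
qed

text \<open>Both components are needed for a closed image: a limit of the first one alone may come
  from a non-invertible map.\<close>

definition emb :: "('a => 'a) => l2 \<times> l2" where
 "emb S = (koop S phi_vec, koop (inv S) phi_vec)"

lemma emb_tendsto:
 assumes S: "!!n. S n \<in> aut M" and T: "T \<in> aut M" and lim: "(%n. emb (S n)) \<longlonglongrightarrow> emb T"
 shows "(%n. koop (S n) v) \<longlonglongrightarrow> koop T v" "(%n. koop (inv (S n)) v) \<longlonglongrightarrow> koop (inv T) v"
proof -
 have "(%n. koop (S n) phi_vec) \<longlonglongrightarrow> koop T phi_vec" "(%n. koop (inv (S n)) phi_vec) \<longlonglongrightarrow> koop (inv T) phi_vec"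
  using tendsto_fst[OF lim] tendsto_snd[OF lim] by (simp_all add: emb_def)
 then show "(%n. koop (S n) v) \<longlonglongrightarrow> koop T v" "(%n. koop (inv (S n)) v) \<longlonglongrightarrow> koop (inv T) v"
  using S T by (auto intro!: koop_tendsto aut_measurable aut_distr aut_inv)
qed

text \<open>A vector is close to a simple function, and the images of the finitely many indicators
  in it are controlled by a basic weak neighbourhood. The approximation error is the same for all
  maps because the operators are isometric.\<close>

lemma koop_near:
 assumes S: "S \<in> aut M" and e: "e > 0"
 obtains As d where "finite As" "As <= sets M" "d > 0"
  "!!S'. S' \<in> aut M ==> (!!A. A \<in> As ==> prob (symdiff (S' -` A) (S -` A)) < d) ==> norm (koop S' v - koop S v) < e"
proof -
 have "v \<in> closure (cspan (ind ` sets M))" using indicators_total by blast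
 then obtain z where z: "z \<in> cspan (ind ` sets M)" "dist z v < e / 3"
  using e unfolding closure_approachable by (metis divide_pos_pos zero_less_numeral)
 obtain As c where As: "finite As" "As <= sets M" "z = (\<Sum>A\<in>As. c A *\<^sub>C ind A)"
  using z(1) by (rule span_range_explicit)
 define K where "K = 1 + (\<Sum>A\<in>As. cmod (c A))"
 have K: "K >= 1" by (simp add: K_def sum_nonneg)
 define r where "r = e / (3 * K)"
 have r: "r > 0" using e K by (simp add: r_def)
 show thesis
 proof (rule that[OF As(1,2), of "r\<^sup>2"])
  show "r\<^sup>2 > 0" using r by simp
  fix S' assume S': "S' \<in> aut M" and near: "!!A. A \<in> As ==> prob (symdiff (S' -` A) (S -` A)) < r\<^sup>2"
  note mp = aut_measurable[OF S] aut_distr[OF S] and mp' = aut_measurable[OF S'] aut_distr[OF S']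
  have sums: "koop R z = (\<Sum>A\<in>As. c A *\<^sub>C koop R (ind A))" if R: "R \<in> M \<rightarrow>\<^sub>M M" "distr M M R = M" for R
   unfolding As(3) using As(1)
  proof (induction As)
   case empty
   then show ?case using koop_mp_diff[OF R, of 0 0] by simp
  qed (simp add: koop_mp_add[OF R] koop_mp_scale[OF R])
  have "norm (koop S' (ind A) - koop S (ind A)) <= r" if A: "A \<in> As" for A
  proof -
   have [measurable]: "A \<in> sets M" using A As by blast
   have s: "S -` A \<in> sets M" "S' -` A \<in> sets M"
    using measurable_sets[OF mp(1), of A] measurable_sets[OF mp'(1), of A] A As by auto
   have "(norm (koop S' (ind A) - koop S (ind A)))\<^sup>2 < r\<^sup>2"
    using near[OF A] A As s by (simp add: koop_ind_mp mp mp' norm_ind_diff subset_iff)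
   then show ?thesis using r by (simp add: power2_less_imp_less less_imp_le)
  qed
  then have "norm (\<Sum>A\<in>As. c A *\<^sub>C (koop S' (ind A) - koop S (ind A))) <= (\<Sum>A\<in>As. cmod (c A) * r)"
   by (intro order_trans[OF norm_sum] sum_mono) (simp add: norm_scaleC mult_left_mono)
  also have "... = (K - 1) * r" by (simp add: K_def sum_distrib_right)
  also have "... < K * r" using r by simp
  also have "K * r = e / 3" using K by (simp add: r_def)
  finally have 1: "norm (koop S' z - koop S z) < e / 3"
   by (simp add: sums[OF mp] sums[OF mp'] sum_subtractf complex_vs.scale_right_diff_distrib)
  have "norm (koop S' z - koop S' v) = norm (z - v)" "norm (koop S z - koop S v) = norm (z - v)"
   by (simp_all add: koop_mp_diff[OF mp, symmetric] koop_mp_diff[OF mp', symmetric] norm_koop_mp[OF mp] norm_koop_mp[OF mp'])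
  then have "norm (koop S' v - koop S v) <= norm (z - v) + norm (koop S' z - koop S z) + norm (z - v)"
   using norm_diff_three[of "koop S' v" "koop S v" "koop S' z" "koop S z"] by simp
  with 1 z(2) show "norm (koop S' v - koop S v) < e" by (simp add: dist_norm)
 qed
qed

lemma emb_near:
 assumes S: "S \<in> aut M" and e: "e > 0"
 obtains As d where "finite As" "As <= sets M" "d > 0"
  "!!S'. S' \<in> aut M ==> (!!A. A \<in> As ==> prob (symdiff (S' -` A) (S -` A)) < d) ==> dist (emb S') (emb S) < e"
proof -
 have e2: "e / 2 > 0" using e by simp
 obtain A1 d1 where A1: "finite A1" "A1 <= sets M" "d1 > 0"
  "!!S'. S' \<in> aut M ==> (!!A. A \<in> A1 ==> prob (symdiff (S' -` A) (S -` A)) < d1) ==> norm (koop S' phi_vec - koop S phi_vec) < e / 2"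
  using koop_near[OF S e2, of phi_vec] by blast
 \<comment> \<open>Conditions on preimages under \<open>S\<close> also control the inverse: since
   the operator of \<open>S'\<close> is isometric, the distance of the inverse images of
   \<open>phi_vec\<close> equals the distance of \<open>koop S' w\<close> and
   \<open>koop S w\<close>.\<close>
 define w where "w = koop (inv S) phi_vec"
 obtain A2 d2 where A2: "finite A2" "A2 <= sets M" "d2 > 0"
  "!!S'. S' \<in> aut M ==> (!!A. A \<in> A2 ==> prob (symdiff (S' -` A) (S -` A)) < d2) ==> norm (koop S' w - koop S w) < e / 2"
  using koop_near[OF S e2, of w] by blast
 show thesis
 proof (rule that[of "A1 \<union> A2" "min d1 d2"])
  fix S' assume S': "S' \<in> aut M" and near: "!!A. A \<in> A1 \<union> A2 ==> prob (symdiff (S' -` A) (S -` A)) < min d1 d2"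
  have 1: "norm (koop S' phi_vec - koop S phi_vec) < e / 2"
   by (rule A1(4)[OF S']) (use near in force)
  have 2: "norm (koop S' w - koop S w) < e / 2"
   by (rule A2(4)[OF S']) (use near in force)
  note mp' = aut_measurable[OF S'] aut_distr[OF S']
  have "norm (koop (inv S') phi_vec - w) = norm (koop S' (koop (inv S') phi_vec) - koop S' w)"
   by (simp add: koop_mp_diff[OF mp', symmetric] norm_koop_mp[OF mp'])
  also have "... = norm (koop S' w - koop S w)"
   by (simp add: w_def koop_inverse[OF S] koop_inverse[OF S'] norm_minus_commute)
  finally have 3: "norm (koop (inv S') phi_vec - koop (inv S) phi_vec) < e / 2" using 2 by (simp add: w_def)
  have "dist (emb S') (emb S) <= norm (koop S' phi_vec - koop S phi_vec) + norm (koop (inv S') phi_vec - koop (inv S) phi_vec)"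
   by (simp add: emb_def dist_norm norm_Pair_le)
  with 1 3 show "dist (emb S') (emb S) < e" by simp
 qed (use A1 A2 in auto)
qed

lemma topspace_weak: "topspace (weak_top M) = aut M"
 unfolding weak_top_def topology_generated_by_topspace by auto

lemma weak_nbhd_open:
 assumes S: "S \<in> aut M" and As: "finite As" "As <= sets M" and d: "d > 0"
 shows "openin (weak_top M) {S' \<in> aut M. \<forall>A\<in>As. prob (symdiff (S' -` A) (S -` A)) < d}"
 using As
proof (induction As)
 case empty
 then show ?case using openin_topspace[of "weak_top M"] by (simp add: topspace_weak)
next
 case (insert A As)
 have "openin (weak_top M) {S' \<in> aut M. prob (symdiff (S' -` A) (S -` A)) < d}"
  unfolding weak_top_def openin_topology_generated_by_iff
  by (rule generate_topology_on.Basis) (use S d insert in auto)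
 then have "openin (weak_top M) ({S' \<in> aut M. prob (symdiff (S' -` A) (S -` A)) < d}
   \<inter> {S' \<in> aut M. \<forall>A\<in>As. prob (symdiff (S' -` A) (S -` A)) < d})"
  using insert by (intro openin_Int) auto
 then show ?case by (rule back_subst[of "openin (weak_top M)"]) auto
qed

text \<open>The target of \<open>emb\<close> is metric, so openness can be tested along sequences
  whose images converge.\<close>

lemma pullback_openI:
 assumes P: "P <= aut M"
  and seq: "!!S X. S \<in> P ==> (!!k::nat. X k \<in> aut M) ==> (%k. emb (X k)) \<longlonglongrightarrow> emb S ==> EX k. X k \<in> P"
 shows "openin (pullback_topology (aut M) emb euclidean) P"
proof -
 have "EX d. d > 0 & (\<forall>S'\<in>aut M. dist (emb S') (emb S) < d --> S' \<in> P)" if S: "S \<in> P" for S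
 proof (rule ccontr)
  assume n: "\<not> ?thesis"
  have "ALL k. EX S'. S' \<in> aut M & dist (emb S') (emb S) < inverse (real (Suc k)) & S' \<notin> P"
  proof
   fix k
   have "inverse (real (Suc k)) > 0" by simp
   with n show "EX S'. S' \<in> aut M & dist (emb S') (emb S) < inverse (real (Suc k)) & S' \<notin> P" by blast
  qed
  from choice[OF this] obtain X where "ALL k. X k \<in> aut M & dist (emb (X k)) (emb S) < inverse (real (Suc k)) & X k \<notin> P" ..
  then have X: "!!k. X k \<in> aut M" "!!k. dist (emb (X k)) (emb S) < inverse (real (Suc k))" "!!k. X k \<notin> P"
   by blast+
  have "(%k. emb (X k)) \<longlonglongrightarrow> emb S"
  proof (rule tendsto_dist_iff[THEN iffD2], rule tendsto_sandwich[OF _ _ tendsto_const LIMSEQ_inverse_real_of_nat])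
   show "\<forall>\<^sub>F k in sequentially. dist (emb (X k)) (emb S) <= inverse (real (Suc k))"
    by (rule always_eventually, rule allI, rule less_imp_le, rule X(2))
  qed simp
  then show False using seq[of S X, OF S X(1)] X(3) by blast
 qed
 then have "\<forall>S\<in>P. EX d. d > 0 & (\<forall>S'\<in>aut M. dist (emb S') (emb S) < d --> S' \<in> P)" by blast
 from bchoice[OF this] obtain d
  where "\<forall>S\<in>P. d S > 0 & (\<forall>S'\<in>aut M. dist (emb S') (emb S) < d S --> S' \<in> P)" ..
 then have d: "!!S. S \<in> P ==> d S > 0" "!!S S'. S \<in> P ==> S' \<in> aut M ==> dist (emb S') (emb S) < d S ==> S' \<in> P"
  by blast+
 have "P = emb -` (\<Union>S\<in>P. ball (emb S) (d S)) \<inter> aut M"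
 proof (intro equalityI subsetI)
  fix S assume "S \<in> P"
  then show "S \<in> emb -` (\<Union>S\<in>P. ball (emb S) (d S)) \<inter> aut M" using P d(1) by force
 next
  fix S assume "S \<in> emb -` (\<Union>S\<in>P. ball (emb S) (d S)) \<inter> aut M"
  then show "S \<in> P" using d(2) by (auto simp: dist_commute)
 qed
 moreover have "open (\<Union>S\<in>P. ball (emb S) (d S))" by auto
 ultimately show ?thesis unfolding openin_pullback_topology open_openin[symmetric] by blast
qed

lemma weak_top_eq_pullback: "weak_top M = pullback_topology (aut M) emb euclidean"
 unfolding topology_eq
proof (intro allI iffI)
 fix P assume "openin (weak_top M) P"
 then have "generate_topology_on (insert (aut M)
    {{S \<in> aut M. prob (symdiff (S -` A \<inter> space M) (T -` A \<inter> space M)) < e}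
     | T A e. T \<in> aut M & A \<in> sets M & e > 0}) P"
  unfolding weak_top_def by (rule openin_topology_generated_by)
 then show "openin (pullback_topology (aut M) emb euclidean) P"
 proof induction
  case (Basis P)
  then consider "P = aut M" | T A e where "T \<in> aut M" "A \<in> sets M" "e > 0"
   "P = {S \<in> aut M. prob (symdiff (S -` A) (T -` A)) < e}" by auto
  then show ?case
  proof cases
   case 1
   then show ?thesis by (intro pullback_openI) auto
  next
   case 2
   show ?thesis
   proof (rule pullback_openI)
    fix S X assume S: "S \<in> P" and X: "!!k::nat. X k \<in> aut M" "(%k. emb (X k)) \<longlonglongrightarrow> emb S"
    have S': "S \<in> aut M" using S 2 by auto
    have s: "R -` A \<in> sets M" if "R \<in> aut M" for R
     using measurable_sets[OF aut_measurable[OF that] \<open>A \<in> sets M\<close>] by simp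
    have "(%k. koop (X k) (ind A)) \<longlonglongrightarrow> koop S (ind A)"
     by (rule emb_tendsto(1)[OF X(1) S' X(2)])
    then have "(%k. ind (X k -` A)) \<longlonglongrightarrow> ind (S -` A)"
     using X(1) S' 2 by (simp add: koop_ind_mp aut_measurable aut_distr)
    then have "(%k. (norm (ind (X k -` A) - ind (T -` A)))\<^sup>2) \<longlonglongrightarrow> (norm (ind (S -` A) - ind (T -` A)))\<^sup>2"
     by (intro tendsto_intros)
    moreover have "(norm (ind (S -` A) - ind (T -` A)))\<^sup>2 < e"
     using S 2 s S' by (simp add: norm_ind_diff)
    ultimately have "eventually (%k. (norm (ind (X k -` A) - ind (T -` A)))\<^sup>2 < e) sequentially"
     by (rule order_tendstoD(2))
    then obtain k where "(norm (ind (X k -` A) - ind (T -` A)))\<^sup>2 < e"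
     unfolding eventually_sequentially by blast
    then show "EX k. X k \<in> P" using X(1)[of k] 2 s by (auto simp: norm_ind_diff)
   qed (use 2 in auto)
  qed
 qed auto
next
 fix P assume "openin (pullback_topology (aut M) emb euclidean) P"
 then obtain U where U: "open U" "P = emb -` U \<inter> aut M" by (auto simp: openin_pullback_topology)
 show "openin (weak_top M) P"
  unfolding openin_subopen[of _ P]
 proof
  fix S assume "S \<in> P"
  then have S: "S \<in> aut M" "emb S \<in> U" using U by auto
  then obtain e where e: "e > 0" "ball (emb S) e <= U" using U(1) open_contains_ball by blast
  obtain As d where As: "finite As" "As <= sets M" "d > 0"
   "!!S'. S' \<in> aut M ==> (!!A. A \<in> As ==> prob (symdiff (S' -` A) (S -` A)) < d) ==> dist (emb S') (emb S) < e"
   using emb_near[OF S(1) e(1)] by blast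
  let ?N = "{S' \<in> aut M. \<forall>A\<in>As. prob (symdiff (S' -` A) (S -` A)) < d}"
  have "openin (weak_top M) ?N" by (rule weak_nbhd_open[OF S(1) As(1-3)])
  moreover have "S \<in> ?N" using S As by (simp add: symdiff_def)
  moreover have "?N <= P"
  proof
   fix S' assume S': "S' \<in> ?N"
   then have "dist (emb S') (emb S) < e" by (intro As(4)) auto
   then have "emb S' \<in> U" using e(2) by (auto simp: dist_commute)
   then show "S' \<in> P" using S' U by auto
  qed
  ultimately show "EX T. openin (weak_top M) T & S \<in> T & T <= P" by blast
 qed
qed

text \<open>Convergence of the cuts shows that the limit function again has uniform law; composing
  it with \<open>\<kappa>\<close> gives the limit map.\<close>

lemma weak_limit_map:
 assumes S: "!!n. S n \<in> aut M" and lim: "(%n. koop (S n) phi_vec) \<longlonglongrightarrow> a"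
 obtains T where "T \<in> M \<rightarrow>\<^sub>M M" "distr M M T = M" "koop T phi_vec = a"
proof -
 note mp = aut_measurable[OF S] aut_distr[OF S]
 have [measurable]: "S n \<in> M \<rightarrow>\<^sub>M M" for n by (rule mp)
 obtain g where g: "sq g" "vec g = a" by (rule vec_surj)
 have [measurable]: "g \<in> borel_measurable M" using g(1) by (rule square_integrable_measurable)
 \<comment> \<open>The approximating functions are real, so passing to the real part of a
   representative does not increase the distance to them.\<close>
 define \<psi> where "\<psi> x = Re (g x)" for x
 have \<psi> [measurable]: "\<psi> \<in> borel_measurable M" unfolding \<psi>_def[abs_def] by measurable
 have sq\<psi>: "sq (%x. complex_of_real (\<psi> x))"
  unfolding square_integrable_def
 proof
  show "integrable M (%x. (cmod (complex_of_real (\<psi> x)))\<^sup>2)"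
  proof (rule Bochner_Integration.integrable_bound)
   show "integrable M (%x. (cmod (g x))\<^sup>2)" using g(1) by (simp add: square_integrable_def)
   have "norm ((cmod (complex_of_real (\<psi> x)))\<^sup>2) <= norm ((cmod (g x))\<^sup>2)" for x
    using power_mono[OF abs_Re_le_cmod[of "g x"] abs_ge_zero, of 2] by (simp add: \<psi>_def)
   then show "AE x in M. norm ((cmod (complex_of_real (\<psi> x)))\<^sup>2) <= norm ((cmod (g x))\<^sup>2)" by simp
  qed measurable
 qed measurable
 have kS: "koop (S n) phi_vec = vec (%x. complex_of_real (\<phi> (S n x)))" for n
  unfolding phi_vec_def by (rule koop_mp[OF mp sq_phi])
 have sqS: "sq (%x. complex_of_real (\<phi> (S n x)))" for n
  by (rule sq_mp[OF mp sq_phi])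
 have lim\<psi>: "(%n. koop (S n) phi_vec) \<longlonglongrightarrow> vec (%x. complex_of_real (\<psi> x))"
 proof -
  have le: "norm (koop (S n) phi_vec - vec (%x. complex_of_real (\<psi> x))) <= norm (koop (S n) phi_vec - a)" for n
  proof (rule power2_le_imp_le)
   have "(\<integral>x. (cmod (complex_of_real (\<phi> (S n x)) - complex_of_real (\<psi> x)))\<^sup>2 \<partial>M)
     \<le> (\<integral>x. (cmod (complex_of_real (\<phi> (S n x)) - g x))\<^sup>2 \<partial>M)"
   proof (rule integral_mono)
    show "integrable M (%x. (cmod (complex_of_real (\<phi> (S n x)) - complex_of_real (\<psi> x)))\<^sup>2)"
     using square_integrable_diff[OF sqS[of n] sq\<psi>] by (simp add: square_integrable_def)
    show "integrable M (%x. (cmod (complex_of_real (\<phi> (S n x)) - g x))\<^sup>2)"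
     using square_integrable_diff[OF sqS[of n] g(1)] by (simp add: square_integrable_def)
    show "(cmod (complex_of_real (\<phi> (S n x)) - complex_of_real (\<psi> x)))\<^sup>2 <= (cmod (complex_of_real (\<phi> (S n x)) - g x))\<^sup>2" for x
    proof -
     have "complex_of_real (\<phi> (S n x)) - complex_of_real (\<psi> x) = complex_of_real (Re (complex_of_real (\<phi> (S n x)) - g x))"
      by (simp add: \<psi>_def)
     then have "cmod (complex_of_real (\<phi> (S n x)) - complex_of_real (\<psi> x)) = \<bar>Re (complex_of_real (\<phi> (S n x)) - g x)\<bar>"
      by (simp only: norm_of_real)
     then show ?thesis by (simp only:) (intro power_mono abs_Re_le_cmod abs_ge_zero)
    qed
   qed
   then show "(norm (koop (S n) phi_vec - vec (%x. complex_of_real (\<psi> x))))\<^sup>2 <= (norm (koop (S n) phi_vec - a))\<^sup>2"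
    unfolding kS g(2)[symmetric] by (simp add: norm_vec_diff sqS sq\<psi> g(1))
  qed simp
  have z: "(%n. norm (koop (S n) phi_vec - a)) \<longlonglongrightarrow> 0"
   using lim by (simp add: tendsto_norm_zero_iff LIM_zero_iff)
  have "(%n. norm (koop (S n) phi_vec - vec (%x. complex_of_real (\<psi> x)))) \<longlonglongrightarrow> 0"
  proof (rule tendsto_sandwich[OF _ _ tendsto_const z])
   show "\<forall>\<^sub>F n in sequentially. norm (koop (S n) phi_vec - vec (%x. complex_of_real (\<psi> x))) <= norm (koop (S n) phi_vec - a)"
    by (rule always_eventually, rule allI, rule le)
  qed simp
  then show ?thesis by (simp add: tendsto_norm_zero_iff LIM_zero_iff)
 qed
 have a: "a = vec (%x. complex_of_real (\<psi> x))" using LIMSEQ_unique[OF lim lim\<psi>] .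
 have cut: "{x. h x < q} \<in> sets M" if "h \<in> borel_measurable M" for h :: "'a => real" and q
  using measurable_sets[OF that, of "{..<q}"] by (simp add: vimage_def)
 have law: "distr M borel \<psi> = unif"
 proof -
  have eq: "prob {x. \<psi> x < q} = measure unif {..<q}" for q
  proof -
   have "(%n. ind {x. \<phi> (S n x) < q}) \<longlonglongrightarrow> ind {x. \<psi> x < q}"
    by (rule cut_tendsto) (use lim\<psi> in \<open>simp_all add: distr_phi_mp mp sq\<psi> kS\<close>)
   then have "(%n. (norm (ind {x. \<phi> (S n x) < q} - ind {}))\<^sup>2) \<longlonglongrightarrow> (norm (ind {x. \<psi> x < q} - ind {}))\<^sup>2"
    by (intro tendsto_intros)
   moreover have "(norm (ind {x. h x < q} - ind {}))\<^sup>2 = prob {x. h x < q}" if "h \<in> borel_measurable M" for h :: "'a => real"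
    using norm_ind_diff[OF cut[OF that, of q], of "{}"] by (simp add: symdiff_def)
   ultimately have "(%n. prob {x. \<phi> (S n x) < q}) \<longlonglongrightarrow> prob {x. \<psi> x < q}" by simp
   moreover have "prob {x. \<phi> (S n x) < q} = measure unif {..<q}" for n
    using measure_distr[of "%x. \<phi> (S n x)" M borel "{..<q}"] distr_phi_mp[OF mp, of n] by (simp add: vimage_def)
   ultimately show ?thesis by (simp add: LIMSEQ_const_iff)
  qed
  show ?thesis
  proof (rule measure_eqI_lessThan)
   fix q :: real
   interpret D: prob_space "distr M borel \<psi>" by (rule prob_space_distr) simp
   have 1: "measure (distr M borel \<psi>) {..<r} = measure unif {..<r}" for r
    using eq[of r] by (subst measure_distr) (simp_all add: vimage_def)
   \<comment> \<open>So far only open half-lines are compared; closed ones follow by decreasing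
     intersections, and their complements are the half-lines that determine the law.\<close>
   have lim1: "(%n. measure N {..<q + inverse (real (Suc n))}) \<longlonglongrightarrow> measure N {..q}"
    if "finite_measure N" "sets N = sets borel" for N :: "real measure"
   proof -
    interpret finite_measure N by fact
    have "(\<Inter>n. {..<q + inverse (real (Suc n))}) = {..q}"
    proof (intro equalityI subsetI)
     fix x assume x: "x \<in> (\<Inter>n. {..<q + inverse (real (Suc n))})"
     show "x \<in> {..q}"
     proof (rule ccontr)
      assume "x \<notin> {..q}"
      then obtain n where "inverse (real (Suc n)) < x - q" using reals_Archimedean[of "x - q"] by auto
      moreover have "x < q + inverse (real (Suc n))" using x by blast
      ultimately show False by simp
     qed
    next
     fix x assume "x \<in> {..q}"
     then have "x < q + inverse (real (Suc n))" for n by (smt (verit) atMost_iff inverse_positive_iff_positive of_nat_0_less_iff zero_less_Suc)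
     then show "x \<in> (\<Inter>n. {..<q + inverse (real (Suc n))})" by blast
    qed
    moreover have "(%n. measure N {..<q + inverse (real (Suc n))}) \<longlonglongrightarrow> measure N (\<Inter>n. {..<q + inverse (real (Suc n))})"
    proof (rule finite_Lim_measure_decseq)
     show "decseq (%n. {..<q + inverse (real (Suc n))})"
     proof (rule decseq_SucI)
      have "inverse (real (Suc (Suc n))) <= inverse (real (Suc n))" for n by (intro le_imp_inverse_le) auto
      then show "{..<q + inverse (real (Suc (Suc n)))} <= {..<q + inverse (real (Suc n))}" for n
       by (metis add_left_mono lessThan_subset_iff)
     qed
    qed (auto simp: that)
    ultimately show ?thesis by simp
   qed
   have "measure (distr M borel \<psi>) {..q} = measure unif {..q}"
    using LIMSEQ_unique[OF lim1[of "distr M borel \<psi>", unfolded 1] lim1[of unif]] D.finite_measure_axioms unif.finite_measure_axioms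
    by simp
   moreover have "- {..q} = {q<..}" by auto
   ultimately have "measure (distr M borel \<psi>) {q<..} = measure unif {q<..}"
    using D.prob_compl[of "{..q}"] unif.prob_compl[of "{..q}"] by (simp add: Compl_eq_Diff_UNIV[symmetric])
   then show "emeasure (distr M borel \<psi>) {q<..} = emeasure unif {q<..}"
    by (simp add: D.emeasure_eq_measure unif.emeasure_eq_measure)
   show "emeasure (distr M borel \<psi>) {q<..} < \<infinity>" by (simp add: D.emeasure_eq_measure)
  qed simp_all
 qed
 define T where "T x = \<kappa> (\<psi> x)" for x
 have T: "T \<in> M \<rightarrow>\<^sub>M M" unfolding T_def[abs_def] using measurable_compose[OF \<psi> kappa_meas] by (simp cong: measurable_cong_sets)
 have dT: "distr M M T = M"
 proof -
  have "distr M M (\<kappa> \<circ> \<psi>) = distr (distr M borel \<psi>) M \<kappa>"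
   by (rule distr_distr[symmetric]) (simp_all cong: measurable_cong_sets)
  then show ?thesis by (simp add: law distr_kappa T_def[abs_def] o_def)
 qed
 have "AE x in M. \<phi> (T x) = \<psi> x"
 proof -
  have "AE u in distr M borel \<psi>. \<phi> (\<kappa> u) = u" unfolding law by (rule phi_kappa)
  then show ?thesis unfolding T_def by (rule AE_distrD[OF \<psi>])
 qed
 then have "koop T phi_vec = a"
  unfolding phi_vec_def a koop_mp[OF T dT sq_phi]
  by (intro vec_cong_AE sq\<psi> sq_mp[OF T dT] sq_phi) auto
 with T dT show thesis by (rule that)
qed

text \<open>Both components have limit maps, which turn out to be mutually inverse almost everywhere
  and are then corrected to an element of \<open>aut M\<close>.\<close>

lemma closed_emb: "closed (emb ` aut M)"
proof (rule closed_sequential_limits[THEN iffD2], intro allI impI, elim conjE)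
 fix X l assume X: "ALL n. X n \<in> emb ` aut M" and l: "X \<longlonglongrightarrow> l"
 have "ALL n. EX S. S \<in> aut M & X n = emb S" using X by blast
 from choice[OF this] obtain S where "ALL n. S n \<in> aut M & X n = emb (S n)" ..
 then have S: "!!n. S n \<in> aut M" and XS: "!!n. X n = emb (S n)" by blast+
 have l1: "(%n. koop (S n) phi_vec) \<longlonglongrightarrow> fst l" and l2: "(%n. koop (inv (S n)) phi_vec) \<longlonglongrightarrow> snd l"
  using tendsto_fst[OF l] tendsto_snd[OF l] by (simp_all add: XS emb_def)
 obtain T where T: "T \<in> M \<rightarrow>\<^sub>M M" "distr M M T = M" "koop T phi_vec = fst l" by (rule weak_limit_map[OF S l1])
 obtain T' where T': "T' \<in> M \<rightarrow>\<^sub>M M" "distr M M T' = M" "koop T' phi_vec = snd l"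
  by (rule weak_limit_map[OF aut_inv[OF S] l2])
 \<comment> \<open>The vectors \<open>koop (S n) w\<close> converge to \<open>koop R w\<close>, but
   also to \<open>phi_vec\<close>, since isometry carries over the convergence of the inverses. So
   \<open>\<phi> (R' (R x)) = \<phi> x\<close> almost everywhere, and \<open>\<kappa>\<close>
   removes \<open>\<phi>\<close>.\<close>
 have inverse: "AE x in M. R' (R x) = x"
  if S: "!!n. S n \<in> aut M" and R: "R \<in> M \<rightarrow>\<^sub>M M" "distr M M R = M" and R': "R' \<in> M \<rightarrow>\<^sub>M M" "distr M M R' = M"
   and lR: "(%n. koop (S n) phi_vec) \<longlonglongrightarrow> koop R phi_vec" and lR': "(%n. koop (inv (S n)) phi_vec) \<longlonglongrightarrow> koop R' phi_vec"
  for S :: "nat => 'a => 'a" and R R'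
 proof -
  note mp = aut_measurable[OF S] aut_distr[OF S]
  define w where "w = koop R' phi_vec"
  have lw: "(%n. koop (S n) w) \<longlonglongrightarrow> koop R w" by (rule koop_tendsto[OF mp R lR])
  have "(%n. koop (S n) w) \<longlonglongrightarrow> phi_vec"
  proof -
   have "norm (koop (S n) w - phi_vec) = norm (koop (inv (S n)) phi_vec - w)" for n
   proof -
    have "norm (koop (inv (S n)) phi_vec - w) = norm (koop (S n) (koop (inv (S n)) phi_vec) - koop (S n) w)"
     by (simp add: koop_mp_diff[OF mp, symmetric] norm_koop_mp[OF mp])
    then show ?thesis by (simp add: koop_inverse[OF S] norm_minus_commute)
   qed
   moreover have "(%n. norm (koop (inv (S n)) phi_vec - w)) \<longlonglongrightarrow> 0"
    using lR' by (simp add: w_def tendsto_norm_zero_iff LIM_zero_iff)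
   ultimately have "(%n. norm (koop (S n) w - phi_vec)) \<longlonglongrightarrow> 0" by simp
   then show ?thesis by (simp add: tendsto_norm_zero_iff LIM_zero_iff)
  qed
  with lw have "koop R w = phi_vec" by (rule LIMSEQ_unique)
  then have "vec (%x. complex_of_real (\<phi> (R' (R x)))) = vec (%x. complex_of_real (\<phi> x))"
   unfolding w_def phi_vec_def koop_mp[OF R' sq_phi] koop_mp[OF R sq_mp[OF R' sq_phi]] .
  then have "AE x in M. complex_of_real (\<phi> (R' (R x))) = complex_of_real (\<phi> x)"
   by (rule vec_eq_imp_AE[OF sq_mp[OF R sq_mp[OF R' sq_phi]] sq_phi])
  moreover have "AE x in M. \<kappa> (\<phi> (R' (R x))) = R' (R x)"
   using distr_AE[OF R distr_AE[OF R' kappa_phi]] .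
  ultimately show ?thesis using kappa_phi by eventually_elim simp
 qed
 have i1: "AE x in M. T' (T x) = x"
  by (rule inverse[OF S T(1,2) T'(1,2)]) (use l1 l2 T T' in simp_all)
 have i2: "AE x in M. T (T' x) = x"
  by (rule inverse[OF aut_inv[OF S] T'(1,2) T(1,2)])
   (use l1 l2 T T' in \<open>simp_all add: inv_inv_eq aut_bij[OF S]\<close>)
 obtain U where U: "U \<in> aut M" "AE x in M. U x = T x" "AE x in M. inv U x = T' x"
  by (rule aut_of_AE_inverse[OF T(1) T'(1) T(2) T'(2) i1 i2])
 have "koop R phi_vec = koop R' phi_vec"
  if "AE x in M. R x = R' x" and R: "R \<in> M \<rightarrow>\<^sub>M M" "distr M M R = M" and R': "R' \<in> M \<rightarrow>\<^sub>M M" "distr M M R' = M" for R R'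
  unfolding phi_vec_def koop_mp[OF R sq_phi] koop_mp[OF R' sq_phi]
  by (rule vec_cong_AE[OF sq_mp[OF R sq_phi] sq_mp[OF R' sq_phi]]) (use that(1) in \<open>eventually_elim, simp\<close>)
 then have "emb U = l"
  using U T T' by (simp add: emb_def aut_measurable aut_distr aut_inv prod_eq_iff)
 then show "l \<in> emb ` aut M" using U(1) by blast
qed

end

context coordinates
begin

text \<open>A closed subset of a complete metric space is a Baire space. The property passes to
  \<open>aut M\<close>, because weakly open sets are preimages of open sets and density can be
  tested on the image of \<open>emb\<close>.\<close>

lemma weak_Baire:
 assumes O: "!!k::nat. openin (weak_top M) (G k)" "!!k. weak_top M closure_of G k = topspace (weak_top M)"
 shows "weak_top M closure_of (\<Inter>k. G k) = topspace (weak_top M)"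
proof -
 let ?Y = "subtopology euclidean (emb ` aut M)"
 have "ALL k. EX U. open U & G k = emb -` U \<inter> aut M"
  using O(1) by (simp add: weak_top_eq_pullback openin_pullback_topology)
 from choice[OF this] obtain U where U: "!!k. open (U k)" "!!k. G k = emb -` U k \<inter> aut M" by blast
 have dense: "V \<inter> U k \<inter> emb ` aut M ~= {}" if V: "open V" "V \<inter> emb ` aut M ~= {}" for V k
 proof -
  have o: "openin (weak_top M) (emb -` V \<inter> aut M)"
   using V(1) unfolding weak_top_eq_pullback openin_pullback_topology by auto
  obtain S where S: "S \<in> emb -` V \<inter> aut M" using V(2) by blast
  then have "S \<in> weak_top M closure_of G k" using O(2) by (simp add: topspace_weak)
  from closure_of_meets[OF this o S] obtain S' where S': "S' \<in> G k" "S' \<in> emb -` V \<inter> aut M" by blast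
  then have "emb S' \<in> V \<inter> U k \<inter> emb ` aut M" using U(2)[of k] by blast
  then show ?thesis by blast
 qed
 have op: "openin ?Y (U k \<inter> emb ` aut M)" for k
  using openin_open_Int[OF U(1)[of k], of "emb ` aut M"] by (simp only: Int_commute)
 have cl: "?Y closure_of (U k \<inter> emb ` aut M) = topspace ?Y" for k
 proof (rule equalityI[OF closure_of_subset_topspace], rule subsetI)
  fix y assume y: "y \<in> topspace ?Y"
  have "EX z. z \<in> U k \<inter> emb ` aut M & z \<in> T" if T: "y \<in> T" "openin ?Y T" for T
  proof -
   obtain T' where T': "open T'" "T = emb ` aut M \<inter> T'" using T(2) unfolding openin_open by blast
   then have "T' \<inter> emb ` aut M ~= {}" using T(1) by blast
   from dense[OF T'(1) this, of k] show ?thesis unfolding T'(2) by blast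
  qed
  then show "y \<in> ?Y closure_of (U k \<inter> emb ` aut M)" using y by (simp only: in_closure_of) blast
 qed
 have cm: "completely_metrizable_space ?Y"
  by (rule completely_metrizable_space_closedin[OF completely_metrizable_space_euclidean]) (simp only: closed_closedin[symmetric] closed_emb)
 have *: "?Y closure_of (\<Inter>k. U k \<inter> emb ` aut M) = topspace ?Y"
 proof (rule Baire_category[OF disjI1[OF cm]])
  show "openin ?Y V & ?Y closure_of V = topspace ?Y" if "V \<in> range (%k. U k \<inter> emb ` aut M)" for V
   using that op cl by (elim rangeE) (simp only: simp_thms)
 qed simp
 show ?thesis
 proof (rule equalityI[OF closure_of_subset_topspace], rule subsetI)
  fix S assume S: "S \<in> topspace (weak_top M)"
  show "S \<in> weak_top M closure_of (\<Inter>k. G k)"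
   unfolding in_closure_of
  proof (intro conjI allI impI S)
   fix W assume W: "S \<in> W & openin (weak_top M) W"
   then obtain V where V: "open V" "W = emb -` V \<inter> aut M" by (auto simp: weak_top_eq_pullback openin_pullback_topology)
   have c: "emb S \<in> ?Y closure_of (\<Inter>k. U k \<inter> emb ` aut M)" unfolding * using S by (simp add: topspace_weak)
   have o: "openin ?Y (V \<inter> emb ` aut M)" unfolding Int_commute[of V] by (rule openin_open_Int[OF V(1)])
   have "emb S \<in> V \<inter> emb ` aut M" using W V by blast
   from closure_of_meets[OF c o this] obtain z where z: "z \<in> (\<Inter>k. U k \<inter> emb ` aut M)" "z \<in> V" by blast
   have "z \<in> emb ` aut M" by (rule IntD2[OF INT_D[OF z(1) UNIV_I]])
   then obtain S' where S': "S' \<in> aut M" "z = emb S'" by (elim imageE)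
   have "S' \<in> G k" for k
   proof -
    have "z \<in> U k" by (rule IntD1[OF INT_D[OF z(1) UNIV_I]])
    then show ?thesis using S' unfolding U(2)[of k] by simp
   qed
   moreover have "S' \<in> W" using z(2) S' unfolding V(2) by simp
   ultimately show "EX y. y \<in> (\<Inter>k. G k) & y \<in> W" by (intro exI[of _ S'] conjI INT_I)
  qed
 qed
qed

section \<open>Generic transformations have rank one powers\<close>

text \<open>Union of the intervals of length \<open>1 / N\<close> with index in \<open>P\<close>,
  seen through the coordinate; \<open>nat\<close> truncates only where the coordinate is negative, a
  null set.\<close>

definition cell :: "nat => nat set => 'a set" where
 "cell N P = {x. nat \<lfloor>real N * \<phi> x\<rfloor> \<in> P}"

lemma cell_index_measurable: "(%x. nat \<lfloor>real N * \<phi> x\<rfloor>) \<in> M \<rightarrow>\<^sub>M count_space UNIV"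
proof -
 have "(%x. real N * \<phi> x) \<in> borel_measurable M" by simp
 then have "(%x. \<lfloor>real N * \<phi> x\<rfloor>) \<in> M \<rightarrow>\<^sub>M count_space UNIV"
  by (rule measurable_compose[OF _ measurable_real_floor])
 then show ?thesis by (rule measurable_compose[of _ _ _ nat]) simp
qed

lemma cell_sets: "cell N P \<in> sets M"
 using measurable_sets[OF cell_index_measurable, of P N] by (simp add: cell_def vimage_def)

lemma AE_phi: "AE x in M. 0 < \<phi> x & \<phi> x < 1"
proof -
 have "AE u in distr M borel \<phi>. 0 < u & u < 1" unfolding distr_phi by (rule AE_unif)
 then show ?thesis by (subst (asm) AE_distr_iff) auto
qed

text \<open>Asserted for all large \<open>N\<close>, not only for some: the density proof has to
  choose \<open>N\<close> in a prescribed residue class.\<close>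

lemma cells_approx:
 assumes A: "A \<in> sets M" and e: "e > 0"
 shows "EX N0. \<forall>N\<ge>N0. \<exists>P\<subseteq>{..<N}. prob (symdiff A (cell N P)) < e"
proof -
 define step where "step N c x = c (nat \<lfloor>real N * \<phi> x\<rfloor>)" for N and c :: "nat => complex" and x
 define bd where "bd c \<longleftrightarrow> (EX K. ALL p. cmod (c p) <= K)" for c :: "nat => complex"
 have sq: "sq (step N c)" if bc: "bd c" for N c
 proof -
  obtain K where K: "!!p. cmod (c p) <= K" using bc unfolding bd_def by blast
  have "step N c \<in> borel_measurable M"
   unfolding step_def by (rule measurable_compose[OF cell_index_measurable]) simp
  then show ?thesis by (rule sq_bounded[where c=K]) (simp add: step_def K)
 qed
 \<comment> \<open>Vectors that are approximated by step functions at every large scale. They form a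
   closed subspace, so that cuts of the coordinate suffice.\<close>
 define W where "W = {v. \<forall>e>0. EX N0. \<forall>N\<ge>N0. EX c. bd c & norm (v - vec (step N c)) < e}"
 have sub: "csubspace W"
 proof (rule complex_vs.subspaceI)
  show "0 \<in> W"
  proof -
   have "vec (step N (%p. 0)) = 0" for N using vec_zero by (simp add: step_def[abs_def])
   then show ?thesis unfolding W_def by (intro CollectI allI impI exI[of _ 0] exI[of _ "%p. 0"]) (auto simp: bd_def)
  qed
  fix v w assume v: "v \<in> W"
  show "v + w \<in> W" if w: "w \<in> W"
   unfolding W_def mem_Collect_eq
  proof (intro allI impI)
   fix e :: real assume e: "e > 0"
   have e2: "e / 2 > 0" using e by simp
   obtain N1 where N1: "!!N. N >= N1 ==> EX c. bd c & norm (v - vec (step N c)) < e / 2"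
    using v e2 unfolding W_def by blast
   obtain N2 where N2: "!!N. N >= N2 ==> EX c. bd c & norm (w - vec (step N c)) < e / 2"
    using w e2 unfolding W_def by blast
   have "EX c. bd c & norm (v + w - vec (step N c)) < e" if N: "N >= max N1 N2" for N
   proof -
    obtain c where c: "bd c" "norm (v - vec (step N c)) < e / 2" using N1[of N] N by auto
    obtain c' where c': "bd c'" "norm (w - vec (step N c')) < e / 2" using N2[of N] N by auto
    obtain K K' where "!!p. cmod (c p) <= K" "!!p. cmod (c' p) <= K'" using c(1) c'(1) unfolding bd_def by blast
    then have "cmod (c p + c' p) <= K + K'" for p by (rule norm_triangle_mono)
    then have b: "bd (%p. c p + c' p)" unfolding bd_def by blast
    have "vec (step N (%p. c p + c' p)) = vec (step N c) + vec (step N c')"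
     using vec_add[OF sq[OF c(1), of N] sq[OF c'(1), of N]] by (simp add: step_def[abs_def])
    then have "norm (v + w - vec (step N (%p. c p + c' p))) = norm ((v - vec (step N c)) + (w - vec (step N c')))"
     by (simp add: algebra_simps)
    also have "... < e" using c(2) c'(2) by (intro order.strict_trans1[OF norm_triangle_ineq]) simp
    finally show ?thesis using b by blast
   qed
   then show "EX N0. \<forall>N\<ge>N0. EX c. bd c & norm (v + w - vec (step N c)) < e" by blast
  qed
  show "a *\<^sub>C v \<in> W" for a
   unfolding W_def mem_Collect_eq
  proof (intro allI impI)
   fix e :: real assume e: "e > 0"
   have K: "1 + cmod a > 0" using norm_ge_zero[of a] by linarith
   then have "e / (1 + cmod a) > 0" using e by simp
   then obtain N1 where N1: "!!N. N >= N1 ==> EX c. bd c & norm (v - vec (step N c)) < e / (1 + cmod a)"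
    using v unfolding W_def by blast
   have "EX c. bd c & norm (a *\<^sub>C v - vec (step N c)) < e" if N: "N >= N1" for N
   proof -
    obtain c where c: "bd c" "norm (v - vec (step N c)) < e / (1 + cmod a)" using N1[OF N] by blast
    obtain K where "!!p. cmod (c p) <= K" using c(1) unfolding bd_def by blast
    then have "cmod (a * c p) <= cmod a * K" for p by (simp add: norm_mult mult_left_mono)
    then have b: "bd (%p. a * c p)" unfolding bd_def by blast
    have "vec (step N (%p. a * c p)) = a *\<^sub>C vec (step N c)"
     using vec_scale[OF sq[OF c(1), of N]] by (simp add: step_def[abs_def])
    then have "norm (a *\<^sub>C v - vec (step N (%p. a * c p))) = cmod a * norm (v - vec (step N c))"
     by (simp add: norm_scaleC[symmetric] complex_vs.scale_right_diff_distrib)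
    also have "... <= (1 + cmod a) * norm (v - vec (step N c))" by (intro mult_right_mono) auto
    also have "... < e" using c(2) K by (simp add: pos_less_divide_eq mult.commute)
    finally show ?thesis using b by blast
   qed
   then show "EX N0. \<forall>N\<ge>N0. EX c. bd c & norm (a *\<^sub>C v - vec (step N c)) < e" by blast
  qed
 qed
 have cl: "closed W"
 proof (rule closed_sequential_limits[THEN iffD2], intro allI impI, elim conjE)
  fix w v assume w: "ALL k. w k \<in> W" "w \<longlonglongrightarrow> v"
  show "v \<in> W"
   unfolding W_def mem_Collect_eq
  proof (intro allI impI)
   fix e :: real assume e: "e > 0"
   then obtain k where k: "norm (w k - v) < e / 2"
    using w(2) by (metis LIMSEQ_def dist_norm half_gt_zero order_refl)
   have "w k \<in> W" "e / 2 > 0" using w e by auto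
   then obtain N1 where N1: "!!N. N >= N1 ==> EX c. bd c & norm (w k - vec (step N c)) < e / 2"
    unfolding W_def by blast
   have "norm (v - y) < e" if "norm (w k - y) < e / 2" for y
    using that k norm_triangle_sub[of "v - y" "w k - y"] by (simp add: norm_minus_commute)
   then show "EX N0. \<forall>N\<ge>N0. EX c. bd c & norm (v - vec (step N c)) < e"
    using N1 by blast
  qed
 qed
 have cut: "ind {x. \<phi> x < q} \<in> W" for q
  unfolding W_def mem_Collect_eq
 proof (intro allI impI)
  fix e :: real assume e: "e > 0"
  then obtain N0 where N0: "inverse (real (Suc N0)) < e\<^sup>2" using reals_Archimedean[of "e\<^sup>2"] by auto
  have "EX c. bd c & norm (ind {x. \<phi> x < q} - vec (step N c)) < e" if N: "N >= Suc N0" for N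
  proof -
   define P where "P = {p. real p < real N * q}"
   define c where "c p = (if p \<in> P then 1 else 0 :: complex)" for p
   have c: "bd c" unfolding bd_def by (rule exI[of _ 1]) (simp add: c_def)
   have vc: "vec (step N c) = ind (cell N P)"
    by (rule arg_cong[where f=vec]) (auto simp: step_def c_def cell_def indicator_def)
   have D: "{x. \<phi> x < q} \<in> sets M" using measurable_sets[OF phi_meas', of "{..<q}"] by (simp add: vimage_def)
   have I: "{x. q <= \<phi> x & \<phi> x < q + 1 / real N} \<in> sets M"
    using measurable_sets[OF phi_meas', of "{q..<q + 1 / real N}"] by (simp add: vimage_def)
   have Npos: "real N > 0" using N by simp
   have "prob (symdiff {x. \<phi> x < q} (cell N P)) <= prob {x. q <= \<phi> x & \<phi> x < q + 1 / real N}"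
   proof (rule finite_measure_mono_AE)
    show "AE x in M. x \<in> symdiff {x. \<phi> x < q} (cell N P) --> x \<in> {x. q <= \<phi> x & \<phi> x < q + 1 / real N}"
     using AE_phi
    proof eventually_elim
     case (elim x)
     have f: "real (nat \<lfloor>real N * \<phi> x\<rfloor>) <= real N * \<phi> x" "real N * \<phi> x < real (nat \<lfloor>real N * \<phi> x\<rfloor>) + 1"
      using elim Npos by (auto simp: of_nat_nat)
     show ?case
     proof
      assume x: "x \<in> symdiff {x. \<phi> x < q} (cell N P)"
      show "x \<in> {x. q <= \<phi> x & \<phi> x < q + 1 / real N}"
      proof (cases "\<phi> x < q")
       case True
       then have "real N * \<phi> x < real N * q" using Npos by simp
       then have "x \<in> cell N P" using f by (simp add: cell_def P_def)
       then show ?thesis using x True by (simp add: symdiff_def)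
      next
       case False
       then have "real (nat \<lfloor>real N * \<phi> x\<rfloor>) < real N * q" using x by (simp add: symdiff_def cell_def P_def)
       then have "real N * \<phi> x < real N * q + 1" using f by linarith
       then have "\<phi> x < q + 1 / real N" using Npos by (simp add: field_simps)
       then show ?thesis using False by simp
      qed
     qed
    qed
   qed (fact I)
   also have "... <= 1 / real N" using prob_phi_interval[of q "q + 1 / real N"] by simp
   also have "... <= inverse (real (Suc N0))" using N by (simp add: field_simps)
   also have "... < e\<^sup>2" by (rule N0)
   finally have "(norm (ind {x. \<phi> x < q} - ind (cell N P)))\<^sup>2 < e\<^sup>2" unfolding norm_ind_diff[OF D cell_sets] .
   then have "norm (ind {x. \<phi> x < q} - vec (step N c)) < e" unfolding vc by (rule power2_less_imp_less) (use e in simp)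
   then show ?thesis using c by blast
  qed
  then show "EX N0. \<forall>N\<ge>N0. EX c. bd c & norm (ind {x. \<phi> x < q} - vec (step N c)) < e" by blast
 qed
 have "ind A \<in> W" by (rule phi_cuts_total[OF cl sub cut A])
 moreover have se: "sqrt e / 2 > 0" using e by simp
 ultimately obtain N0 where N0: "!!N. N >= N0 ==> EX c. bd c & norm (ind A - vec (step N c)) < sqrt e / 2"
  unfolding W_def by blast
 have "\<exists>P\<subseteq>{..<N}. prob (symdiff A (cell N P)) < e" if N: "N >= max N0 1" for N
 proof -
  obtain c where c: "bd c" "norm (ind A - vec (step N c)) < sqrt e / 2" using N0[of N] N by auto
  \<comment> \<open>Rounding at 1/2: where the rounded function differs from the indicator, the step
    function is off by at least 1/2. This gives the factor 4.\<close>
  define P where "P = {p. p < N & Re (c p) > 1/2}"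
  have "prob (symdiff A (cell N P)) = (norm (ind A - ind (cell N P)))\<^sup>2" by (rule norm_ind_diff[OF A cell_sets, symmetric])
  also have "... = (\<integral>x. (cmod (indicator A x - indicator (cell N P) x))\<^sup>2 \<partial>M)"
   by (rule norm_vec_diff[OF sq_indicator[OF A] sq_indicator[OF cell_sets]])
  also have "... <= (\<integral>x. 4 * (cmod (indicator A x - step N c x))\<^sup>2 \<partial>M)"
  proof (rule integral_mono_AE)
   show "integrable M (%x. (cmod (indicator A x - indicator (cell N P) x))\<^sup>2)"
    using square_integrable_diff[OF sq_indicator[OF A] sq_indicator[OF cell_sets]] by (simp add: square_integrable_def)
   show "integrable M (%x. 4 * (cmod (indicator A x - step N c x))\<^sup>2)"
    using square_integrable_diff[OF sq_indicator[OF A] sq[OF c(1)]] by (simp add: square_integrable_def)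
   show "AE x in M. (cmod (indicator A x - indicator (cell N P) x))\<^sup>2 <= 4 * (cmod (indicator A x - step N c x))\<^sup>2"
    using AE_phi
   proof eventually_elim
    case (elim x)
    define p where "p = nat \<lfloor>real N * \<phi> x\<rfloor>"
    have "real N * \<phi> x < real N" using elim N by simp
    then have "\<lfloor>real N * \<phi> x\<rfloor> < int N" by (simp add: floor_less_iff)
    then have pN: "p < N" using N unfolding p_def by linarith
    have cell: "x \<in> cell N P \<longleftrightarrow> Re (c p) > 1/2" using pN by (simp add: cell_def P_def p_def)
    have st: "step N c x = c p" by (simp add: step_def p_def)
    have big: "1 <= 4 * (cmod z)\<^sup>2" if "\<bar>Re z\<bar> >= 1/2" for z
    proof -
     have "(1/2)\<^sup>2 <= (cmod z)\<^sup>2" using that abs_Re_le_cmod[of z] by (intro power_mono) auto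
     then show ?thesis by (simp add: power2_eq_square)
    qed
    consider "(x \<in> A) = (x \<in> cell N P)" | "x \<in> A" "x \<notin> cell N P" | "x \<notin> A" "x \<in> cell N P" by blast
    then show ?case
    proof cases
     case 1
     then show ?thesis by (simp add: indicator_def)
    next
     case 2
     then show ?thesis using cell st big[of "1 - c p"] by simp
    next
     case 3
     then show ?thesis using cell st big[of "- c p"] by simp
    qed
   qed
  qed
  also have "... = 4 * (norm (ind A - vec (step N c)))\<^sup>2"
   by (simp add: norm_vec_diff[OF sq_indicator[OF A] sq[OF c(1)]])
  also have "... < 4 * (sqrt e / 2)\<^sup>2" using c(2) by (simp add: power_strict_mono)
  also have "... = e" using e by (simp add: power_divide)
  finally show ?thesis by (intro exI[of _ P]) (auto simp: P_def)
 qed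
 then show ?thesis by blast
qed

lemma prob_symdiff_triangle:
 assumes "A \<in> sets M" "B \<in> sets M" "C \<in> sets M"
 shows "prob (symdiff A C) <= prob (symdiff A B) + prob (symdiff B C)"
proof -
 have "prob (symdiff A C) <= prob (symdiff A B \<union> symdiff B C)"
  using assms by (intro finite_measure_mono) (auto simp: symdiff_def)
 also have "... <= prob (symdiff A B) + prob (symdiff B C)"
  using assms by (intro measure_Un_le) (auto simp: symdiff_def)
 finally show ?thesis .
qed

lemma prob_symdiff_UN:
 assumes "finite J" "!!i. i \<in> J ==> A i \<in> sets M" "!!i. i \<in> J ==> B i \<in> sets M"
 shows "prob (symdiff (\<Union>i\<in>J. A i) (\<Union>i\<in>J. B i)) <= (\<Sum>i\<in>J. prob (symdiff (A i) (B i)))"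
proof -
 have "prob (symdiff (\<Union>i\<in>J. A i) (\<Union>i\<in>J. B i)) <= prob (\<Union>i\<in>J. symdiff (A i) (B i))"
  using assms by (intro finite_measure_mono sets.finite_UN symdiff_sets) (auto simp: symdiff_def)
 also have "... <= (\<Sum>i\<in>J. prob (symdiff (A i) (B i)))"
  using assms by (intro finite_measure_subadditive_finite) (auto intro!: symdiff_sets)
 finally show ?thesis .
qed

text \<open>An open substitute for rank one of \<open>S ^^ n\<close>: levels may overlap slightly,
  and only cells of one scale \<open>N\<close> are approximated, so that finitely many strict
  inequalities occur. The factor \<open>h\<close> pays for making all \<open>h\<close> levels
  disjoint.\<close>

definition tower_set :: "nat => nat => real => ('a => 'a) set" where
 "tower_set n N e = {S \<in> aut M. EX B h. B \<in> sets M & h > 0 &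
   real h * (\<Sum>k\<in>{1..<h}. prob (B \<inter> ((S ^^ n) ^^ k) ` B)) < e &
   (\<forall>P\<subseteq>{..<N}. \<exists>J\<subseteq>{..<h}. prob (symdiff (cell N P) (\<Union>i\<in>J. ((S ^^ n) ^^ i) ` B)) < e)}"

text \<open>Images of sets are moved by the inverse operators, whose convergence comes from the
  second component of \<open>emb\<close>.\<close>

lemma image_ind_tendsto:
 assumes X: "!!k. X k \<in> aut M" and S: "S \<in> aut M" and lim: "(%k. emb (X k)) \<longlonglongrightarrow> emb S" and B: "B \<in> sets M"
 shows "(%k. ind ((X k ^^ m) ` B)) \<longlonglongrightarrow> ind ((S ^^ m) ` B)"
proof (induction m)
 case (Suc m)
 have step: "ind ((T ^^ Suc m) ` B) = koop (inv T) (ind ((T ^^ m) ` B))" if T: "T \<in> aut M" for T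
 proof -
  have "koop (inv T) (ind ((T ^^ m) ` B)) = ind (inv T -` ((T ^^ m) ` B))"
   by (rule koop_ind_mp[OF aut_measurable[OF aut_inv[OF T]] aut_distr[OF aut_inv[OF T]] aut_image_sets[OF aut_funpow[OF T] B]])
  also have "inv T -` ((T ^^ m) ` B) = (T ^^ Suc m) ` B"
   by (simp add: aut_image_vimage[OF T, symmetric] image_image)
  finally show ?thesis by simp
 qed
 define a where "a k = ind ((X k ^^ m) ` B)" for k
 define a' where "a' = ind ((S ^^ m) ` B)"
 have "(%k. norm (a k - a') + norm (koop (inv (X k)) a' - koop (inv S) a')) \<longlonglongrightarrow> 0 + 0"
  using Suc emb_tendsto(2)[OF X S lim, of a']
  by (intro tendsto_add) (simp_all add: a_def a'_def tendsto_norm_zero_iff LIM_zero_iff)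
 then have z: "(%k. norm (a k - a') + norm (koop (inv (X k)) a' - koop (inv S) a')) \<longlonglongrightarrow> 0" by simp
 have le: "norm (koop (inv (X k)) (a k) - koop (inv S) a') <= norm (a k - a') + norm (koop (inv (X k)) a' - koop (inv S) a')" for k
 proof -
  note mp = aut_measurable[OF aut_inv[OF X[of k]]] aut_distr[OF aut_inv[OF X[of k]]]
  have "norm (koop (inv (X k)) (a k) - koop (inv (X k)) a') = norm (a k - a')"
   by (simp add: koop_mp_diff[OF mp, symmetric] norm_koop_mp[OF mp])
  then show ?thesis
   using norm_triangle_ineq[of "koop (inv (X k)) (a k) - koop (inv (X k)) a'" "koop (inv (X k)) a' - koop (inv S) a'"] by simp
 qed
 have "(%k. norm (koop (inv (X k)) (a k) - koop (inv S) a')) \<longlonglongrightarrow> 0"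
 proof (rule tendsto_sandwich[OF _ _ tendsto_const z])
  show "\<forall>\<^sub>F k in sequentially. norm (koop (inv (X k)) (a k) - koop (inv S) a') <= norm (a k - a') + norm (koop (inv (X k)) a' - koop (inv S) a')"
   by (rule always_eventually, rule allI, rule le)
 qed simp
 then have "(%k. koop (inv (X k)) (a k)) \<longlonglongrightarrow> koop (inv S) a'" by (simp add: tendsto_norm_zero_iff LIM_zero_iff)
 then show ?case unfolding step[OF S] step[OF X] a_def a'_def .
qed simp

text \<open>The same base and height serve for nearby maps: the measures involved vary continuously,
  and finitely many strict inequalities survive.\<close>

lemma tower_set_open: "openin (weak_top M) (tower_set n N e)"
 unfolding weak_top_eq_pullback
proof (rule pullback_openI)
 show "tower_set n N e <= aut M" by (auto simp: tower_set_def)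
 fix S X assume S: "S \<in> tower_set n N e" and X: "!!k::nat. X k \<in> aut M" and lim: "(%k. emb (X k)) \<longlonglongrightarrow> emb S"
 have S': "S \<in> aut M" using S by (simp add: tower_set_def)
 obtain B h where B: "B \<in> sets M" "h > 0"
  and ov: "real h * (\<Sum>k\<in>{1..<h}. prob (B \<inter> ((S ^^ n) ^^ k) ` B)) < e"
  and ap: "!!P. P <= {..<N} ==> \<exists>J\<subseteq>{..<h}. prob (symdiff (cell N P) (\<Union>i\<in>J. ((S ^^ n) ^^ i) ` B)) < e"
  using S unfolding tower_set_def by blast
 define E where "E i = ((S ^^ n) ^^ i) ` B" for i
 define F where "F k i = ((X k ^^ n) ^^ i) ` B" for k i
 define D where "D i k = prob (symdiff (E i) (F k i))" for i k
 have Es: "E i \<in> sets M" for i unfolding E_def by (intro aut_image_sets aut_funpow S' B)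
 have Fs: "F k i \<in> sets M" for k i unfolding F_def by (intro aut_image_sets aut_funpow X B)
 have D0: "D i \<longlonglongrightarrow> 0" for i
 proof -
  have "(%k. ind (F k i)) \<longlonglongrightarrow> ind (E i)"
   using image_ind_tendsto[OF X S' lim B(1), of "n * i"] by (simp add: E_def F_def funpow_mult)
  then have "(%k. prob (symdiff (F k i) (E i))) \<longlonglongrightarrow> 0" using ind_tendsto_iff[of "%k. F k i" "E i"] Fs Es by blast
  moreover have "symdiff (F k i) (E i) = symdiff (E i) (F k i)" for k by (auto simp: symdiff_def)
  ultimately show ?thesis by (simp add: D_def[abs_def])
 qed
 have ev1: "\<forall>\<^sub>F k in sequentially. real h * (\<Sum>i\<in>{1..<h}. prob (B \<inter> E i) + D i k) < e"
 proof (rule order_tendstoD(2))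
  show "(%k. real h * (\<Sum>i\<in>{1..<h}. prob (B \<inter> E i) + D i k)) \<longlonglongrightarrow> real h * (\<Sum>i\<in>{1..<h}. prob (B \<inter> E i) + 0)"
   by (intro tendsto_intros D0)
  show "real h * (\<Sum>i\<in>{1..<h}. prob (B \<inter> E i) + 0) < e" using ov by (simp add: E_def)
 qed
 have "\<forall>P\<in>Pow {..<N}. EX J. J <= {..<h} & prob (symdiff (cell N P) (\<Union>i\<in>J. E i)) < e" using ap unfolding E_def by blast
 from bchoice[OF this] obtain J where J: "!!P. P <= {..<N} ==> J P <= {..<h}"
  "!!P. P <= {..<N} ==> prob (symdiff (cell N P) (\<Union>i\<in>J P. E i)) < e" by blast
 have ev2: "\<forall>\<^sub>F k in sequentially. \<forall>P\<in>Pow {..<N}. prob (symdiff (cell N P) (\<Union>i\<in>J P. E i)) + (\<Sum>i\<in>J P. D i k) < e"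
 proof (rule eventually_ball_finite)
  show "\<forall>P\<in>Pow {..<N}. \<forall>\<^sub>F k in sequentially. prob (symdiff (cell N P) (\<Union>i\<in>J P. E i)) + (\<Sum>i\<in>J P. D i k) < e"
  proof
   fix P assume P: "P \<in> Pow {..<N}"
   show "\<forall>\<^sub>F k in sequentially. prob (symdiff (cell N P) (\<Union>i\<in>J P. E i)) + (\<Sum>i\<in>J P. D i k) < e"
   proof (rule order_tendstoD(2))
    show "(%k. prob (symdiff (cell N P) (\<Union>i\<in>J P. E i)) + (\<Sum>i\<in>J P. D i k)) \<longlonglongrightarrow> prob (symdiff (cell N P) (\<Union>i\<in>J P. E i)) + (\<Sum>i\<in>J P. 0)"
     by (intro tendsto_intros D0)
    show "prob (symdiff (cell N P) (\<Union>i\<in>J P. E i)) + (\<Sum>i\<in>J P. 0) < e" using J P by simp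
   qed
  qed
 qed simp
 obtain k where k1: "real h * (\<Sum>i\<in>{1..<h}. prob (B \<inter> E i) + D i k) < e"
  and k2: "\<forall>P\<in>Pow {..<N}. prob (symdiff (cell N P) (\<Union>i\<in>J P. E i)) + (\<Sum>i\<in>J P. D i k) < e"
  using eventually_conj[OF ev1 ev2] unfolding eventually_sequentially by blast
 have "real h * (\<Sum>i\<in>{1..<h}. prob (B \<inter> F k i)) <= real h * (\<Sum>i\<in>{1..<h}. prob (B \<inter> E i) + D i k)"
 proof (intro mult_left_mono sum_mono)
  fix i
  have "prob (B \<inter> F k i) <= prob ((B \<inter> E i) \<union> symdiff (E i) (F k i))"
   using B Es Fs by (intro finite_measure_mono) (auto simp: symdiff_def)
  also have "... <= prob (B \<inter> E i) + D i k" unfolding D_def using B Es Fs by (intro measure_Un_le) auto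
  finally show "prob (B \<inter> F k i) <= prob (B \<inter> E i) + D i k" .
 qed simp
 with k1 have c1: "real h * (\<Sum>i\<in>{1..<h}. prob (B \<inter> F k i)) < e" by linarith
 have c2: "\<exists>J\<subseteq>{..<h}. prob (symdiff (cell N P) (\<Union>i\<in>J. F k i)) < e" if P: "P <= {..<N}" for P
 proof -
  have fin: "finite (J P)" using J(1)[OF P] finite_subset by blast
  have "prob (symdiff (cell N P) (\<Union>i\<in>J P. F k i)) <= prob (symdiff (cell N P) (\<Union>i\<in>J P. E i)) + prob (symdiff (\<Union>i\<in>J P. E i) (\<Union>i\<in>J P. F k i))"
   using fin Es Fs by (intro prob_symdiff_triangle sets.finite_UN cell_sets) auto
  also have "... <= prob (symdiff (cell N P) (\<Union>i\<in>J P. E i)) + (\<Sum>i\<in>J P. D i k)"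
   unfolding D_def using fin Es Fs by (intro add_left_mono prob_symdiff_UN) auto
  also have "... < e" using k2 P by blast
  finally show ?thesis using J(1)[OF P] by blast
 qed
 have "X k \<in> tower_set n N e"
  unfolding tower_set_def mem_Collect_eq
  by (rule conjI[OF X], rule exI[of _ B], rule exI[of _ h], intro conjI allI impI)
   (fact B, fact B, fact c1[unfolded F_def], rule c2[unfolded F_def])
 then show "EX k. X k \<in> tower_set n N e" ..
qed

text \<open>Deleting from the base the points that lie in one of its next \<open>h - 1\<close>
  images makes the levels disjoint; the total loss over all levels is bounded by the first
  inequality of \<open>tower_set\<close>.\<close>

lemma rank_one_of_towers:
 assumes S: "S \<in> aut M" and tow: "!!N m. S \<in> tower_set n N (inverse (real (Suc m)))"
 shows "rank_one M (S ^^ n)"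
 unfolding rank_one_def
proof (intro allI impI, elim conjE)
 fix As :: "'a set set" and e :: real
 assume As: "finite As" "As <= sets M" and e: "e > 0"
 \<comment> \<open>Approximating the whole space as well yields the covering condition.\<close>
 let ?As = "insert UNIV As"
 have "\<forall>A\<in>?As. EX N0. \<forall>N\<ge>N0. \<exists>P\<subseteq>{..<N}. prob (symdiff A (cell N P)) < e / 4"
 proof
  fix A assume "A \<in> ?As"
  then have "A \<in> sets M" using As sets.top[of M] by auto
  then show "EX N0. \<forall>N\<ge>N0. \<exists>P\<subseteq>{..<N}. prob (symdiff A (cell N P)) < e / 4" using e by (intro cells_approx) auto
 qed
 from bchoice[OF this] obtain N0 where N0: "!!A N. A \<in> ?As ==> N >= N0 A ==> \<exists>P\<subseteq>{..<N}. prob (symdiff A (cell N P)) < e / 4" by blast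
 define N where "N = Max (N0 ` ?As)"
 have N: "N >= N0 A" if "A \<in> ?As" for A using that As by (auto simp: N_def)
 \<comment> \<open>Three errors below \<open>e / 4\<close> are added: from the set to cells, from
   cells to the overlapping tower, and from there to the disjoint one.\<close>
 have "e / 4 > 0" using e by simp
 then obtain m where m: "inverse (real (Suc m)) < e / 4" using reals_Archimedean by blast
 obtain B h where B: "B \<in> sets M" "h > 0"
  and ov: "real h * (\<Sum>k\<in>{1..<h}. prob (B \<inter> ((S ^^ n) ^^ k) ` B)) < inverse (real (Suc m))"
  and ap: "!!P. P <= {..<N} ==> \<exists>J\<subseteq>{..<h}. prob (symdiff (cell N P) (\<Union>i\<in>J. ((S ^^ n) ^^ i) ` B)) < inverse (real (Suc m))"
  using tow[of N m] unfolding tower_set_def by blast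
 define R where "R = S ^^ n"
 have R: "R ^^ i \<in> aut M" for i unfolding R_def by (intro aut_funpow S)
 note bijR = aut_bij[OF R]
 define E where "E i = (R ^^ i) ` B" for i
 define B' where "B' = B - (\<Union>k\<in>{1..<h}. E k)"
 define E' where "E' i = (R ^^ i) ` B'" for i
 have Es: "E i \<in> sets M" for i unfolding E_def by (intro aut_image_sets R B)
 have B's: "B' \<in> sets M" unfolding B'_def using B Es by auto
 have E's: "E' i \<in> sets M" for i unfolding E'_def by (intro aut_image_sets R B's)
 have disj: "disjoint_family_on E' {..<h}"
 proof -
  have "E' i \<inter> E' j = {}" if ij: "i < j" "j < h" for i j
  proof (rule ccontr)
   assume "E' i \<inter> E' j ~= {}"
   then obtain b b' where b: "b \<in> B'" "b' \<in> B'" "(R ^^ i) b = (R ^^ j) b'" by (auto simp: E'_def)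
   have "(R ^^ j) b' = (R ^^ i) ((R ^^ (j - i)) b')"
    using ij by (metis comp_apply funpow_add le_add_diff_inverse less_imp_le)
   then have "b = (R ^^ (j - i)) b'" using b(3) bijR[of i] by (simp add: bij_is_inj inj_eq)
   moreover have "j - i \<in> {1..<h}" using ij by auto
   ultimately have "b \<in> (\<Union>k\<in>{1..<h}. E k)" using b(2) unfolding E_def B'_def by blast
   then show False using b(1) by (simp add: B'_def)
  qed
  then show ?thesis unfolding disjoint_family_on_def by (metis inf_commute lessThan_iff linorder_neqE_nat)
 qed
 have diff: "prob (symdiff (E i) (E' i)) <= (\<Sum>k\<in>{1..<h}. prob (B \<inter> E k))" for i
 proof -
  have "symdiff (E i) (E' i) = (R ^^ i) ` (B - B')"
   unfolding E_def E'_def symdiff_def using bijR[of i] by (auto simp: B'_def bij_def inj_eq)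
  also have "... = inv (R ^^ i) -` (B - B')" by (rule aut_image_vimage[OF R])
  finally have "prob (symdiff (E i) (E' i)) = prob (B - B')"
   using aut_measure_vimage[OF aut_inv[OF R[of i]], of "B - B'"] B B's by simp
  also have "... <= prob (\<Union>k\<in>{1..<h}. B \<inter> E k)"
   using B Es by (intro finite_measure_mono sets.finite_UN) (auto simp: B'_def)
  also have "... <= (\<Sum>k\<in>{1..<h}. prob (B \<inter> E k))"
   using B Es by (intro finite_measure_subadditive_finite) auto
  finally show ?thesis .
 qed
 have approx: "\<exists>J\<subseteq>{..<h}. prob (symdiff A (\<Union>i\<in>J. E' i)) < e" if A: "A \<in> ?As" for A
 proof -
  have As': "A \<in> sets M" using A As sets.top[of M] by auto
  obtain P where P: "P <= {..<N}" "prob (symdiff A (cell N P)) < e / 4" using N0[OF A N[OF A]] by blast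
  obtain J where J: "J <= {..<h}" "prob (symdiff (cell N P) (\<Union>i\<in>J. E i)) < e / 4"
   using ap[OF P(1)] m unfolding R_def[symmetric] E_def by (meson order.strict_trans)
  have fin: "finite J" using J(1) finite_subset by blast
  have U: "(\<Union>i\<in>J. E i) \<in> sets M" "(\<Union>i\<in>J. E' i) \<in> sets M" using fin Es E's by auto
  have "prob (symdiff (\<Union>i\<in>J. E i) (\<Union>i\<in>J. E' i)) <= (\<Sum>i\<in>J. prob (symdiff (E i) (E' i)))"
   by (rule prob_symdiff_UN[OF fin Es E's])
  also have "... <= (\<Sum>i<h. prob (symdiff (E i) (E' i)))"
   using J(1) by (intro sum_mono2) auto
  also have "... <= (\<Sum>i<h. \<Sum>k\<in>{1..<h}. prob (B \<inter> E k))" by (intro sum_mono diff)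
  also have "... < e / 4" using ov m by (simp add: E_def R_def)
  finally have 3: "prob (symdiff (\<Union>i\<in>J. E i) (\<Union>i\<in>J. E' i)) < e / 4" .
  have "prob (symdiff A (\<Union>i\<in>J. E' i)) <= prob (symdiff A (cell N P)) + prob (symdiff (cell N P) (\<Union>i\<in>J. E' i))"
   by (rule prob_symdiff_triangle[OF As' cell_sets U(2)])
  also have "prob (symdiff (cell N P) (\<Union>i\<in>J. E' i)) <= prob (symdiff (cell N P) (\<Union>i\<in>J. E i)) + prob (symdiff (\<Union>i\<in>J. E i) (\<Union>i\<in>J. E' i))"
   by (rule prob_symdiff_triangle[OF cell_sets U])
  finally have "prob (symdiff A (\<Union>i\<in>J. E' i)) < e" using P(2) J(2) 3 e by linarith
  then show ?thesis using J(1) by blast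
 qed
 obtain J where J: "J <= {..<h}" "prob (symdiff UNIV (\<Union>i\<in>J. E' i)) < e" using approx[of UNIV] by blast
 have U: "(\<Union>i<h. E' i) \<in> sets M" using E's by auto
 have "1 - prob (\<Union>i<h. E' i) = prob (UNIV - (\<Union>i<h. E' i))" using prob_compl[OF U] by simp
 also have "... <= prob (symdiff UNIV (\<Union>i\<in>J. E' i))"
  using J(1) E's finite_subset[OF J(1)] sets.top[of M] by (intro finite_measure_mono symdiff_sets) (auto simp: symdiff_def)
 finally have cov: "prob (\<Union>i<h. E' i) > 1 - e" using J(2) by linarith
 show "EX B h. B \<in> sets M & h > 0 & disjoint_family_on (%i. ((S ^^ n) ^^ i) ` B) {..<h} &
      measure M (\<Union>i<h. ((S ^^ n) ^^ i) ` B) > 1 - e &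
      (\<forall>A\<in>As. \<exists>J \<subseteq> {..<h}. measure M (symdiff A (\<Union>i\<in>J. ((S ^^ n) ^^ i) ` B)) < e)"
  unfolding R_def[symmetric] E'_def[symmetric]
  by (rule exI[of _ B'], rule exI[of _ h], unfold E'_def[symmetric], intro conjI ballI B's B(2) disj cov approx insertI2)
qed

text \<open>The tower is turned upside down: its top level becomes the base.\<close>

lemma rank_one_inv:
 assumes T: "T \<in> aut M" and r: "rank_one M T"
 shows "rank_one M (inv T)"
 unfolding rank_one_def
proof (intro allI impI)
 fix As and e :: real assume As: "finite As & As <= sets M & e > 0"
 from r[unfolded rank_one_def, rule_format, OF As]
 obtain B h where B: "B \<in> sets M" "h > 0" and dis: "disjoint_family_on (%i. (T ^^ i) ` B) {..<h}"
  and cov: "measure M (\<Union>i<h. (T ^^ i) ` B) > 1 - e"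
  and ap: "!!A. A \<in> As ==> \<exists>J \<subseteq> {..<h}. measure M (symdiff A (\<Union>i\<in>J. (T ^^ i) ` B)) < e"
  by blast
 define B' where "B' = (T ^^ (h - 1)) ` B"
 have lev: "(inv T ^^ i) ` B' = (T ^^ (h - 1 - i)) ` B" if "i < h" for i
 proof -
  have "(T ^^ (h - 1)) x = (T ^^ i) ((T ^^ (h - 1 - i)) x)" for x
  proof -
   have "h - 1 = i + (h - 1 - i)" using that by simp
   then show ?thesis by (metis comp_apply funpow_add)
  qed
  moreover have "(inv T ^^ i) ((T ^^ i) y) = y" for y
   using aut_bij[OF T] inv_fn[OF aut_bij[OF T], of i] inv_f_f[OF bij_is_inj[OF aut_bij[OF aut_funpow[OF T]]]] by metis
  ultimately show ?thesis unfolding B'_def image_image by simp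
 qed
 have tr: "(\<Union>i\<in>J. (T ^^ i) ` B) = (\<Union>i\<in>(%i. h - 1 - i) ` J. (inv T ^^ i) ` B')" if J: "J <= {..<h}" for J
 proof -
  have "(inv T ^^ (h - 1 - i)) ` B' = (T ^^ i) ` B" if "i \<in> J" for i
  proof -
   have "h - 1 - i < h" "h - 1 - (h - 1 - i) = i" using that J B(2) by auto
   then show ?thesis using lev[of "h - 1 - i"] by simp
  qed
  then show ?thesis by simp
 qed
 have sub: "(%i. h - 1 - i) ` J <= {..<h}" for J using B(2) by auto
 have c1: "B' \<in> sets M" unfolding B'_def by (intro aut_image_sets aut_funpow T B)
 have c2: "disjoint_family_on (%i. (inv T ^^ i) ` B') {..<h}"
  unfolding disjoint_family_on_def
 proof (intro ballI impI)
  fix i j assume ij: "i \<in> {..<h}" "j \<in> {..<h}" "i ~= j"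
  then have "h - 1 - i ~= h - 1 - j" "h - 1 - i \<in> {..<h}" "h - 1 - j \<in> {..<h}" by auto
  then show "(inv T ^^ i) ` B' \<inter> (inv T ^^ j) ` B' = {}"
   using dis lev[of i] lev[of j] ij by (auto simp: disjoint_family_on_def)
 qed
 have c3: "measure M (\<Union>i<h. (inv T ^^ i) ` B') > 1 - e"
 proof -
  have "(%i. h - 1 - i) ` {..<h} = {..<h}"
  proof (intro equalityI sub subsetI)
   fix i assume "i \<in> {..<h}"
   then show "i \<in> (%i. h - 1 - i) ` {..<h}" by (intro image_eqI[of _ _ "h - 1 - i"]) auto
  qed
  then show ?thesis using cov tr[of "{..<h}"] by simp
 qed
 have c4: "\<exists>J \<subseteq> {..<h}. measure M (symdiff A (\<Union>i\<in>J. (inv T ^^ i) ` B')) < e" if A: "A \<in> As" for A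
 proof -
  obtain J where J: "J <= {..<h}" "measure M (symdiff A (\<Union>i\<in>J. (T ^^ i) ` B)) < e" using ap[OF A] by blast
  have "measure M (symdiff A (\<Union>i\<in>(%i. h - 1 - i) ` J. (inv T ^^ i) ` B')) < e"
   using J(2) unfolding tr[OF J(1)] .
  with sub[of J] show ?thesis by (intro exI[of _ "(%i. h - 1 - i) ` J"] conjI)
 qed
 show "EX B h. B \<in> sets M & h > 0 & disjoint_family_on (%i. (inv T ^^ i) ` B) {..<h} &
      measure M (\<Union>i<h. (inv T ^^ i) ` B) > 1 - e &
      (\<forall>A\<in>As. \<exists>J \<subseteq> {..<h}. measure M (symdiff A (\<Union>i\<in>J. (inv T ^^ i) ` B)) < e)"
  by (rule exI[of _ B'], rule exI[of _ h], intro conjI ballI c1 c2 c3 c4 B(2))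
qed

end

section \<open>Digits of a uniform number, columns and the cyclic rotation of levels\<close>

lemma unif_digits:
 assumes L: "L > 0" and E [measurable]: "E \<in> sets borel"
 shows "measure unif E = (\<Sum>t<L. measure unif {w. (real t + w) / real L \<in> E}) / real L"
proof -
 define G where "G t = E \<inter> {real t / real L <..< (real t + 1) / real L}" for t
 have Lp: "real L > 0" using L by simp
 have G [measurable]: "G t \<in> sets borel" for t by (simp add: G_def)
 have V [measurable]: "{w. (real t + w) / real L \<in> E} \<in> sets borel" for t
 proof -
  have "(%w. (real t + w) / real L) \<in> borel_measurable borel" by simp
  from measurable_sets[OF this E] show ?thesis by (simp add: vimage_def)
 qed
 have Gi: "G t <= {0<..<1}" if "t < L" for t
 proof
  fix y assume "y \<in> G t"
  then have "real t / real L < y" "y < (real t + 1) / real L" by (auto simp: G_def)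
  moreover have "0 <= real t / real L" "(real t + 1) / real L <= 1" using that Lp by auto
  ultimately show "y \<in> {0<..<1}" unfolding greaterThanLessThan_iff by linarith
 qed
 have scale: "measure unif (G t) = measure unif {w. (real t + w) / real L \<in> E} / real L" if t: "t < L" for t
 proof -
  have "emeasure unif (G t) = emeasure lborel (G t)"
   using Gi[OF t] by (simp add: emeasure_unif Int_absorb2)
  also have "... = (\<integral>\<^sup>+x. indicator (G t) x \<partial>lborel)" by simp
  also have "... = \<bar>1 / real L\<bar> * (\<integral>\<^sup>+x. indicator (G t) (real t / real L + 1 / real L * x) \<partial>lborel)"
   by (rule nn_integral_real_affine) (use Lp in auto)
  also have "(\<integral>\<^sup>+x. indicator (G t) (real t / real L + 1 / real L * x) \<partial>lborel)
    = (\<integral>\<^sup>+x. indicator ({w. (real t + w) / real L \<in> E} \<inter> {0<..<1}) x \<partial>lborel)"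
  proof (rule nn_integral_cong)
   fix x :: real
   have eq: "real t / real L + 1 / real L * x = (real t + x) / real L" by (simp add: add_divide_distrib)
   have "(real t + x) / real L \<in> G t \<longleftrightarrow> (real t + x) / real L \<in> E & 0 < x & x < 1"
    unfolding G_def using Lp by (auto simp: divide_less_cancel)
   then show "indicator (G t) (real t / real L + 1 / real L * x) = (indicator ({w. (real t + w) / real L \<in> E} \<inter> {0<..<1}) x :: ennreal)"
    unfolding eq by (simp add: indicator_def)
  qed
  also have "... = emeasure unif {w. (real t + w) / real L \<in> E}"
   by (subst emeasure_unif[OF V]) simp
  finally have "ennreal (measure unif (G t)) = ennreal \<bar>1 / real L\<bar> * ennreal (measure unif {w. (real t + w) / real L \<in> E})"
   by (simp only: unif.emeasure_eq_measure)
  also have "... = ennreal (1 / real L * measure unif {w. (real t + w) / real L \<in> E})"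
   by (subst ennreal_mult[symmetric]) auto
  finally have "ennreal (measure unif (G t)) = ennreal (1 / real L * measure unif {w. (real t + w) / real L \<in> E})" .
  then show ?thesis using Lp by (simp add: ennreal_inj)
 qed
 have "measure unif E = measure unif (\<Union>t<L. G t)"
 proof (rule measure_eq_AE)
  have "emeasure unif ((%t. real t / real L) ` {..L}) = 0"
  proof -
   have "(\<Union>t\<in>{..L}. {real t / real L}) \<in> null_sets unif"
    by (intro null_sets.finite_UN) (auto simp: null_sets_def unif_singleton)
   moreover have "(\<Union>t\<in>{..L}. {real t / real L}) = (%t. real t / real L) ` {..L}" by auto
   ultimately show ?thesis by auto
  qed
  then have "(%t. real t / real L) ` {..L} \<in> null_sets unif"
   by (simp add: null_sets_def finite_imp_closed borel_closed)
  then have "AE y in unif. y \<notin> (%t. real t / real L) ` {..L}" by (rule AE_not_in)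
  with AE_unif show "AE y in unif. y \<in> E \<longleftrightarrow> y \<in> (\<Union>t<L. G t)"
  proof eventually_elim
   case (elim y)
   define t where "t = nat \<lfloor>real L * y\<rfloor>"
   have b: "real t <= real L * y" "real L * y < real t + 1" using elim Lp by (auto simp: t_def of_nat_nat)
   have "real L * y < real L" using elim Lp by simp
   then have tL: "t < L" using b by linarith
   have "real L * y ~= real t"
   proof
    assume "real L * y = real t"
    then have "y = real t / real L" using Lp by (simp add: field_simps)
    then show False using elim tL by auto
   qed
   then have "real t / real L < y" "y < (real t + 1) / real L" using b Lp by (auto simp: field_simps)
   then have "y \<in> E \<longleftrightarrow> y \<in> G t" by (simp add: G_def)
   then show ?case using tL by (auto simp: G_def)
  qed
 qed auto
 also have "... = (\<Sum>t<L. measure unif (G t))"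
 proof (rule unif.finite_measure_finite_Union)
  have "t = t'" if "y \<in> G t" "y \<in> G t'" for y t t'
  proof -
   have "real t / real L < y" "y < (real t + 1) / real L" "real t' / real L < y" "y < (real t' + 1) / real L"
    using that by (auto simp: G_def)
   then have "real t < real L * y" "real L * y < real t + 1" "real t' < real L * y" "real L * y < real t' + 1"
    using Lp by (auto simp: field_simps)
   then show ?thesis by linarith
  qed
  then show "disjoint_family_on G {..<L}" unfolding disjoint_family_on_def by blast
 qed auto
 also have "... = (\<Sum>t<L. measure unif {w. (real t + w) / real L \<in> E} / real L)"
  by (intro sum.cong) (auto simp: scale)
 finally show ?thesis by (simp add: sum_divide_distrib)
qed

text \<open>For a uniform number the level and the position \<open>fr\<close> inside the level are
  independent and both uniform; \<open>unif_lev\<close> is this statement.\<close>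

definition lev :: "nat => real => nat" where
 "lev L y = nat \<lfloor>real L * y\<rfloor>"

definition fr :: "nat => real => real" where
 "fr L y = real L * y - real (lev L y)"

lemma lev_measurable [measurable]: "lev L \<in> borel \<rightarrow>\<^sub>M count_space UNIV"
proof -
 have "(%y. real L * y) \<in> borel_measurable borel" by simp
 then have "(%y. \<lfloor>real L * y\<rfloor>) \<in> borel \<rightarrow>\<^sub>M count_space UNIV"
  by (rule measurable_compose[OF _ measurable_real_floor])
 then show ?thesis unfolding lev_def by (rule measurable_compose[of _ _ _ nat]) simp
qed

lemma fr_measurable [measurable]: "fr L \<in> borel_measurable borel"
proof -
 have "(%y. real (lev L y)) \<in> borel_measurable borel"
  by (rule measurable_compose[OF lev_measurable]) simp
 then show ?thesis unfolding fr_def by simp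
qed

lemma
 assumes "L > 0" "0 <= y" "y < 1"
 shows lev_less: "lev L y < L" and fr_nonneg: "0 <= fr L y" and fr_less: "fr L y < 1"
  and lev_fr: "(real (lev L y) + fr L y) / real L = y"
proof -
 have b: "real (lev L y) <= real L * y" "real L * y < real (lev L y) + 1"
  using assms by (auto simp: lev_def of_nat_nat)
 moreover have "real L * y < real L" using assms by simp
 ultimately show "lev L y < L" by linarith
 show "0 <= fr L y" "fr L y < 1" "(real (lev L y) + fr L y) / real L = y" using b assms(1) by (auto simp: fr_def)
qed

lemma
 assumes "L > 0" "0 <= w" "w < 1"
 shows lev_digit: "lev L ((real t + w) / real L) = t" and fr_digit: "fr L ((real t + w) / real L) = w"
proof -
 have "\<lfloor>real t + w\<rfloor> = int t" using assms by (intro floor_unique) auto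
 then show "lev L ((real t + w) / real L) = t" using assms by (simp add: lev_def)
 then show "fr L ((real t + w) / real L) = w" using assms by (simp add: fr_def)
qed

lemma digit_sets:
 assumes "!!t. {w. G t w} \<in> sets borel"
 shows "{y. G (lev L y) (fr L y)} \<in> sets borel"
proof -
 have "lev L -` {t} \<in> sets borel" "fr L -` {w. G t w} \<in> sets borel" for t
  using measurable_sets[OF lev_measurable, of "{t}" L] measurable_sets[OF fr_measurable[of L] assms[of t]] by auto
 then have "(\<Union>t. lev L -` {t} \<inter> fr L -` {w. G t w}) \<in> sets borel" by auto
 also have "(\<Union>t. lev L -` {t} \<inter> fr L -` {w. G t w}) = {y. G (lev L y) (fr L y)}" by auto
 finally show ?thesis .
qed

lemma unif_lev:
 assumes L: "L > 0" and G: "!!t. {w. G t w} \<in> sets borel"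
 shows "measure unif {y. G (lev L y) (fr L y)} = (\<Sum>t<L. measure unif {w. G t w}) / real L"
proof -
 have E: "{y. G (lev L y) (fr L y)} \<in> sets borel" by (rule digit_sets[OF G])
 have "measure unif {w. (real t + w) / real L \<in> {y. G (lev L y) (fr L y)}} = measure unif {w. G t w}" for t
 proof (rule measure_eq_AE)
  show "AE w in unif. w \<in> {w. (real t + w) / real L \<in> {y. G (lev L y) (fr L y)}} \<longleftrightarrow> w \<in> {w. G t w}"
   using AE_unif by eventually_elim (use L in \<open>simp add: lev_digit fr_digit\<close>)
  have "(%w. (real t + w) / real L) \<in> borel_measurable borel" by simp
  from measurable_sets[OF this E] show "{w. (real t + w) / real L \<in> {y. G (lev L y) (fr L y)}} \<in> sets unif"
   by (simp add: vimage_def)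
 qed (use G in simp)
 then show ?thesis using unif_digits[OF L E] by simp
qed

text \<open>The \<open>s * N\<close> levels are grouped into \<open>N\<close> columns of height
  \<open>s\<close>: level \<open>p * s + i\<close> is floor \<open>i\<close> of column
  \<open>p\<close>. \<open>coli\<close> is the floor, and \<open>colu\<close> glues the columns side
  by side into one base coordinate.\<close>

definition coli :: "nat => nat => real => nat" where
 "coli s N y = lev (s * N) y mod s"

definition colu :: "nat => nat => real => real" where
 "colu s N y = (real (lev (s * N) y div s) + fr (s * N) y) / real N"

lemma colu_measurable [measurable]: "colu s N \<in> borel_measurable borel"
proof -
 have [measurable]: "(%y. real (lev (s * N) y div s)) \<in> borel_measurable borel"
  by (rule measurable_compose[OF lev_measurable]) simp
 show ?thesis unfolding colu_def by simp
qed

lemma coli_measurable: "coli s N \<in> borel \<rightarrow>\<^sub>M count_space UNIV"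
 unfolding coli_def by (rule measurable_compose[OF lev_measurable]) simp

text \<open>The floor is uniform on \<open>s\<close> values and independent of the base coordinate,
  which is again uniform.\<close>

lemma column_law:
 assumes s: "s > 0" and N: "N > 0" and G: "!!i. {u. G i u} \<in> sets borel"
 shows "measure unif {y. G (coli s N y) (colu s N y)} = (\<Sum>i<s. measure unif {u. G i u}) / real s"
proof -
 define m where "m i p = measure unif {w. G i ((real p + w) / real N)}" for i p
 have V: "{w. G i ((real p + w) / real N)} \<in> sets borel" for i and p :: nat
 proof -
  have "(%w. (real p + w) / real N) \<in> borel_measurable borel" by simp
  from measurable_sets[OF this G[of i]] show ?thesis by (simp add: vimage_def)
 qed
 have "measure unif {y. G (coli s N y) (colu s N y)} = (\<Sum>t<s * N. m (t mod s) (t div s)) / real (s * N)"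
  unfolding coli_def colu_def m_def
  by (rule unif_lev[where G="%t w. G (t mod s) ((real (t div s) + w) / real N)"]) (use s N V in auto)
 also have "(\<Sum>t<s * N. m (t mod s) (t div s)) = (\<Sum>(i, p)\<in>{..<s} \<times> {..<N}. m i p)"
 proof (rule sum.reindex_bij_witness[of _ "%(i, p). p * s + i" "%t. (t mod s, t div s)"])
  fix t assume "t \<in> {..<s * N}"
  then show "(t mod s, t div s) \<in> {..<s} \<times> {..<N}"
   using s by (simp add: less_mult_imp_div_less mult.commute)
 next
  fix ip :: "nat \<times> nat" assume "ip \<in> {..<s} \<times> {..<N}"
  then obtain i p where ip: "ip = (i, p)" "i < s" "p < N" by auto
  have "p * s + i < Suc p * s" using ip by simp
  also have "... <= N * s" using ip by (intro mult_right_mono) auto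
  finally show "(case ip of (i, p) => p * s + i) \<in> {..<s * N}" using ip by (simp add: mult.commute)
  show "((case ip of (i, p) => p * s + i) mod s, (case ip of (i, p) => p * s + i) div s) = ip" using ip by simp
 qed auto
 also have "... = (\<Sum>i<s. \<Sum>p<N. m i p)" by (simp add: sum.cartesian_product)
 also have "... = (\<Sum>i<s. real N * measure unif {u. G i u})"
 proof (rule sum.cong[OF refl])
  fix i
  show "(\<Sum>p<N. m i p) = real N * measure unif {u. G i u}"
   using unif_digits[OF N G[of i]] N by (simp add: m_def)
 qed
 also have "... / real (s * N) = (\<Sum>i<s. measure unif {u. G i u}) / real s"
  using N by (simp add: sum_distrib_left[symmetric])
 finally show ?thesis .
qed

definition rt :: "nat => nat => real => real" where
 "rt L k y = (real ((lev L y + k) mod L) + fr L y) / real L"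

lemma rt_measurable [measurable]: "rt L k \<in> borel_measurable borel"
proof -
 have [measurable]: "(%y. real ((lev L y + k) mod L)) \<in> borel_measurable borel"
  by (rule measurable_compose[OF lev_measurable]) simp
 show ?thesis unfolding rt_def by simp
qed

lemma
 assumes "L > 0" "0 <= y" "y < 1"
 shows lev_rt: "lev L (rt L k y) = (lev L y + k) mod L" and fr_rt: "fr L (rt L k y) = fr L y"
  and rt_nonneg: "0 <= rt L k y" and rt_less: "rt L k y < 1"
proof -
 note f = fr_nonneg[OF assms] fr_less[OF assms]
 show "lev L (rt L k y) = (lev L y + k) mod L" "fr L (rt L k y) = fr L y"
  unfolding rt_def by (rule lev_digit[OF assms(1) f] fr_digit[OF assms(1) f])+
 show "0 <= rt L k y" using f by (simp add: rt_def)
 have "(lev L y + k) mod L < L" using assms(1) by simp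
 then have "real ((lev L y + k) mod L) + fr L y < real L" using f(2) by linarith
 then show "rt L k y < 1" using assms(1) by (simp add: rt_def)
qed

lemma rt_rt:
 assumes "L > 0" "0 <= y" "y < 1"
 shows "rt L a (rt L b y) = rt L (b + a) y"
 unfolding rt_def[of L a] lev_rt[OF assms] fr_rt[OF assms] by (simp add: rt_def mod_add_left_eq add.assoc)

lemma rt_period:
 assumes "L > 0" "0 <= y" "y < 1" "k mod L = 0"
 shows "rt L k y = y"
proof -
 have "(lev L y + k) mod L = lev L y" using assms lev_less[OF assms(1-3)] by (metis add.right_neutral mod_add_right_eq mod_less)
 then show ?thesis by (simp add: rt_def lev_fr[OF assms(1-3)])
qed

lemma distr_rt:
 assumes L: "L > 0"
 shows "distr unif borel (rt L k) = unif"
proof (rule measure_eqI)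
 fix E assume "E \<in> sets (distr unif borel (rt L k))"
 then have E: "E \<in> sets borel" by simp
 define m where "m t = measure unif {w. (real t + w) / real L \<in> E}" for t
 have V: "{w. (real t + w) / real L \<in> E} \<in> sets borel" for t
 proof -
  have "(%w. (real t + w) / real L) \<in> borel_measurable borel" by simp
  from measurable_sets[OF this E] show ?thesis by (simp add: vimage_def)
 qed
 have "(\<Sum>t<L. m ((t + k) mod L)) = (\<Sum>t<L. m t)"
 proof -
  \<comment> \<open>The shift that completes \<open>k\<close> to a multiple of \<open>L\<close>;
    adding it inverts the permutation of the levels.\<close>
  define k' where "k' = L - k mod L"
  have "k + k' = k - k mod L + L"
   unfolding k'_def using mod_le_divisor[OF L, of k] mod_less_eq_dividend[of k L] by linarith
  also have "... = (k div L) * L + L" by (simp add: minus_mod_eq_div_mult)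
  finally have kk: "(k + k') mod L = 0" by simp
  have c: "(t + k + k') mod L = t" if "t < L" for t
   using kk that by (metis add.assoc add.right_neutral mod_add_right_eq mod_less)
  show ?thesis
  proof (rule sum.reindex_bij_witness[of _ "%t. (t + k') mod L" "%t. (t + k) mod L"])
   show "((t + k) mod L + k') mod L = t" if "t \<in> {..<L}" for t
    using c[of t] that by (simp add: mod_add_left_eq)
   show "((t + k') mod L + k) mod L = t" if "t \<in> {..<L}" for t
    using c[of t] that by (simp add: mod_add_left_eq add.assoc add.commute[of k' k])
  qed (use L in auto)
 qed
 moreover have "measure unif {y. rt L k y \<in> E} = (\<Sum>t<L. m ((t + k) mod L)) / real L"
  unfolding rt_def m_def
  by (rule unif_lev[OF L, where G="%t w. (real ((t + k) mod L) + w) / real L \<in> E"]) (rule V)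
 ultimately have "measure unif {y. rt L k y \<in> E} = measure unif E"
  using unif_digits[OF L E] by (simp add: m_def)
 then show "emeasure (distr unif borel (rt L k)) E = emeasure unif E"
  using E by (subst emeasure_distr) (simp_all add: vimage_def unif.emeasure_eq_measure)
qed simp

text \<open>One binary digit per set: the code labels the atoms of the partition that the family
  generates.\<close>

lemma finite_family_code:
 fixes \<C> :: "'a::topological_space set set"
 assumes "finite \<C>" "\<C> <= sets borel"
 obtains part :: "'a => nat" where "part \<in> borel \<rightarrow>\<^sub>M count_space UNIV"
  "!!x y C. part x = part y ==> C \<in> \<C> ==> x \<in> C \<longleftrightarrow> y \<in> C"
proof -
 have "\<exists>part :: 'a => nat. part \<in> borel \<rightarrow>\<^sub>M count_space UNIV & (ALL x y C. part x = part y --> C \<in> \<C> --> (x \<in> C \<longleftrightarrow> y \<in> C))"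
  using assms
 proof (induction \<C>)
  case empty
  show ?case by (rule exI[of _ "%x. 0"]) simp
 next
  case (insert D \<C>)
  have "\<C> <= sets borel" using insert.prems by blast
  from insert.IH[OF this] obtain part :: "'a => nat" where P: "part \<in> borel \<rightarrow>\<^sub>M count_space UNIV"
   "ALL x y C. part x = part y --> C \<in> \<C> --> (x \<in> C \<longleftrightarrow> y \<in> C)" by (elim exE conjE)
  note p = P(1) P(2)[rule_format]
  define q where "q x = (if x \<in> D then 2 * part x + 1 else 2 * part x)" for x
  have "(%x. 2 * part x + 1) \<in> borel \<rightarrow>\<^sub>M count_space UNIV" "(%x. 2 * part x) \<in> borel \<rightarrow>\<^sub>M count_space UNIV"
   using measurable_compose[OF p(1), of "%k. 2 * k + 1" "count_space UNIV"]
    measurable_compose[OF p(1), of "%k. 2 * k" "count_space UNIV"] by simp_all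
  moreover have "D \<in> sets borel" using insert.prems by blast
  ultimately have q: "q \<in> borel \<rightarrow>\<^sub>M count_space UNIV"
   unfolding q_def by (intro measurable_If_set) simp_all
  have sep: "x \<in> C \<longleftrightarrow> y \<in> C" if "q x = q y" "C \<in> insert D \<C>" for x y C
  proof -
   have "(x \<in> D) = (y \<in> D) & part x = part y"
   proof -
    have "2 * a + 1 ~= 2 * b" for a b :: nat by presburger
    from this[of "part x" "part y"] this[of "part y" "part x"] show ?thesis
     using that(1) unfolding q_def by (simp split: if_splits)
   qed
   then show ?thesis using that(2) p(2)[of x y C] by (elim conjE insertE) simp_all
  qed
  show ?case by (rule exI[of _ q], intro conjI allI impI q sep)
 qed
 then obtain part :: "'a => nat" where P: "part \<in> borel \<rightarrow>\<^sub>M count_space UNIV"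
  "ALL x y C. part x = part y --> C \<in> \<C> --> (x \<in> C \<longleftrightarrow> y \<in> C)" by (elim exE conjE)
 show thesis by (rule that[OF P(1)]) (rule P(2)[rule_format])
qed

lemma (in std_space) refining_isomorphism:
 fixes part :: "'a => nat" and \<pi> :: "real => 'a"
 assumes part: "part \<in> borel \<rightarrow>\<^sub>M count_space UNIV"
  and pm: "\<pi> \<in> borel_measurable borel" and pd: "distr unif M \<pi> = M"
 obtains \<theta> :: "real => 'a" and \<theta>' :: "'a => real"
 where "\<theta> \<in> borel_measurable borel" "\<theta>' \<in> borel_measurable borel"
  "distr unif M \<theta> = M" "distr M borel \<theta>' = unif"
  "AE x in M. \<theta> (\<theta>' x) = x" "AE y in unif. \<theta>' (\<theta> y) = y" "AE y in unif. part (\<theta> y) = part (\<pi> y)"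
proof -
 interpret U: std_space unif by standard (rule std_nonatomic_unif)
 obtain \<phi>1 :: "'a => real" and \<kappa>1 where 1: "\<phi>1 \<in> borel_measurable borel" "\<kappa>1 \<in> borel_measurable borel"
  "distr M borel \<phi>1 = unif" "distr unif M \<kappa>1 = M" "AE x in M. \<kappa>1 (\<phi>1 x) = x" "AE u in unif. \<phi>1 (\<kappa>1 u) = u"
  "!!l. AE x in M. part x < l \<longleftrightarrow> \<phi>1 x <= prob {x. part x < l}"
  by (rule coordinate_exists[OF part]) blast
 have part2: "(%y. part (\<pi> y)) \<in> borel \<rightarrow>\<^sub>M count_space UNIV" by (rule measurable_compose[OF pm part])
 obtain \<phi>2 :: "real => real" and \<kappa>2 where 2: "\<phi>2 \<in> borel_measurable borel" "\<kappa>2 \<in> borel_measurable borel"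
  "distr unif borel \<phi>2 = unif" "distr unif unif \<kappa>2 = unif" "AE x in unif. \<kappa>2 (\<phi>2 x) = x" "AE u in unif. \<phi>2 (\<kappa>2 u) = u"
  "!!l. AE y in unif. part (\<pi> y) < l \<longleftrightarrow> \<phi>2 y <= measure unif {y. part (\<pi> y) < l}"
  by (rule U.coordinate_exists[OF part2]) blast
 have m: "\<phi>1 \<in> borel_measurable M" "\<kappa>1 \<in> unif \<rightarrow>\<^sub>M M" "\<phi>2 \<in> borel_measurable unif" "\<kappa>2 \<in> unif \<rightarrow>\<^sub>M unif" "\<kappa>2 \<in> borel_measurable unif"
  "\<kappa>1 \<in> borel \<rightarrow>\<^sub>M M" "\<kappa>1 \<in> unif \<rightarrow>\<^sub>M borel"
  using 1(1,2) 2(1,2) by (simp_all cong: measurable_cong_sets)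
 have 24: "distr unif borel \<kappa>2 = unif"
  using 2(4) by (metis distr_cong sets_unif)
 show thesis
 proof (rule that[of "%y. \<kappa>1 (\<phi>2 y)" "%x. \<kappa>2 (\<phi>1 x)"])
  show "(%y. \<kappa>1 (\<phi>2 y)) \<in> borel_measurable borel" by (rule measurable_compose[OF 2(1) 1(2)])
  show "(%x. \<kappa>2 (\<phi>1 x)) \<in> borel_measurable borel" by (rule measurable_compose[OF 1(1) 2(2)])
  have "distr unif M (\<kappa>1 \<circ> \<phi>2) = distr (distr unif borel \<phi>2) M \<kappa>1"
   by (rule distr_distr[symmetric]) (rule m)+
  then show "distr unif M (%y. \<kappa>1 (\<phi>2 y)) = M" by (simp add: 2(3) 1(4) o_def)
  have "distr M borel (\<kappa>2 \<circ> \<phi>1) = distr (distr M borel \<phi>1) borel \<kappa>2"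
   by (rule distr_distr[symmetric]) (rule 2(2) m)+
  then show "distr M borel (%x. \<kappa>2 (\<phi>1 x)) = unif" by (simp add: 24 1(3) o_def)
  have "AE u in distr M borel \<phi>1. \<phi>2 (\<kappa>2 u) = u" unfolding 1(3) by (rule 2(6))
  from AE_distrD[OF m(1) this] 1(5) show "AE x in M. \<kappa>1 (\<phi>2 (\<kappa>2 (\<phi>1 x))) = x"
   by eventually_elim simp
  have "AE u in distr unif borel \<phi>2. \<phi>1 (\<kappa>1 u) = u" unfolding 2(3) by (rule 1(6))
  note A = AE_distrD[OF m(3) this]
  from A 2(5) show "AE y in unif. \<kappa>2 (\<phi>1 (\<kappa>1 (\<phi>2 y))) = y" by eventually_elim simp
  have law: "measure unif {y. part (\<pi> y) < l} = prob {x. part x < l}" for l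
  proof -
   have "{x. part x < l} \<in> sets M" using measurable_sets[OF part, of "{..<l}"] by (simp add: vimage_def)
   then have "measure (distr unif M \<pi>) {x. part x < l} = measure unif {y. part (\<pi> y) < l}"
    using pm by (subst measure_distr) (simp_all add: vimage_def cong: measurable_cong_sets)
   then show ?thesis by (simp add: pd)
  qed
  have dth: "distr unif M (%y. \<kappa>1 (\<phi>2 y)) = M" by fact
  have mth: "(%y. \<kappa>1 (\<phi>2 y)) \<in> unif \<rightarrow>\<^sub>M M" by (rule measurable_compose[OF m(3) m(6)])
  have all: "AE y in unif. ALL l. part (\<kappa>1 (\<phi>2 y)) < l \<longleftrightarrow> part (\<pi> y) < l"
   unfolding AE_all_countable
  proof
   fix l
   have "AE y in unif. part (\<kappa>1 (\<phi>2 y)) < l \<longleftrightarrow> \<phi>1 (\<kappa>1 (\<phi>2 y)) <= prob {x. part x < l}"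
    by (rule distr_AE[OF mth dth 1(7)])
   with A 2(7)[of l] show "AE y in unif. part (\<kappa>1 (\<phi>2 y)) < l \<longleftrightarrow> part (\<pi> y) < l"
    unfolding law by eventually_elim simp
  qed
  then show "AE y in unif. part (\<kappa>1 (\<phi>2 y)) = part (\<pi> y)"
   by eventually_elim (metis lessI less_Suc_eq nat_neq_iff)
 qed
qed

text \<open>Ensures that the n-th power of a rotation of \<open>L\<close> levels still reaches every
  level.\<close>

lemma mult_mod_surj:
 fixes n L t :: nat
 assumes "coprime n L" "t < L"
 shows "\<exists>i<L. n * i mod L = t"
proof -
 obtain x where "[n * x = 1] (mod L)" using cong_solve_coprime_nat[OF assms(1)] by auto
 then have "[n * x * t = 1 * t] (mod L)" by (rule cong_scalar_right)
 then have "n * (x * t mod L) mod L = t" using assms(2) by (simp add: cong_def mod_mult_right_eq mult.assoc)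
 moreover have "x * t mod L < L" using assms(2) by simp
 ultimately show ?thesis by blast
qed

context coordinates
begin

text \<open>Let \<open>\<pi>\<close> send floor \<open>i\<close> and base coordinate
  \<open>u\<close> to \<open>(T ^^ i) (\<kappa> u)\<close>. Advancing one level moves this point by
  \<open>T\<close>, except from the top floor, an event of probability \<open>1 / s\<close>. An
  isomorphism \<open>\<theta>\<close> with the same values as \<open>\<pi>\<close> on a finite
  partition then carries the rotation of the \<open>L\<close> levels to a map \<open>S\<close> close
  to \<open>T\<close>.\<close>

lemma tower_set_dense:
 assumes T: "T \<in> aut M" and As: "finite As" "As <= sets M" and e: "e > 0" and n: "n >= 1" and d: "d > 0"
 shows "\<exists>S\<in>tower_set n N d. \<forall>A\<in>As. prob (symdiff (S -` A) (T -` A)) < e"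
proof -
 note Tm = aut_measurable[OF T]
 have Tp: "T ^^ i \<in> aut M" for i by (rule aut_funpow[OF T])
 have vs: "(T ^^ i) -` A \<in> sets M" if "A \<in> sets M" for i A
  using measurable_sets[OF aut_measurable[OF Tp] that, of i] by simp
 obtain k0 where k0: "inverse (real (Suc k0)) < e" using reals_Archimedean[OF e] by blast
 \<comment> \<open>Congruent to 1 modulo \<open>n\<close>, like \<open>N'\<close> below, so that
   \<open>L = s * N'\<close> is coprime to \<open>n\<close>; and large enough for the top floor to
   have probability below \<open>e\<close>.\<close>
 define s where "s = n * Suc k0 + 1"
 have s0: "s > 0" by (simp add: s_def)
 have se: "1 / real s < e"
 proof -
  have "Suc k0 <= n * Suc k0" using mult_le_mono1[OF n, of "Suc k0"] by (simp only: mult_1)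
  then have "real (Suc k0) <= real s" unfolding s_def by linarith
  then have "1 / real s <= inverse (real (Suc k0))" by (simp add: field_simps)
  with k0 show ?thesis by linarith
 qed
 \<comment> \<open>On floor \<open>i\<close> a set of cells is seen through \<open>T ^^ i\<close>;
   these finitely many preimages are to be approximated by cells of one common scale
   \<open>N'\<close>.\<close>
 have "\<forall>iP\<in>{..<s} \<times> Pow {..<N}. EX N0. \<forall>N'\<ge>N0. \<exists>P'\<subseteq>{..<N'}. prob (symdiff ((T ^^ fst iP) -` cell N (snd iP)) (cell N' P')) < d"
  by (intro ballI cells_approx vs cell_sets d)
 from bchoice[OF this] obtain N0 where N0: "\<forall>iP\<in>{..<s} \<times> Pow {..<N}. \<forall>N'\<ge>N0 iP. \<exists>P'\<subseteq>{..<N'}. prob (symdiff ((T ^^ fst iP) -` cell N (snd iP)) (cell N' P')) < d" ..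
 define K where "K = Max (N0 ` ({..<s} \<times> Pow {..<N}))"
 define N' where "N' = n * K + 1"
 have N'0: "N' > 0" by (simp add: N'_def)
 have N'ge: "N' >= N0 iP" if "iP \<in> {..<s} \<times> Pow {..<N}" for iP
 proof -
  have "N0 iP <= K" unfolding K_def using that by (intro Max_ge) auto
  also have "K <= n * K" using mult_le_mono1[OF n, of K] by (simp only: mult_1)
  finally show ?thesis by (simp add: N'_def)
 qed
 have "\<forall>iP\<in>{..<s} \<times> Pow {..<N}. EX P'. prob (symdiff ((T ^^ fst iP) -` cell N (snd iP)) (cell N' P')) < d"
  using N0 N'ge by blast
 from bchoice[OF this] obtain Pc where Pc: "\<forall>iP\<in>{..<s} \<times> Pow {..<N}. prob (symdiff ((T ^^ fst iP) -` cell N (snd iP)) (cell N' (Pc iP))) < d" ..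
 define L where "L = s * N'"
 have L0: "L > 0" using s0 N'0 by (simp add: L_def)
 have cop: "coprime n L"
 proof -
  have "L = n * (Suc k0 * (n * K + 1) + K) + 1" by (simp add: L_def s_def N'_def algebra_simps)
  then have "L mod n = 1 mod n" by (metis mod_mult_self4 add.commute)
  then have "gcd n L = gcd n 1" by (metis gcd_red_nat gcd.commute)
  then show ?thesis by (simp add: coprime_iff_gcd_eq_1)
 qed
 \<comment> \<open>Each floor carries a full copy of the space, moved by a power of
   \<open>T\<close>; so \<open>\<pi>\<close> preserves the measure but is far from
   injective.\<close>
 define \<pi> where "\<pi> y = (T ^^ coli s N' y) (\<kappa> (colu s N' y))" for y
 have Tkm: "(%u. (T ^^ i) (\<kappa> u)) \<in> borel_measurable borel" for i
 proof -
  have "T ^^ i \<in> borel \<rightarrow>\<^sub>M borel" using aut_measurable[OF Tp, of i] by (simp cong: measurable_cong_sets)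
  then show ?thesis by (rule measurable_compose[OF kappa_meas])
 qed
 have pm: "\<pi> \<in> borel_measurable borel"
  unfolding \<pi>_def
  by (rule measurable_compose_countable[OF _ coli_measurable, where f="%i y. (T ^^ i) (\<kappa> (colu s N' y))"])
   (rule measurable_compose[OF colu_measurable Tkm])
 have pm': "\<pi> \<in> unif \<rightarrow>\<^sub>M M" using pm by (simp cong: measurable_cong_sets)
 have Tk: "measure unif {u. (T ^^ i) (\<kappa> u) \<in> A} = prob A" if A: "A \<in> sets M" for i A
 proof -
  have "prob ((T ^^ i) -` A) = measure (distr unif M \<kappa>) ((T ^^ i) -` A)" by (simp add: distr_kappa)
  also have "... = measure unif {u. (T ^^ i) (\<kappa> u) \<in> A}"
   by (subst measure_distr[OF kappa_meas' vs[OF A]]) (simp add: vimage_def)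
  finally show ?thesis using aut_measure_vimage[OF Tp A, of i] by simp
 qed
 have Tks: "{u. (T ^^ i) (\<kappa> u) \<in> A} \<in> sets borel" if A: "A \<in> sets M" for i A
  using measurable_sets[OF Tkm, of A i] A by (simp add: vimage_def)
 have pd: "distr unif M \<pi> = M"
 proof (rule measure_eqI)
  fix A assume "A \<in> sets (distr unif M \<pi>)"
  then have A: "A \<in> sets M" by simp
  have "measure unif {y. \<pi> y \<in> A} = (\<Sum>i<s. measure unif {u. (T ^^ i) (\<kappa> u) \<in> A}) / real s"
   unfolding \<pi>_def by (rule column_law[OF s0 N'0, where G="%i u. (T ^^ i) (\<kappa> u) \<in> A"]) (rule Tks[OF A])
  also have "... = prob A" using s0 by (simp add: Tk[OF A])
  finally have "measure unif {y. \<pi> y \<in> A} = prob A" .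
  then show "emeasure (distr unif M \<pi>) A = emeasure M A"
   by (subst emeasure_distr[OF pm' A]) (simp add: vimage_def unif.emeasure_eq_measure emeasure_eq_measure)
 qed simp
 \<comment> \<open>The sets on which \<open>S\<close> has to imitate \<open>T\<close>, their
   preimages under \<open>T\<close>, and the cells that the tower has to approximate.\<close>
 define \<C> where "\<C> = As \<union> (%A. T -` A) ` As \<union> cell N ` Pow {..<N}"
 have finC: "finite \<C>" using As(1) by (simp add: \<C>_def)
 have subC: "\<C> <= sets borel"
 proof -
  have "\<C> <= sets M" unfolding \<C>_def using As(2) vs[of _ 1] cell_sets by auto
  then show ?thesis by simp
 qed
 obtain part :: "'a => nat" where part: "part \<in> borel \<rightarrow>\<^sub>M count_space UNIV"
  "!!x y C. part x = part y ==> C \<in> \<C> ==> x \<in> C \<longleftrightarrow> y \<in> C"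
  by (rule finite_family_code[OF finC subC]) blast
 obtain \<theta> :: "real => 'a" and \<theta>' :: "'a => real"
  where th: "\<theta> \<in> borel_measurable borel" "\<theta>' \<in> borel_measurable borel"
   and dth: "distr unif M \<theta> = M" "distr M borel \<theta>' = unif"
   and inv1: "AE x in M. \<theta> (\<theta>' x) = x" and inv2: "AE y in unif. \<theta>' (\<theta> y) = y"
   and ref: "AE y in unif. part (\<theta> y) = part (\<pi> y)"
  by (rule refining_isomorphism[OF part(1) pm pd]) blast
 have th': "\<theta> \<in> unif \<rightarrow>\<^sub>M M" "\<theta>' \<in> borel_measurable M" "\<theta>' \<in> M \<rightarrow>\<^sub>M unif" "\<theta> \<in> borel \<rightarrow>\<^sub>M M"
  using th by (simp_all cong: measurable_cong_sets)
 have pull: "AE x in M. Q (\<theta>' x)" if "AE y in unif. Q y" for Q :: "real => bool"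
 proof -
  have "AE y in distr M borel \<theta>'. Q y" unfolding dth by (rule that)
  then show ?thesis by (rule AE_distrD[OF th'(2)])
 qed
 have pullrt: "AE y in unif. Q (rt L k y)" if "AE y in unif. Q y" for Q :: "real => bool" and k
 proof -
  have "AE y in distr unif borel (rt L k). Q y" unfolding distr_rt[OF L0] by (rule that)
  then show ?thesis by (rule AE_distrD[rotated]) simp
 qed
 have ran: "AE y in unif. 0 <= y & y < 1" using AE_unif by eventually_elim simp
 define R where "R k x = \<theta> (rt L k (\<theta>' x))" for k x
 have Rm: "R k \<in> M \<rightarrow>\<^sub>M M" for k
  unfolding R_def by (rule measurable_compose[OF measurable_compose[OF th'(2) rt_measurable] th'(4)])
 have Rd: "distr M M (R k) = M" for k
 proof -
  have "distr M M (R k) = distr (distr M borel \<theta>') M (\<theta> \<circ> rt L k)"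
   by (subst distr_distr) (auto simp: R_def[abs_def] o_def th'(2) intro!: measurable_compose[OF rt_measurable th'(4)])
  also have "... = distr (distr unif borel (rt L k)) M \<theta>"
   unfolding dth by (rule distr_distr[symmetric]) (auto simp: th'(4))
  also have "... = M" unfolding distr_rt[OF L0] by (rule dth)
  finally show ?thesis .
 qed
 have Rth: "AE x in M. \<theta>' (R k x) = rt L k (\<theta>' x)" for k
  unfolding R_def by (rule pull[OF pullrt[OF inv2]])
 have RR: "AE x in M. R a (R b x) = x" if "(b + a) mod L = 0" for a b
 proof -
  have "AE x in M. 0 <= \<theta>' x & \<theta>' x < 1" by (rule pull[OF ran])
  with Rth[of b] inv1 show ?thesis
  proof eventually_elim
   case (elim x)
   have "R a (R b x) = \<theta> (rt L a (rt L b (\<theta>' x)))" using elim by (simp add: R_def[of a])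
   also have "rt L a (rt L b (\<theta>' x)) = \<theta>' x" using elim that L0 by (simp add: rt_rt rt_period)
   finally show ?case using elim by simp
  qed
 qed
 have per: "(1 + (L - 1)) mod L = 0" "((L - 1) + 1) mod L = 0" using L0 by simp_all
 \<comment> \<open>The transported rotation is invertible only almost everywhere, with the rotation
   by \<open>L - 1\<close> as its inverse.\<close>
 obtain S where S: "S \<in> aut M" "AE x in M. S x = R 1 x" "AE x in M. inv S x = R (L - 1) x"
  by (rule aut_of_AE_inverse[OF Rm Rm Rd Rd RR[OF per(1)] RR[OF per(2)]])
 have Sp: "S ^^ i \<in> aut M" for i by (rule aut_funpow[OF S(1)])
 have S1: "AE x in M. \<theta>' (S x) = rt L 1 (\<theta>' x)" using S(2) Rth[of 1] by eventually_elim simp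
 have ran': "AE x in M. 0 <= \<theta>' x & \<theta>' x < 1" by (rule pull[OF ran])
 have Sk: "AE x in M. \<theta>' ((S ^^ k) x) = rt L k (\<theta>' x)" for k
 proof (induction k)
  case 0
  show ?case using ran' by eventually_elim (simp add: rt_period L0)
 next
  case (Suc k)
  from Suc aut_AE[OF Sp[of k] S1] ran' show ?case
   by eventually_elim (simp add: rt_rt L0)
 qed
 define B where "B = {x. lev L (\<theta>' x) = 0}"
 have levM: "(%x. lev L (\<theta>' x)) \<in> M \<rightarrow>\<^sub>M count_space UNIV"
  by (rule measurable_compose[OF th'(2) lev_measurable])
 have B: "B \<in> sets M" using measurable_sets[OF levM, of "{0}"] by (simp add: B_def vimage_def)
 have level: "AE x in M. x \<in> (S ^^ j) ` B \<longleftrightarrow> lev L (\<theta>' x) = j mod L" for j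
 proof -
  have i: "inv (S ^^ j) \<in> aut M" by (rule aut_inv[OF Sp])
  from aut_AE[OF i Sk[of j]] aut_AE[OF i ran'] show ?thesis
  proof eventually_elim
   case (elim x)
   define z where "z = inv (S ^^ j) x"
   have "(S ^^ j) z = x" unfolding z_def by (rule surj_f_inv_f[OF bij_is_surj[OF aut_bij[OF Sp]]])
   then have "\<theta>' x = rt L j (\<theta>' z)" and zr: "0 <= \<theta>' z" "\<theta>' z < 1" using elim by (simp_all add: z_def)
   then have lx: "lev L (\<theta>' x) = (lev L (\<theta>' z) + j) mod L" using L0 by (simp add: lev_rt)
   have "x \<in> (S ^^ j) ` B \<longleftrightarrow> z \<in> B" unfolding aut_image_vimage[OF Sp] z_def by simp
   also have "... \<longleftrightarrow> lev L (\<theta>' z) = 0" by (simp add: B_def)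
   also have "... \<longleftrightarrow> lev L (\<theta>' x) = j mod L"
   proof
    assume "lev L (\<theta>' x) = j mod L"
    then have "[lev L (\<theta>' z) + j = j] (mod L)" using lx by (simp add: cong_def)
    then have "[lev L (\<theta>' z) = 0] (mod L)" by (simp add: cong_add_rcancel_0_nat)
    then show "lev L (\<theta>' z) = 0" using lev_less[OF L0 zr] by (simp add: cong_def)
   qed (simp add: lx)
   finally show ?case .
  qed
 qed
 \<comment> \<open>By coprimality \<open>L\<close> divides \<open>n * k\<close> only if it divides
   \<open>k\<close>. So the first \<open>L\<close> images of \<open>B\<close> under
   \<open>S ^^ n\<close> are, up to null sets, the different levels in some order.\<close>
 have overlap: "prob (B \<inter> ((S ^^ n) ^^ k) ` B) = 0" if k: "k \<in> {1..<L}" for k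
 proof -
  have nk: "n * k mod L ~= 0"
  proof
   assume "n * k mod L = 0"
   then have "L dvd n * k" by (simp add: mod_eq_0_iff_dvd)
   then have "L dvd k" using cop by (simp add: coprime_commute coprime_dvd_mult_right_iff)
   then show False using k by (auto dest: dvd_imp_le)
  qed
  have "prob (B \<inter> (S ^^ (n * k)) ` B) = prob {}"
  proof (rule measure_eq_AE)
   show "AE x in M. x \<in> B \<inter> (S ^^ (n * k)) ` B \<longleftrightarrow> x \<in> {}"
    using level[of "n * k"]
   proof eventually_elim
    case (elim x)
    have False if x: "x \<in> B \<inter> (S ^^ (n * k)) ` B"
    proof -
     have "lev L (\<theta>' x) = 0" using IntD1[OF x] by (simp add: B_def)
     moreover have "lev L (\<theta>' x) = n * k mod L" using IntD2[OF x] elim by (rule iffD1[rotated])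
     ultimately show False using nk by simp
    qed
    then show ?case by blast
   qed
   show "B \<inter> (S ^^ (n * k)) ` B \<in> sets M" by (rule sets.Int[OF B aut_image_sets[OF Sp B]])
  qed simp
  then show ?thesis by (simp add: funpow_mult)
 qed
 have t1: "S \<in> tower_set n N d"
 proof -
  have c1: "real L * (\<Sum>k\<in>{1..<L}. prob (B \<inter> ((S ^^ n) ^^ k) ` B)) < d" using overlap d by simp
  have c2: "\<exists>J\<subseteq>{..<L}. prob (symdiff (cell N P) (\<Union>i\<in>J. ((S ^^ n) ^^ i) ` B)) < d" if P: "P <= {..<N}" for P
  proof -
   define C where "C = cell N P"
   have C1: "C \<in> sets M" unfolding C_def by (rule cell_sets)
   have C2: "C \<in> \<C>" unfolding C_def \<C>_def using P by blast
   note C = C1 C2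
   \<comment> \<open>The error event on floor \<open>i\<close>; it has measure below
     \<open>d\<close> by the choice of \<open>Pc\<close>.\<close>
   define G where "G i u \<longleftrightarrow> ((T ^^ i) (\<kappa> u) \<in> C) ~= (lev N' u \<in> Pc (i, P))" for i u
   have levs: "{u. lev N' u \<in> Z} \<in> sets borel" for Z using measurable_sets[OF lev_measurable, of Z N'] by (simp add: vimage_def)
   have Gs: "{u. G i u} \<in> sets borel" for i
   proof -
    have "{u. G i u} = symdiff {u. (T ^^ i) (\<kappa> u) \<in> C} {u. lev N' u \<in> Pc (i, P)}" by (auto simp: G_def symdiff_def)
    then show ?thesis using Tks[OF C(1)] levs by simp
   qed
   have Gd: "measure unif {u. G i u} < d" if i: "i < s" for i
   proof -
    have "measure unif {u. G i u} = measure (distr M borel \<phi>) {u. G i u}" by (simp add: distr_phi)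
    also have "... = prob (\<phi> -` {u. G i u})" by (subst measure_distr[OF phi_meas' Gs]) simp
    also have "... = prob (symdiff ((T ^^ i) -` C) (cell N' (Pc (i, P))))"
    proof (rule measure_eq_AE)
     show "AE x in M. x \<in> \<phi> -` {u. G i u} \<longleftrightarrow> x \<in> symdiff ((T ^^ i) -` C) (cell N' (Pc (i, P)))"
      using kappa_phi by eventually_elim (auto simp: G_def symdiff_def cell_def lev_def)
     show "\<phi> -` {u. G i u} \<in> sets M" using measurable_sets[OF phi_meas' Gs] by simp
     show "symdiff ((T ^^ i) -` C) (cell N' (Pc (i, P))) \<in> sets M" by (intro symdiff_sets vs C cell_sets)
    qed
    also have "... < d" using bspec[OF Pc, of "(i, P)"] i P by (simp add: C_def)
    finally show ?thesis .
   qed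
   \<comment> \<open>The levels to be collected: those on floor \<open>t mod s\<close> whose column
     belongs to the approximating cells. \<open>J\<close> lists them by the exponent of
     \<open>S ^^ n\<close> that reaches them from the base.\<close>
   define Q where "Q = {t. t < L & t div s \<in> Pc (t mod s, P)}"
   define J where "J = {i. i < L & n * i mod L \<in> Q}"
   define UU where "UU = (\<Union>i\<in>J. ((S ^^ n) ^^ i) ` B)"
   have U: "UU \<in> sets M"
    unfolding UU_def funpow_mult by (intro sets.finite_UN aut_image_sets Sp B) (auto simp: J_def)
   have AEU: "AE x in M. x \<in> UU \<longleftrightarrow> lev L (\<theta>' x) \<in> Q"
   proof -
    have "AE x in M. ALL j. x \<in> (S ^^ j) ` B \<longleftrightarrow> lev L (\<theta>' x) = j mod L" unfolding AE_all_countable by (intro allI level)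
    then show ?thesis
    proof eventually_elim
     case (elim x)
     show ?case
     proof
      assume "x \<in> UU"
      then obtain i where i: "i \<in> J" "x \<in> ((S ^^ n) ^^ i) ` B" unfolding UU_def by (rule UN_E)
      then have "lev L (\<theta>' x) = n * i mod L" using elim[rule_format, of "n * i"] by (simp only: funpow_mult)
      then show "lev L (\<theta>' x) \<in> Q" using i(1) by (simp add: J_def)
     next
      assume q: "lev L (\<theta>' x) \<in> Q"
      then have "lev L (\<theta>' x) < L" by (simp add: Q_def)
      then obtain i where i: "i < L" "n * i mod L = lev L (\<theta>' x)" using mult_mod_surj[OF cop] by blast
      then have "i \<in> J" using q by (simp add: J_def)
      moreover have "x \<in> ((S ^^ n) ^^ i) ` B" using elim[rule_format, of "n * i"] i(2) by (simp only: funpow_mult)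
      ultimately show "x \<in> UU" unfolding UU_def by (rule UN_I)
     qed
    qed
   qed
   have Es: "{y. G (coli s N' y) (colu s N' y)} \<in> sets borel"
    unfolding coli_def colu_def
   proof (rule digit_sets[where G="%t w. G (t mod s) ((real (t div s) + w) / real N')"])
    fix t
    have "(%w. (real (t div s) + w) / real N') \<in> borel_measurable borel" by simp
    from measurable_sets[OF this Gs[of "t mod s"]] show "{w. G (t mod s) ((real (t div s) + w) / real N')} \<in> sets borel"
     by (simp add: vimage_def)
   qed
   have "prob (symdiff C UU) = prob (\<theta>' -` {y. G (coli s N' y) (colu s N' y)})"
   proof (rule measure_eq_AE)
    show "\<theta>' -` {y. G (coli s N' y) (colu s N' y)} \<in> sets M" using measurable_sets[OF th'(2) Es] by simp
    show "symdiff C UU \<in> sets M" by (intro symdiff_sets C U)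
    from AEU ran' inv1 pull[OF ref]
    show "AE x in M. x \<in> symdiff C UU \<longleftrightarrow> x \<in> \<theta>' -` {y. G (coli s N' y) (colu s N' y)}"
    proof eventually_elim
     case (elim x)
     define y where "y = \<theta>' x"
     have y: "0 <= y" "y < 1" using elim by (simp_all add: y_def)
     have "x \<in> C \<longleftrightarrow> \<pi> y \<in> C" using part(2)[OF elim(4) C(2)] elim(3) by (simp add: y_def)
     moreover have "lev N' (colu s N' y) = lev L y div s"
      unfolding colu_def L_def[symmetric] by (rule lev_digit[OF N'0 fr_nonneg[OF L0 y] fr_less[OF L0 y]])
     then have "lev N' (colu s N' y) \<in> Pc (coli s N' y, P) \<longleftrightarrow> lev L y \<in> Q"
      using lev_less[OF L0 y] by (simp add: Q_def coli_def L_def[symmetric])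
     ultimately have "G (coli s N' y) (colu s N' y) \<longleftrightarrow> (x \<in> C) ~= (lev L y \<in> Q)"
      by (simp add: G_def \<pi>_def)
     moreover have "x \<in> symdiff C UU \<longleftrightarrow> (x \<in> C) ~= (lev L y \<in> Q)"
      by (simp add: symdiff_def y_def elim(1)) blast
     ultimately show ?case by (simp add: y_def)
    qed
   qed
   also have "... = measure (distr M borel \<theta>') {y. G (coli s N' y) (colu s N' y)}"
    by (subst measure_distr[OF th'(2) Es]) simp
   also have "... = (\<Sum>i<s. measure unif {u. G i u}) / real s"
    unfolding dth by (rule column_law[OF s0 N'0 Gs])
   also have "... < d"
   proof -
    have "(\<Sum>i<s. measure unif {u. G i u}) < (\<Sum>i<s. d)"
     using Gd s0 by (intro sum_strict_mono) auto
    then show ?thesis using s0 by (simp add: divide_less_eq mult.commute)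
   qed
   finally have "prob (symdiff (cell N P) (\<Union>i\<in>J. ((S ^^ n) ^^ i) ` B)) < d" by (simp only: C_def UU_def)
   moreover have "J <= {..<L}" by (auto simp: J_def)
   ultimately show ?thesis by (intro exI[of _ J] conjI)
  qed
  show ?thesis
   unfolding tower_set_def mem_Collect_eq
   by (rule conjI[OF S(1)], rule exI[of _ B], rule exI[of _ L], intro conjI allI impI)
    (fact B, fact L0, fact c1, rule c2)
 qed
 have t2: "prob (symdiff (S -` A) (T -` A)) < e" if A: "A \<in> As" for A
 proof -
  have As': "A \<in> sets M" using A As by blast
  have AC: "A \<in> \<C>" "T -` A \<in> \<C>" using A by (auto simp: \<C>_def)
  have Cs: "{y. coli s N' y = s - 1} \<in> sets borel" using measurable_sets[OF coli_measurable, of "{s - 1}" s N'] by (simp add: vimage_def)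
  \<comment> \<open>Below the top floor, rotation by one level raises the floor and keeps the base
    coordinate, so \<open>\<pi>\<close> moves exactly by \<open>T\<close>; on \<open>A\<close> and
    its preimage \<open>\<theta>\<close> cannot be told from \<open>\<pi>\<close>.\<close>
  have "prob (symdiff (S -` A) (T -` A)) <= prob (\<theta>' -` {y. coli s N' y = s - 1})"
  proof (rule finite_measure_mono_AE)
   show "\<theta>' -` {y. coli s N' y = s - 1} \<in> sets M" using measurable_sets[OF th'(2) Cs] by simp
   from ran' inv1 S(2) pull[OF ref] pull[OF pullrt[OF ref, of 1]]
   show "AE x in M. x \<in> symdiff (S -` A) (T -` A) --> x \<in> \<theta>' -` {y. coli s N' y = s - 1}"
   proof eventually_elim
    case (elim x)
    define y where "y = \<theta>' x"
    have y: "0 <= y" "y < 1" using elim by (simp_all add: y_def)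
    have 1: "S x \<in> A \<longleftrightarrow> \<pi> (rt L 1 y) \<in> A" using part(2)[OF elim(5) AC(1)] elim(3) by (simp add: y_def R_def)
    have 2: "T x \<in> A \<longleftrightarrow> T (\<pi> y) \<in> A" using part(2)[OF elim(4) AC(2)] elim(2) by (simp add: y_def)
    have eq: "\<pi> (rt L 1 y) = T (\<pi> y)" if ns: "coli s N' y ~= s - 1"
    proof -
     define t where "t = lev L y"
     have t: "t < L" unfolding t_def by (rule lev_less[OF L0 y])
     have ts: "Suc (t mod s) ~= s" using ns by (simp add: coli_def L_def[symmetric] t_def)
     have m: "Suc t mod s = Suc (t mod s)" using ts by (simp add: mod_Suc)
     have dv: "Suc t div s = t div s" using m by (simp add: div_Suc)
     have "Suc t ~= L"
     proof
      assume "Suc t = L"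
      then have "Suc t mod s = 0" by (simp add: L_def)
      then show False using m by simp
     qed
     then have "Suc t < L" using t by linarith
     then have lr: "lev L (rt L 1 y) = Suc t" by (simp add: lev_rt[OF L0 y] t_def)
     have "coli s N' (rt L 1 y) = Suc (coli s N' y)" using lr m by (simp add: coli_def L_def[symmetric] t_def)
     moreover have "colu s N' (rt L 1 y) = colu s N' y"
      using lr dv by (simp add: colu_def L_def[symmetric] t_def fr_rt[OF L0 y])
     ultimately show ?thesis by (simp add: \<pi>_def)
    qed
    show ?case
    proof (intro impI, rule ccontr)
     assume x: "x \<in> symdiff (S -` A) (T -` A)" and "x \<notin> \<theta>' -` {y. coli s N' y = s - 1}"
     then have "coli s N' y ~= s - 1" by (simp add: y_def)
     then have "\<pi> (rt L 1 y) = T (\<pi> y)" by (rule eq)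
     then have "S x \<in> A \<longleftrightarrow> T x \<in> A" using 1 2 by simp
     then show False using x by (simp add: symdiff_def)
    qed
   qed
  qed
  also have "... = measure (distr M borel \<theta>') {y. coli s N' y = s - 1}"
   by (subst measure_distr[OF th'(2) Cs]) simp
  also have "... = (\<Sum>i<s. measure unif {u::real. i = s - 1}) / real s"
   unfolding dth by (rule column_law[OF s0 N'0, where G="%i u. i = s - 1"]) simp
  also have "(\<Sum>i<s. measure unif {u::real. i = s - 1}) = (\<Sum>i<s. if i = s - 1 then 1 else 0)"
   using unif.prob_space by (intro sum.cong) auto
  also have "... = 1" using s0 by (simp add: sum.delta)
  finally show ?thesis using se by simp
 qed
 show ?thesis by (rule bexI[OF _ t1]) (intro ballI t2)
qed

text \<open>Countably many dense open sets, indexed by power, scale and precision through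
  \<open>prod_encode\<close>. \<open>Suc\<close> keeps the power positive; negative powers follow by
  inverting the tower.\<close>

lemma generic_rank_one_powers:
 "EX R. gdelta_in (weak_top M) R & weak_top M closure_of R = topspace (weak_top M) &
   (\<forall>T\<in>R. T \<in> aut M & (ALL n. n ~= 0 --> rank_one M (zpow T n)))"
proof -
 define G where "G k = tower_set (Suc (fst (prod_decode k))) (fst (prod_decode (snd (prod_decode k))))
   (inverse (real (Suc (snd (prod_decode (snd (prod_decode k)))))))" for k
 have G: "G (prod_encode (n, prod_encode (N, m))) = tower_set (Suc n) N (inverse (real (Suc m)))" for n N m
  by (simp add: G_def)
 have op: "openin (weak_top M) (G k)" for k unfolding G_def by (rule tower_set_open)
 have dense: "weak_top M closure_of G k = topspace (weak_top M)" for k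
 proof (rule equalityI[OF closure_of_subset_topspace], rule subsetI)
  fix T assume T: "T \<in> topspace (weak_top M)"
  then have T': "T \<in> aut M" by (simp add: topspace_weak)
  have "EX S. S \<in> G k & S \<in> W" if W: "T \<in> W" "openin (weak_top M) W" for W
  proof -
   have "EX V. open V & W = emb -` V \<inter> aut M"
    using W(2) by (simp add: weak_top_eq_pullback openin_pullback_topology)
   then obtain V where V: "open V" "W = emb -` V \<inter> aut M" by (elim exE conjE)
   have "emb T \<in> V" using W(1) unfolding V(2) by simp
   then have "EX r. r > 0 & ball (emb T) r <= V" using V(1) open_contains_ball by blast
   then obtain r where r: "r > 0" "ball (emb T) r <= V" by (elim exE conjE)
   obtain As e where As: "finite As" "As <= sets M" "e > 0"
    "!!S. S \<in> aut M ==> (!!A. A \<in> As ==> prob (symdiff (S -` A) (T -` A)) < e) ==> dist (emb S) (emb T) < r"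
    using emb_near[OF T' r(1)] by blast
   have "\<exists>S\<in>G k. \<forall>A\<in>As. prob (symdiff (S -` A) (T -` A)) < e"
    unfolding G_def by (rule tower_set_dense[OF T' As(1-3)]) simp_all
   then obtain S where S: "S \<in> G k" "\<forall>A\<in>As. prob (symdiff (S -` A) (T -` A)) < e" by (elim bexE)
   have S': "S \<in> aut M" using S(1) by (simp add: G_def tower_set_def)
   have "dist (emb S) (emb T) < r" by (rule As(4)[OF S' S(2)[rule_format]])
   then have "emb S \<in> ball (emb T) r" by (simp add: dist_commute)
   then have "emb S \<in> V" by (rule subsetD[OF r(2)])
   then have "S \<in> W" unfolding V(2) using S' by simp
   with S(1) show ?thesis by (intro exI[of _ S] conjI)
  qed
  then show "T \<in> weak_top M closure_of G k" using T by (simp only: in_closure_of) blast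
 qed
 have g1: "gdelta_in (weak_top M) (\<Inter>k. G k)"
 proof (rule gdelta_in_Inter)
  show "gdelta_in (weak_top M) X" if "X \<in> range G" for X
   using that by (elim rangeE) (simp only: open_imp_gdelta_in[OF op])
 qed simp_all
 have g2: "weak_top M closure_of (\<Inter>k. G k) = topspace (weak_top M)" by (rule weak_Baire[OF op dense])
 have g3: "T \<in> aut M & (ALL n. n ~= 0 --> rank_one M (zpow T n))" if T: "T \<in> (\<Inter>k. G k)" for T
 proof -
  have TG: "T \<in> G k" for k using T by simp
  have T': "T \<in> aut M" using TG[of 0] by (simp add: G_def tower_set_def)
  have pos: "rank_one M (T ^^ n)" if n: "n >= 1" for n
  proof (rule rank_one_of_towers[OF T'])
   show "T \<in> tower_set n N (inverse (real (Suc m)))" for N m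
    using TG[of "prod_encode (n - 1, prod_encode (N, m))"] n unfolding G by simp
  qed
  have rk: "rank_one M (zpow T n)" if n: "n ~= 0" for n
  proof (cases "n > 0")
   case True
   then show ?thesis using pos[of "nat n"] by (simp add: zpow_def)
  next
   case False
   then have "zpow T n = inv (T ^^ nat (- n))" using n by (simp add: zpow_def inv_fn[OF aut_bij[OF T']])
   then show ?thesis using False n by (simp add: rank_one_inv[OF aut_funpow[OF T']] pos)
  qed
  show ?thesis by (intro conjI allI impI T' rk)
 qed
 show ?thesis by (rule exI[of _ "\<Inter>k. G k"], intro conjI ballI g1 g2 conjunct1[OF g3] conjunct2[OF g3])
qed

end

theorem mainTheorem10:
  fixes M :: "'a::polish_space measure"
  assumes "std_nonatomic M"
  shows "(\<exists>R. gdelta_in (weak_top M) R \<and> (weak_top M) closure_of R = topspace (weak_top M) \<and>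
            (\<forall>T\<in>R. (\<forall>n::int. n \<noteq> 0 \<longrightarrow> rank_one M (zpow T n)) \<and>
                    (\<forall>n::nat. n \<ge> 1 \<longrightarrow> simple_spectrum M (T ^^ n)) \<and>
                    Jinf M T = J2 M T \<and>
                    closedin (C2_top M) (periodic_pts M T) \<and>
                    nowhere_dense_in (C2_top M) (periodic_pts M T) \<and>
                    \<not> P_system M T))
       \<and> (\<forall>T. gaussian_system M T \<and> simple_spectrum M T \<longrightarrow>
            (\<forall>n::nat. n \<ge> 1 \<longrightarrow> simple_spectrum M (T ^^ n)) \<and>
            Jinf M T = J2 M T \<and> \<not> P_system M T)"
proof -
  interpret std_space M by standard (rule assms)
  \<comment> \<open>Any coordinate serves here, so the partition is trivial.\<close>
  have p: "(\<lambda>_::'a. 0::nat) \<in> borel \<rightarrow>\<^sub>M count_space UNIV" by simp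
  obtain \<phi> :: "'a \<Rightarrow> real" and \<kappa> where c: "\<phi> \<in> borel_measurable borel" "\<kappa> \<in> borel_measurable borel"
    "distr M borel \<phi> = unif" "distr unif M \<kappa> = M" "AE x in M. \<kappa> (\<phi> x) = x" "AE u in unif. \<phi> (\<kappa> u) = u"
    by (rule coordinate_exists[OF p]) blast
  interpret coordinates M \<phi> \<kappa>
    by (intro coordinates.intro coordinates_axioms.intro std_space_axioms c)
  obtain R where R: "gdelta_in (weak_top M) R" "weak_top M closure_of R = topspace (weak_top M)"
    "\<forall>T\<in>R. T \<in> aut M \<and> (\<forall>n. n \<noteq> 0 \<longrightarrow> rank_one M (zpow T n))"
    using generic_rank_one_powers by (elim exE conjE)
  have generic: "(\<forall>n::int. n \<noteq> 0 \<longrightarrow> rank_one M (zpow T n)) \<and>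
      (\<forall>n::nat. n \<ge> 1 \<longrightarrow> simple_spectrum M (T ^^ n)) \<and> Jinf M T = J2 M T \<and>
      closedin (C2_top M) (periodic_pts M T) \<and> nowhere_dense_in (C2_top M) (periodic_pts M T) \<and> \<not> P_system M T"
    if "T \<in> R" for T
  proof -
    have T: "T \<in> aut M" and r1: "\<forall>n. n \<noteq> 0 \<longrightarrow> rank_one M (zpow T n)" using bspec[OF R(3) that] by simp_all
    have simple: "simple_spectrum M (T ^^ n)" if n: "n \<ge> 1" for n
      using rank_one_imp_simple_spectrum[OF aut_funpow[OF T, of n]] r1[rule_format, of "int n"] n
      by (simp add: zpow_of_nat)
    show ?thesis
    proof (intro conjI allI impI)
      show "rank_one M (zpow T n)" if "n \<noteq> 0" for n using r1 that by blast
      show "simple_spectrum M (T ^^ n)" if "n \<ge> 1" for n by (rule simple[OF that])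
    qed (rule simple_powers_consequences[OF T], erule simple)+
  qed
  have gaussian: "(\<forall>n::nat. n \<ge> 1 \<longrightarrow> simple_spectrum M (T ^^ n)) \<and> Jinf M T = J2 M T \<and> \<not> P_system M T"
    if g: "gaussian_system M T" "simple_spectrum M T" for T
  proof -
    have T: "T \<in> aut M" using g(1) by (simp add: gaussian_system_def)
    have simple: "simple_spectrum M (T ^^ n)" if "n \<ge> 1" for n
      by (rule gaussian_simple_spectrum_power[OF g that])
    show ?thesis
    proof (intro conjI allI impI)
      show "simple_spectrum M (T ^^ n)" if "n \<ge> 1" for n by (rule simple[OF that])
    qed (rule simple_powers_consequences[OF T], erule simple)+
  qed
  show ?thesis
    by (rule conjI, rule exI[of _ R], rule conjI[OF R(1)], rule conjI[OF R(2)], rule ballI, erule generic,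
        rule allI, rule impI, erule conjE, rule gaussian)
qed

end
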